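(* Let $N\ge3$, $R>0$, and let $B_R\subset\mathbb{R}^N$ be the open ball of radius $R$ centered at the origin. For a constant $C>0$, consider the inequality $$\int_{B_R}|\nabla u(|x|)|^2dx\ \ge\ \left(\frac{N-2}{2}\right)^2\int_{B_R}\frac{u^2(|x|)}{|x|^2}dx+C\left(\int_{B_R}|u(|x|)|^{\frac{2N}{N-2}}\left(-\log\frac{|x|}{R}\right)^{-\frac{2(N-1)}{N-2}}dx\right)^{\frac{N-2}{N}}\qquad(A)$$ for radially symmetric $u\in C_0^\infty(B_R\setminus\{0\})$, and the inequality $$\int_{\mathbb{R}^N}|\nabla w|^2\,dy\ \ge\ (N-2)^{\frac{2(N-1)}{N}}\,C\left(\int_{\mathbb{R}^N}|w|^{\frac{2N}{N-2}}\,dy\right)^{\frac{N-2}{N}}\qquad(B)$$ for radial functions $w=w(t)$, $t=|y|$, on $\mathbb{R}^N$. Then (A) and (B) are equivalent under the transformation $$w(t)=|x|^{\frac{N-2}{2}}u(|x|),\qquad t=\left(-\log\frac{|x|}{R}\right)^{-\frac1{N-2}}.$$ Consequently, the best constant in (A) is $$C_{HS}=S(N)\,(N-2)^{-2(N-1)/N},$$ and the minimizers are given by $$u_{m,n}(|x|)=|x|^{-\frac{N-2}{2}}\left(m^2+n^2\left(-\log\frac{|x|}{R}\right)^{-\frac{2}{N-2}}\right)^{-\frac{N-2}{2}},\quad x\in B_R\setminus\{0\},\qquad u_{m,n}|_{\partial B_R}=0,$$ with $m\neq0$, $n\ne0$.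
   Context: $S(N)=\frac{N(N-2)}{4}|\mathbb{S}_N|^{2/N}$, with $|\mathbb{S}_N|=2\pi^{(N+1)/2}/\Gamma((N+1)/2)$ the area of the $N$-dimensional unit sphere, is the best constant in the Sobolev inequality in $\mathbb{R}^N$. Minimizers are understood (up to nonzero multiplicative constants) in the space $H_r(B_R)$ of radial functions of $H(B_R)$, with $\int_{B_R}|\nabla u|^2dx-\left(\frac{N-2}{2}\right)^2\int_{B_R}\frac{u^2}{|x|^2}dx$ replaced by its extension $\|u\|^2_{H(B_R)}$ (the two agree on $C_0^\infty(B_R\setminus\{0\})$). Here $H(B_R)$ is the completion of $\{|x|^{-\frac{N-2}{2}}\phi:\phi\in C_0^\infty(B_R)\}$ under the norm $$\|u\|_{H(B_R)}^2=\int_{B_R}|\nabla u|^2dx-\left(\frac{N-2}{2}\right)^2\int_{B_R}\frac{u^2}{|x|^2}dx-L^2(u),$$ where $L(u)=\left(\frac{N(N-2)}{2}\omega_N\right)^{1/2}\lim_{|x|\to0}|x|^{\frac{N-2}{2}}u_r(|x|)$, $\omega_N$ is the Lebesgue measure of the unit ball of $\mathbb{R}^N$, $u_r(\rho)=\frac1{|\partial B_\rho|}\int_{\partial B_\rho}u\,ds$, and the difference of integrals is understood as the limit as $\varepsilon\to0$ of the difference over $B_R\setminus B_\varepsilon(0)$ for $u$ in the dense set (and the whole expression by completion in general). *)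

theory Defs
  imports "HOL-Analysis.Analysis"
begin

text \<open>
  The space \<open>\<real>\<^sup>N\<close> is a Euclidean space \<open>'a\<close> with \<open>N = DIM('a)\<close>.
\<close>

primrec C_k :: "nat \<Rightarrow> ('a::euclidean_space \<Rightarrow> real) \<Rightarrow> bool" where
  "C_k 0 f \<longleftrightarrow> continuous_on UNIV f"
| "C_k (Suc k) f \<longleftrightarrow> (\<forall>x. f differentiable at x) \<and>
     (\<forall>b\<in>Basis. C_k k (\<lambda>x. frechet_derivative f (at x) b))"

text \<open>
  The elements of \<open>C\<^sub>0\<^sup>\<infinity>(\<Omega>)\<close>, extended by zero to the whole space.
\<close>

definition test_functions :: "'a::euclidean_space set \<Rightarrow> ('a \<Rightarrow> real) set" where
  "test_functions \<Omega> = {f. (\<forall>k. C_k k f) \<and> compact (closure {x. f x \<noteq> 0}) \<and>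
     closure {x. f x \<noteq> 0} \<subseteq> \<Omega>}"

definition radial :: "('a::real_normed_vector \<Rightarrow> real) \<Rightarrow> bool" where
  "radial f \<longleftrightarrow> (\<forall>x y. norm x = norm y \<longrightarrow> f x = f y)"

definition grad :: "('a::euclidean_space \<Rightarrow> real) \<Rightarrow> 'a \<Rightarrow> 'a" where
  "grad f x = (THE D. GDERIV f x :> D)"

text \<open>
  The area of the \<open>N\<close>-dimensional unit sphere, which lies in \<open>\<real>\<^sup>N\<^sup>+\<^sup>1\<close>.
\<close>

definition sphere_area :: "real \<Rightarrow> real" where
  "sphere_area N = 2 * pi powr ((N + 1) / 2) / Gamma ((N + 1) / 2)"

definition sobolev_const :: "real \<Rightarrow> real" where
  "sobolev_const N = N * (N - 2) / 4 * sphere_area N powr (2 / N)"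

definition weighted_mass :: "real \<Rightarrow> ('a::euclidean_space \<Rightarrow> real) \<Rightarrow> real" where
  "weighted_mass R u = (let N = real DIM('a) in
     LINT x|lebesgue_on (ball 0 R).
       \<bar>u x\<bar> powr (2 * N / (N - 2)) * (- ln (norm x / R)) powr (- (2 * (N - 1) / (N - 2))))"

definition ineq_A :: "real \<Rightarrow> real \<Rightarrow> ('a::euclidean_space \<Rightarrow> real) \<Rightarrow> bool" where
  "ineq_A R C u \<longleftrightarrow> (let N = real DIM('a) in
     (LINT x|lebesgue_on (ball 0 R). (norm (grad u x))\<^sup>2)
       \<ge> ((N - 2) / 2)\<^sup>2 * (LINT x|lebesgue_on (ball 0 R). (u x)\<^sup>2 / (norm x)\<^sup>2)
         + C * weighted_mass R u powr ((N - 2) / N))"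

definition ineq_B :: "real \<Rightarrow> ('a::euclidean_space \<Rightarrow> real) \<Rightarrow> bool" where
  "ineq_B C w \<longleftrightarrow> (let N = real DIM('a) in
     (LINT y|lebesgue. (norm (grad w y))\<^sup>2)
       \<ge> (N - 2) powr (2 * (N - 1) / N) * C *
         (LINT y|lebesgue. \<bar>w y\<bar> powr (2 * N / (N - 2))) powr ((N - 2) / N))"

text \<open>
  The variable \<open>t = |y|\<close> runs through \<open>]0,\<infinity>[\<close> as \<open>|x|\<close> runs through \<open>]0,R[\<close>,
  so that the value \<open>w 0\<close> is not prescribed.
\<close>

definition transformed ::
  "real \<Rightarrow> ('a::euclidean_space \<Rightarrow> real) \<Rightarrow> ('a \<Rightarrow> real) \<Rightarrow> bool" where
  "transformed R u w \<longleftrightarrow> (let N = real DIM('a) in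
     \<forall>x\<in>ball 0 R - {0}. \<forall>y. norm y = (- ln (norm x / R)) powr (- (1 / (N - 2))) \<longrightarrow>
       w y = norm x powr ((N - 2) / 2) * u x)"

text \<open>
  The surface measure on \<open>\<partial>B\<^sub>\<rho>\<close>: the part of \<open>\<partial>B\<^sub>\<rho>\<close> in a cone has measure
  \<open>N \<rho>\<^sup>N\<^sup>-\<^sup>1\<close> times the volume of the part of the unit ball in the same cone. As a
  measure on the whole space it is concentrated on \<open>\<partial>B\<^sub>\<rho>\<close>.
\<close>

definition surface_measure :: "real \<Rightarrow> 'a::euclidean_space measure" where
  "surface_measure \<rho> = scale_measure (ennreal (real DIM('a) * \<rho> ^ (DIM('a) - 1)))
     (distr (restrict_space lborel (ball 0 1)) borel (\<lambda>x. (\<rho> / norm x) *\<^sub>R x))"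

definition spherical_mean :: "('a::euclidean_space \<Rightarrow> real) \<Rightarrow> real \<Rightarrow> real" where
  "spherical_mean u \<rho> =
     (LINT x:sphere 0 \<rho>|surface_measure \<rho>. u x) / measure (surface_measure \<rho> :: 'a measure) (sphere 0 \<rho>)"

definition L_functional :: "('a::euclidean_space \<Rightarrow> real) \<Rightarrow> real" where
  "L_functional u = (let N = real DIM('a) in
     sqrt (N * (N - 2) / 2 * measure lebesgue (ball (0::'a) 1)) *
       Lim (at_right 0) (\<lambda>\<rho>. \<rho> powr ((N - 2) / 2) * spherical_mean u \<rho>))"

definition H_core :: "real \<Rightarrow> ('a::euclidean_space \<Rightarrow> real) set" where
  "H_core R = {u. \<exists>\<phi>\<in>test_functions (ball 0 R).
     u = (\<lambda>x. norm x powr (- ((real DIM('a) - 2) / 2)) * \<phi> x)}"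

definition core_norm_sq :: "real \<Rightarrow> ('a::euclidean_space \<Rightarrow> real) \<Rightarrow> real" where
  "core_norm_sq R u =
     Lim (at_right 0) (\<lambda>\<epsilon>.
       (LINT x|lebesgue_on (ball 0 R - ball 0 \<epsilon>). (norm (grad u x))\<^sup>2)
       - ((real DIM('a) - 2) / 2)\<^sup>2 *
         (LINT x|lebesgue_on (ball 0 R - ball 0 \<epsilon>). (u x)\<^sup>2 / (norm x)\<^sup>2))
     - (L_functional u)\<^sup>2"

text \<open>
  Up to a constant, the norm on the dense set dominates that of \<open>L\<^sup>2(B\<^sub>R)\<close>, and the completion
  embeds into \<open>L\<^sup>2(B\<^sub>R)\<close>. So its elements are functions, up to equality almost
  everywhere in the ball: the limits in \<open>L\<^sup>2(B\<^sub>R)\<close> of the sequences in the dense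
  set that are Cauchy sequences for the norm.
\<close>

definition H_approx ::
  "real \<Rightarrow> (nat \<Rightarrow> 'a::euclidean_space \<Rightarrow> real) \<Rightarrow> ('a \<Rightarrow> real) \<Rightarrow> bool" where
  "H_approx R X u \<longleftrightarrow>
     (\<forall>k. X k \<in> H_core R) \<and>
     (\<forall>e>0. \<exists>M. \<forall>j\<ge>M. \<forall>k\<ge>M. core_norm_sq R (\<lambda>x. X j x - X k x) < e) \<and>
     (\<lambda>k. \<integral>\<^sup>+x. ennreal ((X k x - u x)\<^sup>2) \<partial>lebesgue_on (ball 0 R)) \<longlonglongrightarrow> 0"

definition H_space :: "real \<Rightarrow> ('a::euclidean_space \<Rightarrow> real) set" where
  "H_space R = {u \<in> borel_measurable (lebesgue_on (ball 0 R)). \<exists>X. H_approx R X u}"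

definition H_norm_sq :: "real \<Rightarrow> ('a::euclidean_space \<Rightarrow> real) \<Rightarrow> real" where
  "H_norm_sq R u = (THE l. \<exists>X. H_approx R X u \<and> (\<lambda>k. core_norm_sq R (X k)) \<longlonglongrightarrow> l)"

definition Hr_space :: "real \<Rightarrow> ('a::euclidean_space \<Rightarrow> real) set" where
  "Hr_space R = {u \<in> H_space R. \<exists>g::'a \<Rightarrow> real. radial g \<and> (AE x in lebesgue_on (ball 0 R). u x = g x)}"

definition HS_quotient :: "real \<Rightarrow> ('a::euclidean_space \<Rightarrow> real) \<Rightarrow> real" where
  "HS_quotient R u =
     H_norm_sq R u / weighted_mass R u powr ((real DIM('a) - 2) / real DIM('a))"

definition HS_minimizer :: "real \<Rightarrow> ('a::euclidean_space \<Rightarrow> real) \<Rightarrow> bool" where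
  "HS_minimizer R u \<longleftrightarrow>
     u \<in> Hr_space R \<and> \<not> (AE x in lebesgue_on (ball 0 R). u x = 0) \<and>
     (\<forall>v\<in>Hr_space R :: ('a \<Rightarrow> real) set. \<not> (AE x in lebesgue_on (ball 0 R). v x = 0) \<longrightarrow>
        HS_quotient R u \<le> HS_quotient R v)"

definition u_mn :: "real \<Rightarrow> real \<Rightarrow> real \<Rightarrow> 'a::euclidean_space \<Rightarrow> real" where
  "u_mn R m n x = (let N = real DIM('a) in
     if x \<in> ball 0 R - {0}
     then norm x powr (- ((N - 2) / 2)) *
       (m\<^sup>2 + n\<^sup>2 * (- ln (norm x / R)) powr (- (2 / (N - 2)))) powr (- ((N - 2) / 2))
     else 0)"

end

theory Submission
  imports Defs "HOL-Real_Asymp.Real_Asymp"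
begin

text \<open>
  Write \<open>u(x) = |x|\<^sup>-\<^sup>(\<^sup>N\<^sup>-\<^sup>2\<^sup>)\<^sup>/\<^sup>2 \<phi>(x)\<close> and, along a ray, \<open>\<phi> = e\<^sup>\<tau>\<^sup>/\<^sup>2 h(\<tau>)\<close> with
  \<open>\<tau> = ln (- ln (|x| / R))\<close>. For radial functions both (A) and (B) then become the inequality
  \<open>\<integral>(h' + h/2)\<^sup>2 \<ge> K (\<integral>|h|\<^sup>p)\<^sup>2\<^sup>/\<^sup>p\<close> on the line, \<open>p = 2N/(N-2)\<close>. With \<open>M = max |h|\<close>, completing squares
  in \<open>h' \<mp> M A(h/M)\<close>, where \<open>A(x) = |x|/2 (1 - |x|\<^sup>p\<^sup>-\<^sup>2)\<^sup>1\<^sup>/\<^sup>2\<close>, on the two sides of a maximum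
  point proves it with the sharp constant; equality forces the first order equation
  \<open>h' = \<plusminus> M A(h/M)\<close>, whose solutions are the translates of a power of \<open>cosh\<close>.

  On the dense set \<open>\<parallel>u\<parallel>\<^sup>2\<close> is the weighted Dirichlet integral of \<open>\<phi>\<close>, because the functional \<open>L\<close> is
  exactly the boundary term of an integration by parts. That form is closable in \<open>L\<^sup>2\<close>, so the
  extended norm is well defined. The approximating functions of an element of \<open>H\<^sub>r\<close> need not be
  radial, but by Fatou's lemma they converge along almost every ray, and on some ray the limiting
  energy is at most its average.
\<close>

subsection \<open>Smooth functions on open sets\<close>

text \<open>In the variable \<open>\<tau>\<close> all weights become constant and both sides of the
  line inequality are invariant under shifts of \<open>h\<close>; this is where the extremals get
  their second parameter besides the height. With \<open>q = 2 / (N - 2)\<close> one has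
  \<open>p = 2 + 2 * q\<close>. For a fixed \<open>M\<close> the calibration bounds the energy from
  below only by \<open>M^(-2q)/4 * P + 4 * c * M^2\<close>, where \<open>P\<close> is the mass.
  Minimising over \<open>M\<close> gives the sharp constant, and equality there ties the mass to
  \<open>M\<close>. That relation is indispensable, because the extremal equation is not uniquely
  solvable at height \<open>M\<close>: a solution may rest there on an interval before it descends.
  Such a plateau makes the mass too large. The other obstacle is that a minimizer is only a limit
  and has no derivative of its own. Equality is therefore analysed along the approximating sequence:
  the defect of the calibration tends to zero and the equation survives in integrated form. Uniform
  convergence of the profiles comes from the energies alone, since \<open>h(t)^2\<close> never
  exceeds the energy.\<close>

primrec Ck_on :: "nat \<Rightarrow> 'a::euclidean_space set \<Rightarrow> ('a \<Rightarrow> real) \<Rightarrow> bool" where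
  "Ck_on 0 S f \<longleftrightarrow> continuous_on S f"
| "Ck_on (Suc k) S f \<longleftrightarrow> (\<forall>x\<in>S. f differentiable at x) \<and>
     (\<forall>b\<in>Basis. Ck_on k S (\<lambda>x. frechet_derivative f (at x) b))"

definition smooth_on :: "'a::euclidean_space set \<Rightarrow> ('a \<Rightarrow> real) \<Rightarrow> bool" where
  "smooth_on S f \<longleftrightarrow> (\<forall>k. Ck_on k S f)"

lemma C_k_iff_Ck_on: "C_k k f \<longleftrightarrow> Ck_on k UNIV f"
  by (induction k arbitrary: f) auto

lemma Ck_on_subset: "Ck_on k S f \<Longrightarrow> T \<subseteq> S \<Longrightarrow> Ck_on k T f"
  by (induction k arbitrary: f) (auto intro: continuous_on_subset)

lemma frechet_derivative_cong_open:
  assumes "open S" "x \<in> S" "\<And>y. y \<in> S \<Longrightarrow> f y = g y"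
  shows "frechet_derivative f (at x) = frechet_derivative g (at x)"
proof -
  have "(f has_derivative D) (at x) \<longleftrightarrow> (g has_derivative D) (at x)" for D
    using has_derivative_transform_within_open[OF _ assms(1,2), of f D UNIV g]
      has_derivative_transform_within_open[OF _ assms(1,2), of g D UNIV f] assms(3) by auto
  then show ?thesis unfolding frechet_derivative_def by simp
qed

lemma differentiable_cong_open:
  assumes "open S" "x \<in> S" "\<And>y. y \<in> S \<Longrightarrow> f y = g y" "f differentiable at x"
  shows "g differentiable at x"
  using has_derivative_transform_within_open[OF _ assms(1,2), of f _ UNIV g] assms(3,4)
  unfolding differentiable_def by blast

text \<open>Derivatives are taken with respect to full neighbourhoods, so equality on
  \<open>S\<close> passes to derivatives because \<open>S\<close> is open. This lets a piecewise
  defined profile be treated on each piece separately.\<close>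

lemma Ck_on_cong:
  assumes "open S" "\<And>x. x \<in> S \<Longrightarrow> f x = g x" "Ck_on k S f"
  shows "Ck_on k S g"
  using assms(2,3)
proof (induction k arbitrary: f g)
  case 0
  then show ?case using continuous_on_cong[of S S f g] by simp
next
  case (Suc k)
  show ?case unfolding Ck_on.simps
  proof (intro conjI ballI)
    fix x assume "x \<in> S"
    then show "g differentiable at x"
      using Suc.prems(2) by (intro differentiable_cong_open[OF assms(1) \<open>x \<in> S\<close> Suc.prems(1)]) auto
  next
    fix b :: 'a assume b: "b \<in> Basis"
    have "frechet_derivative f (at x) b = frechet_derivative g (at x) b" if "x \<in> S" for x
      by (rule fun_cong[OF frechet_derivative_cong_open[OF assms(1) that Suc.prems(1)]])
    moreover have "Ck_on k S (\<lambda>x. frechet_derivative f (at x) b)"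
      using Suc.prems(2) b by simp
    ultimately show "Ck_on k S (\<lambda>x. frechet_derivative g (at x) b)"
      by (rule Suc.IH)
  qed
qed

text \<open>Any explicit derivative \<open>D\<close> may replace \<open>frechet_derivative\<close>,
  so each closure property below becomes a derivative rule followed by the induction
  hypothesis.\<close>

lemma Ck_on_Suc_I:
  assumes "open S" "\<And>x. x \<in> S \<Longrightarrow> (f has_derivative D x) (at x)"
    "\<And>b. b \<in> Basis \<Longrightarrow> Ck_on k S (\<lambda>x. D x b)"
  shows "Ck_on (Suc k) S f"
  unfolding Ck_on.simps
proof (intro conjI ballI)
  fix x assume "x \<in> S"
  then show "f differentiable at x" using assms(2) differentiable_def by blast
next
  fix b :: 'a assume b: "b \<in> Basis"
  show "Ck_on k S (\<lambda>x. frechet_derivative f (at x) b)"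
    by (rule Ck_on_cong[OF assms(1) _ assms(3)[OF b]]) (simp add: frechet_derivative_at[OF assms(2)])
qed

lemma Ck_on_Un: "open S \<Longrightarrow> open T \<Longrightarrow> Ck_on k S f \<Longrightarrow> Ck_on k T f \<Longrightarrow> Ck_on k (S \<union> T) f"
  by (induction k arbitrary: f) (auto intro: continuous_on_open_Un)

lemma Ck_on_has_derivative:
  "Ck_on (Suc k) S f \<Longrightarrow> x \<in> S \<Longrightarrow> (f has_derivative frechet_derivative f (at x)) (at x)"
  using frechet_derivative_works by auto

lemma frechet_derivative_worksI:
  "f differentiable at x \<Longrightarrow> (f has_derivative frechet_derivative f (at x)) (at x)"
  using frechet_derivative_works by auto

lemma Ck_on_SucD: "Ck_on (Suc k) S f \<Longrightarrow> Ck_on k S f"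
proof (induction k arbitrary: f)
  case 0
  then have "isCont f x" if "x \<in> S" for x
    using differentiable_imp_continuous_within[of f x UNIV] that by simp
  then show ?case by (simp add: continuous_at_imp_continuous_on)
next
  case (Suc k)
  then show ?case by (metis Ck_on.simps(2))
qed

lemma Ck_on_const: "open S \<Longrightarrow> Ck_on k S (\<lambda>x. c)"
proof (induction k arbitrary: c)
  case (Suc k)
  show ?case by (rule Ck_on_Suc_I[where D="\<lambda>x h. 0"]) (use Suc in auto)
qed auto

lemma Ck_on_add: "open S \<Longrightarrow> Ck_on k S f \<Longrightarrow> Ck_on k S g \<Longrightarrow> Ck_on k S (\<lambda>x. f x + g x)"
proof (induction k arbitrary: f g)
  case (Suc k)
  show ?case
    by (rule Ck_on_Suc_I[where D="\<lambda>x h. frechet_derivative f (at x) h + frechet_derivative g (at x) h"])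
      (use Suc in \<open>simp_all add: has_derivative_add frechet_derivative_worksI\<close>)
qed (auto intro: continuous_intros)

lemma Ck_on_mult: "open S \<Longrightarrow> Ck_on k S f \<Longrightarrow> Ck_on k S g \<Longrightarrow> Ck_on k S (\<lambda>x. f x * g x)"
proof (induction k arbitrary: f g)
  case (Suc k)
  note fg = Ck_on_SucD[OF Suc.prems(2)] Ck_on_SucD[OF Suc.prems(3)]
  have d: "((\<lambda>x. f x * g x) has_derivative
      (\<lambda>h. f x * frechet_derivative g (at x) h + frechet_derivative f (at x) h * g x)) (at x)" if "x \<in> S" for x
    using has_derivative_mult[OF Ck_on_has_derivative[OF Suc.prems(2) that] Ck_on_has_derivative[OF Suc.prems(3) that]] .
  show ?case
    by (rule Ck_on_Suc_I[OF Suc.prems(1) d]) (use Suc fg in \<open>auto intro!: Ck_on_add Suc.IH\<close>)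
qed (auto intro: continuous_intros)

lemma Ck_on_sum: "open S \<Longrightarrow> (\<And>i. i \<in> I \<Longrightarrow> Ck_on k S (f i)) \<Longrightarrow> Ck_on k S (\<lambda>x. \<Sum>i\<in>I. f i x)"
  by (induction I rule: infinite_finite_induct) (auto intro: Ck_on_const Ck_on_add)

lemma Ck_on_inner: "open S \<Longrightarrow> Ck_on k S (\<lambda>x. x \<bullet> v)"
proof (induction k)
  case (Suc k)
  show ?case
    by (rule Ck_on_Suc_I[where D="\<lambda>x h. h \<bullet> v"]) (auto intro!: derivative_eq_intros Ck_on_const Suc.prems)
qed (auto intro!: continuous_intros)

text \<open>The outer function is one-dimensional, so its derivative is again a single real
  function. The chain rule is then a product of that derivative, composed with \<open>g\<close>, and
  a partial derivative of \<open>g\<close>; the induction runs over \<open>F\<close> for this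
  reason.\<close>

lemma Ck_on_compose:
  fixes F :: "real \<Rightarrow> real"
  assumes "open S" "open I" "Ck_on k I F" "Ck_on k S g" "g ` S \<subseteq> I"
  shows "Ck_on k S (\<lambda>x. F (g x))"
  using assms(3,4)
proof (induction k arbitrary: F)
  case 0
  then show ?case using assms(5) by (auto intro: continuous_on_compose2)
next
  case (Suc k)
  have d: "((\<lambda>x. F (g x)) has_derivative
      (\<lambda>h. frechet_derivative F (at (g x)) 1 * frechet_derivative g (at x) h)) (at x)" if "x \<in> S" for x
  proof -
    have "(F has_derivative frechet_derivative F (at (g x))) (at (g x))"
      using Suc.prems(1) that assms(5) by (intro frechet_derivative_worksI) auto
    moreover have "frechet_derivative F (at (g x)) = (\<lambda>h. frechet_derivative F (at (g x)) 1 * h)"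
    proof
      fix h
      have "frechet_derivative F (at (g x)) (h *\<^sub>R 1) = h *\<^sub>R frechet_derivative F (at (g x)) 1"
        by (rule linear_cmul[OF has_derivative_linear[OF calculation]])
      then show "frechet_derivative F (at (g x)) h = frechet_derivative F (at (g x)) 1 * h"
        by simp
    qed
    ultimately have "(F has_derivative (\<lambda>h. frechet_derivative F (at (g x)) 1 * h)) (at (g x))"
      by simp
    from has_derivative_compose[OF Ck_on_has_derivative[OF Suc.prems(2) that] this]
    show ?thesis .
  qed
  show ?case
  proof (rule Ck_on_Suc_I[OF assms(1) d])
    fix b :: 'a assume "b \<in> Basis"
    show "Ck_on k S (\<lambda>x. frechet_derivative F (at (g x)) 1 * frechet_derivative g (at x) b)"
    proof (rule Ck_on_mult[OF assms(1)])
      show "Ck_on k S (\<lambda>x. frechet_derivative F (at (g x)) 1)"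
        by (rule Suc.IH[where F="\<lambda>y. frechet_derivative F (at y) 1"])
          (use Suc.prems(1) Ck_on_SucD[OF Suc.prems(2)] in simp_all)
      show "Ck_on k S (\<lambda>x. frechet_derivative g (at x) b)"
        using Suc.prems(2) \<open>b \<in> Basis\<close> by simp
    qed
  qed auto
qed

text \<open>The derivative along the ray is a combination of partial derivatives restricted to the
  same ray, to which the induction hypothesis applies.\<close>

lemma Ck_on_ray:
  fixes u :: "'a::euclidean_space \<Rightarrow> real"
  assumes "Ck_on k UNIV u"
  shows "Ck_on k UNIV (\<lambda>r::real. u (r *\<^sub>R e))"
  using assms
proof (induction k arbitrary: u)
  case 0
  then show ?case by (auto intro!: continuous_intros intro: continuous_on_compose2)
next
  case (Suc k)
  have d: "((\<lambda>r. u (r *\<^sub>R e)) has_derivative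
      (\<lambda>h. h * (\<Sum>b\<in>Basis. frechet_derivative u (at (r *\<^sub>R e)) b * (e \<bullet> b)))) (at r)" for r
  proof -
    let ?D = "frechet_derivative u (at (r *\<^sub>R e))"
    have D: "(u has_derivative ?D) (at (r *\<^sub>R e))"
      using Suc.prems by (intro frechet_derivative_worksI) auto
    have l: "linear ?D" using D has_derivative_linear by blast
    have "((\<lambda>r. u (r *\<^sub>R e)) has_derivative (\<lambda>h. ?D (h *\<^sub>R e))) (at r)"
      by (rule has_derivative_compose[where f="\<lambda>r. r *\<^sub>R e" and g=u and f'="\<lambda>h. h *\<^sub>R e", OF _ D])
        (auto intro!: derivative_eq_intros)
    moreover have "?D (h *\<^sub>R e) = h * (\<Sum>b\<in>Basis. ?D b * (e \<bullet> b))" for h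
    proof -
      have "?D e = ?D (\<Sum>b\<in>Basis. (e \<bullet> b) *\<^sub>R b)" by (simp add: euclidean_representation)
      also have "\<dots> = (\<Sum>b\<in>Basis. ?D b * (e \<bullet> b))"
        by (simp add: linear_sum[OF l] linear_cmul[OF l] mult.commute)
      finally show ?thesis by (simp add: linear_cmul[OF l])
    qed
    ultimately show ?thesis by simp
  qed
  show ?case
    by (rule Ck_on_Suc_I[OF _ d])
      (use Suc in \<open>auto intro!: Ck_on_sum Ck_on_mult Ck_on_const\<close>)
qed

lemma Ck_on_Suc_real_I:
  fixes f :: "real \<Rightarrow> real"
  assumes "open S" "\<And>x. x \<in> S \<Longrightarrow> (f has_real_derivative f' x) (at x)" "Ck_on k S f'"
  shows "Ck_on (Suc k) S f"
  by (rule Ck_on_Suc_I[where D="\<lambda>x h. f' x * h"])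
    (use assms in \<open>auto simp: has_field_derivative_def\<close>)

lemma smooth_on_powr: "smooth_on {0<..} (\<lambda>x::real. x powr a)"
proof -
  \<comment> \<open>Differentiation changes both the factor and the exponent, so both are general in
    the induction.\<close>
  have "Ck_on k {0<..} (\<lambda>x::real. c * x powr a)" for k c
  proof (induction k arbitrary: c a)
    case (Suc k)
    show ?case
      by (rule Ck_on_Suc_real_I[OF _ _ Suc[of "c * a" "a - 1"]])
        (auto intro!: derivative_eq_intros simp: powr_diff)
  qed (auto intro!: continuous_intros)
  from this[of _ 1] show ?thesis by (simp add: smooth_on_def)
qed

lemma smooth_on_exp: "smooth_on UNIV (exp :: real \<Rightarrow> real)"
proof -
  have "Ck_on k UNIV (exp :: real \<Rightarrow> real)" for k
  proof (induction k)
    case (Suc k)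
    show ?case by (rule Ck_on_Suc_real_I[OF _ _ Suc]) (auto intro!: derivative_eq_intros)
  qed (auto intro!: continuous_intros)
  then show ?thesis by (simp add: smooth_on_def)
qed

lemma smooth_on_ln: "smooth_on {0<..} (ln :: real \<Rightarrow> real)"
  unfolding smooth_on_def
proof
  fix k show "Ck_on k {0<..} (ln :: real \<Rightarrow> real)"
  proof (cases k)
    case (Suc n)
    have d: "(ln has_real_derivative x powr -1) (at x)" if "x \<in> {0<..}" for x :: real
      using DERIV_ln[of x] that by (simp add: powr_minus)
    have "Ck_on n {0<..} (\<lambda>x::real. x powr -1)"
      using smooth_on_powr[of "-1"] unfolding smooth_on_def by blast
    from Ck_on_Suc_real_I[OF _ d this] have "Ck_on (Suc n) {0<..} (ln :: real \<Rightarrow> real)"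
      by simp
    then show ?thesis using Suc by simp
  qed (auto intro!: continuous_intros)
qed

lemma smooth_on_subset: "smooth_on S f \<Longrightarrow> T \<subseteq> S \<Longrightarrow> smooth_on T f"
  unfolding smooth_on_def using Ck_on_subset by blast

lemma smooth_on_cong: "open S \<Longrightarrow> (\<And>x. x \<in> S \<Longrightarrow> f x = g x) \<Longrightarrow> smooth_on S f \<Longrightarrow> smooth_on S g"
  unfolding smooth_on_def using Ck_on_cong by blast

lemma smooth_on_Un: "open S \<Longrightarrow> open T \<Longrightarrow> smooth_on S f \<Longrightarrow> smooth_on T f \<Longrightarrow> smooth_on (S \<union> T) f"
  unfolding smooth_on_def using Ck_on_Un by blast

lemma smooth_on_const: "open S \<Longrightarrow> smooth_on S (\<lambda>x. c)"
  unfolding smooth_on_def using Ck_on_const by blast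

lemma smooth_on_add: "open S \<Longrightarrow> smooth_on S f \<Longrightarrow> smooth_on S g \<Longrightarrow> smooth_on S (\<lambda>x. f x + g x)"
  unfolding smooth_on_def using Ck_on_add by blast

lemma smooth_on_mult: "open S \<Longrightarrow> smooth_on S f \<Longrightarrow> smooth_on S g \<Longrightarrow> smooth_on S (\<lambda>x. f x * g x)"
  unfolding smooth_on_def using Ck_on_mult by blast

lemma smooth_on_diff: "open S \<Longrightarrow> smooth_on S f \<Longrightarrow> smooth_on S g \<Longrightarrow> smooth_on S (\<lambda>x. f x - g x)"
  using smooth_on_add[of S f "\<lambda>x. (-1) * g x"] smooth_on_mult[of S "\<lambda>x. -1" g] smooth_on_const[of S "-1"]
  by simp

lemma smooth_on_compose:
  fixes F :: "real \<Rightarrow> real"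
  shows "open S \<Longrightarrow> open I \<Longrightarrow> smooth_on I F \<Longrightarrow> smooth_on S g \<Longrightarrow> g ` S \<subseteq> I \<Longrightarrow> smooth_on S (\<lambda>x. F (g x))"
  unfolding smooth_on_def using Ck_on_compose by blast

lemma smooth_on_id: "open S \<Longrightarrow> smooth_on S (\<lambda>x::real. x)"
  unfolding smooth_on_def using Ck_on_inner[of S _ "1::real"] by (simp add: inner_real_def)

lemma open_Compl_0 [simp]: "open (- {0 :: 'a::{zero,t1_space}})"
  by (simp add: open_Compl)

text \<open>The norm is the power \<open>1/2\<close> of \<open>x \<bullet> x\<close>, whose partial
  derivatives are linear.\<close>

lemma smooth_on_norm: "smooth_on (- {0}) (norm :: 'a::euclidean_space \<Rightarrow> real)"
proof -
  have "Ck_on k (- {0}) (\<lambda>x::'a. x \<bullet> x)" for k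
  proof (cases k)
    case (Suc n)
    have "Ck_on (Suc n) (- {0}) (\<lambda>x::'a. x \<bullet> x)"
    proof (rule Ck_on_Suc_I[where D="\<lambda>x h. x \<bullet> (2 *\<^sub>R h)"])
      show "((\<lambda>x. x \<bullet> x) has_derivative (\<lambda>h. x \<bullet> (2 *\<^sub>R h))) (at x)" for x :: 'a
      proof -
        have "(\<lambda>h. x \<bullet> h + h \<bullet> x) = (\<lambda>h. x \<bullet> (2 *\<^sub>R h))"
          using inner_commute[of x] by auto
        then show ?thesis
          using has_derivative_inner[OF has_derivative_ident has_derivative_ident, of x UNIV] by metis
      qed
    next
      show "Ck_on n (- {0}) (\<lambda>x::'a. x \<bullet> (2 *\<^sub>R b))" for b
        by (rule Ck_on_inner) (simp add: open_Compl)
    qed (simp add: open_Compl)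
    then show ?thesis using Suc by simp
  qed (simp add: continuous_on_inner continuous_on_id)
  then have "smooth_on (- {0}) (\<lambda>x::'a. (x \<bullet> x) powr (1/2))"
    by (intro smooth_on_compose[OF _ _ smooth_on_powr]) (auto simp: smooth_on_def)
  then show ?thesis
    by (rule smooth_on_cong[rotated 2]) (auto simp: powr_half_sqrt norm_eq_sqrt_inner)
qed

subsection \<open>A smooth step\<close>

text \<open>The functions \<open>exp (-1/x) / x^n\<close>, continued by zero, are closed under
  differentiation up to linear combinations. Indexing them by \<open>n\<close> makes smoothness at 0
  a single induction.\<close>

definition flat :: "nat \<Rightarrow> real \<Rightarrow> real" where
  "flat n x = (if x \<le> 0 then 0 else exp (- (1 / x)) / x ^ n)"

lemma flat_has_derivative: "(flat n has_real_derivative flat (n + 2) x - real n * flat (Suc n) x) (at x)"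
proof -
  consider "x < 0" | "x > 0" | "x = 0" by linarith
  then show ?thesis
  proof cases
    case 1
    have "((\<lambda>x. 0) has_real_derivative 0) (at x)" by simp
    then have "(flat n has_real_derivative 0) (at x)"
      by (rule has_field_derivative_transform_within_open[where S="{..<0}"]) (use 1 in \<open>auto simp: flat_def\<close>)
    then show ?thesis using 1 by (simp add: flat_def)
  next
    case 2
    let ?y = "inverse x"
    have fl: "flat m x = exp (- ?y) * ?y ^ m" for m
      using 2 by (simp add: flat_def divide_inverse power_inverse)
    have "((\<lambda>x. exp (- inverse x) * inverse x ^ n) has_real_derivative
        exp (- ?y) * ?y ^ 2 * ?y ^ n + (real n * (?y ^ (n - 1) * - (?y ^ 2))) * exp (- ?y)) (at x)"
      using 2 by (auto intro!: derivative_eq_intros simp: power2_eq_square)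
    moreover have "exp (- ?y) * ?y ^ 2 * ?y ^ n + (real n * (?y ^ (n - 1) * - (?y ^ 2))) * exp (- ?y)
        = flat (n + 2) x - real n * flat (Suc n) x"
      unfolding fl by (cases n) (auto simp: power2_eq_square algebra_simps)
    ultimately have "((\<lambda>x. exp (- inverse x) * inverse x ^ n) has_real_derivative
        flat (n + 2) x - real n * flat (Suc n) x) (at x)"
      by metis
    then show ?thesis
      by (rule has_field_derivative_transform_within_open[where S="{0<..}"])
        (use 2 in \<open>auto simp: flat_def divide_inverse power_inverse\<close>)
  next
    case 3
    \<comment> \<open>Only the right difference quotient at 0 is not identically zero; with
      \<open>z = 1/y\<close> it is a power against an exponential.\<close>
    have "((\<lambda>y. exp (- (1 / y)) / y ^ Suc n) \<longlongrightarrow> 0) (at_right (0::real))"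
    proof -
      have "((\<lambda>z::real. z ^ Suc n / exp z) \<longlongrightarrow> 0) at_top"
        by (rule tendsto_power_div_exp_0)
      then have "((\<lambda>y. (inverse y) ^ Suc n / exp (inverse y)) \<longlongrightarrow> 0) (at_right (0::real))"
        by (rule filterlim_compose[OF _ filterlim_inverse_at_top_right])
      then show ?thesis
        by (rule Lim_transform_eventually)
          (simp add: exp_minus divide_inverse power_inverse mult.commute)
    qed
    moreover have "\<forall>\<^sub>F y in at_right (0::real). exp (- (1 / y)) / y ^ Suc n = flat n y / y"
      using eventually_at_right_less[of "0::real"] by eventually_elim (simp add: flat_def)
    ultimately have r: "((\<lambda>y. flat n y / y) \<longlongrightarrow> 0) (at_right 0)"
      by (rule Lim_transform_eventually)
    have l: "((\<lambda>y. flat n y / y) \<longlongrightarrow> 0) (at_left 0)"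
      by (rule tendsto_eventually) (simp add: eventually_at_filter flat_def)
    have "((\<lambda>y. flat n y / y) \<longlongrightarrow> 0) (at 0)"
      using l r by (simp add: filterlim_at_split)
    then show ?thesis using 3 by (simp add: has_field_derivative_iff flat_def)
  qed
qed

lemma smooth_on_flat: "smooth_on UNIV (flat n)"
  unfolding smooth_on_def
proof
  fix k show "Ck_on k UNIV (flat n)"
  proof (induction k arbitrary: n)
    case 0
    show ?case
      using DERIV_isCont[OF flat_has_derivative[of n]] by (simp add: continuous_at_imp_continuous_on)
  next
    case (Suc k)
    have "Ck_on k UNIV (\<lambda>x. flat (n + 2) x + (- real n) * flat (Suc n) x)"
      by (intro Ck_on_add Ck_on_mult Ck_on_const Suc) auto
    then have "Ck_on k UNIV (\<lambda>x. flat (n + 2) x - real n * flat (Suc n) x)" by simp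
    from Ck_on_Suc_real_I[OF _ flat_has_derivative this] show ?case by simp
  qed
qed

text \<open>The summands of the denominator never vanish together, since \<open>x\<close> and
  \<open>1 - x\<close> cannot both be nonpositive.\<close>

definition smooth_step :: "real \<Rightarrow> real" where
  "smooth_step x = flat 0 x / (flat 0 x + flat 0 (1 - x))"

lemma smooth_step_denom_pos: "flat 0 x + flat 0 (1 - x) > 0"
  unfolding flat_def by (auto simp: add_pos_pos)

lemma smooth_step_le_0: "x \<le> 0 \<Longrightarrow> smooth_step x = 0"
  by (simp add: smooth_step_def flat_def)

lemma smooth_step_ge_1: "x \<ge> 1 \<Longrightarrow> smooth_step x = 1"
  by (simp add: smooth_step_def flat_def)

lemma smooth_step_bounds: "0 \<le> smooth_step x" "smooth_step x \<le> 1"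
  using smooth_step_denom_pos[of x] by (auto simp: smooth_step_def flat_def divide_simps)

lemma smooth_on_smooth_step: "smooth_on UNIV smooth_step"
proof -
  have s: "smooth_on UNIV (\<lambda>x. flat 0 (1 - x))"
    by (rule smooth_on_compose[OF _ _ smooth_on_flat[of 0] smooth_on_diff[OF _ smooth_on_const smooth_on_id]]) auto
  have "smooth_on UNIV (\<lambda>x. flat 0 x * (flat 0 x + flat 0 (1 - x)) powr (-1))"
    by (intro smooth_on_mult smooth_on_flat smooth_on_compose[OF _ _ smooth_on_powr smooth_on_add] s)
      (use smooth_step_denom_pos in auto)
  moreover have "flat 0 x * (flat 0 x + flat 0 (1 - x)) powr (-1) = smooth_step x" for x
    using smooth_step_denom_pos[of x] by (simp add: smooth_step_def powr_minus field_simps)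
  ultimately show ?thesis by (simp add: fun_eq_iff cong: if_cong)
qed

subsection \<open>Radial test functions\<close>

lemma test_functions_iff_smooth:
  "f \<in> test_functions S \<longleftrightarrow> smooth_on UNIV f \<and> compact (closure {x. f x \<noteq> 0}) \<and> closure {x. f x \<noteq> 0} \<subseteq> S"
  by (simp add: test_functions_def smooth_on_def C_k_iff_Ck_on)

lemma compact_closure_subset:
  fixes A K :: "'a::euclidean_space set"
  assumes "A \<subseteq> K" "compact K"
  shows "compact (closure A)" "closure A \<subseteq> K"
proof -
  show "closure A \<subseteq> K" using assms by (simp add: closure_minimal compact_imp_closed)
  then show "compact (closure A)"
    using compact_Int_closed[OF assms(2) closed_closure, of A] by (simp add: Int_absorb1)
qed

lemma test_functions_subset: "S \<subseteq> T \<Longrightarrow> test_functions S \<subseteq> test_functions T"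
  unfolding test_functions_def by blast

lemma test_functions_outside: "f \<in> test_functions S \<Longrightarrow> x \<notin> S \<Longrightarrow> f x = 0"
  unfolding test_functions_def using closure_subset[of "{x. f x \<noteq> 0}"] by blast

lemma test_functions_diff:
  assumes "f \<in> test_functions S" "g \<in> test_functions S"
  shows "(\<lambda>x. f x - g x) \<in> test_functions S"
proof -
  let ?K = "closure {x. f x \<noteq> 0} \<union> closure {x. g x \<noteq> 0}"
  have K: "compact ?K" "?K \<subseteq> S" using assms by (auto simp: test_functions_iff_smooth)
  have "{x. f x - g x \<noteq> 0} \<subseteq> {x. f x \<noteq> 0} \<union> {x. g x \<noteq> 0}" by auto
  then have "{x. f x - g x \<noteq> 0} \<subseteq> ?K"
    using closure_subset[of "{x. f x \<noteq> 0}"] closure_subset[of "{x. g x \<noteq> 0}"] by blast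
  then have c: "closure {x. f x - g x \<noteq> 0} \<subseteq> ?K"
    using K(1) by (simp add: closure_minimal compact_imp_closed)
  then have "compact (closure {x. f x - g x \<noteq> 0})"
    using compact_Int_closed[OF K(1) closed_closure, of "{x. f x - g x \<noteq> 0}"] by (simp add: Int_absorb1)
  then show ?thesis
    using assms c K(2) smooth_on_diff[OF open_UNIV, of f g] unfolding test_functions_iff_smooth by blast
qed

lemma test_functions_norm_bounds:
  fixes f :: "'a::euclidean_space \<Rightarrow> real"
  assumes "f \<in> test_functions S" "S \<subseteq> ball 0 c - {0}" "c > 0"
  obtains a b where "0 < a" "a \<le> b" "b < c" "\<And>x. f x \<noteq> 0 \<Longrightarrow> a \<le> norm x \<and> norm x \<le> b"
proof -
  let ?K = "closure {x. f x \<noteq> 0}"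
  have K: "compact ?K" "?K \<subseteq> ball 0 c - {0}" using assms by (auto simp: test_functions_iff_smooth)
  show ?thesis
  proof (cases "?K = {}")
    case True
    then have "f x = 0" for x using closure_subset[of "{x. f x \<noteq> 0}"] by auto
    \<comment> \<open>The zero function has no support to read bounds from; any annulus inside the
      ball serves.\<close>
    then show ?thesis using that[of "c/2" "c/2"] assms(3) by auto
  next
    case False
    have "continuous_on ?K norm" by (intro continuous_intros)
    obtain p where p: "p \<in> ?K" "\<And>x. x \<in> ?K \<Longrightarrow> norm p \<le> norm x"
      using continuous_attains_inf[OF K(1) False \<open>continuous_on ?K norm\<close>] by blast
    obtain q where q: "q \<in> ?K" "\<And>x. x \<in> ?K \<Longrightarrow> norm x \<le> norm q"
      using continuous_attains_sup[OF K(1) False \<open>continuous_on ?K norm\<close>] by blast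
    have "x \<in> ?K" if "f x \<noteq> 0" for x using closure_subset[of "{x. f x \<noteq> 0}"] that by blast
    then show ?thesis using that[of "norm p" "norm q"] p q K(2) by fastforce
  qed
qed

lemma test_functions_norm_bounds_UNIV:
  fixes f :: "'a::euclidean_space \<Rightarrow> real"
  assumes "f \<in> test_functions (UNIV - {0})"
  obtains a b where "0 < a" "a \<le> b" "\<And>x. f x \<noteq> 0 \<Longrightarrow> a \<le> norm x \<and> norm x \<le> b"
proof -
  let ?K = "closure {x. f x \<noteq> 0}"
  have K: "compact ?K" "?K \<subseteq> UNIV - {0}" using assms by (auto simp: test_functions_iff_smooth)
  obtain c where c: "c > 0" "\<And>x. x \<in> ?K \<Longrightarrow> norm x < c"
    using K(1) bounded_pos_less compact_imp_bounded by metis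
  have "f \<in> test_functions (ball 0 c - {0})"
    using assms c K by (auto simp: test_functions_iff_smooth)
  then show ?thesis using test_functions_norm_bounds[OF _ order_refl c(1)] that by metis
qed

text \<open>The norm is not smooth at the origin. The gap \<open>a > 0\<close> below the support
  makes the function vanish near that point, and the two open sets glued here cover the
  space.\<close>

lemma test_functions_profile:
  assumes "smooth_on {0<..} F" "0 < a" "\<And>r. F r \<noteq> 0 \<Longrightarrow> a \<le> r \<and> r \<le> b"
  shows "(\<lambda>x::'a::euclidean_space. F (norm x)) \<in> test_functions (cball 0 b - ball 0 a)"
proof -
  let ?f = "\<lambda>x::'a. F (norm x)"
  have "smooth_on (- {0}) ?f"
    by (rule smooth_on_compose[OF _ _ assms(1) smooth_on_norm]) auto
  moreover have "smooth_on (ball 0 a) ?f"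
    by (rule smooth_on_cong[OF _ _ smooth_on_const[of _ 0]]) (use assms(3) in fastforce)+
  ultimately have "smooth_on (- {0} \<union> ball 0 a) ?f"
    by (intro smooth_on_Un) auto
  moreover have "- {0} \<union> ball (0::'a) a = UNIV" using assms(2) by auto
  ultimately have "smooth_on UNIV ?f" by simp
  moreover have "{x. ?f x \<noteq> 0} \<subseteq> cball 0 b - ball 0 a" using assms(3) by fastforce
  moreover have "compact (cball 0 b - ball (0::'a) a)" by (simp add: compact_diff)
  ultimately show ?thesis
    using compact_closure_subset[of "{x. ?f x \<noteq> 0}" "cball 0 b - ball 0 a"]
    unfolding test_functions_iff_smooth by blast
qed

lemma radial_eq: "radial f \<Longrightarrow> norm e = 1 \<Longrightarrow> f x = f (norm x *\<^sub>R e)"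
  unfolding radial_def by (drule spec[of _ x], drule spec[of _ "norm x *\<^sub>R e"]) simp

lemma smooth_profile: "f \<in> test_functions S \<Longrightarrow> smooth_on UNIV (\<lambda>r::real. f (r *\<^sub>R e))"
  unfolding test_functions_iff_smooth smooth_on_def using Ck_on_ray by blast

lemma ex_unit_vector: "\<exists>e::'a::euclidean_space. norm e = 1"
  using norm_Basis[OF SOME_Basis] by blast

section \<open>The substitution between radii in the ball and in the whole space\<close>

definition log_radius :: "real \<Rightarrow> real \<Rightarrow> real \<Rightarrow> real" where
  "log_radius R N r = (- ln (r / R)) powr (- (1 / (N - 2)))"

definition exp_radius :: "real \<Rightarrow> real \<Rightarrow> real \<Rightarrow> real" where
  "exp_radius R N t = R * exp (- (t powr (- (N - 2))))"

lemma radius_inverse: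
  assumes "R > 0" "N > 2"
  shows "0 < r \<Longrightarrow> r < R \<Longrightarrow> exp_radius R N (log_radius R N r) = r"
    and "0 < r \<Longrightarrow> r < R \<Longrightarrow> log_radius R N r > 0"
    and "0 < t \<Longrightarrow> log_radius R N (exp_radius R N t) = t"
    and "0 < t \<Longrightarrow> 0 < exp_radius R N t \<and> exp_radius R N t < R"
proof -
  assume r: "0 < r" "r < R"
  have l: "ln (r / R) < 0" using r assms by simp
  have m: "(- (1 / (N - 2))) * (- (N - 2)) = 1"
    unfolding minus_mult_minus using assms by simp
  show "exp_radius R N (log_radius R N r) = r"
    unfolding exp_radius_def log_radius_def powr_powr m using r l assms by simp
  show "log_radius R N r > 0" using l by (simp add: log_radius_def)
next
  assume t: "0 < t"
  have m: "(- (N - 2)) * (- (1 / (N - 2))) = 1"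
    unfolding minus_mult_minus using assms by simp
  show "log_radius R N (exp_radius R N t) = t"
    unfolding exp_radius_def log_radius_def using t assms by (simp add: powr_powr m del: minus_diff_eq)
  show "0 < exp_radius R N t \<and> exp_radius R N t < R"
    using t assms by (simp add: exp_radius_def)
qed

lemma exp_radius_mono: "R > 0 \<Longrightarrow> N > 2 \<Longrightarrow> 0 < s \<Longrightarrow> s \<le> t \<Longrightarrow> exp_radius R N s \<le> exp_radius R N t"
  by (simp add: exp_radius_def powr_mono2')

lemma log_radius_mono: "R > 0 \<Longrightarrow> N > 2 \<Longrightarrow> 0 < r \<Longrightarrow> r \<le> s \<Longrightarrow> s < R \<Longrightarrow> log_radius R N r \<le> log_radius R N s"
  using radius_inverse[of R N] exp_radius_mono[of R N "log_radius R N s" "log_radius R N r"]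
  by (smt (verit))

lemma smooth_on_exp_radius:
  assumes "R > 0" "N > 2"
  shows "smooth_on {0<..} (exp_radius R N)"
proof -
  have "smooth_on {0<..} (\<lambda>t. (-1) * t powr (- (N - 2)))"
    by (intro smooth_on_mult smooth_on_const smooth_on_powr) auto
  from smooth_on_compose[OF _ open_UNIV smooth_on_exp this]
  have "smooth_on {0<..} (\<lambda>t. exp ((-1) * t powr (- (N - 2))))" by simp
  then have "smooth_on {0<..} (\<lambda>t. R * exp ((-1) * t powr (- (N - 2))))"
    by (intro smooth_on_mult smooth_on_const) auto
  then show ?thesis by (simp add: exp_radius_def[abs_def])
qed

lemma smooth_on_neg_ln_div:
  assumes "R > 0"
  shows "smooth_on {0<..<R} (\<lambda>r. - ln (r / R))"
proof -
  have "smooth_on {0<..<R} (\<lambda>r. ln R - ln r)"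
    by (intro smooth_on_diff smooth_on_const smooth_on_subset[OF smooth_on_ln]) auto
  then show ?thesis
    by (rule smooth_on_cong[rotated 2]) (use assms in \<open>auto simp: ln_div\<close>)
qed

lemma smooth_on_log_radius:
  assumes "R > 0" "N > 2"
  shows "smooth_on {0<..<R} (log_radius R N)"
proof -
  have "smooth_on {0<..<R} (\<lambda>r. (- ln (r / R)) powr (- (1 / (N - 2))))"
    by (rule smooth_on_compose[OF _ _ smooth_on_powr smooth_on_neg_ln_div]) (use assms in auto)
  then show ?thesis by (simp add: log_radius_def[abs_def])
qed

text \<open>For radial functions the condition on pairs of points is a condition on one ray,
  parametrised by the radius in the whole space.\<close>

lemma transformed_iff:
  fixes u w :: "'a::euclidean_space \<Rightarrow> real"
  assumes N: "DIM('a) \<ge> 3" and R: "R > 0" and "norm (e::'a) = 1" "radial u" "radial w"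
  shows "transformed R u w \<longleftrightarrow> (\<forall>t>0. w (t *\<^sub>R e) =
    exp_radius R (real DIM('a)) t powr ((real DIM('a) - 2) / 2) * u (exp_radius R (real DIM('a)) t *\<^sub>R e))"
    (is "_ \<longleftrightarrow> ?rhs")
proof -
  let ?N = "real DIM('a)"
  have N2: "?N > 2" using N by simp
  note inv = radius_inverse[OF R N2]
  show ?thesis
  proof
    assume tr: "transformed R u w"
    show ?rhs
    proof (intro allI impI)
      fix t :: real assume t: "t > 0"
      have "exp_radius R ?N t *\<^sub>R e \<in> ball 0 R - {0}"
        using inv(4)[OF t] assms(3) by auto
      moreover have "norm (t *\<^sub>R e) = (- ln (norm (exp_radius R ?N t *\<^sub>R e) / R)) powr (- (1 / (?N - 2)))"
        using inv(3)[OF t] inv(4)[OF t] t assms(3) by (simp add: log_radius_def)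
      ultimately have "w (t *\<^sub>R e) = norm (exp_radius R ?N t *\<^sub>R e) powr ((?N - 2) / 2) * u (exp_radius R ?N t *\<^sub>R e)"
        using tr unfolding transformed_def Let_def by blast
      then show "w (t *\<^sub>R e) = exp_radius R (real DIM('a)) t powr ((real DIM('a) - 2) / 2) * u (exp_radius R (real DIM('a)) t *\<^sub>R e)"
        using inv(4)[OF t] assms(3) by simp
    qed
  next
    assume r: ?rhs
    show "transformed R u w"
      unfolding transformed_def Let_def
    proof (intro ballI allI impI)
      fix x y :: 'a assume x: "x \<in> ball 0 R - {0}" and y: "norm y = (- ln (norm x / R)) powr (- (1 / (?N - 2)))"
      then have nx: "0 < norm x" "norm x < R" by auto
      have ny: "norm y = log_radius R ?N (norm x)" using y by (simp add: log_radius_def)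
      have "w y = w (norm y *\<^sub>R e)" using radial_eq[OF assms(5,3)] .
      also have "\<dots> = norm x powr ((?N - 2) / 2) * u (norm x *\<^sub>R e)"
        using r[rule_format, of "norm y"] inv(1,2)[OF nx] unfolding ny by simp
      also have "u (norm x *\<^sub>R e) = u x" using radial_eq[OF assms(4,3), of x] by simp
      finally show "w y = norm x powr ((?N - 2) / 2) * u x" .
    qed
  qed
qed

text \<open>Both radius maps are smooth and monotone, so supports bounded away from the two ends
  stay so. The relation leaves \<open>w 0\<close> open; uniqueness holds because the support of a
  candidate \<open>w\<close> avoids the origin.\<close>

lemma transform_bijection:
  fixes R :: real
  assumes N: "DIM('a::euclidean_space) \<ge> 3" and R: "R > 0"
  shows "u \<in> test_functions (ball (0::'a) R - {0}) \<Longrightarrow> radial u \<Longrightarrow>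
      \<exists>!w. w \<in> test_functions (UNIV - {0}) \<and> radial w \<and> transformed R u w"
    and "w \<in> test_functions (UNIV - {0::'a}) \<Longrightarrow> radial w \<Longrightarrow>
      \<exists>!u. u \<in> test_functions (ball 0 R - {0}) \<and> radial u \<and> transformed R u w"
proof -
  let ?N = "real DIM('a)"
  have N2: "?N > 2" using N by simp
  note inv = radius_inverse[OF R N2]
  let ?\<alpha> = "(real DIM('a) - 2) / 2"
  obtain e :: 'a where e: "norm e = 1" using ex_unit_vector by blast
  note tr = transformed_iff[OF N R e]
  {
    assume u: "u \<in> test_functions (ball (0::'a) R - {0})" "radial u"
    obtain a b where ab: "0 < a" "a \<le> b" "b < R" "\<And>x. u x \<noteq> 0 \<Longrightarrow> a \<le> norm x \<and> norm x \<le> b"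
      using test_functions_norm_bounds[OF u(1) order_refl R] by blast
    define F where "F t = (if t > 0 then exp_radius R ?N t powr ?\<alpha> * u (exp_radius R ?N t *\<^sub>R e) else 0)" for t
    have "smooth_on {0<..} (\<lambda>t. exp_radius R ?N t powr ?\<alpha> * u (exp_radius R ?N t *\<^sub>R e))"
      using smooth_on_exp_radius[OF R N2] inv(4)
      by (intro smooth_on_mult smooth_on_compose[OF _ _ smooth_on_powr] smooth_on_compose[OF _ _ smooth_profile[OF u(1)]])
         auto
    then have sF: "smooth_on {0<..} F" by (rule smooth_on_cong[rotated 2]) (auto simp: F_def)
    have F0: "log_radius R ?N a \<le> t \<and> t \<le> log_radius R ?N b" if "F t \<noteq> 0" for t
    proof -
      have t: "t > 0" "u (exp_radius R ?N t *\<^sub>R e) \<noteq> 0" using that by (auto simp: F_def split: if_splits)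
      then have "a \<le> exp_radius R ?N t \<and> exp_radius R ?N t \<le> b"
        using ab(4)[OF t(2)] inv(4)[OF t(1)] e by simp
      then show ?thesis
        using log_radius_mono[OF R N2, of a "exp_radius R ?N t"] log_radius_mono[OF R N2, of "exp_radius R ?N t" b]
          inv(3,4)[OF t(1)] ab(1,3) by auto
    qed
    have la: "log_radius R ?N a > 0" using ab inv(2) by auto
    let ?w = "\<lambda>y::'a. F (norm y)"
    have w: "?w \<in> test_functions (UNIV - {0})"
      by (rule subsetD[OF test_functions_subset test_functions_profile[OF sF la F0]]) (use la in auto)
    have rw: "radial ?w" by (simp add: radial_def)
    have tw: "transformed R u ?w" unfolding tr[OF u(2) rw] using e by (simp add: F_def)
    show "\<exists>!w. w \<in> test_functions (UNIV - {0}) \<and> radial w \<and> transformed R u w"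
    proof (rule ex1I[of _ ?w])
      fix w assume w': "w \<in> test_functions (UNIV - {0}) \<and> radial w \<and> transformed R u w"
      show "w = ?w"
      proof
        fix y :: 'a
        show "w y = ?w y"
        proof (cases "y = 0")
          case True then show ?thesis using test_functions_outside[of w "UNIV - {0}" 0] w' by (simp add: F_def)
        next
          case False
          then have "w (norm y *\<^sub>R e) = F (norm y)" using w' tr[OF u(2), of w] by (simp add: F_def)
          then show ?thesis using radial_eq[OF _ e, of w y] w' by simp
        qed
      qed
    qed (use w rw tw in simp)
  }
  {
    assume w: "w \<in> test_functions (UNIV - {0::'a})" "radial w"
    obtain a b where ab: "0 < a" "a \<le> b" "\<And>x. w x \<noteq> 0 \<Longrightarrow> a \<le> norm x \<and> norm x \<le> b"
      using test_functions_norm_bounds_UNIV[OF w(1)] by blast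
    define F where "F r = (if 0 < r \<and> r < R then r powr (- ?\<alpha>) * w (log_radius R ?N r *\<^sub>R e) else 0)" for r
    have F0: "exp_radius R ?N a \<le> r \<and> r \<le> exp_radius R ?N b" if "F r \<noteq> 0" for r
    proof -
      have t: "0 < r" "r < R" "w (log_radius R ?N r *\<^sub>R e) \<noteq> 0" using that by (auto simp: F_def split: if_splits)
      then have "a \<le> log_radius R ?N r \<and> log_radius R ?N r \<le> b"
        using ab(3)[OF t(3)] inv(2)[OF t(1,2)] e by simp
      then show ?thesis
        using exp_radius_mono[OF R N2, of a "log_radius R ?N r"] exp_radius_mono[OF R N2, of "log_radius R ?N r" b]
          inv(1,2)[OF t(1,2)] ab(1) by auto
    qed
    have ra: "exp_radius R ?N a > 0" and rb: "exp_radius R ?N b < R" using ab inv(4) by auto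
    have "smooth_on {0<..<R} (\<lambda>r. r powr (- ?\<alpha>) * w (log_radius R ?N r *\<^sub>R e))"
      using smooth_on_log_radius[OF R N2]
      by (intro smooth_on_mult smooth_on_subset[OF smooth_on_powr] smooth_on_compose[OF _ _ smooth_profile[OF w(1)]])
         auto
    then have "smooth_on {0<..<R} F" by (rule smooth_on_cong[rotated 2]) (auto simp: F_def)
    \<comment> \<open>\<open>log_radius\<close> is singular at \<open>R\<close>. Smoothness across
      that radius comes from \<open>F\<close> being zero already beyond
      \<open>exp_radius R ?N b\<close>, which is less than \<open>R\<close>.\<close>
    moreover have "smooth_on {exp_radius R ?N b<..} F"
      by (rule smooth_on_cong[OF _ _ smooth_on_const[of _ 0]]) (use F0 in fastforce)+
    ultimately have "smooth_on ({0<..<R} \<union> {exp_radius R ?N b<..}) F" by (intro smooth_on_Un) auto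
    then have sF: "smooth_on {0<..} F" by (rule smooth_on_subset) (use rb in auto)
    let ?u = "\<lambda>y::'a. F (norm y)"
    have u: "?u \<in> test_functions (ball 0 R - {0})"
      by (rule subsetD[OF test_functions_subset test_functions_profile[OF sF ra F0]]) (use ra rb in auto)
    have ru: "radial ?u" by (simp add: radial_def)
    have tu: "transformed R ?u w"
      unfolding tr[OF ru w(2)]
    proof (intro allI impI)
      fix t :: real assume t: "t > 0"
      show "w (t *\<^sub>R e) = exp_radius R ?N t powr ?\<alpha> * F (norm (exp_radius R ?N t *\<^sub>R e))"
        using inv(3,4)[OF t] e by (simp add: F_def powr_minus)
    qed
    show "\<exists>!u. u \<in> test_functions (ball 0 R - {0}) \<and> radial u \<and> transformed R u w"
    proof (rule ex1I[of _ ?u])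
      fix u assume u': "u \<in> test_functions (ball 0 R - {0}) \<and> radial u \<and> transformed R u w"
      show "u = ?u"
      proof
        fix x :: 'a
        show "u x = ?u x"
        proof (cases "x \<in> ball 0 R - {0}")
          case False
          then show ?thesis using test_functions_outside[of u "ball 0 R - {0}" x] u' by (auto simp: F_def)
        next
          case True
          then have nx: "0 < norm x" "norm x < R" by auto
          have "w (log_radius R ?N (norm x) *\<^sub>R e) = norm x powr ?\<alpha> * u (norm x *\<^sub>R e)"
            using u' tr[of u w] w(2) inv(1,2)[OF nx] by simp
          then have "u (norm x *\<^sub>R e) = F (norm x)" using nx by (simp add: F_def powr_minus field_simps)
          then show ?thesis using radial_eq[OF _ e, of u x] u' by simp
        qed
      qed
    qed (use u ru tu in simp)
  }
qed

subsection \<open>The inequality on the line\<close>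

text \<open>The root of \<open>A^2 = x^2/4 - |x|^(2+2q)/4\<close>, the zero energy level of the
  Euler-Lagrange equation for extremals of height 1. Since \<open>sqrt\<close> is odd and continuous
  on the reals, the formula is continuous also for \<open>|x| > 1\<close>, so an antiderivative
  exists on the whole line.\<close>

definition A_fun :: "real \<Rightarrow> real \<Rightarrow> real" where
  "A_fun q x = \<bar>x\<bar> / 2 * sqrt (1 - \<bar>x\<bar> powr (2 * q))"

lemma continuous_A_fun: "q > 0 \<Longrightarrow> continuous_on S (A_fun q)"
  unfolding A_fun_def[abs_def]
  by (intro continuous_on_mult continuous_on_divide continuous_on_real_sqrt continuous_on_diff
      continuous_on_const continuous_on_powr' continuous_on_rabs continuous_on_id) auto

text \<open>An arbitrary antiderivative; only differences of its values matter.\<close>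

definition G_fun :: "real \<Rightarrow> real \<Rightarrow> real" where
  "G_fun q = (SOME G. \<forall>x. (G has_real_derivative A_fun q x) (at x))"

lemma G_fun_derivative:
  assumes "q > 0"
  shows "(G_fun q has_real_derivative A_fun q x) (at x)"
proof -
  have "isCont (A_fun q) x" for x
    using continuous_A_fun[OF assms, of UNIV] by (simp add: continuous_on_eq_continuous_at)
  then have "\<exists>F. \<forall>x::real. (-\<infinity>) < ereal x \<longrightarrow> ereal x < \<infinity> \<longrightarrow> (F has_vector_derivative A_fun q x) (at x)"
    by (intro einterval_antiderivative) auto
  then have "\<exists>G. \<forall>x. (G has_real_derivative A_fun q x) (at x)"
    by (simp add: has_real_derivative_iff_has_vector_derivative)
  then have "\<forall>x. (G_fun q has_real_derivative A_fun q x) (at x)"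
    unfolding G_fun_def by (rule someI_ex)
  then show ?thesis by blast
qed

lemma isCont_G_fun: "q > 0 \<Longrightarrow> isCont (G_fun q) x"
  using G_fun_derivative DERIV_isCont by blast

lemma A_fun_bounds:
  assumes "q > 0" "\<bar>x\<bar> \<le> 1"
  shows "0 \<le> A_fun q x" "A_fun q x \<le> \<bar>x\<bar> / 2"
proof -
  have "\<bar>x\<bar> powr (2 * q) \<le> 1" using assms powr_le1[of "2*q" "\<bar>x\<bar>"] by simp
  then have "0 \<le> sqrt (1 - \<bar>x\<bar> powr (2 * q))" "sqrt (1 - \<bar>x\<bar> powr (2 * q)) \<le> 1" by auto
  then show "0 \<le> A_fun q x" "A_fun q x \<le> \<bar>x\<bar> / 2"
    unfolding A_fun_def by (auto intro: mult_left_le)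
qed

lemma A_fun_square:
  assumes "q > 0" "M > 0" "\<bar>x\<bar> \<le> M"
  shows "(M * A_fun q (x / M))\<^sup>2 = x\<^sup>2 / 4 - M powr (- 2 * q) / 4 * \<bar>x\<bar> powr (2 + 2 * q)"
proof -
  let ?z = "\<bar>x / M\<bar> powr (2 * q)"
  have "\<bar>x / M\<bar> \<le> 1" using assms by simp
  then have z: "?z \<le> 1" using assms(1) powr_le1[of "2*q" "\<bar>x / M\<bar>"] by simp
  have zeq: "?z = \<bar>x\<bar> powr (2 * q) * M powr (- 2 * q)"
    using assms(2) by (simp add: powr_divide powr_minus field_simps)
  have "(M * A_fun q (x / M))\<^sup>2 = M\<^sup>2 * ((x / M)\<^sup>2 / 4) * (1 - ?z)"
    using z by (simp add: A_fun_def power_mult_distrib power_divide real_sqrt_pow2)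
  also have "\<dots> = x\<^sup>2 / 4 * (1 - ?z)" using assms(2) by (simp add: power_divide)
  also have "\<dots> = x\<^sup>2 / 4 - M powr (- 2 * q) / 4 * (x\<^sup>2 * \<bar>x\<bar> powr (2 * q))"
    unfolding zeq by (simp add: algebra_simps)
  also have "x\<^sup>2 * \<bar>x\<bar> powr (2 * q) = \<bar>x\<bar> powr (2 + 2 * q)"
    by (cases "x = 0") (simp_all add: powr_add)
  finally show ?thesis .
qed

text \<open>The derivative of the calibrating function is subtracted from the energy density.\<close>

lemma calibration:
  fixes h h' :: "real \<Rightarrow> real"
  assumes q: "q > 0" and M: "M > 0" and ab: "a \<le> b"
    and h: "\<And>t. (h has_real_derivative h' t) (at t)" and h': "continuous_on UNIV h'"
    and hM: "\<And>t. \<bar>h t\<bar> \<le> M" and s: "s = 1 \<or> s = -1"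
  defines "B \<equiv> \<lambda>t. (h t)\<^sup>2 / 2 + s * 2 * M\<^sup>2 * G_fun q (h t / M)"
  shows "integral {a..b} (\<lambda>t. (h' t + h t / 2)\<^sup>2) =
    M powr (- 2 * q) / 4 * integral {a..b} (\<lambda>t. \<bar>h t\<bar> powr (2 + 2 * q)) +
    integral {a..b} (\<lambda>t. (h' t - s * M * A_fun q (h t / M))\<^sup>2) + (B b - B a)"
proof -
  have ch: "continuous_on S h" for S using h DERIV_isCont by (blast intro: continuous_at_imp_continuous_on)
  have ch': "continuous_on S h'" for S using h' continuous_on_subset by blast
  have cA: "continuous_on S (\<lambda>t. A_fun q (h t / M))" for S
    by (rule continuous_on_compose2[OF continuous_A_fun[OF q, of UNIV]]) (use ch M in \<open>auto intro!: continuous_intros\<close>)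
  have i1: "(\<lambda>t. (h' t - s * M * A_fun q (h t / M))\<^sup>2) integrable_on {a..b}"
    by (intro integrable_continuous_interval continuous_intros ch' cA)
  have i2: "(\<lambda>t. \<bar>h t\<bar> powr (2 + 2 * q)) integrable_on {a..b}"
    by (intro integrable_continuous_interval continuous_on_powr' continuous_intros ch) (use q in auto)
  have dB: "(B has_real_derivative h t * h' t + s * 2 * M * A_fun q (h t / M) * h' t) (at t)" for t
  proof -
    have "((\<lambda>t. G_fun q (h t / M)) has_real_derivative A_fun q (h t / M) * (h' t / M)) (at t)"
      by (rule DERIV_chain2[OF G_fun_derivative[OF q]]) (use M in \<open>auto intro!: derivative_eq_intros h\<close>)
    then have "(B has_real_derivative 2 * h t * h' t / 2 + s * 2 * M\<^sup>2 * (A_fun q (h t / M) * (h' t / M))) (at t)"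
      unfolding B_def by (auto intro!: derivative_eq_intros h)
    then show ?thesis using M by (simp add: power2_eq_square mult_ac)
  qed
  then have i3: "((\<lambda>t. h t * h' t + s * 2 * M * A_fun q (h t / M) * h' t) has_integral B b - B a) {a..b}"
    using ab by (intro fundamental_theorem_of_calculus)
      (auto simp: has_real_derivative_iff_has_vector_derivative intro: has_vector_derivative_at_within)
  \<comment> \<open>The part \<open>(h t)\<^sup>2 / 4\<close> of the expanded square is rewritten by
    \<open>A_fun_square\<close>. As \<open>s\<^sup>2 = 1\<close>, its \<open>A_fun\<close> part
    completes a square with \<open>h' t\<close>, and the cross terms form the derivative of
    \<open>B\<close>.\<close>
  have "(h' t + h t / 2)\<^sup>2 = M powr (- 2 * q) / 4 * \<bar>h t\<bar> powr (2 + 2 * q) +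
      (h' t - s * M * A_fun q (h t / M))\<^sup>2 + (h t * h' t + s * 2 * M * A_fun q (h t / M) * h' t)" for t
  proof -
    from s show ?thesis
      by (elim disjE; simp) (use A_fun_square[OF q M hM[of t]] in \<open>simp_all add: power2_eq_square algebra_simps\<close>)
  qed
  moreover have "((\<lambda>t. M powr (- 2 * q) / 4 * \<bar>h t\<bar> powr (2 + 2 * q) +
      (h' t - s * M * A_fun q (h t / M))\<^sup>2 + (h t * h' t + s * 2 * M * A_fun q (h t / M) * h' t)) has_integral
      M powr (- 2 * q) / 4 * integral {a..b} (\<lambda>t. \<bar>h t\<bar> powr (2 + 2 * q)) +
    integral {a..b} (\<lambda>t. (h' t - s * M * A_fun q (h t / M))\<^sup>2) + (B b - B a)) {a..b}"
    by (intro has_integral_add has_integral_mult_right i3 integrable_integral i1 i2)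
  ultimately show ?thesis by (simp add: integral_unique)
qed

text \<open>This decay is what the extremals have, and what a bounded \<open>\<phi>\<close>
  vanishing near the boundary of the ball gives after division by \<open>exp (t / 2)\<close>. It
  makes energy and mass finite and removes the boundary terms at infinity.\<close>

definition line_fun :: "(real \<Rightarrow> real) \<Rightarrow> (real \<Rightarrow> real) \<Rightarrow> bool" where
  "line_fun h h' \<longleftrightarrow> (\<forall>t. (h has_real_derivative h' t) (at t)) \<and> continuous_on UNIV h' \<and>
     (\<exists>C. \<forall>t. \<bar>h t\<bar> \<le> C * exp (- \<bar>t\<bar> / 2) \<and> \<bar>h' t\<bar> \<le> C * exp (- \<bar>t\<bar> / 2))"

text \<open>As \<open>\<phi> = exp (t / 2) * h\<close>, the integrand is \<open>exp (- t)\<close>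
  times the square of the derivative of \<open>\<phi>\<close>. The cross term \<open>h * h'\<close>
  integrates to zero; keeping it makes the density an exact square.\<close>

definition energy :: "(real \<Rightarrow> real) \<Rightarrow> (real \<Rightarrow> real) \<Rightarrow> real" where
  "energy h h' = (LBINT t. (h' t + h t / 2)\<^sup>2)"

definition mass :: "real \<Rightarrow> (real \<Rightarrow> real) \<Rightarrow> real" where
  "mass q h = (LBINT t. \<bar>h t\<bar> powr (2 + 2 * q))"

lemma integrable_exp_abs: "integrable lborel (\<lambda>t::real. exp (- \<bar>t\<bar>))"
proof -
  have h: "((\<lambda>x::real. exp (-1*x)) has_integral exp (-1*0)/1) {0..}"
    by (rule has_integral_exp_minus_to_infinity) simp
  have "integral\<^sup>N lborel (\<lambda>x. ennreal (exp (-1*x)) * indicator {0..} x) = ennreal (exp (-1*0)/1)"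
    by (rule nn_integral_has_integral_lebesgue'[OF _ h]) simp
  then have 1: "integrable lborel (\<lambda>x::real. indicator {0..} x * exp (-x))"
    by (intro integrableI_nonneg) (auto simp: ennreal_mult'[symmetric] mult.commute ennreal_indicator[symmetric])
  have 2: "integrable lborel (\<lambda>x::real. indicator {0..} (0 + (-1) * x) * exp (-(0 + (-1) * x)))"
    by (rule lborel_integrable_real_affine[OF 1]) simp
  show ?thesis
    by (rule Bochner_Integration.integrable_bound[OF Bochner_Integration.integrable_add[OF 1 2]])
      (auto simp: indicator_def)
qed

lemma line_fun_continuous:
  assumes "line_fun h h'" shows "continuous_on S h" "continuous_on S h'"
proof -
  have "isCont h t" for t using assms DERIV_isCont unfolding line_fun_def by blast
  then show "continuous_on S h" by (simp add: continuous_at_imp_continuous_on)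
  show "continuous_on S h'" using assms continuous_on_subset unfolding line_fun_def by blast
qed

lemma line_fun_measurable:
  assumes "line_fun h h'" shows "h \<in> borel_measurable borel" "h' \<in> borel_measurable borel"
  using line_fun_continuous[OF assms, of UNIV] by (auto intro: borel_measurable_continuous_onI)

lemma integrable_exp_bound:
  fixes f :: "real \<Rightarrow> real"
  assumes "f \<in> borel_measurable borel" "\<And>t. \<bar>f t\<bar> \<le> C * exp (- \<bar>t\<bar>)"
  shows "integrable lborel f"
  by (rule Bochner_Integration.integrable_bound[OF integrable_mult_right[OF integrable_exp_abs, of C]])
    (use assms in \<open>auto intro: order_trans[OF _ abs_ge_self]\<close>)

lemma exp_half_square: "(exp (- \<bar>t\<bar> / 2))\<^sup>2 = exp (- \<bar>t::real\<bar>)"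
  by (simp add: exp_double[symmetric])

lemma line_fun_integrable:
  assumes "line_fun h h'"
  shows "integrable lborel (\<lambda>t. (h' t + h t / 2)\<^sup>2)"
    and "integrable lborel (\<lambda>t. (h t)\<^sup>2)"
    and "integrable lborel (\<lambda>t. h t * h' t)"
    and "q > 0 \<Longrightarrow> integrable lborel (\<lambda>t. \<bar>h t\<bar> powr (2 + 2 * q))"
proof -
  note [measurable] = line_fun_measurable[OF assms]
  obtain C where C: "\<And>t. \<bar>h t\<bar> \<le> C * exp (- \<bar>t\<bar> / 2)" "\<And>t. \<bar>h' t\<bar> \<le> C * exp (- \<bar>t\<bar> / 2)"
    using assms unfolding line_fun_def by blast
  have C0: "0 \<le> C" using C(1)[of 0] by simp
  have sq: "x\<^sup>2 \<le> K\<^sup>2 * exp (- \<bar>t\<bar>)" if "\<bar>x\<bar> \<le> K * exp (- \<bar>t\<bar> / 2)" for x K t :: real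
    using power_mono[OF that, of 2] unfolding power_mult_distrib exp_half_square by simp
  show "integrable lborel (\<lambda>t. (h t)\<^sup>2)"
    by (rule integrable_exp_bound[of _ "C\<^sup>2"]) (use sq[OF C(1)] in auto)
  show "integrable lborel (\<lambda>t. (h' t + h t / 2)\<^sup>2)"
  proof (rule integrable_exp_bound[of _ "(2 * C)\<^sup>2"])
    fix t
    have "\<bar>h' t + h t / 2\<bar> \<le> C * exp (- \<bar>t\<bar> / 2) + C * exp (- \<bar>t\<bar> / 2)"
      using C(1)[of t] C(2)[of t] abs_triangle_ineq[of "h' t" "h t / 2"] by simp
    then show "\<bar>(h' t + h t / 2)\<^sup>2\<bar> \<le> (2 * C)\<^sup>2 * exp (- \<bar>t\<bar>)"
      using sq[of "h' t + h t / 2" "2 * C" t] by simp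
  qed simp
  show "integrable lborel (\<lambda>t. h t * h' t)"
  proof (rule integrable_exp_bound[of _ "C\<^sup>2"])
    fix t
    have "\<bar>h t\<bar> * \<bar>h' t\<bar> \<le> (C * exp (- \<bar>t\<bar> / 2)) * (C * exp (- \<bar>t\<bar> / 2))"
      using C(1)[of t] C(2)[of t] C0 by (intro mult_mono) auto
    then show "\<bar>h t * h' t\<bar> \<le> C\<^sup>2 * exp (- \<bar>t\<bar>)"
      using exp_half_square[of t] by (simp add: abs_mult power2_eq_square mult_ac)
  qed simp
  assume q: "q > 0"
  show "integrable lborel (\<lambda>t. \<bar>h t\<bar> powr (2 + 2 * q))"
  proof (rule integrable_exp_bound[of _ "C powr (2 + 2 * q)"])
    fix t
    have "\<bar>h t\<bar> powr (2 + 2 * q) \<le> (C * exp (- \<bar>t\<bar> / 2)) powr (2 + 2 * q)"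
      using C(1)[of t] q by (intro powr_mono2) auto
    also have "\<dots> = C powr (2 + 2 * q) * exp (- (\<bar>t\<bar> * (1 + q)))"
      using C0 by (simp add: powr_mult exp_powr_real field_simps)
    also have "exp (- (\<bar>t\<bar> * (1 + q))) \<le> exp (- \<bar>t\<bar>)" using q by (simp add: algebra_simps)
    finally show "\<bar>\<bar>h t\<bar> powr (2 + 2 * q)\<bar> \<le> C powr (2 + 2 * q) * exp (- \<bar>t\<bar>)"
      by (simp add: mult_left_mono)
  qed simp
qed

lemma line_fun_tendsto:
  assumes "line_fun h h'"
  shows "(\<lambda>n. h (real n)) \<longlonglongrightarrow> 0" "(\<lambda>n. h (- real n)) \<longlonglongrightarrow> 0"
proof -
  obtain C where C: "\<And>t. \<bar>h t\<bar> \<le> C * exp (- \<bar>t\<bar> / 2)"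
    using assms unfolding line_fun_def by blast
  have l: "(\<lambda>n. C * exp (- real n / 2)) \<longlonglongrightarrow> 0" by real_asymp
  show "(\<lambda>n. h (real n)) \<longlonglongrightarrow> 0" "(\<lambda>n. h (- real n)) \<longlonglongrightarrow> 0"
    by (rule Lim_null_comparison[OF always_eventually l], use C[of "real _"] C[of "- real _"] in simp)+
qed

lemma integral_interval_le:
  fixes f :: "real \<Rightarrow> real"
  assumes "integrable lborel f" "\<And>t. 0 \<le> f t"
  shows "integral {a..b} f \<le> integral\<^sup>L lborel f"
proof -
  have "f integrable_on UNIV" by (rule integrable_on_lborel[OF assms(1)])
  moreover from this have "f integrable_on {a..b}" by (rule integrable_on_subinterval) simp
  ultimately show ?thesis
    using integral_subset_le[of "{a..b}" UNIV f] assms integral_lborel[OF assms(1)] by simp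
qed

text \<open>The link between Lebesgue integrals over the line and the interval integrals to which
  the fundamental theorem of calculus applies.\<close>

lemma integral_interval_tendsto:
  fixes f :: "real \<Rightarrow> real"
  assumes "integrable lborel f"
  shows "(\<lambda>n. integral {- real n..real n} f) \<longlonglongrightarrow> integral\<^sup>L lborel f"
proof -
  have [measurable]: "f \<in> borel_measurable borel" using assms by auto
  have "(\<lambda>n. \<integral>t. indicator {- real n..real n} t * f t \<partial>lborel) \<longlonglongrightarrow> integral\<^sup>L lborel f"
  proof (rule integral_dominated_convergence[where w="\<lambda>t. norm (f t)"])
    show "AE t in lborel. (\<lambda>n. indicator {- real n..real n} t * f t) \<longlonglongrightarrow> f t"
    proof (rule AE_I2, rule tendsto_eventually)
      fix t
      show "\<forall>\<^sub>F n in sequentially. indicator {- real n..real n} t * f t = f t"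
        using eventually_ge_at_top[of "nat \<lceil>\<bar>t\<bar>\<rceil>"] by eventually_elim (auto simp: indicator_def nat_le_iff ceiling_le_iff)
    qed
  qed (use assms in \<open>auto simp: indicator_def\<close>)
  moreover have "(LBINT t. indicator {- real n..real n} t * f t) = integral {- real n..real n} f" for n
  proof -
    have "set_integrable lborel {- real n..real n} f"
      using assms unfolding set_integrable_def by (intro integrable_mult_indicator) auto
    then show ?thesis using set_borel_integral_eq_integral(2) unfolding set_lebesgue_integral_def by fastforce
  qed
  ultimately show ?thesis by simp
qed

lemma integral_derivative_zero:
  fixes f :: "real \<Rightarrow> real"
  assumes "\<And>t. (f has_real_derivative f' t) (at t)" "integrable lborel f'"
    "(\<lambda>n. f (real n)) \<longlonglongrightarrow> 0" "(\<lambda>n. f (- real n)) \<longlonglongrightarrow> 0"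
  shows "integral\<^sup>L lborel f' = 0"
proof -
  have "integral {- real n..real n} f' = f (real n) - f (- real n)" for n
    by (intro integral_unique fundamental_theorem_of_calculus)
      (use assms(1) in \<open>auto simp: has_real_derivative_iff_has_vector_derivative intro: has_vector_derivative_at_within\<close>)
  moreover have "(\<lambda>n. f (real n) - f (- real n)) \<longlonglongrightarrow> 0 - 0" by (intro tendsto_diff assms)
  ultimately show ?thesis using LIMSEQ_unique[OF integral_interval_tendsto[OF assms(2)]] by simp
qed

text \<open>The energy density exceeds the derivative \<open>2 * h * h'\<close> of
  \<open>h^2\<close> by the square of \<open>h' - h / 2\<close>. Integrating from minus infinity,
  where \<open>h\<close> tends to 0, gives the bound. It later turns small energies into uniformly
  small functions.\<close>

lemma line_fun_square_le_energy:
  assumes "line_fun h h'"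
  shows "(h t)\<^sup>2 \<le> energy h h'"
proof -
  have d: "(h has_real_derivative h' t) (at t)" for t using assms unfolding line_fun_def by blast
  have le: "(h t)\<^sup>2 - (h (- real n))\<^sup>2 \<le> energy h h'" if "- real n \<le> t" for n
  proof -
    have hi: "((\<lambda>t. 2 * h t * h' t) has_integral (h t)\<^sup>2 - (h (- real n))\<^sup>2) {- real n..t}"
    proof (rule fundamental_theorem_of_calculus[OF that])
      fix x
      have "((\<lambda>t. (h t)\<^sup>2) has_real_derivative 2 * h x * h' x) (at x)"
        using DERIV_power[OF d[of x], of 2] by (simp add: mult_ac)
      then show "((\<lambda>t. (h t)\<^sup>2) has_vector_derivative 2 * h x * h' x) (at x within {- real n..t})"
        unfolding has_real_derivative_iff_has_vector_derivative by (rule has_vector_derivative_at_within)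
    qed
    have "(h t)\<^sup>2 - (h (- real n))\<^sup>2 = integral {- real n..t} (\<lambda>t. 2 * h t * h' t)"
      using hi by (simp add: integral_unique)
    also have "\<dots> \<le> integral {- real n..t} (\<lambda>t. (h' t + h t / 2)\<^sup>2)"
    proof (rule integral_le)
      show "(\<lambda>t. (h' t + h t / 2)\<^sup>2) integrable_on {- real n..t}"
        by (intro integrable_continuous_interval continuous_intros line_fun_continuous[OF assms]) auto
      fix t
      have "0 \<le> (h' t - h t / 2)\<^sup>2" by simp
      then show "2 * h t * h' t \<le> (h' t + h t / 2)\<^sup>2" by (simp add: power2_eq_square algebra_simps)
    qed (use hi in blast)
    also have "\<dots> \<le> energy h h'"
      unfolding energy_def by (intro integral_interval_le line_fun_integrable[OF assms]) simp
    finally show ?thesis .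
  qed
  have "(\<lambda>n. (h t)\<^sup>2 - (h (- real n))\<^sup>2) \<longlonglongrightarrow> (h t)\<^sup>2 - 0\<^sup>2"
    by (intro tendsto_intros line_fun_tendsto[OF assms])
  moreover have "\<forall>\<^sub>F n in sequentially. (h t)\<^sup>2 - (h (- real n))\<^sup>2 \<le> energy h h'"
    using eventually_ge_at_top[of "nat \<lceil>\<bar>t\<bar>\<rceil>"]
    by eventually_elim (rule le, auto simp: nat_le_iff ceiling_le_iff)
  ultimately show ?thesis using tendsto_upperbound[of _ _ sequentially "energy h h'"] by fastforce
qed

text \<open>\<open>calibration\<close> is used with \<open>s = 1\<close> to the left of
  \<open>t0\<close> and \<open>s = -1\<close> to the right. The boundary terms at infinity tend to
  their values at \<open>h = 0\<close>; at \<open>t0\<close> the quadratic parts cancel while the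
  \<open>G_fun\<close> parts add up.\<close>

lemma line_identity:
  assumes q: "q > 0" and M: "M > 0" and h: "line_fun h h'" and hM: "\<And>t. \<bar>h t\<bar> \<le> M"
  shows "(\<lambda>n. integral {- real n..t0} (\<lambda>t. (h' t - M * A_fun q (h t / M))\<^sup>2) +
       integral {t0..real n} (\<lambda>t. (h' t + M * A_fun q (h t / M))\<^sup>2)) \<longlonglongrightarrow>
     energy h h' - M powr (- 2 * q) / 4 * mass q h - 4 * M\<^sup>2 * (G_fun q (h t0 / M) - G_fun q 0)"
proof -
  let ?S = "\<lambda>n. integral {- real n..t0} (\<lambda>t. (h' t - M * A_fun q (h t / M))\<^sup>2) +
       integral {t0..real n} (\<lambda>t. (h' t + M * A_fun q (h t / M))\<^sup>2)"
  let ?e = "\<lambda>t. (h' t + h t / 2)\<^sup>2" and ?p = "\<lambda>t. \<bar>h t\<bar> powr (2 + 2 * q)"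
  have d: "\<And>t. (h has_real_derivative h' t) (at t)" and c': "continuous_on UNIV h'"
    using h unfolding line_fun_def by auto
  note c = line_fun_continuous[OF h]
  let ?B1 = "\<lambda>t. (h t)\<^sup>2 / 2 + 2 * M\<^sup>2 * G_fun q (h t / M)"
  let ?B2 = "\<lambda>t. (h t)\<^sup>2 / 2 - 2 * M\<^sup>2 * G_fun q (h t / M)"
  let ?r = "\<lambda>n. integral {- real n..real n} ?e - M powr (- 2 * q) / 4 * integral {- real n..real n} ?p
     - (?B1 t0 - ?B1 (- real n)) - (?B2 (real n) - ?B2 t0)"
  have eq: "?S n = ?r n" if n: "\<bar>t0\<bar> \<le> real n" for n
  proof -
    have t: "- real n \<le> t0" "t0 \<le> real n" using n by auto
    have se: "integral {- real n..t0} ?e + integral {t0..real n} ?e = integral {- real n..real n} ?e"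
      using t by (intro Henstock_Kurzweil_Integration.integral_combine integrable_continuous_interval continuous_intros c) auto
    have sp: "integral {- real n..t0} ?p + integral {t0..real n} ?p = integral {- real n..real n} ?p"
      using t q by (intro Henstock_Kurzweil_Integration.integral_combine integrable_continuous_interval continuous_on_powr' continuous_intros c) auto
    show ?thesis
      using calibration[OF q M t(1) d c' hM, of 1] calibration[OF q M t(2) d c' hM, of "-1"]
      unfolding se[symmetric] sp[symmetric] by (simp add: algebra_simps)
  qed
  have "?r \<longlonglongrightarrow> energy h h' - M powr (- 2 * q) / 4 * mass q h
     - (?B1 t0 - (0\<^sup>2 / 2 + 2 * M\<^sup>2 * G_fun q (0 / M))) - ((0\<^sup>2 / 2 - 2 * M\<^sup>2 * G_fun q (0 / M)) - ?B2 t0)"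
    unfolding energy_def mass_def
    by (intro tendsto_intros integral_interval_tendsto line_fun_integrable[OF h] q line_fun_tendsto[OF h]
        isCont_tendsto_compose[OF isCont_G_fun[OF q]]) (use M in auto)
  then have "?r \<longlonglongrightarrow> energy h h' - M powr (- 2 * q) / 4 * mass q h - 4 * M\<^sup>2 * (G_fun q (h t0 / M) - G_fun q 0)"
    by (simp add: algebra_simps)
  moreover have "\<forall>\<^sub>F n in sequentially. ?r n = ?S n"
    using eventually_ge_at_top[of "nat \<lceil>\<bar>t0\<bar>\<rceil>"]
    by eventually_elim (rule eq[symmetric], auto simp: nat_le_iff ceiling_le_iff)
  ultimately show ?thesis by (rule Lim_transform_eventually)
qed

text \<open>The integrals of squares in \<open>line_identity\<close> grow with the window, so every
  fixed window is bounded by the limit. The degenerate window \<open>a = b = t0\<close> leaves just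
  the nonnegativity of the right side.\<close>

lemma line_lower:
  assumes q: "q > 0" and M: "M > 0" and h: "line_fun h h'" and hM: "\<And>t. \<bar>h t\<bar> \<le> M"
  shows "integral {a..t0} (\<lambda>t. (h' t - M * A_fun q (h t / M))\<^sup>2) +
       integral {t0..b} (\<lambda>t. (h' t + M * A_fun q (h t / M))\<^sup>2) \<le>
     energy h h' - M powr (- 2 * q) / 4 * mass q h - 4 * M\<^sup>2 * (G_fun q (h t0 / M) - G_fun q 0)"
proof (rule tendsto_lowerbound[OF line_identity[OF assms]])
  let ?f = "\<lambda>s t. (h' t - s * M * A_fun q (h t / M))\<^sup>2"
  have cA: "continuous_on S (\<lambda>t. A_fun q (h t / M))" for S
    by (rule continuous_on_compose2[OF continuous_A_fun[OF q, of UNIV]])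
      (use line_fun_continuous[OF h] M in \<open>auto intro!: continuous_intros\<close>)
  have i: "?f s integrable_on {x..y}" for s x y
    by (intro integrable_continuous_interval continuous_intros line_fun_continuous[OF h] cA)
  show "\<forall>\<^sub>F n in sequentially. integral {a..t0} (\<lambda>t. (h' t - M * A_fun q (h t / M))\<^sup>2) +
       integral {t0..b} (\<lambda>t. (h' t + M * A_fun q (h t / M))\<^sup>2) \<le>
       integral {- real n..t0} (\<lambda>t. (h' t - M * A_fun q (h t / M))\<^sup>2) +
       integral {t0..real n} (\<lambda>t. (h' t + M * A_fun q (h t / M))\<^sup>2)"
    using eventually_ge_at_top[of "nat \<lceil>\<bar>a\<bar> + \<bar>b\<bar>\<rceil>"]
  proof eventually_elim
    case (elim n)
    then have "\<bar>a\<bar> + \<bar>b\<bar> \<le> real n" by (simp add: nat_le_iff ceiling_le_iff)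
    then have n: "- real n \<le> a" "b \<le> real n" by linarith+
    have "integral {a..t0} (?f 1) \<le> integral {- real n..t0} (?f 1)"
      by (rule integral_subset_le[OF _ i i]) (use n in auto)
    moreover have "integral {t0..b} (?f (-1)) \<le> integral {t0..real n} (?f (-1))"
      by (rule integral_subset_le[OF _ i i]) (use n in auto)
    ultimately show ?case by simp
  qed
qed simp

section \<open>The sharp constant on the line\<close>

definition c_const :: "real \<Rightarrow> real" where "c_const q = G_fun q 1 - G_fun q 0"

text \<open>The minimum over \<open>M > 0\<close> of
  \<open>M powr (- 2 * q) / 4 * P + 4 * M\<^sup>2 * c_const q\<close> is this constant times
  \<open>P powr (1 / (1 + q))\<close>. It is attained where
  \<open>P = 16 * c_const q / q * M powr (2 + 2 * q)\<close>.\<close>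

definition K_const :: "real \<Rightarrow> real" where
  "K_const q = 4 * c_const q * (1 + q) / q * (16 * c_const q / q) powr (- (1 / (1 + q)))"

text \<open>The substitution \<open>v = y powr (2 * q)\<close> turns the Beta integrand into
  \<open>4 * q * A_fun q y\<close>. The value gives positivity now and the Gamma factors of the area
  of the sphere at the end.\<close>

lemma c_const_eq:
  assumes q: "q > 0"
  shows "c_const q = Beta (1 / q) (3 / 2) / (4 * q)"
proof -
  have A: "(A_fun q has_integral c_const q) {0..1}"
    unfolding c_const_def using G_fun_derivative[OF q]
    by (intro fundamental_theorem_of_calculus)
      (auto simp: has_real_derivative_iff_has_vector_derivative intro: has_vector_derivative_at_within)
  let ?f = "\<lambda>v::real. v powr (1 / q - 1) * (1 - v) powr (3 / 2 - 1)"
  let ?g = "\<lambda>y::real. y powr (2 * q)" and ?g' = "\<lambda>y::real. (2 * q) * y powr (2 * q - 1)"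
  let ?S = "{0<..<1::real}"
  have f: "(?f has_integral Beta (1 / q) (3 / 2)) ?S"
    using has_integral_Beta_real[of "1 / q" "3 / 2"] q has_integral_open_interval[of ?f _ 0 1] by simp
  have gS: "?g ` ?S = ?S"
  proof (intro equalityI subsetI)
    fix y assume "y \<in> ?g ` ?S"
    then obtain x where x: "0 < x" "x < 1" "y = x powr (2 * q)" by auto
    then show "y \<in> ?S" using q powr_less_mono2[of "2*q" x 1] by auto
  next
    fix y assume "y \<in> ?S"
    then have y: "0 < y" "y < 1" by auto
    then have "y powr (1 / (2 * q)) \<in> ?S" using q powr_less_mono2[of "1/(2*q)" y 1] by auto
    moreover have "y = ?g (y powr (1 / (2 * q)))" using y q by (simp add: powr_powr)
    ultimately show "y \<in> ?g ` ?S" by blast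
  qed
  have inj: "inj_on ?g ?S"
  proof (rule inj_onI)
    fix x y :: real assume "x \<in> ?S" "y \<in> ?S" "?g x = ?g y"
    then show "x = y" using powr_inj[of "2*q"] q by (metis greaterThanLessThan_iff less_eq_real_def powr_less_mono2 linorder_cases mult_pos_pos zero_less_numeral order.irrefl)
  qed
  have der: "(?g has_real_derivative ?g' x) (at x within ?S)" if "x \<in> ?S" for x
    by (rule has_field_derivative_at_within, rule has_real_derivative_powr) (use that in auto)
  have "?f absolutely_integrable_on ?S"
    by (rule nonnegative_absolutely_integrable_1) (use f in auto)
  then have fS: "?f absolutely_integrable_on (?g ` ?S) \<and> integral (?g ` ?S) ?f = Beta (1 / q) (3 / 2)"
    unfolding gS using f by (simp add: integral_unique)
  have m: "?S \<in> sets lebesgue" by simp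
  have "integral ?S (\<lambda>y. \<bar>?g' y\<bar> * ?f (?g y)) = Beta (1 / q) (3 / 2)"
    using fS has_absolute_integral_change_of_variables_1'[OF m der inj, of ?f "Beta (1 / q) (3 / 2)"] by simp
  moreover have "integral ?S (\<lambda>y. \<bar>?g' y\<bar> * ?f (?g y)) = integral ?S (\<lambda>y. 4 * q * A_fun q y)"
  proof (rule Henstock_Kurzweil_Integration.integral_cong)
    fix y :: real assume y: "y \<in> ?S"
    have "?g y powr (1 / q - 1) = y powr (2 - 2 * q)"
      using q by (simp add: powr_powr right_diff_distrib)
    then have "\<bar>?g' y\<bar> * ?f (?g y) = 2 * q * (y powr (2 * q - 1) * y powr (2 - 2 * q)) * sqrt (1 - y powr (2 * q))"
      using q y powr_le1[of "2*q" y] by (simp add: powr_half_sqrt)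
    also have "y powr (2 * q - 1) * y powr (2 - 2 * q) = y"
      using y by (simp add: powr_add[symmetric])
    finally show "\<bar>?g' y\<bar> * ?f (?g y) = 4 * q * A_fun q y" using y by (simp add: A_fun_def)
  qed
  moreover have "integral ?S (\<lambda>y. 4 * q * A_fun q y) = 4 * q * c_const q"
  proof -
    have "(A_fun q has_integral c_const q) ?S"
      using A has_integral_open_interval[of "A_fun q" _ 0 1] by simp
    from has_integral_mult_right[OF this, of "4 * q"] show ?thesis by (rule integral_unique)
  qed
  ultimately show ?thesis using q by (simp add: field_simps)
qed

lemma c_const_pos: "q > 0 \<Longrightarrow> c_const q > 0"
  unfolding c_const_eq Beta_def by (intro divide_pos_pos mult_pos_pos Gamma_real_pos add_pos_pos) auto

lemma K_const_pos: "q > 0 \<Longrightarrow> K_const q > 0"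
  using c_const_pos[of q] by (simp add: K_const_def)

text \<open>Strict concavity: away from 1 the graph of the power lies below its tangent at 1. The
  strictness identifies the case of equality in \<open>young_mass\<close>.\<close>

lemma powr_less_affine:
  fixes y \<alpha> :: real
  assumes \<alpha>: "0 < \<alpha>" "\<alpha> < 1" and y: "y \<ge> 0" "y \<noteq> 1"
  shows "y powr \<alpha> < 1 + \<alpha> * (y - 1)"
proof -
  define f where "f = (\<lambda>y. 1 + \<alpha> * (y - 1) - y powr \<alpha>)"
  have d: "(f has_real_derivative \<alpha> * (1 - x powr (\<alpha> - 1))) (at x)" if "x > 0" for x
    unfolding f_def using that by (auto intro!: derivative_eq_intros simp: algebra_simps powr_diff)
  have c: "continuous_on {a..b} f" if "a \<ge> 0" for a b
    unfolding f_def by (intro continuous_intros continuous_on_powr') (use that \<alpha> in auto)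
  have "f 1 < f y"
  proof (cases "y > 1")
    case True
    show ?thesis
    proof (rule DERIV_pos_imp_increasing_open[OF True])
      fix x :: real assume x: "1 < x" "x < y"
      have "x powr (\<alpha> - 1) < 1" using x \<alpha> powr_less_mono[of "\<alpha> - 1" 0 x] by simp
      then show "\<exists>z. (f has_real_derivative z) (at x) \<and> 0 < z" using d[of x] x \<alpha>
        by (intro exI[of _ "\<alpha> * (1 - x powr (\<alpha> - 1))"]) auto
    qed (rule c, simp)
  next
    case False
    then have y1: "y < 1" using y by simp
    show ?thesis
    proof (rule DERIV_neg_imp_decreasing_open[OF y1])
      fix x :: real assume x: "y < x" "x < 1"
      have "x powr (\<alpha> - 1) > 1" using x y \<alpha> powr_less_mono'[of x "\<alpha> - 1" 0] by simp
      then show "\<exists>z. (f has_real_derivative z) (at x) \<and> z < 0" using d[of x] x y \<alpha>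
        by (intro exI[of _ "\<alpha> * (1 - x powr (\<alpha> - 1))"]) (auto intro: mult_pos_neg)
    qed (rule c, use y in simp)
  qed
  then show ?thesis by (simp add: f_def)
qed

text \<open>With \<open>y\<close> the quotient of \<open>P\<close> by its optimal value for the
  given \<open>M\<close>, both parts reduce to \<open>powr_less_affine\<close> with the exponent
  \<open>1 / (1 + q)\<close>; equality is the case \<open>y = 1\<close>.\<close>

lemma young_mass:
  assumes q: "q > 0" and M: "M > 0" and P: "P \<ge> 0"
  shows "K_const q * P powr (1 / (1 + q)) \<le> M powr (- 2 * q) / 4 * P + 4 * M\<^sup>2 * c_const q"
    and "M powr (- 2 * q) / 4 * P + 4 * M\<^sup>2 * c_const q \<le> K_const q * P powr (1 / (1 + q)) \<Longrightarrow>
      P = 16 * c_const q / q * M powr (2 + 2 * q)"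
proof -
  let ?c = "c_const q" and ?\<alpha> = "1 / (1 + q)"
  define D where "D = 16 * ?c / q"
  define y where "y = P / (D * M powr (2 + 2 * q))"
  have c: "?c > 0" by (rule c_const_pos[OF q])
  have D: "D > 0" unfolding D_def using c q by simp
  have y0: "y \<ge> 0" unfolding y_def using P D by simp
  have Peq: "P = D * M powr (2 + 2 * q) * y" unfolding y_def using D M by simp
  have MM: "M powr (- 2 * q) * M powr (2 + 2 * q) = M\<^sup>2"
    using M by (simp add: powr_add[symmetric])
  have L: "M powr (- 2 * q) / 4 * P + 4 * M\<^sup>2 * ?c = 4 * ?c * M\<^sup>2 * (y / q + 1)"
  proof -
    have "M powr (- 2 * q) / 4 * P = (M powr (- 2 * q) * M powr (2 + 2 * q)) * D * y / 4"
      unfolding Peq by (simp add: mult_ac)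
    then show ?thesis unfolding MM D_def using q by (simp add: field_simps)
  qed
  have "(M powr (2 + 2 * q)) powr ?\<alpha> = M powr ((2 + 2 * q) * ?\<alpha>)" by (simp add: powr_powr)
  also have "(2 + 2 * q) * ?\<alpha> = 2" using q by (simp add: field_simps)
  finally have "(M powr (2 + 2 * q)) powr ?\<alpha> = M\<^sup>2" using M by simp
  then have "P powr ?\<alpha> = D powr ?\<alpha> * M\<^sup>2 * y powr ?\<alpha>"
    unfolding Peq using D M y0 by (simp add: powr_mult)
  moreover have "D powr (- ?\<alpha>) * D powr ?\<alpha> = 1" using D by (simp add: powr_add[symmetric])
  moreover have "K_const q * (D powr ?\<alpha> * M\<^sup>2 * y powr ?\<alpha>) =
      4 * ?c * M\<^sup>2 * ((1 + q) / q * y powr ?\<alpha>) * (D powr (- ?\<alpha>) * D powr ?\<alpha>)"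
    unfolding K_const_def D_def[symmetric] by (simp only: mult_ac times_divide_eq_left times_divide_eq_right)
  ultimately have R: "K_const q * P powr ?\<alpha> = 4 * ?c * M\<^sup>2 * ((1 + q) / q * y powr ?\<alpha>)"
    by simp
  have pos: "4 * ?c * M\<^sup>2 > 0" using c M by simp
  have eq: "(1 + q) / q * (1 + ?\<alpha> * (y - 1)) = y / q + 1" using q by (simp add: divide_simps)
  have \<alpha>: "0 < ?\<alpha>" "?\<alpha> < 1" using q by auto
  have lt: "(1 + q) / q * y powr ?\<alpha> < y / q + 1" if "y \<noteq> 1"
    unfolding eq[symmetric] using powr_less_affine[OF \<alpha> y0 that] q by (intro mult_strict_left_mono) auto
  show "K_const q * P powr ?\<alpha> \<le> M powr (- 2 * q) / 4 * P + 4 * M\<^sup>2 * ?c"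
  proof (cases "y = 1")
    case True
    then show ?thesis unfolding L R using q by (simp add: field_simps)
  next
    case False
    show ?thesis unfolding L R using lt[OF False] pos by (intro mult_left_mono) auto
  qed
  assume "M powr (- 2 * q) / 4 * P + 4 * M\<^sup>2 * ?c \<le> K_const q * P powr ?\<alpha>"
  then have "y / q + 1 \<le> (1 + q) / q * y powr ?\<alpha>" unfolding L R using pos by (simp only: mult_le_cancel_left_pos)
  then have "y = 1" using lt by fastforce
  then show "P = 16 * ?c / q * M powr (2 + 2 * q)" using Peq by (simp add: D_def)
qed

text \<open>Outside a compact interval \<open>\<bar>h\<bar>\<close> stays below
  \<open>\<bar>h t1\<bar>\<close>, so its maximum over an interval that also contains
  \<open>t1\<close> is global.\<close>

lemma attains_abs_sup:
  fixes h :: "real \<Rightarrow> real"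
  assumes h: "continuous_on UNIV h" "\<And>e. e > 0 \<Longrightarrow> \<exists>T. \<forall>t. \<bar>t\<bar> > T \<longrightarrow> \<bar>h t\<bar> < e" "h t1 \<noteq> 0"
  shows "\<exists>t0. h t0 \<noteq> 0 \<and> (\<forall>t. \<bar>h t\<bar> \<le> \<bar>h t0\<bar>)"
proof -
  obtain T where T: "\<And>t. \<bar>t\<bar> > T \<Longrightarrow> \<bar>h t\<bar> < \<bar>h t1\<bar>" using h(2)[of "\<bar>h t1\<bar>"] h(3) by auto
  let ?I = "{- max T \<bar>t1\<bar>..max T \<bar>t1\<bar>}"
  have c: "continuous_on ?I (\<lambda>t. \<bar>h t\<bar>)" using continuous_on_subset[OF h(1)] by (auto intro!: continuous_intros)
  have t1: "t1 \<in> ?I" by auto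
  obtain t0 where t0: "t0 \<in> ?I" "\<And>t. t \<in> ?I \<Longrightarrow> \<bar>h t\<bar> \<le> \<bar>h t0\<bar>"
    using continuous_attains_sup[OF _ _ c] t1 by blast
  have "\<bar>h t\<bar> \<le> \<bar>h t0\<bar>" for t
  proof (cases "t \<in> ?I")
    case False
    then have "\<bar>t\<bar> > T" by auto
    then show ?thesis using T[of t] t0(2)[OF t1] by simp
  qed (rule t0)
  moreover have "h t0 \<noteq> 0" using t0(2)[OF t1] h(3) by auto
  ultimately show ?thesis by blast
qed

lemma line_fun_small:
  assumes "line_fun h h'" "e > 0"
  shows "\<exists>T. \<forall>t. \<bar>t\<bar> > T \<longrightarrow> \<bar>h t\<bar> < e"
proof -
  obtain C where C: "\<And>t. \<bar>h t\<bar> \<le> C * exp (- \<bar>t\<bar> / 2)"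
    using assms unfolding line_fun_def by blast
  have "((\<lambda>t. C * exp (- t / 2)) \<longlongrightarrow> 0) at_top" by real_asymp
  then have "\<forall>\<^sub>F t in at_top. C * exp (- t / 2) < e" using assms(2) order_tendstoD(2) by blast
  then obtain T where "\<And>t. t \<ge> T \<Longrightarrow> C * exp (- t / 2) < e" unfolding eventually_at_top_linorder by blast
  then have "\<bar>h t\<bar> < e" if "\<bar>t\<bar> > T" for t using C[of t] that le_less_trans less_imp_le by blast
  then show ?thesis by blast
qed

lemma line_fun_uminus:
  assumes "line_fun h h'"
  shows "line_fun (\<lambda>t. - h t) (\<lambda>t. - h' t)" "energy (\<lambda>t. - h t) (\<lambda>t. - h' t) = energy h h'"
    "mass q (\<lambda>t. - h t) = mass q h"
proof -
  show "line_fun (\<lambda>t. - h t) (\<lambda>t. - h' t)"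
    using assms unfolding line_fun_def by (auto intro!: derivative_intros continuous_intros)
  have "(- h' t + - h t / 2)\<^sup>2 = (h' t + h t / 2)\<^sup>2" for t by (simp add: power2_eq_square algebra_simps)
  then show "energy (\<lambda>t. - h t) (\<lambda>t. - h' t) = energy h h'" by (simp add: energy_def)
qed (simp add: mass_def)

lemma energy_nonneg: "energy h h' \<ge> 0" unfolding energy_def by simp
lemma mass_nonneg: "mass q h \<ge> 0" unfolding mass_def by simp

text \<open>Taking for \<open>M\<close> the attained maximum makes \<open>h t0 / M = 1\<close>, so
  the boundary term is exactly \<open>4 * M\<^sup>2 * c_const q\<close>, and
  \<open>young_mass\<close> then eliminates \<open>M\<close>. If the extreme value is negative, the
  sign of \<open>h\<close> is changed.\<close>

theorem line_inequality:
  assumes q: "q > 0" and h: "line_fun h h'"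
  shows "K_const q * mass q h powr (1 / (1 + q)) \<le> energy h h'"
proof (cases "\<exists>t. h t \<noteq> 0")
  case False
  then show ?thesis by (simp add: mass_def energy_nonneg)
next
  case True
  have main: "K_const q * mass q g powr (1 / (1 + q)) \<le> energy g g'"
    if g: "line_fun g g'" "g t0 > 0" "\<And>t. \<bar>g t\<bar> \<le> g t0" for g g' t0
  proof -
    have "0 \<le> energy g g' - g t0 powr (- 2 * q) / 4 * mass q g - 4 * (g t0)\<^sup>2 * (G_fun q (g t0 / g t0) - G_fun q 0)"
      by (rule order_trans[OF _ line_lower[OF q g(2,1,3), of t0 t0 t0]]) simp
    then have "g t0 powr (- 2 * q) / 4 * mass q g + 4 * (g t0)\<^sup>2 * c_const q \<le> energy g g'"
      using g(2) by (simp add: c_const_def)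
    then show ?thesis using young_mass(1)[OF q g(2) mass_nonneg[of q g]] by simp
  qed
  obtain t1 where "h t1 \<noteq> 0" using True by blast
  from attains_abs_sup[OF line_fun_continuous(1)[OF h] line_fun_small[OF h] this]
  obtain t0 where t0: "h t0 \<noteq> 0" "\<And>t. \<bar>h t\<bar> \<le> \<bar>h t0\<bar>" by blast
  show ?thesis
  proof (cases "h t0 > 0")
    case True
    show ?thesis by (rule main[OF h True]) (use t0 True in auto)
  next
    case False
    have "K_const q * mass q (\<lambda>t. - h t) powr (1 / (1 + q)) \<le> energy (\<lambda>t. - h t) (\<lambda>t. - h' t)"
      by (rule main[OF line_fun_uminus(1)[OF h], of t0]) (use t0 False in auto)
    then show ?thesis unfolding line_fun_uminus(2,3)[OF h] .
  qed
qed

subsection \<open>The extremals on the line\<close>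

text \<open>The even solution of height 1 of the first order equation that leaves its maximum
  immediately: \<open>prof q t powr (- q)\<close> is \<open>cosh (q * t / 2)\<close>. In the
  original variables it becomes \<open>u_mn\<close>.\<close>

definition prof :: "real \<Rightarrow> real \<Rightarrow> real" where
  "prof q t = cosh (q * t / 2) powr (- (1 / q))"

definition prof' :: "real \<Rightarrow> real \<Rightarrow> real" where
  "prof' q t = - (tanh (q * t / 2) / 2 * prof q t)"

lemma prof_pos: "prof q t > 0"
  using cosh_real_pos[of "q * t / 2"] unfolding prof_def by (simp add: less_le)

lemma prof_0: "prof q 0 = 1" by (simp add: prof_def)

lemma prof_le_1: "q > 0 \<Longrightarrow> prof q t \<le> 1"
  unfolding prof_def using cosh_real_ge_1[of "q * t / 2"] powr_mono[of "- (1/q)" 0 "cosh (q * t / 2)"] by simp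

lemma prof_derivative:
  assumes "q > 0"
  shows "(prof q has_real_derivative prof' q t) (at t)"
proof -
  have c: "cosh (q * t / 2) > 0" by (rule cosh_real_pos)
  have "((\<lambda>t. cosh (q * t / 2)) has_real_derivative sinh (q * t / 2) * (q / 2)) (at t)"
    by (auto intro!: derivative_eq_intros)
  from DERIV_chain2[OF has_real_derivative_powr[OF c] this]
  have "(prof q has_real_derivative - (1 / q) * cosh (q * t / 2) powr (- (1 / q) - 1) * (sinh (q * t / 2) * (q / 2))) (at t)"
    unfolding prof_def[abs_def] .
  moreover have "- (1 / q) * cosh (q * t / 2) powr (- (1 / q) - 1) * (sinh (q * t / 2) * (q / 2)) = prof' q t"
    using assms c unfolding prof'_def prof_def tanh_def powr_diff by (simp add: field_simps)
  ultimately show ?thesis by simp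
qed

lemma prof_bound:
  assumes "q > 0"
  shows "prof q t \<le> 2 powr (1 / q) * exp (- \<bar>t\<bar> / 2)"
proof -
  have "exp (q * \<bar>t\<bar> / 2) / 2 \<le> cosh (q * t / 2)"
    unfolding cosh_def by (cases "t \<ge> 0") auto
  then have "prof q t \<le> (exp (q * \<bar>t\<bar> / 2) / 2) powr (- (1 / q))"
    unfolding prof_def using assms by (intro powr_mono2') auto
  also have "\<dots> = 2 powr (1 / q) * exp (- \<bar>t\<bar> / 2)"
  proof -
    have "exp (q * \<bar>t\<bar> / 2) powr (- (1 / q)) = exp (- \<bar>t\<bar> / 2)"
      unfolding exp_powr_real using assms by simp
    moreover have "2 powr (- (1 / q)) * 2 powr (1 / q) = (1::real)" by (simp add: powr_add[symmetric])
    ultimately show ?thesis by (simp add: powr_divide field_simps)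
  qed
  finally show ?thesis .
qed

lemma line_fun_prof:
  assumes q: "q > 0"
  shows "line_fun (\<lambda>t. M * prof q (t - t0)) (\<lambda>t. M * prof' q (t - t0))"
  unfolding line_fun_def
proof (intro conjI allI exI)
  have d: "((\<lambda>t. prof q (t - t0)) has_real_derivative prof' q (t - t0)) (at t)" for t
  proof -
    have "((\<lambda>t. t - t0) has_real_derivative 1) (at t)" by (auto intro!: derivative_eq_intros)
    from DERIV_chain2[OF prof_derivative[OF q] this] show ?thesis by simp
  qed
  show "((\<lambda>t. M * prof q (t - t0)) has_real_derivative M * prof' q (t - t0)) (at t)" for t
    by (rule DERIV_cmult[OF d])
  have "isCont (\<lambda>t. prof q (t - t0)) t" for t using d DERIV_isCont by blast
  then have c: "continuous_on UNIV (\<lambda>t. prof q (t - t0))" by (simp add: continuous_at_imp_continuous_on)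
  show "continuous_on UNIV (\<lambda>t. M * prof' q (t - t0))"
    unfolding prof'_def by (intro continuous_intros c) (use cosh_real_nonzero in auto)
  fix t
  let ?C = "\<bar>M\<bar> * (2 powr (1 / q) * exp (\<bar>t0\<bar> / 2))"
  have "exp (- \<bar>t - t0\<bar> / 2) \<le> exp (\<bar>t0\<bar> / 2) * exp (- \<bar>t\<bar> / 2)"
    unfolding exp_add[symmetric] exp_le_cancel_iff using abs_triangle_ineq[of "t - t0" t0] by simp
  from order_trans[OF prof_bound[OF q, of "t - t0"] mult_left_mono[OF this]]
  have b: "prof q (t - t0) \<le> 2 powr (1 / q) * exp (\<bar>t0\<bar> / 2) * exp (- \<bar>t\<bar> / 2)"
    by (simp add: mult.assoc)
  then have b1: "\<bar>M\<bar> * prof q (t - t0) \<le> ?C * exp (- \<bar>t\<bar> / 2)"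
    using mult_left_mono[OF b, of "\<bar>M\<bar>"] by (simp add: mult_ac)
  then show "\<bar>M * prof q (t - t0)\<bar> \<le> ?C * exp (- \<bar>t\<bar> / 2)"
    using prof_pos[of q "t - t0"] by (simp add: abs_mult)
  have "\<bar>tanh (q * (t - t0) / 2) / 2\<bar> \<le> 1" using tanh_real_bounds[of "q * (t - t0) / 2"] by auto
  then have "\<bar>prof' q (t - t0)\<bar> \<le> prof q (t - t0)"
    using prof_pos[of q "t - t0"] mult_right_mono[of "\<bar>tanh (q * (t - t0) / 2) / 2\<bar>" 1 "prof q (t - t0)"]
    by (simp add: prof'_def abs_mult)
  then have "\<bar>M\<bar> * \<bar>prof' q (t - t0)\<bar> \<le> \<bar>M\<bar> * prof q (t - t0)" by (intro mult_left_mono) auto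
  then show "\<bar>M * prof' q (t - t0)\<bar> \<le> ?C * exp (- \<bar>t\<bar> / 2)" using b1 by (simp add: abs_mult)
qed

lemma line_fun_prof_0: "q > 0 \<Longrightarrow> line_fun (prof q) (prof' q)"
  using line_fun_prof[of q 1 0] by simp

lemma tanh_square: "(tanh x)\<^sup>2 = 1 - 1 / (cosh x)\<^sup>2" for x :: real
proof -
  have "(sinh x)\<^sup>2 = (cosh x)\<^sup>2 - 1" using cosh_square_eq[of x] by simp
  then show ?thesis using cosh_real_nonzero[of x] by (simp add: tanh_def power_divide diff_divide_distrib)
qed

lemma prof_powr:
  assumes "q > 0"
  shows "prof q t powr (2 * q) = 1 - (tanh (q * t / 2))\<^sup>2"
proof -
  have "cosh (q * t / 2) > 0" by (rule cosh_real_pos)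
  then show ?thesis using assms unfolding prof_def powr_powr tanh_square
    by (simp add: powr_minus_divide)
qed

lemma A_fun_prof:
  assumes q: "q > 0" shows "A_fun q (prof q t) = \<bar>tanh (q * t / 2)\<bar> / 2 * prof q t"
  unfolding A_fun_def using prof_powr[OF q, of t] prof_pos[of q t] by simp

text \<open>No integral is evaluated. The derivatives of \<open>h^2\<close> and of
  \<open>tanh * h^2\<close> integrate to zero, which expresses the energy through the mass. The
  second relation between the two is \<open>line_identity\<close>, where both squares vanish because
  \<open>prof\<close> solves the equation on either side of 0.\<close>

lemma mass_energy_prof:
  assumes q: "q > 0"
  shows "mass q (prof q) = 16 * c_const q / q" "energy (prof q) (prof' q) = (1 + q) / 4 * mass q (prof q)"
proof -
  let ?h = "prof q" and ?T = "\<lambda>t. tanh (q * t / 2)"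
  note lf = line_fun_prof_0[OF q]
  note d = prof_derivative[OF q]
  have p: "\<bar>?h t\<bar> powr (2 + 2 * q) = (?h t)\<^sup>2 * (1 - (?T t)\<^sup>2)" for t
    using prof_pos[of q t] prof_powr[OF q, of t] by (simp add: powr_add)
  have e: "(prof' q t + ?h t / 2)\<^sup>2 = (?h t)\<^sup>2 / 4 * (1 - ?T t)\<^sup>2" for t
    unfolding prof'_def by (simp add: power2_eq_square field_simps)
  have dh2: "((\<lambda>t. (?h t)\<^sup>2) has_real_derivative - (?T t * (?h t)\<^sup>2)) (at t)" for t
    using DERIV_power[OF d[of t], of 2] unfolding prof'_def by (simp add: power2_eq_square field_simps)
  have i0: "integrable lborel (\<lambda>t. (?h t)\<^sup>2)" by (rule line_fun_integrable[OF lf])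
  have ip: "integrable lborel (\<lambda>t. (?h t)\<^sup>2 * (1 - (?T t)\<^sup>2))"
    using line_fun_integrable(4)[OF lf q] unfolding p .
  have iT: "integrable lborel (\<lambda>t. ?T t * (?h t)\<^sup>2)"
    using integrable_mult_right[OF line_fun_integrable(3)[OF lf], of "-2"]
    unfolding prof'_def by (simp add: power2_eq_square mult_ac)
  have iTT: "integrable lborel (\<lambda>t. (?T t)\<^sup>2 * (?h t)\<^sup>2)"
    using Bochner_Integration.integrable_diff[OF i0 ip] by (simp add: algebra_simps)
  have z1: "(LBINT t. - (?T t * (?h t)\<^sup>2)) = 0"
    by (rule integral_derivative_zero[OF dh2])
      (use iT tendsto_power[OF line_fun_tendsto(1)[OF lf], of 2] tendsto_power[OF line_fun_tendsto(2)[OF lf], of 2] in auto)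
  have z2: "(LBINT t. q / 2 * ((?h t)\<^sup>2 * (1 - (?T t)\<^sup>2)) - (?T t)\<^sup>2 * (?h t)\<^sup>2) = 0"
  proof (rule integral_derivative_zero[of "\<lambda>t. ?T t * (?h t)\<^sup>2"])
    fix t
    have "(?T has_real_derivative (1 - (?T t)\<^sup>2) * (q / 2)) (at t)"
      by (auto intro!: derivative_eq_intros simp: cosh_real_nonzero)
    from DERIV_mult[OF this dh2[of t]]
    show "((\<lambda>t. ?T t * (?h t)\<^sup>2) has_real_derivative q / 2 * ((?h t)\<^sup>2 * (1 - (?T t)\<^sup>2)) - (?T t)\<^sup>2 * (?h t)\<^sup>2) (at t)"
      by (simp add: power2_eq_square algebra_simps)
  next
    have b: "norm (?T t * (?h t)\<^sup>2) \<le> (?h t)\<^sup>2" for t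
      using tanh_real_bounds[of "q * t / 2"] by (auto simp: abs_mult intro!: mult_left_le_one_le)
    have n: "(\<lambda>n. (?h (real n))\<^sup>2) \<longlonglongrightarrow> 0" "(\<lambda>n. (?h (- real n))\<^sup>2) \<longlonglongrightarrow> 0"
      using tendsto_power[OF line_fun_tendsto(1)[OF lf], of 2] tendsto_power[OF line_fun_tendsto(2)[OF lf], of 2] by auto
    show "(\<lambda>n. ?T (real n) * (?h (real n))\<^sup>2) \<longlonglongrightarrow> 0" "(\<lambda>n. ?T (- real n) * (?h (- real n))\<^sup>2) \<longlonglongrightarrow> 0"
      by (rule Lim_null_comparison[OF always_eventually n(1)] Lim_null_comparison[OF always_eventually n(2)], use b in blast)+
  qed (use ip iTT in auto)
  define P where "P = mass q ?h"
  have P: "P = (LBINT t. (?h t)\<^sup>2 * (1 - (?T t)\<^sup>2))" unfolding P_def mass_def p ..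
  define I where "I = (LBINT t. (?T t)\<^sup>2 * (?h t)\<^sup>2)"
  have I: "I = q / 2 * P" using z2 ip iTT unfolding P I_def by simp
  have "energy ?h (prof' q) = (LBINT t. ((?h t)\<^sup>2 * (1 - (?T t)\<^sup>2)) / 4 + (?T t)\<^sup>2 * (?h t)\<^sup>2 / 2 + - (?T t * (?h t)\<^sup>2) / 2)"
    unfolding energy_def e by (rule Bochner_Integration.integral_cong) (auto simp: power2_eq_square field_simps)
  also have "\<dots> = P / 4 + I / 2 + 0 / 2"
    using ip iTT iT z1 unfolding P I_def by simp
  finally have E: "energy ?h (prof' q) = (1 + q) / 4 * P" unfolding I by (simp add: field_simps)
  then show "energy ?h (prof' q) = (1 + q) / 4 * mass q ?h" by (simp add: P_def)
  have z3: "integral {- real n..0} (\<lambda>t. (prof' q t - 1 * A_fun q (?h t / 1))\<^sup>2) +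
       integral {0..real n} (\<lambda>t. (prof' q t + 1 * A_fun q (?h t / 1))\<^sup>2) = 0" for n
  proof -
    have "integral {- real n..0} (\<lambda>t. (prof' q t - 1 * A_fun q (?h t / 1))\<^sup>2) = integral {- real n..0} (\<lambda>t. 0)"
      by (rule Henstock_Kurzweil_Integration.integral_cong)
        (use q in \<open>auto simp: A_fun_prof[OF q] prof'_def abs_if mult_nonneg_nonpos not_less zero_le_mult_iff\<close>)
    moreover have "integral {0..real n} (\<lambda>t. (prof' q t + 1 * A_fun q (?h t / 1))\<^sup>2) = integral {0..real n} (\<lambda>t. 0)"
      by (rule Henstock_Kurzweil_Integration.integral_cong)
        (use q in \<open>auto simp: A_fun_prof[OF q] prof'_def\<close>)
    ultimately show ?thesis by simp
  qed
  have "\<bar>?h t\<bar> \<le> 1" for t using prof_pos[of q t] prof_le_1[OF q, of t] by simp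
  from line_identity[OF q zero_less_one lf this, of 0]
  have "(\<lambda>n::nat. 0) \<longlonglongrightarrow> energy ?h (prof' q) - 1 / 4 * P - 4 * c_const q"
    unfolding z3 by (simp add: P_def c_const_def prof_0)
  then have "energy ?h (prof' q) - 1 / 4 * P - 4 * c_const q = 0" using LIMSEQ_unique by blast
  then show "mass q ?h = 16 * c_const q / q" unfolding E P_def using q by (simp add: field_simps)
qed

text \<open>Mass and energy are invariant under translation and homogeneous of degrees
  \<open>2 + 2 * q\<close> and 2. The constant is attained because
  \<open>16 * c_const q / q\<close>, the mass at height 1, is also the base of the power in
  \<open>K_const\<close>.\<close>

lemma mass_energy_prof_shift:
  assumes q: "q > 0"
  shows "mass q (\<lambda>t. M * prof q (t - t0)) = \<bar>M\<bar> powr (2 + 2 * q) * (16 * c_const q / q)"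
    and "energy (\<lambda>t. M * prof q (t - t0)) (\<lambda>t. M * prof' q (t - t0)) = M\<^sup>2 * ((1 + q) / 4 * (16 * c_const q / q))"
    and "energy (\<lambda>t. M * prof q (t - t0)) (\<lambda>t. M * prof' q (t - t0)) =
      K_const q * mass q (\<lambda>t. M * prof q (t - t0)) powr (1 / (1 + q))"
proof -
  have sh: "(LBINT t. f (t - t0)) = (LBINT t. f t)" for f :: "real \<Rightarrow> real"
    using lborel_integral_real_affine[of 1 f "- t0"] by simp
  have "mass q (\<lambda>t. M * prof q (t - t0)) = (LBINT t. \<bar>M\<bar> powr (2 + 2 * q) * \<bar>prof q (t - t0)\<bar> powr (2 + 2 * q))"
    unfolding mass_def by (simp add: abs_mult powr_mult)
  also have "\<dots> = \<bar>M\<bar> powr (2 + 2 * q) * mass q (prof q)"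
    using sh[of "\<lambda>t. \<bar>prof q t\<bar> powr (2 + 2 * q)"] by (simp add: mass_def)
  finally show m: "mass q (\<lambda>t. M * prof q (t - t0)) = \<bar>M\<bar> powr (2 + 2 * q) * (16 * c_const q / q)"
    unfolding mass_energy_prof[OF q] .
  have "energy (\<lambda>t. M * prof q (t - t0)) (\<lambda>t. M * prof' q (t - t0)) =
      (LBINT t. M\<^sup>2 * (prof' q (t - t0) + prof q (t - t0) / 2)\<^sup>2)"
    unfolding energy_def by (rule Bochner_Integration.integral_cong) (auto simp: power2_eq_square algebra_simps)
  also have "\<dots> = M\<^sup>2 * energy (prof q) (prof' q)"
    using sh[of "\<lambda>t. (prof' q t + prof q t / 2)\<^sup>2"] by (simp add: energy_def)
  finally show e: "energy (\<lambda>t. M * prof q (t - t0)) (\<lambda>t. M * prof' q (t - t0)) = M\<^sup>2 * ((1 + q) / 4 * (16 * c_const q / q))"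
    unfolding mass_energy_prof[OF q] .
  define D where "D = 16 * c_const q / q"
  have D: "D > 0" unfolding D_def using c_const_pos[OF q] q by simp
  have "(\<bar>M\<bar> powr (2 + 2 * q)) powr (1 / (1 + q)) = \<bar>M\<bar> powr ((2 + 2 * q) * (1 / (1 + q)))" by (simp add: powr_powr)
  also have "(2 + 2 * q) * (1 / (1 + q)) = 2" using q by (simp add: field_simps)
  finally have "(\<bar>M\<bar> powr (2 + 2 * q)) powr (1 / (1 + q)) = M\<^sup>2" by simp
  then have "K_const q * (\<bar>M\<bar> powr (2 + 2 * q) * D) powr (1 / (1 + q)) =
     4 * c_const q * (1 + q) / q * M\<^sup>2 * (D powr (- (1 / (1 + q))) * D powr (1 / (1 + q)))"
    unfolding K_const_def D_def[symmetric] using D by (simp add: powr_mult)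
  also have "D powr (- (1 / (1 + q))) * D powr (1 / (1 + q)) = 1" using D by (simp add: powr_add[symmetric])
  finally have "K_const q * (\<bar>M\<bar> powr (2 + 2 * q) * D) powr (1 / (1 + q)) = 4 * c_const q * (1 + q) / q * M\<^sup>2"
    by simp
  moreover have "M\<^sup>2 * ((1 + q) / 4 * (16 * c_const q / q)) = 4 * c_const q * (1 + q) / q * M\<^sup>2"
    by simp
  ultimately show "energy (\<lambda>t. M * prof q (t - t0)) (\<lambda>t. M * prof' q (t - t0)) =
      K_const q * mass q (\<lambda>t. M * prof q (t - t0)) powr (1 / (1 + q))"
    unfolding m e D_def[symmetric] by simp
qed

section \<open>The first order equation of the extremals\<close>

lemma ode_positive:
  assumes q: "q > 0" and M: "M > 0" and H: "continuous_on UNIV H" "H t0 = M" "\<And>t. t \<ge> t0 \<Longrightarrow> \<bar>H t\<bar> \<le> M"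
    and d: "\<And>t. t > t0 \<Longrightarrow> (H has_real_derivative - (M * A_fun q (H t / M))) (at t)" and t: "t \<ge> t0"
  shows "H t > 0"
proof (rule ccontr)
  assume "\<not> H t > 0"
  then have "\<exists>x\<ge>t0. x \<le> t \<and> H x = 0"
    using IVT2'[of H t 0 t0] H(2) M t continuous_on_subset[OF H(1)] by auto
  then obtain x where x: "t0 \<le> x" "x \<le> t" "H x = 0" by blast
  let ?Z = "{t0..x} \<inter> H -` {0}"
  have cl: "closed ?Z" using continuous_on_subset[OF H(1)] by (intro continuous_closed_preimage) auto
  have ne: "?Z \<noteq> {}" using x by auto
  have bd: "bdd_below ?Z" by (auto intro!: bdd_belowI[of _ t0])
  define s where "s = Inf ?Z"
  have s: "s \<in> ?Z" unfolding s_def by (rule closed_contains_Inf[OF ne bd cl])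
  have nz: "H y > 0" if y: "t0 \<le> y" "y < s" for y
  proof (rule ccontr)
    assume "\<not> H y > 0"
    then have "\<exists>z\<ge>t0. z \<le> y \<and> H z = 0"
      using IVT2'[of H y 0 t0] H(2) M y continuous_on_subset[OF H(1)] by auto
    then obtain z where "z \<in> ?Z" "z < s" using y s by fastforce
    then show False using cInf_lower[OF _ bd, of z] unfolding s_def by auto
  qed
  \<comment> \<open>Up to the first zero \<open>s\<close>, the bound
    \<open>A_fun q x \<le> \<bar>x\<bar> / 2\<close> gives \<open>H' \<ge> - H / 2\<close>, so
    \<open>H * exp (t / 2)\<close> cannot fall to 0.\<close>
  have "H t0 * exp (t0 / 2) \<le> H s * exp (s / 2)"
  proof (rule DERIV_nonneg_imp_increasing_open[of t0 s])
    show "t0 \<le> s" using s by auto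
    show "continuous_on {t0..s} (\<lambda>y. H y * exp (y / 2))"
      using continuous_on_subset[OF H(1)] by (intro continuous_intros) auto
    fix y assume y: "t0 < y" "y < s"
    have "M * A_fun q (H y / M) \<le> M * (\<bar>H y / M\<bar> / 2)"
      using M H(3)[of y] y by (intro mult_left_mono A_fun_bounds q) auto
    also have "\<dots> = H y / 2" using M nz[of y] y by simp
    finally have "0 \<le> (- (M * A_fun q (H y / M)) + H y / 2) * exp (y / 2)" by simp
    moreover have "((\<lambda>y. H y * exp (y / 2)) has_real_derivative (- (M * A_fun q (H y / M)) + H y / 2) * exp (y / 2)) (at y)"
      using y by (auto intro!: derivative_eq_intros d simp: algebra_simps)
    ultimately show "\<exists>z. ((\<lambda>y. H y * exp (y / 2)) has_real_derivative z) (at y) \<and> 0 \<le> z" by blast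
  qed
  moreover have "H s = 0" using s by auto
  ultimately have "M * exp (t0 / 2) \<le> 0" using H(2) by simp
  then show False using M by (simp add: mult_le_0_iff)
qed

text \<open>In the unknown \<open>Y = x powr (- q)\<close> the equation becomes
  \<open>Y' = q / 2 * sqrt (Y\<^sup>2 - 1)\<close>, that of a hyperbolic cosine.\<close>

lemma A_fun_powr_neg:
  assumes q: "q > 0" and x: "0 < x" "x < 1"
  shows "q * x powr (- q - 1) * A_fun q x = q / 2 * sqrt ((x powr (- q))\<^sup>2 - 1)"
proof -
  have "(x powr (- q))\<^sup>2 - 1 = (x powr (- q))\<^sup>2 * (1 - x powr (2 * q))"
    using x by (simp add: power2_eq_square powr_add[symmetric] right_diff_distrib)
  then have "sqrt ((x powr (- q))\<^sup>2 - 1) = x powr (- q) * sqrt (1 - x powr (2 * q))"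
    by (simp add: real_sqrt_mult)
  moreover have "x powr (- q - 1) * x = x powr (- q)"
    using x by (simp add: powr_diff)
  ultimately show ?thesis using x by (simp add: A_fun_def)
qed

text \<open>Below its maximum, \<open>arcosh ((H / M) powr - q)\<close> grows at the constant rate \<open>q / 2\<close>;
  the equation has the constant solution \<open>M\<close> as well, so only an inequality can hold.\<close>

lemma ode_lower_derivative:
  assumes q: "q > 0" and M: "M > 0" and H: "continuous_on UNIV H" "H t0 = M" "\<And>t. t \<ge> t0 \<Longrightarrow> \<bar>H t\<bar> \<le> M"
    and d: "\<And>t. t > t0 \<Longrightarrow> (H has_real_derivative - (M * A_fun q (H t / M))) (at t)" and t: "t \<ge> t0"
  shows "M * prof q (t - t0) \<le> H t"
proof (cases "H t = M")
  case True
  then show ?thesis using mult_left_mono[OF prof_le_1[OF q, of "t - t0"], of M] M by simp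
next
  case False
  note pos = ode_positive[OF assms(1-6)]
  let ?Z = "{t0..t} \<inter> H -` {M}"
  have cl: "closed ?Z" using continuous_on_subset[OF H(1)] by (intro continuous_closed_preimage) auto
  have ne: "?Z \<noteq> {}" using H(2) t by auto
  have bd: "bdd_above ?Z" by (auto intro!: bdd_aboveI[of _ t])
  \<comment> \<open>The last time up to \<open>t\<close> at which the solution is at height
    \<open>M\<close>. Beyond it \<open>Y > 1\<close>, where \<open>arcosh\<close> is
    differentiable.\<close>
  define s where "s = Sup ?Z"
  have s: "s \<in> ?Z" unfolding s_def by (rule closed_contains_Sup[OF ne bd cl])
  then have s': "t0 \<le> s" "s < t" "H s = M" using False by auto (metis less_le)
  have lt: "H y < M" if "s < y" "y \<le> t" for y
  proof -
    have "y \<notin> ?Z" using cSup_upper[OF _ bd, of y] that unfolding s_def by auto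
    then have "H y \<noteq> M" using that s' by auto
    then show ?thesis using H(3)[of y] that s' by auto
  qed
  define Y where "Y = (\<lambda>y. (H y / M) powr (- q))"
  have Hp: "H y / M > 0" if "y \<ge> s" for y using pos[of y] that s' M by simp
  have Hne: "H y \<noteq> 0" if "s \<le> y" for y using Hp[OF that] by auto
  have Y1: "Y y > 1" if "s < y" "y \<le> t" for y
    unfolding Y_def using lt[OF that] Hp[of y] that q M powr_less_mono2_neg[of "-q" "H y / M" 1] by simp
  have Ys: "Y s = 1" unfolding Y_def using s' M by simp
  have Yge: "Y y \<ge> 1" if "s \<le> y" "y \<le> t" for y using Y1[of y] Ys that by (cases "y = s") auto
  have dY: "(Y has_real_derivative q / 2 * sqrt ((Y y)\<^sup>2 - 1)) (at y)" if y: "s < y" "y \<le> t" for y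
  proof -
    let ?x = "H y / M"
    have x: "0 < ?x" "?x < 1" using Hp[of y] lt[OF y] y M by auto
    have "((\<lambda>y. H y / M) has_real_derivative - A_fun q ?x) (at y)"
      using DERIV_cdivide[OF d[of y], of M] y s' M by simp
    from DERIV_chain2[OF has_real_derivative_powr[OF x(1)] this]
    have "(Y has_real_derivative (- q) * ?x powr (- q - 1) * (- A_fun q ?x)) (at y)"
      unfolding Y_def .
    moreover have "(- q) * ?x powr (- q - 1) * (- A_fun q ?x) = q / 2 * sqrt ((Y y)\<^sup>2 - 1)"
      using A_fun_powr_neg[OF q x] by (simp add: Y_def)
    ultimately show ?thesis by (rule DERIV_cong)
  qed
  define z where "z = (\<lambda>y. arcosh (Y y) - q / 2 * y)"
  have cY: "continuous_on {s..t} Y"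
    unfolding Y_def using continuous_on_subset[OF H(1)] Hne M by (intro continuous_intros) auto
  have cz: "continuous_on {s..t} z"
    unfolding z_def using Yge by (intro continuous_intros continuous_on_arcosh' cY) auto
  have dz: "(z has_real_derivative 0) (at y)" if y: "s < y" "y < t" for y
  proof -
    have g: "(Y y)\<^sup>2 - 1 > 0" using Y1[of y] y by (simp add: one_less_power)
    have "(arcosh has_real_derivative 1 / sqrt ((Y y)\<^sup>2 - 1)) (at (Y y))"
      using arcosh_real_has_field_derivative[of "Y y" UNIV] Y1[of y] y by simp
    from DERIV_chain2[OF this dY[of y]] y
    have "((\<lambda>y. arcosh (Y y)) has_real_derivative 1 / sqrt ((Y y)\<^sup>2 - 1) * (q / 2 * sqrt ((Y y)\<^sup>2 - 1))) (at y)" by simp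
    moreover have "1 / sqrt ((Y y)\<^sup>2 - 1) * (q / 2 * sqrt ((Y y)\<^sup>2 - 1)) = q / 2" using g by simp
    ultimately have "((\<lambda>y. arcosh (Y y)) has_real_derivative q / 2) (at y)" by simp
    then show ?thesis unfolding z_def by (auto intro!: derivative_eq_intros)
  qed
  have "z t = z s"
    by (rule DERIV_isconst_end[OF s'(2) cz]) (use dz in auto)
  then have arc: "arcosh (Y t) = q * (t - s) / 2" unfolding z_def Ys by (simp add: field_simps)
  have "cosh (arcosh (Y t)) = Y t" using cosh_arcosh_real[of "Y t"] Yge[of t] s' by simp
  then have "Y t = cosh (q * (t - s) / 2)" by (simp only: arc)
  \<comment> \<open>A later departure leaves less time to descend, so \<open>H\<close> lies above
    the profile that leaves its maximum at \<open>t0\<close>.\<close>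
  moreover have "cosh (q * (t - s) / 2) \<le> cosh (q * (t - t0) / 2)"
    using s' q t by (subst cosh_real_nonneg_le_iff) (auto intro!: divide_right_mono mult_left_mono)
  ultimately have "Y t \<le> cosh (q * (t - t0) / 2)" by simp
  then have "cosh (q * (t - t0) / 2) powr (- (1 / q)) \<le> Y t powr (- (1 / q))"
    using q Yge[of t] s' by (intro powr_mono2') auto
  also have "Y t powr (- (1 / q)) = H t / M"
    unfolding Y_def powr_powr using q pos[of t] t M by simp
  finally show ?thesis using M by (simp add: prof_def field_simps)
qed

text \<open>The limit function is only known to satisfy the integrated equation; the fundamental
  theorem of calculus recovers the derivative to the right of \<open>t0\<close>.\<close>

lemma ode_lower:
  assumes q: "q > 0" and M: "M > 0" and H: "continuous_on UNIV H" "H t0 = M" "\<And>t. \<bar>H t\<bar> \<le> M"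
    and eq: "\<And>x y. t0 \<le> x \<Longrightarrow> x \<le> y \<Longrightarrow> H y - H x = - integral {x..y} (\<lambda>t. M * A_fun q (H t / M))"
    and t: "t \<ge> t0"
  shows "M * prof q (t - t0) \<le> H t"
proof (rule ode_lower_derivative[OF q M H(1,2) H(3) _ t])
  fix t assume t: "t > t0"
  have c: "continuous_on S (\<lambda>t. M * A_fun q (H t / M))" for S
    by (intro continuous_intros continuous_on_compose2[OF continuous_A_fun[OF q, of UNIV]])
      (use H(1) M in \<open>auto intro!: continuous_intros intro: continuous_on_subset\<close>)
  have "((\<lambda>y. integral {t0..y} (\<lambda>t. M * A_fun q (H t / M))) has_real_derivative M * A_fun q (H t / M)) (at t within {t0..t+1})"
    by (rule integral_has_real_derivative[OF c]) (use t in auto)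
  then have "((\<lambda>y. integral {t0..y} (\<lambda>t. M * A_fun q (H t / M))) has_real_derivative M * A_fun q (H t / M)) (at t)"
    using at_within_Icc_at[of t0 t "t+1"] t by simp
  then have "((\<lambda>y. M - integral {t0..y} (\<lambda>t. M * A_fun q (H t / M))) has_real_derivative - (M * A_fun q (H t / M))) (at t)"
    by (rule DERIV_cong[OF DERIV_diff[OF DERIV_const]]) simp
  then show "(H has_real_derivative - (M * A_fun q (H t / M))) (at t)"
    by (rule has_field_derivative_transform_within_open[where S="{t0<..}"])
      (use t eq[of t0] H(2) in \<open>auto simp: algebra_simps\<close>)
qed

text \<open>Cauchy-Schwarz against the constant 1, from the nonnegativity of the variance about the
  mean \<open>m\<close>. It converts small integrals of squares into small integrals.\<close>

lemma integral_square_le: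
  fixes f :: "real \<Rightarrow> real"
  assumes f: "continuous_on {x..y} f" and xy: "x \<le> y"
  shows "(integral {x..y} f)\<^sup>2 \<le> (y - x) * integral {x..y} (\<lambda>t. (f t)\<^sup>2)"
proof (cases "x = y")
  case False
  define I where "I = integral {x..y} f"
  define m where "m = I / (y - x)"
  have i: "f integrable_on {x..y}" "(\<lambda>t. (f t)\<^sup>2) integrable_on {x..y}"
    by (intro integrable_continuous_interval continuous_intros f)+
  have "0 \<le> integral {x..y} (\<lambda>t. (f t - m)\<^sup>2)"
    by (intro integral_nonneg integrable_continuous_interval continuous_intros f) auto
  also have "integral {x..y} (\<lambda>t. (f t - m)\<^sup>2) = integral {x..y} (\<lambda>t. (f t)\<^sup>2 - 2 * m * f t + m\<^sup>2)"
    by (simp add: power2_eq_square algebra_simps)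
  also have "((\<lambda>t. (f t)\<^sup>2 - 2 * m * f t + m\<^sup>2) has_integral
     integral {x..y} (\<lambda>t. (f t)\<^sup>2) - 2 * m * I + (y - x) * m\<^sup>2) {x..y}"
    unfolding I_def using has_integral_const_real[of "m\<^sup>2" x y] xy
    by (intro has_integral_add has_integral_diff has_integral_mult_right integrable_integral i) auto
  then have "integral {x..y} (\<lambda>t. (f t)\<^sup>2 - 2 * m * f t + m\<^sup>2) =
     integral {x..y} (\<lambda>t. (f t)\<^sup>2) - 2 * m * I + (y - x) * m\<^sup>2" by (rule integral_unique)
  also have "2 * m * I - (y - x) * m\<^sup>2 = I\<^sup>2 / (y - x)"
  proof -
    have "2 * (I / d) * I - d * (I / d)\<^sup>2 = I\<^sup>2 / d" if "d \<noteq> 0" for d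
      using that by (simp add: power2_eq_square field_simps)
    from this[of "y - x"] show ?thesis using False unfolding m_def by simp
  qed
  then have "integral {x..y} (\<lambda>t. (f t)\<^sup>2) - 2 * m * I + (y - x) * m\<^sup>2 = integral {x..y} (\<lambda>t. (f t)\<^sup>2) - I\<^sup>2 / (y - x)"
    by linarith
  finally show ?thesis using False xy unfolding I_def by (simp add: field_simps)
qed simp

section \<open>Uniform limits of line functions and the case of equality\<close>

abbreviation nn_mass :: "real \<Rightarrow> (real \<Rightarrow> real) \<Rightarrow> ennreal" where
  "nn_mass q H \<equiv> (\<integral>\<^sup>+t. ennreal (\<bar>H t\<bar> powr (2 + 2 * q)) \<partial>lborel)"

text \<open>\<open>H\<close> stands for the profile of an element of the completion: a uniform limit
  without a derivative of its own. The limit \<open>e\<close> of the energies takes the place of an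
  energy of \<open>H\<close>.\<close>

locale line_limit =
  fixes q :: real and h h' :: "nat \<Rightarrow> real \<Rightarrow> real" and H :: "real \<Rightarrow> real" and \<delta> :: "nat \<Rightarrow> real" and e :: real
  assumes q: "q > 0" and h: "\<And>k. line_fun (h k) (h' k)"
    and \<delta>: "\<And>k t. \<bar>h k t - H t\<bar> \<le> \<delta> k" "\<delta> \<longlonglongrightarrow> 0"
    and e: "(\<lambda>k. energy (h k) (h' k)) \<longlonglongrightarrow> e"
begin

abbreviation "\<alpha> \<equiv> 1 / (1 + q)"

lemma unif: "uniform_limit UNIV h H sequentially"
proof (rule uniform_limitI)
  fix r :: real assume "r > 0"
  then have "\<forall>\<^sub>F k in sequentially. \<delta> k < r" using \<delta>(2) order_tendstoD(2) by blast
  then show "\<forall>\<^sub>F k in sequentially. \<forall>t\<in>UNIV. dist (h k t) (H t) < r"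
    by eventually_elim (use \<delta>(1) in \<open>auto simp: dist_real_def intro: le_less_trans\<close>)
qed

lemma H_cont: "continuous_on UNIV H"
  by (rule uniform_limit_theorem[OF always_eventually unif]) (simp_all add: line_fun_continuous[OF h])

lemma H_meas [measurable]: "H \<in> borel_measurable borel"
  using H_cont by (rule borel_measurable_continuous_onI)

lemma pointwise: "(\<lambda>k. h k t) \<longlonglongrightarrow> H t"
  using tendsto_uniform_limitI[OF unif] by simp

lemma H_small: "r > 0 \<Longrightarrow> \<exists>T. \<forall>t. \<bar>t\<bar> > T \<longrightarrow> \<bar>H t\<bar> < r"
proof -
  assume r: "r > 0"
  then have "\<forall>\<^sub>F k in sequentially. \<delta> k < r / 2" using \<delta>(2) order_tendstoD(2)[of \<delta> 0 _ "r/2"] by simp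
  then obtain k where k: "\<delta> k < r / 2" using eventually_happens'[OF sequentially_bot] by blast
  obtain T where T: "\<And>t. \<bar>t\<bar> > T \<Longrightarrow> \<bar>h k t\<bar> < r / 2" using line_fun_small[OF h, of "r/2"] r by auto
  have "\<bar>H t\<bar> < r" if "\<bar>t\<bar> > T" for t using T[OF that] \<delta>(1)[of k t] k by linarith
  then show ?thesis by blast
qed

lemma e_nonneg: "e \<ge> 0"
  by (rule LIMSEQ_le_const[OF e]) (use energy_nonneg in auto)

lemma mass_le: "mass q (h k) \<le> (energy (h k) (h' k) / K_const q) powr (1 + q)"
proof -
  have "mass q (h k) powr \<alpha> \<le> energy (h k) (h' k) / K_const q"
    using line_inequality[OF q h, of k] K_const_pos[OF q] by (simp add: field_simps)
  then have "(mass q (h k) powr \<alpha>) powr (1 + q) \<le> (energy (h k) (h' k) / K_const q) powr (1 + q)"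
    using q by (intro powr_mono2) auto
  then show ?thesis using q mass_nonneg by (simp add: powr_powr)
qed

lemma nn_mass_h: "(\<integral>\<^sup>+t. ennreal (\<bar>h k t\<bar> powr (2 + 2 * q)) \<partial>lborel) = ennreal (mass q (h k))"
  unfolding mass_def by (rule nn_integral_eq_integral) (use line_fun_integrable(4)[OF h q] in auto)

lemma fatou: "nn_mass q H \<le> liminf (\<lambda>k. ennreal (mass q (h k)))"
proof -
  have [measurable]: "h k \<in> borel_measurable borel" for k by (rule line_fun_measurable[OF h])
  have l: "(\<lambda>k. ennreal (\<bar>h k t\<bar> powr (2 + 2 * q))) \<longlonglongrightarrow> ennreal (\<bar>H t\<bar> powr (2 + 2 * q))" for t
    using q by (intro tendsto_ennrealI tendsto_powr' tendsto_rabs pointwise tendsto_const) auto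
  have "nn_mass q H =
      (\<integral>\<^sup>+t. liminf (\<lambda>k. ennreal (\<bar>h k t\<bar> powr (2 + 2 * q))) \<partial>lborel)"
    by (rule nn_integral_cong, rule lim_imp_Liminf[symmetric, OF _ l]) simp
  also have "\<dots> \<le> liminf (\<lambda>k. \<integral>\<^sup>+t. ennreal (\<bar>h k t\<bar> powr (2 + 2 * q)) \<partial>lborel)"
    by (intro nn_integral_liminf) simp
  finally show ?thesis by (simp add: nn_mass_h)
qed

lemma bound_tendsto: "(\<lambda>k. (energy (h k) (h' k) / K_const q) powr (1 + q)) \<longlonglongrightarrow> (e / K_const q) powr (1 + q)"
  using q K_const_pos[OF q] energy_nonneg
  by (intro tendsto_powr' tendsto_divide e tendsto_const) auto

text \<open>No common dominating function for the masses is at hand, but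
  \<open>line_inequality\<close> bounds them by the energies, and Fatou's lemma carries the bound
  over to \<open>H\<close>.\<close>

lemma nn_mass_le: "nn_mass q H \<le> ennreal ((e / K_const q) powr (1 + q))"
proof -
  have "liminf (\<lambda>k. ennreal (mass q (h k))) \<le> liminf (\<lambda>k. ennreal ((energy (h k) (h' k) / K_const q) powr (1 + q)))"
    by (intro Liminf_mono always_eventually allI ennreal_leI mass_le)
  also have "\<dots> = ennreal ((e / K_const q) powr (1 + q))"
    by (intro lim_imp_Liminf tendsto_ennrealI bound_tendsto) simp
  finally show ?thesis using fatou by (rule order_trans[rotated])
qed

lemma H_integrable: "integrable lborel (\<lambda>t. \<bar>H t\<bar> powr (2 + 2 * q))"
  by (rule integrableI_nonneg) (use nn_mass_le in \<open>auto intro: le_less_trans\<close>)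

lemma nn_mass_H: "nn_mass q H = ennreal (mass q H)"
  unfolding mass_def by (rule nn_integral_eq_integral[OF H_integrable]) auto

lemma mass_H_le: "mass q H \<le> (e / K_const q) powr (1 + q)"
  using nn_mass_le unfolding nn_mass_H by simp

theorem limit_inequality: "K_const q * mass q H powr \<alpha> \<le> e"
proof -
  have "mass q H powr \<alpha> \<le> ((e / K_const q) powr (1 + q)) powr \<alpha>"
    using mass_H_le q mass_nonneg[of q H] by (intro powr_mono2) auto
  also have "\<dots> = e / K_const q" using q e_nonneg K_const_pos[OF q] by (simp add: powr_powr)
  finally show ?thesis using K_const_pos[OF q] by (simp add: field_simps)
qed

context
  assumes opt: "e \<le> K_const q * mass q H powr \<alpha>"
begin

text \<open>Fatou's lemma bounds the masses from below in the limit, \<open>line_inequality\<close>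
  bounds them from above by \<open>(e / K_const q) powr (1 + q)\<close>; under \<open>opt\<close>
  the two bounds coincide.\<close>

lemma mass_tendsto: "(\<lambda>k. mass q (h k)) \<longlonglongrightarrow> mass q H"
proof -
  have "e = K_const q * mass q H powr \<alpha>" using opt limit_inequality by simp
  then have eq: "(e / K_const q) powr (1 + q) = mass q H"
    using q K_const_pos[OF q] mass_nonneg[of q H] by (simp add: powr_powr)
  show ?thesis
  proof (rule order_tendstoI)
    fix a assume a: "a < mass q H"
    show "\<forall>\<^sub>F k in sequentially. a < mass q (h k)"
    proof (cases "a < 0")
      case True
      then show ?thesis using mass_nonneg[of q] by (auto intro!: always_eventually intro: less_le_trans)
    next
      case False
      then have "ennreal a < liminf (\<lambda>k. ennreal (mass q (h k)))"
        using a by (intro less_le_trans[OF _ fatou[unfolded nn_mass_H]]) (simp add: ennreal_less_iff)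
      then have "\<forall>\<^sub>F k in sequentially. ennreal a < ennreal (mass q (h k))" by (rule less_LiminfD)
      then show ?thesis by eventually_elim (use False in \<open>auto simp: ennreal_less_iff\<close>)
    qed
  next
    fix a assume a: "mass q H < a"
    have "\<forall>\<^sub>F k in sequentially. (energy (h k) (h' k) / K_const q) powr (1 + q) < a"
      using order_tendstoD(2)[OF bound_tendsto, of a] a unfolding eq by blast
    then show "\<forall>\<^sub>F k in sequentially. mass q (h k) < a"
      by eventually_elim (use mass_le in \<open>auto intro: le_less_trans\<close>)
  qed
qed

context
  fixes t0 M :: real
  assumes M: "M > 0" "H t0 = M" "\<And>t. \<bar>H t\<bar> \<le> M"
begin

text \<open>The approximants may exceed \<open>M\<close>, whereas the calibration requires a bound
  for each of them; the uniform distance to \<open>H\<close> supplies the margin.\<close>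

definition Mk :: "nat \<Rightarrow> real" where "Mk k = M + \<delta> k"

lemma Mk: "Mk k > 0" "\<bar>h k t\<bar> \<le> Mk k" "Mk \<longlonglongrightarrow> M"
proof -
  have "\<delta> k \<ge> 0" using \<delta>(1)[of k 0] by linarith
  then show "Mk k > 0" using M by (simp add: Mk_def)
  show "\<bar>h k t\<bar> \<le> Mk k" using \<delta>(1)[of k t] M(3)[of t] unfolding Mk_def by linarith
  show "Mk \<longlonglongrightarrow> M" unfolding Mk_def[abs_def] using tendsto_add[OF tendsto_const \<delta>(2), of M] by simp
qed

text \<open>The right side of \<open>line_lower\<close> for \<open>h k\<close>: it dominates the
  squared residuals of the first order equation on both sides of \<open>t0\<close>.\<close>

definition defect :: "nat \<Rightarrow> real" where
  "defect k = energy (h k) (h' k) - Mk k powr (- 2 * q) / 4 * mass q (h k) -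
     4 * (Mk k)\<^sup>2 * (G_fun q (h k t0 / Mk k) - G_fun q 0)"

text \<open>The limit is nonnegative by \<open>line_lower\<close> and nonpositive by
  \<open>opt\<close> together with \<open>young_mass\<close>. Being squeezed, Young's inequality is
  in its case of equality, which determines the mass from \<open>M\<close>.\<close>

lemma defect_tendsto:
  "defect \<longlonglongrightarrow> 0" "mass q H = 16 * c_const q / q * M powr (2 + 2 * q)"
proof -
  let ?l = "e - M powr (- 2 * q) / 4 * mass q H - 4 * M\<^sup>2 * (G_fun q (H t0 / M) - G_fun q 0)"
  have l: "defect \<longlonglongrightarrow> ?l"
    unfolding defect_def[abs_def]
    by (intro tendsto_intros tendsto_powr e mass_tendsto Mk pointwise isCont_tendsto_compose[OF isCont_G_fun[OF q]])
      (use M in auto)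
  have l': "?l = e - (M powr (- 2 * q) / 4 * mass q H + 4 * M\<^sup>2 * c_const q)"
    using M by (simp add: c_const_def)
  have "0 \<le> defect k" for k
    unfolding defect_def
    by (rule order_trans[OF _ line_lower[OF q Mk(1)[of k] h[of k] Mk(2)[of k], of t0 t0 t0]]) simp
  then have "0 \<le> ?l" using LIMSEQ_le_const[OF l] by blast
  then have a: "M powr (- 2 * q) / 4 * mass q H + 4 * M\<^sup>2 * c_const q \<le> K_const q * mass q H powr \<alpha>"
    using opt unfolding l' by linarith
  show "mass q H = 16 * c_const q / q * M powr (2 + 2 * q)"
    by (rule young_mass(2)[OF q M(1) mass_nonneg a])
  have "?l \<le> 0" unfolding l' using opt young_mass(1)[OF q M(1) mass_nonneg[of q H]] by linarith
  with \<open>0 \<le> ?l\<close> have "?l = 0" by linarith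
  with l show "defect \<longlonglongrightarrow> 0" by simp
qed

text \<open>The residuals tend to 0 in mean square, hence so do their integrals over
  \<open>{x..y}\<close>. The other terms of the integrated equation converge as well:
  \<open>h k\<close> pointwise, the \<open>A_fun\<close> terms under a constant bound.\<close>

lemma limit_ode_aux:
  assumes s: "s = 1 \<or> s = -1" and xy: "x \<le> y"
    and le: "\<And>k. integral {x..y} (\<lambda>t. (h' k t - s * Mk k * A_fun q (h k t / Mk k))\<^sup>2) \<le> defect k"
  shows "H y - H x = s * integral {x..y} (\<lambda>t. M * A_fun q (H t / M))"
proof -
  let ?f = "\<lambda>k t. h' k t - s * Mk k * A_fun q (h k t / Mk k)"
  let ?g = "\<lambda>k t. Mk k * A_fun q (h k t / Mk k)"
  have cg: "continuous_on S (?g k)" for S k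
    by (intro continuous_intros continuous_on_compose2[OF continuous_A_fun[OF q, of UNIV]])
      (use line_fun_continuous[OF h] Mk(1)[of k] in \<open>auto intro!: continuous_intros\<close>)
  have cf: "continuous_on S (?f k)" for S k
    using continuous_on_diff[OF line_fun_continuous(2)[OF h, of S k] continuous_on_mult[OF continuous_on_const cg[of S k], of s]]
    by (simp add: mult.assoc)
  have "(\<lambda>k. (y - x) * defect k) \<longlonglongrightarrow> (y - x) * 0" by (intro tendsto_mult defect_tendsto tendsto_const)
  then have z: "(\<lambda>k. (y - x) * defect k) \<longlonglongrightarrow> 0" by simp
  have "(\<lambda>k. (integral {x..y} (?f k))\<^sup>2) \<longlonglongrightarrow> 0"
  proof (rule Lim_null_comparison[OF always_eventually z], rule allI)
    fix k
    have "(integral {x..y} (?f k))\<^sup>2 \<le> (y - x) * integral {x..y} (\<lambda>t. (?f k t)\<^sup>2)"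
      by (rule integral_square_le[OF cf xy])
    also have "\<dots> \<le> (y - x) * defect k" using le[of k] xy by (intro mult_left_mono) auto
    finally show "norm ((integral {x..y} (?f k))\<^sup>2) \<le> (y - x) * defect k" by simp
  qed
  then have "(\<lambda>k. sqrt ((integral {x..y} (?f k))\<^sup>2)) \<longlonglongrightarrow> sqrt 0" by (intro tendsto_real_sqrt)
  then have f0: "(\<lambda>k. integral {x..y} (?f k)) \<longlonglongrightarrow> 0" by (simp add: tendsto_rabs_zero_iff)
  have eq: "integral {x..y} (?f k) = h k y - h k x - s * integral {x..y} (?g k)" for k
  proof -
    have "(h' k has_integral h k y - h k x) {x..y}"
      using h[of k] xy unfolding line_fun_def
      by (intro fundamental_theorem_of_calculus)
        (auto simp: has_real_derivative_iff_has_vector_derivative intro: has_vector_derivative_at_within)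
    from has_integral_diff[OF this has_integral_mult_right[OF integrable_integral[OF integrable_continuous_interval[OF cg]], of s]]
    have "((\<lambda>t. h' k t - s * ?g k t) has_integral h k y - h k x - s * integral {x..y} (?g k)) {x..y}" .
    then show ?thesis by (intro integral_unique) (simp add: mult.assoc)
  qed
  obtain B where B: "\<And>k. \<bar>Mk k\<bar> \<le> B"
    using convergent_imp_Bseq[OF convergentI[OF Mk(3)]] unfolding Bseq_def by auto
  have gl: "(\<lambda>k. integral {x..y} (?g k)) \<longlonglongrightarrow> integral {x..y} (\<lambda>t. M * A_fun q (H t / M))"
  proof (rule dominated_convergence(2))
    show "?g k integrable_on {x..y}" for k by (rule integrable_continuous_interval[OF cg])
    show "(\<lambda>t. B) integrable_on {x..y}" by (rule integrable_const_ivl)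
    fix k t
    have "\<bar>h k t / Mk k\<bar> \<le> 1" using Mk(1,2)[of k] by (auto simp: abs_divide divide_le_eq)
    then have "0 \<le> A_fun q (h k t / Mk k)" "A_fun q (h k t / Mk k) \<le> 1"
      using A_fun_bounds[OF q, of "h k t / Mk k"] by auto
    then have "\<bar>?g k t\<bar> \<le> \<bar>Mk k\<bar> * 1" unfolding abs_mult by (intro mult_left_mono) auto
    then show "norm (?g k t) \<le> B" using B[of k] by simp
  next
    fix t
    have "isCont (A_fun q) (H t / M)"
      using continuous_A_fun[OF q, of UNIV] by (simp add: continuous_on_eq_continuous_at)
    then show "(\<lambda>k. ?g k t) \<longlonglongrightarrow> M * A_fun q (H t / M)"
      by (intro tendsto_mult isCont_tendsto_compose[where g="A_fun q"] tendsto_divide pointwise Mk) (use M in auto)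
  qed
  have "(\<lambda>k. integral {x..y} (?f k)) \<longlonglongrightarrow> H y - H x - s * integral {x..y} (\<lambda>t. M * A_fun q (H t / M))"
    unfolding eq by (intro tendsto_diff pointwise tendsto_mult tendsto_const gl)
  from LIMSEQ_unique[OF this f0] show ?thesis by simp
qed

lemma limit_ode:
  shows "t0 \<le> x \<Longrightarrow> x \<le> y \<Longrightarrow> H y - H x = - integral {x..y} (\<lambda>t. M * A_fun q (H t / M))"
    and "x \<le> y \<Longrightarrow> y \<le> t0 \<Longrightarrow> H y - H x = integral {x..y} (\<lambda>t. M * A_fun q (H t / M))"
proof -
  let ?F = "\<lambda>k s t. (h' k t - s * Mk k * A_fun q (h k t / Mk k))\<^sup>2"
  have c: "continuous_on S (?F k s)" for S k s
    by (intro continuous_intros line_fun_continuous[OF h] continuous_on_compose2[OF continuous_A_fun[OF q, of UNIV]])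
      (use line_fun_continuous[OF h] Mk(1)[of k] in \<open>auto intro!: continuous_intros\<close>)
  have i: "?F k s integrable_on {x..y}" for k s x y by (rule integrable_continuous_interval[OF c])
  {
    assume xy: "t0 \<le> x" "x \<le> y"
    have "integral {x..y} (?F k (-1)) \<le> defect k" for k
    proof -
      have "integral {x..y} (?F k (-1)) \<le> integral {t0..y} (?F k (-1))"
        by (rule integral_subset_le[OF _ i i]) (use xy in auto)
      also have "\<dots> \<le> defect k"
        using line_lower[OF q Mk(1)[of k] h[of k] Mk(2)[of k], of t0 t0 y] unfolding defect_def by simp
      finally show ?thesis .
    qed
    then show "H y - H x = - integral {x..y} (\<lambda>t. M * A_fun q (H t / M))"
      using limit_ode_aux[of "-1" x y] xy by simp
  }
  {
    assume xy: "x \<le> y" "y \<le> t0"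
    have "integral {x..y} (?F k 1) \<le> defect k" for k
    proof -
      have "integral {x..y} (?F k 1) \<le> integral {x..t0} (?F k 1)"
        by (rule integral_subset_le[OF _ i i]) (use xy in auto)
      also have "\<dots> \<le> defect k"
        using line_lower[OF q Mk(1)[of k] h[of k] Mk(2)[of k], of x t0 t0] unfolding defect_def by simp
      finally show ?thesis .
    qed
    then show "H y - H x = integral {x..y} (\<lambda>t. M * A_fun q (H t / M))"
      using limit_ode_aux[of "1" x y] xy by simp
  }
qed

text \<open>The comparison is made only to the right of the maximum; the other side follows by
  reflection at \<open>t0\<close>, which exchanges the two integrated equations.\<close>

lemma H_ge_prof: "M * prof q (t - t0) \<le> H t"
proof (cases "t \<ge> t0")
  case True
  show ?thesis by (rule ode_lower[OF q M(1) H_cont M(2,3) limit_ode(1) True])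
next
  case False
  define H' where "H' = (\<lambda>t. H (2 * t0 - t))"
  have "M * prof q ((2 * t0 - t) - t0) \<le> H' (2 * t0 - t)"
  proof (rule ode_lower[OF q M(1)])
    show "continuous_on UNIV H'" unfolding H'_def
      by (rule continuous_on_compose2[OF H_cont]) (auto intro!: continuous_intros)
    show "H' t0 = M" using M(2) by (simp add: H'_def)
    show "\<bar>H' t\<bar> \<le> M" for t using M(3) by (simp add: H'_def)
    show "2 * t0 - t \<ge> t0" using False by simp
    fix x y assume xy: "t0 \<le> x" "x \<le> y"
    let ?g = "\<lambda>t. M * A_fun q (H t / M)"
    have "H' y - H' x = - (H (2 * t0 - x) - H (2 * t0 - y))" by (simp add: H'_def)
    also have "\<dots> = - integral {2 * t0 - y..2 * t0 - x} ?g" using xy by (subst limit_ode(2)) auto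
    also have "integral {2 * t0 - y..2 * t0 - x} ?g = integral {x..y} (\<lambda>t. ?g (2 * t0 - t))"
    proof -
      have c: "continuous_on S ?g" for S
        by (intro continuous_intros continuous_on_compose2[OF continuous_A_fun[OF q, of UNIV]])
          (use continuous_on_subset[OF H_cont] M(1) in \<open>auto intro!: continuous_intros\<close>)
      have "(?g has_integral integral {2 * t0 - y..2 * t0 - x} ?g) (cbox (2 * t0 - y) (2 * t0 - x))"
        using integrable_integral[OF integrable_continuous_interval[OF c]] by simp
      from has_integral_affinity[OF this, of "-1" "2 * t0"]
      have "((\<lambda>t. ?g (2 * t0 - t)) has_integral integral {2 * t0 - y..2 * t0 - x} ?g) ((\<lambda>t. 2 * t0 - t) ` {2 * t0 - y..2 * t0 - x})"
        by simp
      moreover have "(\<lambda>t. 2 * t0 - t) ` {2 * t0 - y..2 * t0 - x} = {x..y}"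
        using image_diff_atLeastAtMost[of "2 * t0" "2 * t0 - y" "2 * t0 - x"] by simp
      ultimately show ?thesis by (metis integral_unique)
    qed
    finally show "H' y - H' x = - integral {x..y} (\<lambda>t. M * A_fun q (H' t / M))" by (simp add: H'_def)
  qed
  moreover have "prof q (t0 - t) = prof q (t - t0)"
    using cosh_minus[of "q * (t0 - t) / 2"] unfolding prof_def by (metis minus_diff_eq minus_divide_left mult_minus_right)
  ultimately show ?thesis by (simp add: H'_def)
qed

text \<open>The equation would permit a plateau and yields only \<open>H_ge_prof\<close>. But the
  mass of \<open>H\<close> is that of the profile, and ordered continuous integrands with equal
  integrals coincide.\<close>

lemma H_eq_prof: "H t = M * prof q (t - t0)"
proof (rule ccontr)
  assume ne: "H t \<noteq> M * prof q (t - t0)"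
  let ?p = "\<lambda>t. M * prof q (t - t0)"
  let ?f = "\<lambda>t. \<bar>H t\<bar> powr (2 + 2 * q) - \<bar>?p t\<bar> powr (2 + 2 * q)"
  have pp: "0 < ?p t" for t using M(1) prof_pos[of q "t - t0"] by simp
  have lf: "line_fun ?p (\<lambda>t. M * prof' q (t - t0))" by (rule line_fun_prof[OF q])
  have nn: "?f t \<ge> 0" for t
    using H_ge_prof[of t] pp[of t] q powr_mono2[of "2 + 2 * q" "\<bar>?p t\<bar>" "\<bar>H t\<bar>"] by simp
  have i: "integrable lborel ?f"
    by (intro Bochner_Integration.integrable_diff H_integrable line_fun_integrable(4)[OF lf q])
  have "integral\<^sup>L lborel ?f = mass q H - mass q ?p"
    unfolding mass_def by (intro Bochner_Integration.integral_diff H_integrable line_fun_integrable(4)[OF lf q])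
  also have "\<dots> = 0" unfolding mass_energy_prof_shift(1)[OF q] defect_tendsto(2) using M(1) by simp
  finally have I: "integral\<^sup>L lborel ?f = 0" .
  have c: "continuous_on S ?f" for S
    using q by (intro continuous_intros continuous_on_powr' continuous_on_subset[OF H_cont] line_fun_continuous(1)[OF lf]) auto
  have le: "integral {t - 1..t + 1} ?f \<le> 0"
    using integral_interval_le[OF i nn, of "t - 1" "t + 1"] I by simp
  have "0 \<le> integral {t - 1..t + 1} ?f" by (rule integral_nonneg[OF integrable_continuous_interval[OF c]]) (use nn in auto)
  with le have "(?f has_integral 0) (cbox (t - 1) (t + 1))"
    using integrable_integral[OF integrable_continuous_interval[OF c], of "t - 1" "t + 1"] by simp
  from has_integral_0_cbox_imp_0[OF c nn this, of t] have "?f t = 0" by simp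
  moreover have "\<bar>?p t\<bar> < \<bar>H t\<bar>" using ne H_ge_prof[of t] pp[of t] by simp
  then have "\<bar>?p t\<bar> powr (2 + 2 * q) < \<bar>H t\<bar> powr (2 + 2 * q)" using q by (intro powr_less_mono2) auto
  ultimately show False by simp
qed

end
end
end

theorem line_limit_equality:
  assumes "line_limit q h h' H \<delta> e" and opt: "e \<le> K_const q * mass q H powr (1 / (1 + q))" and ne: "H t1 \<noteq> 0"
  shows "\<exists>M t0. M \<noteq> 0 \<and> (\<forall>t. H t = M * prof q (t - t0))"
proof -
  interpret line_limit q h h' H \<delta> e by fact
  have "\<exists>t0. H t0 \<noteq> 0 \<and> (\<forall>t. \<bar>H t\<bar> \<le> \<bar>H t0\<bar>)"
    by (rule attains_abs_sup[OF H_cont _ ne]) (rule H_small)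
  then obtain t0 where t0': "H t0 \<noteq> 0 \<and> (\<forall>t. \<bar>H t\<bar> \<le> \<bar>H t0\<bar>)" by (rule exE)
  have t0: "H t0 \<noteq> 0" "\<bar>H t\<bar> \<le> \<bar>H t0\<bar>" for t
    using conjunct1[OF t0'] spec[OF conjunct2[OF t0'], of t] .
  show ?thesis
  proof (cases "H t0 > 0")
    case True
    have "\<bar>H t\<bar> \<le> H t0" for t by (rule order_trans[OF t0(2)]) (use True in simp)
    then have "\<forall>t. H t = H t0 * prof q (t - t0)"
      by (intro allI H_eq_prof[OF opt True refl])
    then show ?thesis by (intro exI conjI) (rule t0(1))
  next
    case False
    \<comment> \<open>The extreme value of \<open>H\<close> is negative here; all hypotheses survive
      a simultaneous change of sign of \<open>H\<close> and its approximants.\<close>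
    interpret neg: line_limit q "\<lambda>k t. - h k t" "\<lambda>k t. - h' k t" "\<lambda>t. - H t" \<delta> e
    proof
      show "\<bar>- h k t - - H t\<bar> \<le> \<delta> k" for k t using \<delta>(1)[of k t] by simp
    qed (use q line_fun_uminus(1,2)[OF h] \<delta>(2) e in auto)
    have pos: "- H t0 > 0" using False t0(1) by simp
    have le: "\<bar>- H t\<bar> \<le> - H t0" for t using t0(2)[of t] pos by simp
    have opt': "e \<le> K_const q * mass q (\<lambda>t. - H t) powr (1 / (1 + q))"
      using opt by (simp add: mass_def)
    have "- H t = - H t0 * prof q (t - t0)" for t
      by (rule neg.H_eq_prof[OF opt' pos refl le])
    then have "\<forall>t. H t = H t0 * prof q (t - t0)"
      unfolding mult_minus_left neg_equal_iff_equal by (rule allI)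
    then show ?thesis by (intro exI conjI) (rule t0(1))
  qed
qed

subsection \<open>Polar coordinates\<close>

lemma measurable_sgn_vec [measurable]: "(sgn :: 'a::euclidean_space \<Rightarrow> 'a) \<in> borel_measurable borel"
  unfolding sgn_div_norm[abs_def] by measurable

lemma nn_integral_scaleR:
  fixes f :: "'a::euclidean_space \<Rightarrow> ennreal"
  assumes [measurable]: "f \<in> borel_measurable borel" and c: "c > 0"
  shows "(\<integral>\<^sup>+x. f (c *\<^sub>R x) \<partial>lborel) = ennreal (1 / c ^ DIM('a)) * (\<integral>\<^sup>+x. f x \<partial>lborel)"
proof -
  have "(\<integral>\<^sup>+x. f x \<partial>lborel) = ennreal (c ^ DIM('a)) * (\<integral>\<^sup>+x. f (c *\<^sub>R x) \<partial>lborel)"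
    using c by (subst lborel_affine[of c 0]) (simp_all add: nn_integral_density nn_integral_distr nn_integral_cmult)
  moreover have "ennreal (1 / c ^ DIM('a)) * ennreal (c ^ DIM('a)) = 1"
    using c by (simp add: ennreal_mult[symmetric])
  ultimately show ?thesis by (simp add: mult.assoc[symmetric])
qed

lemma nn_integral_power_tail:
  assumes "b > 0" "n > 0"
  shows "(\<integral>\<^sup>+s. ennreal (real n / s ^ (n + 1)) * indicator {b<..} s \<partial>lborel) = ennreal (1 / b ^ n)"
proof -
  have "(\<integral>\<^sup>+s. ennreal (real n / s ^ (n + 1)) * indicator {b<..} s \<partial>lborel) =
      (\<integral>\<^sup>+s. ennreal (real n / s ^ (n + 1)) * indicator {b..} s \<partial>lborel)"
    by (rule nn_integral_cong_AE) (use AE_lborel_singleton[of b] in \<open>auto simp: indicator_def\<close>)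
  also have "\<dots> = ennreal (0 - (- (1 / b ^ n)))"
  proof (rule nn_integral_FTC_atLeast)
    fix x assume x: "b \<le> x"
    have "((\<lambda>s. - (inverse s ^ n)) has_real_derivative - (real n * (inverse x ^ (n - 1) * - (inverse x ^ 2)))) (at x)"
      using x assms(1) by (auto intro!: derivative_eq_intros simp: power2_eq_square)
    moreover have "- (real n * (inverse x ^ (n - 1) * - (inverse x ^ 2))) = real n / x ^ (n + 1)"
    proof -
      have "inverse x ^ (n - 1) * inverse x ^ 2 = inverse x ^ (n + 1)"
        using assms(2) by (cases n) (auto simp: power2_eq_square)
      then show ?thesis by (simp add: divide_inverse power_inverse)
    qed
    ultimately have "((\<lambda>s. - (inverse s ^ n)) has_real_derivative real n / x ^ (n + 1)) (at x)"
      by (rule DERIV_cong)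
    moreover have "(\<lambda>s::real. - (1 / s ^ n)) = (\<lambda>s. - (inverse s ^ n))"
      by (simp add: fun_eq_iff divide_inverse power_inverse)
    ultimately show "((\<lambda>s. - (1 / s ^ n)) has_real_derivative real n / x ^ (n + 1)) (at x)"
      by (simp only:)
    show "0 \<le> real n / x ^ (n + 1)" using x assms by simp
  next
    have "((\<lambda>s::real. inverse s) \<longlongrightarrow> 0) at_top" by (rule tendsto_inverse_0_at_top[OF filterlim_ident])
    from tendsto_minus[OF tendsto_null_power[OF this assms(2)]]
    have l: "((\<lambda>s::real. - (inverse s ^ n)) \<longlongrightarrow> 0) at_top" by (simp only: minus_zero)
    show "((\<lambda>s::real. - (1 / s ^ n)) \<longlongrightarrow> 0) at_top"
      by (rule Lim_transform_eventually[OF l]) (simp add: divide_inverse power_inverse)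
  qed simp
  finally show ?thesis by simp
qed

abbreviation "jointly_measurable \<equiv> borel_measurable (lborel \<Otimes>\<^sub>M lborel)"

text \<open>The unit ball with its Lebesgue measure serves as the space of directions: no measure on the
  sphere is needed, and Tonelli's theorem and scaling give the formula.\<close>

theorem nn_integral_polar:
  fixes f :: "'a::euclidean_space \<Rightarrow> ennreal"
  assumes f [measurable]: "f \<in> borel_measurable borel"
  shows "(\<integral>\<^sup>+x. f x \<partial>lborel) = (\<integral>\<^sup>+\<xi>. (\<integral>\<^sup>+r. indicator (ball 0 1) \<xi> * indicator {0<..} r *
     ennreal (real DIM('a) * r ^ (DIM('a) - 1)) * f (r *\<^sub>R sgn \<xi>) \<partial>lborel) \<partial>lborel)"
    (is "_ = ?rhs")
proof -
  let ?n = "DIM('a)"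
  let ?d = "\<lambda>s::real. ennreal (real ?n * s ^ (?n - 1))"
  \<comment> \<open>\<open>?A\<close> is the integrand after \<open>r = norm \<xi> * s\<close>, and
    \<open>?B\<close> the one after \<open>y = s *\<^sub>R \<xi>\<close> for fixed \<open>s\<close>,
    which turns the unit ball into \<open>norm y < s\<close>. Integrating
    \<open>n / s ^ (n + 1)\<close> over those \<open>s\<close> cancels
    \<open>norm y ^ n\<close>.\<close>
  let ?A = "\<lambda>(\<xi>::'a) s. ennreal (norm \<xi> ^ ?n) * indicator (ball 0 1) \<xi> * (indicator {0<..} s * ?d s * f (s *\<^sub>R \<xi>))"
  let ?B = "\<lambda>(y::'a) s. ennreal (real ?n / s ^ (?n + 1)) * indicator {norm y<..} s * (ennreal (norm y ^ ?n) * f y)"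
  have n: "?n > 0" by simp
  have nS: "s * s ^ (?n - 1) = s ^ ?n" for s :: real using n by (metis power_Suc Suc_diff_1)
  have [measurable]: "ball (0::'a) r \<in> sets borel" for r by (simp add: borel_open)
  have [measurable]: "(\<lambda>x::'a \<times> real. ennreal (norm (fst x) ^ ?n) * indicator (ball 0 1) (fst x)) \<in> jointly_measurable"
    by (rule measurable_compose[OF measurable_fst, of "\<lambda>x. ennreal (norm x ^ ?n) * indicator (ball 0 1) x"]) measurable
  have [measurable]: "(\<lambda>x::'a \<times> real. indicator {0<..} (snd x) * ?d (snd x)) \<in> jointly_measurable"
    by (rule measurable_compose[OF measurable_snd, of "\<lambda>r. indicator {0<..} r * ?d r"]) measurable
  have [measurable]: "(\<lambda>x::'a \<times> real. f (snd x *\<^sub>R fst x)) \<in> jointly_measurable"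
    by measurable
  have inner: "(\<integral>\<^sup>+r. indicator (ball 0 1) \<xi> * indicator {0<..} r * ?d r * f (r *\<^sub>R sgn \<xi>) \<partial>lborel) =
      (\<integral>\<^sup>+s. ?A \<xi> s \<partial>lborel)"
    if \<xi>: "\<xi> \<noteq> 0" for \<xi> :: 'a
  proof -
    have c: "norm \<xi> \<noteq> 0" using \<xi> by simp
    have "(\<integral>\<^sup>+r. indicator (ball 0 1) \<xi> * indicator {0<..} r * ?d r * f (r *\<^sub>R sgn \<xi>) \<partial>lborel) =
       ennreal \<bar>norm \<xi>\<bar> * (\<integral>\<^sup>+s. indicator (ball 0 1) \<xi> * indicator {0<..} (0 + norm \<xi> * s) * ?d (0 + norm \<xi> * s) * f ((0 + norm \<xi> * s) *\<^sub>R sgn \<xi>) \<partial>lborel)"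
      by (rule nn_integral_real_affine[OF _ c]) measurable
    also have "\<dots> = (\<integral>\<^sup>+s. ennreal (norm \<xi>) * (indicator (ball 0 1) \<xi> * indicator {0<..} (norm \<xi> * s) * ?d (norm \<xi> * s) * f ((norm \<xi> * s) *\<^sub>R sgn \<xi>)) \<partial>lborel)"
      by (subst nn_integral_cmult) auto
    also have "\<dots> = (\<integral>\<^sup>+s. ?A \<xi> s \<partial>lborel)"
    proof (rule nn_integral_cong)
      fix s :: real
      have v: "(norm \<xi> * s) *\<^sub>R sgn \<xi> = s *\<^sub>R \<xi>" using c by (simp add: sgn_div_norm)
      show "ennreal (norm \<xi>) * (indicator (ball 0 1) \<xi> * indicator {0<..} (norm \<xi> * s) * ?d (norm \<xi> * s) * f ((norm \<xi> * s) *\<^sub>R sgn \<xi>)) =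
         ?A \<xi> s"
      proof (cases "s > 0")
        case True
        have "ennreal (norm \<xi>) * ?d (norm \<xi> * s) = ennreal (norm \<xi> ^ ?n) * ?d s"
          using True by (simp add: ennreal_mult'[symmetric] power_mult_distrib nS[symmetric] mult_ac)
        then have "ennreal (norm \<xi>) * ?d (norm \<xi> * s) * X = ennreal (norm \<xi> ^ ?n) * ?d s * X" for X by simp
        from this[of "indicator (ball 0 1) \<xi> * f (s *\<^sub>R \<xi>)"] show ?thesis
          unfolding v using True \<xi> by (simp add: mult_ac)
      next
        case False
        then have "\<not> norm \<xi> * s > 0" using \<xi> by (simp add: zero_less_mult_iff)
        then show ?thesis using False by simp
      qed
    qed
    finally show ?thesis .
  qed
  have "?rhs = (\<integral>\<^sup>+\<xi>. (\<integral>\<^sup>+s. ?A \<xi> s \<partial>lborel) \<partial>lborel)"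
    by (rule nn_integral_cong_AE, use AE_lborel_singleton[of "0::'a"] in eventually_elim) (rule inner)
  also have "\<dots> = (\<integral>\<^sup>+s. (\<integral>\<^sup>+\<xi>. ?A \<xi> s \<partial>lborel) \<partial>lborel)"
    by (rule lborel_pair.Fubini'[symmetric]) (unfold case_prod_beta, measurable)
  also have "\<dots> = (\<integral>\<^sup>+s. (\<integral>\<^sup>+y. ?B y s \<partial>lborel) \<partial>lborel)"
  proof (rule nn_integral_cong)
    fix s :: real
    show "(\<integral>\<^sup>+\<xi>. ?A \<xi> s \<partial>lborel) =
       (\<integral>\<^sup>+y. ?B y s \<partial>lborel)"
    proof (cases "s > 0")
      case False
      then have "\<not> norm y < s" for y :: 'a using norm_ge_zero[of y] by linarith
      then have "indicator {norm y<..} s = (0::ennreal)" for y :: 'a by simp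
      then show ?thesis using False by simp
    next
      case True
      define g where "g = (\<lambda>y::'a. ennreal (norm y ^ ?n / s ^ ?n) * indicator (ball 0 s) y * (?d s * f y))"
      have [measurable]: "g \<in> borel_measurable borel" unfolding g_def by measurable
      have "(\<integral>\<^sup>+\<xi>. ?A \<xi> s \<partial>lborel) =
         (\<integral>\<^sup>+\<xi>. g (s *\<^sub>R \<xi>) \<partial>lborel)"
        unfolding g_def using True by (intro nn_integral_cong) (auto simp: power_mult_distrib indicator_def)
      also have "\<dots> = ennreal (1 / s ^ ?n) * (\<integral>\<^sup>+y. g y \<partial>lborel)"
        by (rule nn_integral_scaleR) (use True in auto)
      also have "\<dots> = (\<integral>\<^sup>+y. ennreal (1 / s ^ ?n) * g y \<partial>lborel)" by (rule nn_integral_cmult[symmetric]) auto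
      also have "\<dots> = (\<integral>\<^sup>+y. ?B y s \<partial>lborel)"
      proof (rule nn_integral_cong)
        fix y :: 'a
        have "1 / s ^ ?n * (norm y ^ ?n / s ^ ?n) * (real ?n * s ^ (?n - 1)) = real ?n / s ^ (?n + 1) * norm y ^ ?n"
        proof -
          have p: "s ^ (?n - 1) > 0" using True by simp
          show ?thesis using True p unfolding nS[symmetric] power_add by (simp add: field_simps)
        qed
        then have "ennreal (1 / s ^ ?n) * (ennreal (norm y ^ ?n / s ^ ?n) * ?d s) = ennreal (real ?n / s ^ (?n + 1)) * ennreal (norm y ^ ?n)"
          using True by (simp add: ennreal_mult'[symmetric] mult.assoc)
        then have "ennreal (1 / s ^ ?n) * (ennreal (norm y ^ ?n / s ^ ?n) * ?d s) * X = ennreal (real ?n / s ^ (?n + 1)) * ennreal (norm y ^ ?n) * X" for X by simp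
        from this[of "f y"] show "ennreal (1 / s ^ ?n) * g y = ?B y s"
          unfolding g_def by (auto simp: indicator_def mult_ac)
      qed
      finally show ?thesis .
    qed
  qed
  also have "\<dots> = (\<integral>\<^sup>+y. (\<integral>\<^sup>+s. ?B y s \<partial>lborel) \<partial>lborel)"
  proof (rule lborel_pair.Fubini')
    have "{x::'a \<times> real. norm (fst x) < snd x} \<in> sets borel" by (intro borel_open open_Collect_less continuous_intros)
    moreover have "(\<lambda>x::'a \<times> real. indicator {norm (fst x)<..} (snd x) :: ennreal) = indicator {x. norm (fst x) < snd x}"
      by (auto simp: fun_eq_iff indicator_def)
    ultimately have [measurable]: "(\<lambda>x::'a \<times> real. indicator {norm (fst x)<..} (snd x) :: ennreal) \<in> borel_measurable (borel \<Otimes>\<^sub>M borel)"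
      by (simp add: borel_prod)
    show "(\<lambda>(y::'a, s). ?B y s) \<in> jointly_measurable"
      unfolding case_prod_beta by measurable
  qed
  also have "\<dots> = (\<integral>\<^sup>+y. f y \<partial>lborel)"
  proof (rule nn_integral_cong_AE)
    show "AE y in lborel. (\<integral>\<^sup>+s. ?B y s \<partial>lborel) = f y"
      using AE_lborel_singleton[of "0::'a"]
    proof eventually_elim
      case (elim y)
      have "(\<integral>\<^sup>+s. ?B y s \<partial>lborel) =
        ennreal (1 / norm y ^ ?n) * (ennreal (norm y ^ ?n) * f y)"
        using elim by (subst nn_integral_multc) (auto simp: nn_integral_power_tail[OF _ n, simplified])
      also have "ennreal (1 / norm y ^ ?n) * ennreal (norm y ^ ?n) = 1"
        using elim by (simp add: ennreal_mult'[symmetric])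
      then have "ennreal (1 / norm y ^ ?n) * (ennreal (norm y ^ ?n) * f y) = f y"
        by (simp add: mult.assoc[symmetric])
      finally show ?case .
    qed
  qed
  finally show ?thesis by simp
qed

text \<open>The increasing substitution \<open>g (- t)\<close> is applied on \<open>{- n..n}\<close>
  and exhausted by monotone convergence. Describing \<open>I\<close> through the intervals from
  \<open>g n\<close> to \<open>g (- n)\<close> covers bounded and unbounded ranges alike.\<close>

lemma nn_integral_substitution_decreasing:
  fixes F :: "real \<Rightarrow> ennreal"
  assumes F [measurable]: "F \<in> borel_measurable borel"
    and g: "\<And>t. (g has_real_derivative g' t) (at t)" "continuous_on UNIV g'" "\<And>t. g' t \<le> 0"
    and I: "\<And>r. r \<in> I \<longleftrightarrow> (\<exists>n. g (real n) \<le> r \<and> r \<le> g (- real n))" and Im [measurable]: "I \<in> sets borel"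
  shows "(\<integral>\<^sup>+r. F r * indicator I r \<partial>lborel) = (\<integral>\<^sup>+t. F (g t) * ennreal (- g' t) \<partial>lborel)"
proof -
  let ?k = "\<lambda>t. g (- t)" and ?k' = "\<lambda>t. - g' (- t)"
  have cg: "continuous_on UNIV g" using g(1) DERIV_isCont by (blast intro: continuous_at_imp_continuous_on)
  note [measurable] = borel_measurable_continuous_onI[OF cg] borel_measurable_continuous_onI[OF g(2)]
  have anti: "g t \<le> g s" if "s \<le> t" for s t
    by (rule DERIV_nonpos_imp_nonincreasing[OF that]) (use g in blast)
  have step: "(\<integral>\<^sup>+r. F r * indicator {?k (- real n)..?k (real n)} r \<partial>lborel) =
     (\<integral>\<^sup>+t. F (?k t) * ?k' t * indicator {- real n..real n} t \<partial>lborel)" if "n > 0" for n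
  proof (rule nn_integral_substitution_aux)
    fix t
    show "(?k has_real_derivative ?k' t) (at t)"
    proof -
      have "(uminus has_real_derivative -1) (at t)" by (auto intro!: derivative_eq_intros)
      from DERIV_chain2[OF g(1) this] show ?thesis by simp
    qed
    show "0 \<le> ?k' t" using g(3) by simp
  next
    show "continuous_on {- real n..real n} ?k'"
      by (intro continuous_intros continuous_on_compose2[OF g(2)]) auto
  qed (use that in auto)
  let ?F1 = "\<lambda>n r. F r * indicator {?k (- real n)..?k (real n)} r"
  let ?F2 = "\<lambda>n t. F (?k t) * ?k' t * indicator {- real n..real n} t"
  have L1: "(\<lambda>n. \<integral>\<^sup>+r. ?F1 n r \<partial>lborel) \<longlonglongrightarrow> (\<integral>\<^sup>+r. F r * indicator I r \<partial>lborel)"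
  proof (rule nn_integral_LIMSEQ)
    show "incseq ?F1"
    proof (intro incseq_SucI le_funI)
      fix n r
      have "g (real (Suc n)) \<le> g (real n)" "g (- real n) \<le> g (- real (Suc n))" by (intro anti; simp)+
      then have "r \<in> {?k (- real n)..?k (real n)} \<Longrightarrow> r \<in> {?k (- real (Suc n))..?k (real (Suc n))}"
        unfolding atLeastAtMost_iff minus_minus by (meson order_trans)
      then show "?F1 n r \<le> ?F1 (Suc n) r" by (cases "r \<in> {?k (- real n)..?k (real n)}") simp_all
    qed
    fix r
    show "(\<lambda>n. ?F1 n r) \<longlonglongrightarrow> F r * indicator I r"
    proof (cases "r \<in> I")
      case True
      then obtain m where m: "g (real m) \<le> r" "r \<le> g (- real m)" using I by blast
      have "\<forall>\<^sub>F n in sequentially. ?F1 n r = F r * indicator I r"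
        using eventually_ge_at_top[of m]
      proof eventually_elim
        case (elim n)
        have "g (real n) \<le> g (real m)" "g (- real m) \<le> g (- real n)" using elim by (intro anti; simp)+
        then show ?case using m True by auto
      qed
      then show ?thesis by (rule tendsto_eventually)
    next
      case False
      then have z: "?F1 n r = 0" for n using I[of r] by (auto simp: indicator_def)
      show ?thesis unfolding z using False by simp
    qed
  qed auto
  have L2: "(\<lambda>n. \<integral>\<^sup>+t. ?F2 n t \<partial>lborel) \<longlonglongrightarrow> (\<integral>\<^sup>+t. F (?k t) * ?k' t \<partial>lborel)"
  proof (rule nn_integral_LIMSEQ)
    show "incseq ?F2" by (intro incseq_SucI le_funI) (auto simp: indicator_def)
    fix t
    have "\<forall>\<^sub>F n in sequentially. ?F2 n t = F (?k t) * ?k' t"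
      using eventually_ge_at_top[of "nat \<lceil>\<bar>t\<bar>\<rceil>"]
      by eventually_elim (auto simp: nat_le_iff ceiling_le_iff abs_le_iff indicator_def)
    then show "(\<lambda>n. ?F2 n t) \<longlonglongrightarrow> F (?k t) * ?k' t" by (rule tendsto_eventually)
  qed auto
  have "\<forall>\<^sub>F n in sequentially. (\<integral>\<^sup>+r. ?F1 n r \<partial>lborel) = (\<integral>\<^sup>+t. ?F2 n t \<partial>lborel)"
    using eventually_gt_at_top[of 0] by eventually_elim (rule step)
  with L1 have "(\<lambda>n. \<integral>\<^sup>+t. ?F2 n t \<partial>lborel) \<longlonglongrightarrow> (\<integral>\<^sup>+r. F r * indicator I r \<partial>lborel)"
    by (rule Lim_transform_eventually)
  with L2 have "(\<integral>\<^sup>+r. F r * indicator I r \<partial>lborel) = (\<integral>\<^sup>+t. F (g (- t)) * ennreal (- g' (- t)) \<partial>lborel)"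
    using LIMSEQ_unique by blast
  also have "\<dots> = (\<integral>\<^sup>+t. F (g t) * ennreal (- g' t) \<partial>lborel)"
    using nn_integral_real_affine[of "\<lambda>t. F (g t) * ennreal (- g' t)" "-1" 0] by simp
  finally show ?thesis .
qed

lemma integral_polar:
  fixes f :: "'a::euclidean_space \<Rightarrow> real"
  assumes f: "integrable lborel f"
  shows "(LBINT x. f x) = (LBINT \<xi>. (LBINT r. indicator (ball 0 1) \<xi> * indicator {0<..} r *
     (real DIM('a) * r ^ (DIM('a) - 1)) * f (r *\<^sub>R sgn \<xi>)))"
proof -
  let ?n = "DIM('a)"
  let ?D = "\<lambda>(\<xi>::'a, r::real). indicator (ball 0 1) \<xi> * indicator {0<..} r * (real ?n * r ^ (?n - 1)) :: real"
  let ?T = "\<lambda>(\<xi>::'a, r::real). r *\<^sub>R sgn \<xi>"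
  let ?M = "density (lborel \<Otimes>\<^sub>M lborel) (\<lambda>x. ennreal (?D x))"
  have [measurable]: "f \<in> borel_measurable borel" using f by auto
  have [measurable]: "(\<lambda>x::'a \<times> real. indicator (ball 0 1) (fst x) :: real) \<in> jointly_measurable"
    by (rule measurable_compose[OF measurable_fst borel_measurable_indicator]) simp
  have [measurable]: "(\<lambda>x::'a \<times> real. indicator {0<..} (snd x) * (real ?n * snd x ^ (?n - 1)) :: real) \<in> jointly_measurable"
    by (rule measurable_compose[OF measurable_snd, of "\<lambda>r. indicator {0<..} r * (real ?n * r ^ (?n - 1))"]) simp
  have [measurable]: "?D \<in> jointly_measurable"
    unfolding case_prod_beta mult.assoc by measurable
  have [measurable]: "?T \<in> measurable (lborel \<Otimes>\<^sub>M lborel) borel" by measurable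
  have D0: "?D x \<ge> 0" for x by (auto simp: indicator_def split: prod.split)
  have Deq: "ennreal (?D (\<xi>, r)) = indicator (ball 0 1) \<xi> * indicator {0<..} r * ennreal (real ?n * r ^ (?n - 1))" for \<xi> r
    by (auto simp: indicator_def)
  \<comment> \<open>For indicators, \<open>nn_integral_polar\<close> says that the polar map carries
    the weighted product measure to Lebesgue measure. Signed integrals then follow by image measures
    and Fubini's theorem.\<close>
  have eq: "lborel = distr ?M borel ?T"
  proof (rule measure_eqI)
    fix A :: "'a set" assume "A \<in> sets lborel"
    then have [measurable]: "A \<in> sets borel" by simp
    have "emeasure (distr ?M borel ?T) A = (\<integral>\<^sup>+y. indicator A y \<partial>distr ?M borel ?T)" by simp
    also have "\<dots> = (\<integral>\<^sup>+x. indicator A (?T x) \<partial>?M)" by (rule nn_integral_distr) auto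
    also have "\<dots> = (\<integral>\<^sup>+x. ennreal (?D x) * indicator A (?T x) \<partial>(lborel \<Otimes>\<^sub>M lborel))"
      by (rule nn_integral_density) auto
    also have "\<dots> = (\<integral>\<^sup>+\<xi>. (\<integral>\<^sup>+r. ennreal (?D (\<xi>, r)) * indicator A (?T (\<xi>, r)) \<partial>lborel) \<partial>lborel)"
      by (rule lborel.nn_integral_fst[symmetric]) measurable
    also have "\<dots> = (\<integral>\<^sup>+y. indicator A y \<partial>lborel)"
      unfolding Deq by (subst nn_integral_polar[of "indicator A"]) (auto)
    finally show "emeasure lborel A = emeasure (distr ?M borel ?T) A" by simp
  qed simp
  have i1: "integrable ?M (\<lambda>x. f (?T x))"
  proof -
    have "integrable (distr ?M borel ?T) f" using f unfolding eq[symmetric] .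
    then show ?thesis by (subst (asm) integrable_distr_eq) auto
  qed
  have i2: "integrable (lborel \<Otimes>\<^sub>M lborel) (\<lambda>x. ?D x * f (?T x))"
    using i1 D0 by (subst (asm) integrable_density) auto
  have "(LBINT x. f x) = (\<integral>x. f x \<partial>distr ?M borel ?T)" unfolding eq[symmetric] ..
  also have "\<dots> = (\<integral>x. f (?T x) \<partial>?M)" by (rule integral_distr) auto
  also have "\<dots> = (\<integral>x. ?D x * f (?T x) \<partial>(lborel \<Otimes>\<^sub>M lborel))"
    by (subst integral_density) (use D0 in auto)
  also have "\<dots> = (LBINT \<xi>. (LBINT r. ?D (\<xi>, r) * f (?T (\<xi>, r))))"
    by (rule lborel_pair.integral_fst'[symmetric, OF i2])
  finally show ?thesis by simp
qed

subsection \<open>The norm on the dense set\<close>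

lemma grad_eqI:
  assumes "(f has_derivative (\<lambda>h. h \<bullet> D)) (at x)"
  shows "grad f x = D"
  unfolding grad_def
proof (rule the_equality)
  show "GDERIV f x :> D" using assms by (simp add: gderiv_def)
  fix E assume "GDERIV f x :> E"
  then have "(\<lambda>h. h \<bullet> E) = (\<lambda>h. h \<bullet> D)"
    using assms has_derivative_unique unfolding gderiv_def by blast
  then show "E = D" by (metis vector_eq_ldot)
qed

lemma grad_has_derivative:
  fixes f :: "'a::euclidean_space \<Rightarrow> real"
  assumes "f differentiable at x"
  shows "(f has_derivative (\<lambda>h. h \<bullet> grad f x)) (at x)"
    and "grad f x = (\<Sum>b\<in>Basis. frechet_derivative f (at x) b *\<^sub>R b)"
    and "b \<in> Basis \<Longrightarrow> grad f x \<bullet> b = frechet_derivative f (at x) b"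
proof -
  let ?D = "frechet_derivative f (at x)"
  let ?g = "\<Sum>b\<in>Basis. ?D b *\<^sub>R b"
  have D: "(f has_derivative ?D) (at x)" by (rule frechet_derivative_worksI[OF assms])
  have l: "linear ?D" by (rule has_derivative_linear[OF D])
  have "?D h = h \<bullet> ?g" for h
  proof -
    have "?D h = ?D (\<Sum>b\<in>Basis. (h \<bullet> b) *\<^sub>R b)" by (simp add: euclidean_representation)
    also have "\<dots> = (\<Sum>b\<in>Basis. (h \<bullet> b) * ?D b)" by (simp add: linear_sum[OF l] linear_cmul[OF l])
    also have "\<dots> = h \<bullet> ?g" by (simp add: inner_sum_right mult.commute)
    finally show ?thesis .
  qed
  then have "?D = (\<lambda>h. h \<bullet> ?g)" by (rule ext)
  with D have d: "(f has_derivative (\<lambda>h. h \<bullet> ?g)) (at x)" by simp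
  show g: "grad f x = ?g" by (rule grad_eqI[OF d])
  show "(f has_derivative (\<lambda>h. h \<bullet> grad f x)) (at x)" unfolding g by (rule d)
  show "b \<in> Basis \<Longrightarrow> grad f x \<bullet> b = frechet_derivative f (at x) b"
    unfolding g by (simp add: inner_sum_left_Basis)
qed

lemma smooth_differentiable: "smooth_on S f \<Longrightarrow> x \<in> S \<Longrightarrow> f differentiable at x"
  unfolding smooth_on_def using Ck_on.simps(2)[of 0] by blast

lemma smooth_partial:
  assumes "smooth_on S f" "b \<in> Basis"
  shows "smooth_on S (\<lambda>x. frechet_derivative f (at x) b)"
  unfolding smooth_on_def
proof
  fix k
  have "Ck_on (Suc k) S f" using assms(1) unfolding smooth_on_def by blast
  then show "Ck_on k S (\<lambda>x. frechet_derivative f (at x) b)" using assms(2) by simp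
qed

lemma smooth_continuous: "smooth_on S f \<Longrightarrow> continuous_on S f"
  unfolding smooth_on_def using Ck_on.simps(1) by blast

lemma test_smooth: "f \<in> test_functions S \<Longrightarrow> smooth_on UNIV f"
  by (simp add: test_functions_iff_smooth)

lemma test_continuous: "f \<in> test_functions S \<Longrightarrow> continuous_on T f"
  using smooth_continuous[OF test_smooth] continuous_on_subset by blast

lemma test_has_derivative:
  assumes "f \<in> test_functions S"
  shows "(f has_derivative (\<lambda>h. h \<bullet> grad f x)) (at x)"
  by (rule grad_has_derivative(1)[OF smooth_differentiable[OF test_smooth[OF assms]]]) simp

lemma continuous_on_grad:
  assumes "f \<in> test_functions S"
  shows "continuous_on T (grad f)"
proof -
  have "grad f = (\<lambda>x. \<Sum>b\<in>Basis. frechet_derivative f (at x) b *\<^sub>R b)"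
    by (rule ext, rule grad_has_derivative(2)[OF smooth_differentiable[OF test_smooth[OF assms]]]) simp
  moreover have "continuous_on T (\<lambda>x. \<Sum>b\<in>Basis. frechet_derivative f (at x) b *\<^sub>R b)"
    using continuous_on_subset[OF smooth_continuous[OF smooth_partial[OF test_smooth[OF assms]]]]
    by (intro continuous_intros) auto
  ultimately show ?thesis by simp
qed

lemma test_support:
  assumes "f \<in> test_functions S"
  obtains K where "compact K" "K \<subseteq> S" "\<And>x. x \<notin> K \<Longrightarrow> f x = 0" "\<And>x. x \<notin> K \<Longrightarrow> grad f x = 0"
proof
  let ?K = "closure {x. f x \<noteq> 0}"
  show "compact ?K" "?K \<subseteq> S" using assms by (auto simp: test_functions_iff_smooth)
  have z: "f x = 0" if "x \<notin> ?K" for x using that closure_subset[of "{x. f x \<noteq> 0}"] by blast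
  show "f x = 0" if "x \<notin> ?K" for x by (rule z[OF that])
  fix x assume x: "x \<notin> ?K"
  have op: "open (- ?K)" by (rule open_Compl[OF closed_closure])
  have "(f has_derivative (\<lambda>h. 0)) (at x)"
  proof (rule has_derivative_transform_within_open[OF has_derivative_const[where c=0] op])
    show "x \<in> - ?K" using x by simp
    fix y assume "y \<in> - ?K"
    then have "y \<notin> ?K" by simp
    from z[OF this] show "0 = f y" by (rule sym)
  qed
  then show "grad f x = 0" by (intro grad_eqI) simp
qed

lemma test_bounded:
  assumes "f \<in> test_functions S"
  obtains B where "B \<ge> 0" "\<And>x. \<bar>f x\<bar> \<le> B" "\<And>x. norm (grad f x) \<le> B"
proof -
  obtain K where K: "compact K" "\<And>x. x \<notin> K \<Longrightarrow> f x = 0" "\<And>x. x \<notin> K \<Longrightarrow> grad f x = 0"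
    using test_support[OF assms] by metis
  have "bounded (f ` K)" "bounded (grad f ` K)"
    using K(1) test_continuous[OF assms, of K] continuous_on_grad[OF assms, of K]
    by (simp_all add: compact_continuous_image compact_imp_bounded)
  then obtain B1 B2 where B: "\<And>x. x \<in> K \<Longrightarrow> \<bar>f x\<bar> \<le> B1" "\<And>x. x \<in> K \<Longrightarrow> norm (grad f x) \<le> B2"
    unfolding bounded_iff by (metis imageI real_norm_def)
  show ?thesis
  proof (rule that[of "\<bar>B1\<bar> + \<bar>B2\<bar>"])
    fix x
    show "\<bar>f x\<bar> \<le> \<bar>B1\<bar> + \<bar>B2\<bar>" by (cases "x \<in> K") (use B(1)[of x] K(2)[of x] in auto)
    show "norm (grad f x) \<le> \<bar>B1\<bar> + \<bar>B2\<bar>" by (cases "x \<in> K") (use B(2)[of x] K(3)[of x] in auto)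
  qed simp
qed

lemma grad_diff:
  assumes "f \<in> test_functions S" "g \<in> test_functions S"
  shows "grad (\<lambda>x. f x - g x) x = grad f x - grad g x"
  by (rule grad_eqI)
    (use has_derivative_diff[OF test_has_derivative[OF assms(1)] test_has_derivative[OF assms(2)]]
      in \<open>simp add: inner_diff_right\<close>)

section \<open>The weighted Dirichlet form\<close>

definition wgt :: "'a::euclidean_space \<Rightarrow> real" where
  "wgt x = norm x powr (2 - real DIM('a))"

text \<open>The power of \<open>norm x\<close> in front is the ground state of the critical Hardy
  operator and its square is \<open>wgt\<close>. In the unknown \<open>f\<close> the Hardy term
  disappears from the quadratic form, up to a boundary term at the origin.\<close>

definition to_u :: "('a::euclidean_space \<Rightarrow> real) \<Rightarrow> 'a \<Rightarrow> real" where
  "to_u f x = norm x powr (- ((real DIM('a) - 2) / 2)) * f x"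

definition Qf :: "('a::euclidean_space \<Rightarrow> real) \<Rightarrow> real" where
  "Qf f = (LBINT x. wgt x * (norm (grad f x))\<^sup>2)"

text \<open>The origin is removed so that \<open>sgn \<xi>\<close> is a unit vector for every point
  used as a direction.\<close>

abbreviation pball :: "'a::euclidean_space set" where "pball \<equiv> ball 0 1 - {0}"

lemma ball_borel [measurable]: "ball (x::'a::euclidean_space) r \<in> sets borel" by (simp add: borel_open)
lemma pball_borel [measurable]: "(pball::'a::euclidean_space set) \<in> sets borel" by (simp add: borel_open)

lemma nn_integral_polar':
  fixes f :: "'a::euclidean_space \<Rightarrow> ennreal"
  assumes f: "f \<in> borel_measurable borel"
  shows "(\<integral>\<^sup>+x. f x \<partial>lborel) = (\<integral>\<^sup>+\<xi>. indicator pball \<xi> * (\<integral>\<^sup>+r. indicator {0<..} r *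
     ennreal (real DIM('a) * r ^ (DIM('a) - 1)) * f (r *\<^sub>R sgn \<xi>) \<partial>lborel) \<partial>lborel)"
  unfolding nn_integral_polar[OF f]
proof (rule nn_integral_cong_AE, use AE_lborel_singleton[of "0::'a"] in eventually_elim)
  fix \<xi> :: 'a assume "\<xi> \<noteq> 0"
  then show "(\<integral>\<^sup>+ r. indicator (ball 0 1) \<xi> * indicator {0<..} r * ennreal (real DIM('a) * r ^ (DIM('a) - 1)) * f (r *\<^sub>R sgn \<xi>) \<partial>lborel) =
    indicator pball \<xi> * (\<integral>\<^sup>+ r. indicator {0<..} r * ennreal (real DIM('a) * r ^ (DIM('a) - 1)) * f (r *\<^sub>R sgn \<xi>) \<partial>lborel)"
    by (cases "\<xi> \<in> ball 0 1") (simp_all add: mult.assoc)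
qed

lemma integral_polar':
  fixes f :: "'a::euclidean_space \<Rightarrow> real"
  assumes f: "integrable lborel f"
  shows "(LBINT x. f x) = (LBINT \<xi>. indicator pball \<xi> * (LBINT r. indicator {0<..} r *
     ((real DIM('a) * r ^ (DIM('a) - 1)) * f (r *\<^sub>R sgn \<xi>))))"
proof -
  let ?g = "\<lambda>\<xi>::'a. indicator pball \<xi> * (LBINT r. indicator {0<..} r * ((real DIM('a) * r ^ (DIM('a) - 1)) * f (r *\<^sub>R sgn \<xi>)))"
  let ?h = "\<lambda>\<xi>::'a. (LBINT r. indicator (ball 0 1) \<xi> * indicator {0<..} r * (real DIM('a) * r ^ (DIM('a) - 1)) * f (r *\<^sub>R sgn \<xi>))"
  have [measurable]: "f \<in> borel_measurable borel" using f by auto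
  have [measurable]: "(\<lambda>x::'a \<times> real. f (snd x *\<^sub>R sgn (fst x))) \<in> jointly_measurable" by measurable
  have [measurable]: "(\<lambda>x::'a \<times> real. indicator (ball 0 1) (fst x) :: real) \<in> jointly_measurable"
    by (rule measurable_compose[OF measurable_fst borel_measurable_indicator]) simp
  have [measurable]: "(\<lambda>x::'a \<times> real. indicator {0<..} (snd x) * (real DIM('a) * snd x ^ (DIM('a) - 1)) :: real) \<in> jointly_measurable"
    by (rule measurable_compose[OF measurable_snd, of "\<lambda>r. indicator {0<..} r * (real DIM('a) * r ^ (DIM('a) - 1))"]) simp
  have mh: "?h \<in> borel_measurable lborel"
  proof (rule lborel.borel_measurable_lebesgue_integral)
    have "(\<lambda>x::'a \<times> real. (indicator (ball 0 1) (fst x) * (indicator {0<..} (snd x) * (real DIM('a) * snd x ^ (DIM('a) - 1)))) * f (snd x *\<^sub>R sgn (fst x)))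
        \<in> jointly_measurable" by measurable
    then show "(\<lambda>(\<xi>::'a, r). indicator (ball 0 1) \<xi> * indicator {0<..} r * (real DIM('a) * r ^ (DIM('a) - 1)) * f (r *\<^sub>R sgn \<xi>))
        \<in> jointly_measurable"
      by (simp add: case_prod_beta mult.assoc)
  qed
  have "AE \<xi> in lborel. ?h \<xi> = ?g \<xi>"
  proof (rule AE_mp[OF AE_lborel_singleton[of "0::'a"]], rule AE_I2, rule impI)
    fix \<xi> :: 'a assume "\<xi> \<noteq> 0"
    then show "?h \<xi> = ?g \<xi>" by (cases "\<xi> \<in> ball 0 1") (simp_all add: mult.assoc)
  qed
  moreover have "?g \<in> borel_measurable lborel"
  proof -
    have "?g = (\<lambda>\<xi>. indicator pball \<xi> * ?h \<xi>)" by (auto simp: fun_eq_iff indicator_def mult.assoc)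
    then show ?thesis using mh by simp
  qed
  ultimately show ?thesis unfolding integral_polar[OF f] using mh by (intro integral_cong_AE)
qed

definition omega :: "'a::euclidean_space itself \<Rightarrow> real" where
  "omega T = measure lborel (ball (0::'a) 1)"

lemma omega_pos: "omega TYPE('a::euclidean_space) > 0"
  unfolding omega_def by (simp add: content_ball_pos)

lemma emeasure_pball: "emeasure lborel (pball::'a::euclidean_space set) = ennreal (omega TYPE('a))"
proof -
  have "emeasure lborel (pball::'a set) = emeasure lborel (ball (0::'a) 1) - emeasure lborel {0::'a}"
    by (rule emeasure_Diff) auto
  also have "\<dots> = ennreal (omega TYPE('a))"
    unfolding omega_def using emeasure_lborel_ball_finite[of "0::'a" 1] by (simp add: emeasure_eq_ennreal_measure less_top)
  finally show ?thesis .
qed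

lemma measure_pball: "measure lborel (pball::'a::euclidean_space set) = omega TYPE('a)"
  unfolding measure_def emeasure_pball using omega_pos[where 'a='a] by (simp add: less_imp_le)

lemma norm_pball: "\<xi> \<in> pball \<Longrightarrow> r > 0 \<Longrightarrow> norm (r *\<^sub>R sgn \<xi>) = r"
  by (simp add: norm_sgn)

lemma wgt_measurable [measurable]: "(wgt :: 'a::euclidean_space \<Rightarrow> real) \<in> borel_measurable borel"
  unfolding wgt_def[abs_def] by measurable

lemma wgt_nonneg [simp]: "wgt x \<ge> 0" by (simp add: wgt_def)

text \<open>In polar coordinates the weight leaves just one power of the radius, hence a bound of
  order \<open>\<rho>\<^sup>2\<close>. Its smallness makes the origin negligible in the proof of
  closability.\<close>

lemma nn_integral_wgt:
  assumes "\<rho> > 0"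
  shows "(\<integral>\<^sup>+x. ennreal (indicator (ball (0::'a::euclidean_space) \<rho>) x * wgt x) \<partial>lborel) \<le> ennreal (real DIM('a) * omega TYPE('a) * \<rho>\<^sup>2)"
proof -
  let ?n = "DIM('a)"
  have "(\<integral>\<^sup>+x. ennreal (indicator (ball (0::'a) \<rho>) x * wgt x) \<partial>lborel) =
     (\<integral>\<^sup>+\<xi>. indicator (pball::'a set) \<xi> * (\<integral>\<^sup>+r. indicator {0<..} r * ennreal (real ?n * r ^ (?n - 1)) *
       ennreal (indicator (ball (0::'a) \<rho>) (r *\<^sub>R sgn \<xi>) * wgt (r *\<^sub>R sgn \<xi>)) \<partial>lborel) \<partial>lborel)"
    by (rule nn_integral_polar') measurable
  also have "\<dots> \<le> (\<integral>\<^sup>+\<xi>. indicator (pball::'a set) \<xi> * ennreal (real ?n * \<rho>\<^sup>2) \<partial>lborel)"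
  proof (rule nn_integral_mono)
    fix \<xi> :: 'a
    show "indicator pball \<xi> * (\<integral>\<^sup>+r. indicator {0<..} r * ennreal (real ?n * r ^ (?n - 1)) *
       ennreal (indicator (ball (0::'a) \<rho>) (r *\<^sub>R sgn \<xi>) * wgt (r *\<^sub>R sgn \<xi>)) \<partial>lborel) \<le> indicator pball \<xi> * ennreal (real ?n * \<rho>\<^sup>2)"
    proof (cases "\<xi> \<in> pball")
      case True
      have "(\<integral>\<^sup>+r. indicator {0<..} r * ennreal (real ?n * r ^ (?n - 1)) *
         ennreal (indicator (ball (0::'a) \<rho>) (r *\<^sub>R sgn \<xi>) * wgt (r *\<^sub>R sgn \<xi>)) \<partial>lborel) \<le> (\<integral>\<^sup>+r. ennreal (real ?n * \<rho>) * indicator {0..\<rho>} r \<partial>lborel)"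
      proof (rule nn_integral_mono)
        fix r :: real
        show "indicator {0<..} r * ennreal (real ?n * r ^ (?n - 1)) *
         ennreal (indicator (ball (0::'a) \<rho>) (r *\<^sub>R sgn \<xi>) * wgt (r *\<^sub>R sgn \<xi>)) \<le> ennreal (real ?n * \<rho>) * indicator {0..\<rho>} r"
        proof (cases "0 < r \<and> r < \<rho>")
          case rr: True
          have "r ^ (?n - 1) = r powr real (?n - 1)" using rr powr_realpow[of r "?n - 1"] by simp
          moreover have "real (?n - 1) + (2 - real ?n) = 1" by (simp add: of_nat_diff)
          ultimately have "r ^ (?n - 1) * r powr (2 - real ?n) = r powr 1" by (metis powr_add)
          also have "r powr 1 = r" using rr by simp
          finally have e: "r ^ (?n - 1) * r powr (2 - real ?n) = r" .
          have "real ?n * r ^ (?n - 1) * r powr (2 - real ?n) = real ?n * r" unfolding mult.assoc e ..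
          then have "real ?n * r ^ (?n - 1) * r powr (2 - real ?n) \<le> real ?n * \<rho>" using rr by simp
          then show ?thesis using rr norm_pball[OF True, of r]
            by (simp add: wgt_def ennreal_mult'[symmetric] ennreal_leI)
        next
          case False
          then have "r \<le> 0 \<or> (r > 0 \<and> r *\<^sub>R sgn \<xi> \<notin> ball 0 \<rho>)" using norm_pball[OF True, of r] by auto
          then show ?thesis by auto
        qed
      qed
      also have "\<dots> = ennreal (real ?n * \<rho>\<^sup>2)" using assms
        by (simp add: nn_integral_cmult ennreal_mult'[symmetric] power2_eq_square mult.assoc)
      finally show ?thesis by (intro mult_left_mono) auto
    qed simp
  qed
  also have "\<dots> = ennreal (real ?n * omega TYPE('a) * \<rho>\<^sup>2)"
    using omega_pos[where 'a='a] by (simp add: nn_integral_multc emeasure_pball ennreal_mult'[symmetric] mult_ac)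
  finally show ?thesis .
qed

lemma integrable_wgt_ball: "integrable lborel (\<lambda>x::'a::euclidean_space. indicator (ball 0 \<rho>) x * wgt x)"
proof (cases "\<rho> > 0")
  case True
  show ?thesis
    by (rule integrableI_nonneg) (use nn_integral_wgt[OF True, where 'a='a] in \<open>auto intro: le_less_trans\<close>)
qed (simp add: ball_empty)

lemma integral_wgt_ball_le:
  assumes "\<rho> > 0"
  shows "(LBINT x. indicator (ball (0::'a::euclidean_space) \<rho>) x * wgt x) \<le> real DIM('a) * omega TYPE('a) * \<rho>\<^sup>2"
proof -
  have "ennreal (LBINT x. indicator (ball (0::'a) \<rho>) x * wgt x) = (\<integral>\<^sup>+x. ennreal (indicator (ball (0::'a) \<rho>) x * wgt x) \<partial>lborel)"
    by (rule nn_integral_eq_integral[OF integrable_wgt_ball, symmetric]) auto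
  also have "\<dots> \<le> ennreal (real DIM('a) * omega TYPE('a) * \<rho>\<^sup>2)" by (rule nn_integral_wgt[OF assms])
  finally show ?thesis using omega_pos[where 'a='a] by (subst (asm) ennreal_le_iff) (auto simp: less_imp_le)
qed

lemma grad_measurable: "f \<in> test_functions S \<Longrightarrow> grad f \<in> borel_measurable borel"
  by (rule borel_measurable_continuous_onI[OF continuous_on_grad])

lemma test_measurable: "f \<in> test_functions S \<Longrightarrow> f \<in> borel_measurable borel"
  by (rule borel_measurable_continuous_onI[OF test_continuous])

lemma integrable_wgt_bounded:
  fixes g :: "'a::euclidean_space \<Rightarrow> real"
  assumes [measurable]: "g \<in> borel_measurable borel" and g: "\<And>x. \<bar>g x\<bar> \<le> B * indicator (ball 0 \<rho>) x"
  shows "integrable lborel (\<lambda>x. wgt x * g x)"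
proof (rule Bochner_Integration.integrable_bound[OF integrable_mult_right[OF integrable_wgt_ball[of \<rho>], of B]])
  show "AE x in lborel. norm (wgt x * g x) \<le> norm (B * (indicator (ball 0 \<rho>) x * wgt x))"
  proof (rule AE_I2)
    fix x :: 'a
    have "wgt x * \<bar>g x\<bar> \<le> wgt x * (B * indicator (ball 0 \<rho>) x)" by (intro mult_left_mono g) simp
    also have "\<dots> \<le> \<bar>B * (indicator (ball 0 \<rho>) x * wgt x)\<bar>" by (simp add: mult_ac)
    finally show "norm (wgt x * g x) \<le> norm (B * (indicator (ball 0 \<rho>) x * wgt x))" by (simp add: abs_mult)
  qed
qed simp

lemma test_product_bound:
  fixes f g :: "'a::euclidean_space \<Rightarrow> real"
  assumes "f \<in> test_functions (ball 0 R)" "g \<in> test_functions (ball 0 R)"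
  obtains B where "B \<ge> 0" "\<And>x. \<bar>grad f x \<bullet> grad g x\<bar> \<le> B * indicator (ball 0 R) x" "\<And>x. \<bar>f x * g x\<bar> \<le> B * indicator (ball 0 R) x"
    "\<And>x. norm (grad f x) * \<bar>g x\<bar> \<le> B * indicator (ball 0 R) x"
proof -
  obtain B1 where B1: "B1 \<ge> 0" "\<And>x. \<bar>f x\<bar> \<le> B1" "\<And>x. norm (grad f x) \<le> B1" using test_bounded[OF assms(1)] by metis
  obtain B2 where B2: "B2 \<ge> 0" "\<And>x. \<bar>g x\<bar> \<le> B2" "\<And>x. norm (grad g x) \<le> B2" using test_bounded[OF assms(2)] by metis
  obtain K where K: "K \<subseteq> ball 0 R" "\<And>x. x \<notin> K \<Longrightarrow> f x = 0" "\<And>x. x \<notin> K \<Longrightarrow> grad f x = 0"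
    using test_support[OF assms(1)] by metis
  show ?thesis
  proof (rule that[of "B1 * B2"])
    show "B1 * B2 \<ge> 0" using B1 B2 by simp
    fix x
    have "\<bar>grad f x \<bullet> grad g x\<bar> \<le> norm (grad f x) * norm (grad g x)" by (rule Cauchy_Schwarz_ineq2)
    also have "\<dots> \<le> B1 * B2" by (intro mult_mono B1 B2) auto
    finally have 1: "\<bar>grad f x \<bullet> grad g x\<bar> \<le> B1 * B2" .
    have 2: "\<bar>f x * g x\<bar> \<le> B1 * B2" unfolding abs_mult by (intro mult_mono B1 B2) auto
    have 3: "norm (grad f x) * \<bar>g x\<bar> \<le> B1 * B2" by (intro mult_mono B1 B2) auto
    have K0: "f x = 0 \<and> grad f x = 0" if "x \<notin> ball 0 R" using K that by blast
    show "\<bar>grad f x \<bullet> grad g x\<bar> \<le> B1 * B2 * indicator (ball 0 R) x"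
      using 1 K0 by (cases "x \<in> ball 0 R") auto
    show "\<bar>f x * g x\<bar> \<le> B1 * B2 * indicator (ball 0 R) x"
      using 2 K0 by (cases "x \<in> ball 0 R") auto
    show "norm (grad f x) * \<bar>g x\<bar> \<le> B1 * B2 * indicator (ball 0 R) x"
      using 3 K0 by (cases "x \<in> ball 0 R") auto
  qed
qed

lemma integrable_Q:
  fixes f g :: "'a::euclidean_space \<Rightarrow> real"
  assumes "f \<in> test_functions (ball 0 R)" "g \<in> test_functions (ball 0 R)"
  shows "integrable lborel (\<lambda>x. wgt x * (grad f x \<bullet> grad g x))"
    and "integrable lborel (\<lambda>x. wgt x * (f x * g x))"
    and "integrable lborel (\<lambda>x. wgt x * (norm (grad f x))\<^sup>2)"
proof -
  note [measurable] = test_measurable[OF assms(1)] test_measurable[OF assms(2)] grad_measurable[OF assms(1)] grad_measurable[OF assms(2)]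
  obtain B where B: "\<And>x. \<bar>grad f x \<bullet> grad g x\<bar> \<le> B * indicator (ball 0 R) x" "\<And>x. \<bar>f x * g x\<bar> \<le> B * indicator (ball 0 R) x"
    using test_product_bound[OF assms] by metis
  show "integrable lborel (\<lambda>x. wgt x * (grad f x \<bullet> grad g x))" by (rule integrable_wgt_bounded[OF _ B(1)]) measurable
  show "integrable lborel (\<lambda>x. wgt x * (f x * g x))" by (rule integrable_wgt_bounded[OF _ B(2)]) measurable
  obtain B' where B': "\<And>x. \<bar>grad f x \<bullet> grad f x\<bar> \<le> B' * indicator (ball 0 R) x"
    using test_product_bound[OF assms(1,1)] by metis
  show "integrable lborel (\<lambda>x. wgt x * (norm (grad f x))\<^sup>2)"
    unfolding power2_norm_eq_inner by (rule integrable_wgt_bounded[OF _ B']) measurable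
qed

lemma integral_lebesgue_on_eq:
  fixes f g :: "'a::euclidean_space \<Rightarrow> real"
  assumes S: "S \<in> sets borel" and g: "g \<in> borel_measurable borel" and eq: "\<And>x. x \<in> S \<Longrightarrow> f x = g x"
  shows "(LINT x|lebesgue_on S. f x) = (LBINT x. indicator S x * g x)"
proof -
  have "(LINT x|lebesgue_on S. f x) = (LINT x|lebesgue_on S. g x)"
    by (rule Bochner_Integration.integral_cong) (auto simp: eq)
  also have "\<dots> = (LINT x|lebesgue. indicator S x *\<^sub>R g x)"
    by (rule integral_restrict_space) (use S in auto)
  also have "\<dots> = (LBINT x. indicator S x *\<^sub>R g x)"
    by (rule integral_completion) (use S g in measurable)
  finally show ?thesis by simp
qed

lemma nn_integral_lebesgue_on_eq:
  fixes f :: "'a::euclidean_space \<Rightarrow> ennreal"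
  assumes S: "S \<in> sets borel"
  shows "(\<integral>\<^sup>+x. f x \<partial>lebesgue_on S) = (\<integral>\<^sup>+x. f x * indicator S x \<partial>lborel)"
proof -
  have "(\<integral>\<^sup>+x. f x \<partial>lebesgue_on S) = (\<integral>\<^sup>+x. f x * indicator S x \<partial>lebesgue)"
    by (rule nn_integral_restrict_space) (use S in auto)
  then show ?thesis by (simp add: nn_integral_completion)
qed

text \<open>Off the origin, \<open>|\<nabla>u|\<^sup>2 - ((N-2)/2)\<^sup>2 u\<^sup>2/|x|\<^sup>2\<close> is the density of \<open>Qf\<close> minus a
  divergence.\<close>

lemma grad_to_u:
  fixes f :: "'a::euclidean_space \<Rightarrow> real"
  assumes f: "f \<in> test_functions S" and x: "x \<noteq> 0"
  defines "a \<equiv> (real DIM('a) - 2) / 2"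
  shows "(norm (grad (to_u f) x))\<^sup>2 - a\<^sup>2 * ((to_u f x)\<^sup>2 / (norm x)\<^sup>2) =
    wgt x * (norm (grad f x))\<^sup>2 - 2 * a * norm x powr (- real DIM('a)) * f x * (x \<bullet> grad f x)"
    and "grad (to_u f) x = norm x powr (- a) *\<^sub>R grad f x - (a * norm x powr (- a - 2) * f x) *\<^sub>R x"
proof -
  let ?N = "real DIM('a)"
  have nx: "norm x > 0" using x by simp
  have dn: "(norm has_derivative (\<lambda>h. h \<bullet> (x /\<^sub>R norm x))) (at x)"
    using has_derivative_norm[OF x] by (simp add: sgn_div_norm)
  have dp: "((\<lambda>x::'a. norm x powr (- a)) has_derivative (\<lambda>h. (- a) * norm x powr (- a - 1) * (h \<bullet> (x /\<^sub>R norm x)))) (at x)"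
  proof (rule has_derivative_compose[OF dn])
    show "((\<lambda>t. t powr (- a)) has_derivative (*) ((- a) * norm x powr (- a - 1))) (at (norm x))"
      using has_real_derivative_powr[OF nx, of "- a"] unfolding has_field_derivative_def .
  qed
  have pp: "norm x powr (- a - 1) / norm x = norm x powr (- a - 2)"
  proof -
    have "norm x powr (- a - 1) = norm x powr (- a - 2) * norm x"
      using nx by (metis powr_mult_base abs_norm_cancel add.commute diff_add_cancel mult.commute norm_ge_zero one_add_one add_diff_eq diff_diff_eq)
    then show ?thesis using nx by simp
  qed
  have "(to_u f has_derivative (\<lambda>h. norm x powr (- a) * (h \<bullet> grad f x) +
     (- a) * norm x powr (- a - 1) * (h \<bullet> (x /\<^sub>R norm x)) * f x)) (at x)"
    unfolding to_u_def[abs_def] a_def[symmetric] by (rule has_derivative_mult[OF dp test_has_derivative[OF f]])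
  moreover have "(\<lambda>h. norm x powr (- a) * (h \<bullet> grad f x) + (- a) * norm x powr (- a - 1) * (h \<bullet> (x /\<^sub>R norm x)) * f x) =
    (\<lambda>h. h \<bullet> (norm x powr (- a) *\<^sub>R grad f x - (a * norm x powr (- a - 2) * f x) *\<^sub>R x))"
    unfolding pp[symmetric] by (simp add: fun_eq_iff inner_diff_right divide_inverse)
  ultimately have d: "(to_u f has_derivative (\<lambda>h. h \<bullet> (norm x powr (- a) *\<^sub>R grad f x - (a * norm x powr (- a - 2) * f x) *\<^sub>R x))) (at x)"
    by simp
  show g: "grad (to_u f) x = norm x powr (- a) *\<^sub>R grad f x - (a * norm x powr (- a - 2) * f x) *\<^sub>R x"
    by (rule grad_eqI[OF d])
  let ?p = "norm x powr (- a)" and ?c = "a * norm x powr (- a - 2) * f x"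
  have w: "?p * ?p = wgt x"
  proof -
    have "- a + - a = 2 - ?N" by (simp add: a_def field_simps)
    then show ?thesis unfolding wgt_def powr_add[symmetric] by (simp only:)
  qed
  have pc: "?p * norm x powr (- a - 2) = norm x powr (- ?N)"
  proof -
    have "- a + (- a - 2) = - ?N" by (simp add: a_def field_simps)
    then show ?thesis unfolding powr_add[symmetric] by (simp only:)
  qed
  have p2: "norm x powr (- a - 2) = ?p / (norm x)\<^sup>2"
    using nx by (simp add: powr_diff)
  have "(norm (grad (to_u f) x))\<^sup>2 = ?p * ?p * (norm (grad f x))\<^sup>2 - 2 * (?p * ?c) * (x \<bullet> grad f x) + ?c * ?c * (norm x)\<^sup>2"
    unfolding g power2_norm_eq_inner
    by (simp add: inner_diff_left inner_diff_right inner_commute[of x "grad f x"] algebra_simps)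
  moreover have "?c * ?c * (norm x)\<^sup>2 = a\<^sup>2 * ((to_u f x)\<^sup>2 / (norm x)\<^sup>2)"
    unfolding p2 to_u_def a_def[symmetric] using nx by (simp add: power2_eq_square)
  moreover have "2 * (?p * ?c) * (x \<bullet> grad f x) = 2 * a * norm x powr (- ?N) * f x * (x \<bullet> grad f x)"
    unfolding pc[symmetric] by simp
  ultimately show "(norm (grad (to_u f) x))\<^sup>2 - a\<^sup>2 * ((to_u f x)\<^sup>2 / (norm x)\<^sup>2) =
    wgt x * (norm (grad f x))\<^sup>2 - 2 * a * norm x powr (- real DIM('a)) * f x * (x \<bullet> grad f x)"
    unfolding w by simp
qed

lemma integrable_indicator_compact:
  fixes f :: "'a::euclidean_space \<Rightarrow> real"
  assumes "compact K" "continuous_on K f" "S \<subseteq> K" "S \<in> sets borel"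
  shows "integrable lborel (\<lambda>x. indicator S x * f x)"
proof -
  have "set_integrable lborel K f" using borel_integrable_compact[OF assms(1,2)] unfolding set_integrable_def by simp
  then have "set_integrable lborel S f" by (rule set_integrable_subset) (use assms in auto)
  then show ?thesis unfolding set_integrable_def by simp
qed

lemma integral_FTC_indicator:
  fixes F f :: "real \<Rightarrow> real"
  assumes "a \<le> b" "\<And>x. (F has_real_derivative f x) (at x)" "continuous_on UNIV f"
  shows "(LBINT x. indicator {a..b} x * f x) = F b - F a"
proof -
  have "set_integrable lborel {a..b} f"
    using borel_integrable_compact[of "{a..b}" f] continuous_on_subset[OF assms(3)] unfolding set_integrable_def by simp
  from set_borel_integral_eq_integral(2)[OF this]
  have "(LBINT x. indicator {a..b} x * f x) = integral {a..b} f"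
    unfolding set_lebesgue_integral_def by simp
  also have "\<dots> = F b - F a"
    by (intro integral_unique fundamental_theorem_of_calculus assms(1))
      (use assms(2) in \<open>auto simp: has_real_derivative_iff_has_vector_derivative intro: has_vector_derivative_at_within\<close>)
  finally show ?thesis .
qed

lemma radial_derivative:
  assumes "f \<in> test_functions S"
  shows "((\<lambda>r. f (r *\<^sub>R e)) has_real_derivative e \<bullet> grad f (r *\<^sub>R e)) (at r)"
proof -
  have "((\<lambda>r. r *\<^sub>R e) has_derivative (\<lambda>h. h *\<^sub>R e)) (at r)" by (auto intro!: derivative_eq_intros)
  from has_derivative_compose[OF this test_has_derivative[OF assms, of "r *\<^sub>R e"]]
  have "((\<lambda>r. f (r *\<^sub>R e)) has_derivative (\<lambda>h. (h *\<^sub>R e) \<bullet> grad f (r *\<^sub>R e))) (at r)" .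
  moreover have "(\<lambda>h. (h *\<^sub>R e) \<bullet> grad f (r *\<^sub>R e)) = (*) (e \<bullet> grad f (r *\<^sub>R e))"
    by (auto simp: fun_eq_iff)
  ultimately show ?thesis unfolding has_field_derivative_def by simp
qed

lemma continuous_on_ray_grad:
  assumes "f \<in> test_functions S"
  shows "continuous_on T (\<lambda>r. e \<bullet> grad f (r *\<^sub>R e))"
  by (intro continuous_intros continuous_on_compose2[OF continuous_on_grad[OF assms, of UNIV]]) auto

text \<open>With the polar Jacobian, the divergence term of \<open>grad_to_u\<close> is on each ray
  a multiple of the derivative of \<open>f^2 / 2\<close>. The outer boundary value vanishes; the
  inner one is the integral of \<open>f^2\<close> over directions at radius
  \<open>\<epsilon>\<close>.\<close>

lemma core_aux:
  fixes f :: "'a::euclidean_space \<Rightarrow> real"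
  assumes f: "f \<in> test_functions (ball 0 R)" and \<epsilon>: "0 < \<epsilon>" "\<epsilon> < R"
  defines "a \<equiv> (real DIM('a) - 2) / 2"
  shows "(LINT x|lebesgue_on (ball 0 R - ball 0 \<epsilon>). (norm (grad (to_u f) x))\<^sup>2) -
      a\<^sup>2 * (LINT x|lebesgue_on (ball 0 R - ball 0 \<epsilon>). (to_u f x)\<^sup>2 / (norm x)\<^sup>2) =
    (LBINT x. indicator (- ball 0 \<epsilon>) x * (wgt x * (norm (grad f x))\<^sup>2)) +
      real DIM('a) * a * (LBINT \<xi>. indicator pball \<xi> * (f (\<epsilon> *\<^sub>R sgn \<xi>))\<^sup>2)"
proof -
  let ?N = "real DIM('a)" and ?S = "ball 0 R - ball (0::'a) \<epsilon>" and ?K = "cball 0 R - ball (0::'a) \<epsilon>"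
  note [measurable] = test_measurable[OF f] grad_measurable[OF f]
  have K: "compact ?K" by (simp add: compact_diff)
  have SK: "?S \<subseteq> ?K" by auto
  have S0: "x \<noteq> 0" if "x \<in> ?K" for x using that \<epsilon> by auto
  have [measurable]: "?S \<in> sets borel" "- ball (0::'a) \<epsilon> \<in> sets borel" by auto
  have cn: "continuous_on ?K (\<lambda>x. norm x powr b)" for b
    by (intro continuous_intros) (use S0 in auto)
  note cf = test_continuous[OF f, of ?K] and cg = continuous_on_grad[OF f, of ?K]
  define g1 where "g1 = (\<lambda>x. (norm (norm x powr (- a) *\<^sub>R grad f x - (a * norm x powr (- a - 2) * f x) *\<^sub>R x))\<^sup>2)"
  define g2 where "g2 = (\<lambda>x. (to_u f x)\<^sup>2 / (norm x)\<^sup>2)"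
  define k where "k = (\<lambda>x. norm x powr (- ?N) * f x * (x \<bullet> grad f x))"
  have m1: "g1 \<in> borel_measurable borel" unfolding g1_def by measurable
  have m2: "g2 \<in> borel_measurable borel" unfolding g2_def to_u_def[abs_def] by measurable
  have i1: "integrable lborel (\<lambda>x. indicator ?S x * g1 x)"
    unfolding g1_def by (rule integrable_indicator_compact[OF K _ SK]) (auto intro!: continuous_intros cf cg cn)
  have i2: "integrable lborel (\<lambda>x. indicator ?S x * g2 x)"
    unfolding g2_def to_u_def by (rule integrable_indicator_compact[OF K _ SK]) (use S0 in \<open>auto intro!: continuous_intros cf cn\<close>)
  have ik: "integrable lborel (\<lambda>x. indicator ?S x * k x)"
    unfolding k_def by (rule integrable_indicator_compact[OF K _ SK]) (auto intro!: continuous_intros cf cg cn)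
  have iw: "integrable lborel (\<lambda>x. indicator ?S x * (wgt x * (norm (grad f x))\<^sup>2))"
    unfolding wgt_def by (rule integrable_indicator_compact[OF K _ SK]) (auto intro!: continuous_intros cf cg cn)
  have id: "g1 x - a\<^sup>2 * g2 x = wgt x * (norm (grad f x))\<^sup>2 - 2 * a * k x" if "x \<in> ?S" for x
  proof -
    have "x \<noteq> 0" using that S0 SK by blast
    from grad_to_u[OF f this] show ?thesis unfolding g1_def g2_def k_def a_def by (simp add: mult.assoc)
  qed
  have "(LINT x|lebesgue_on ?S. (norm (grad (to_u f) x))\<^sup>2) = (LBINT x. indicator ?S x * g1 x)"
  proof (rule integral_lebesgue_on_eq[OF _ m1])
    fix x assume "x \<in> ?S"
    then have "x \<noteq> 0" using S0 SK by blast
    from grad_to_u(2)[OF f this] show "(norm (grad (to_u f) x))\<^sup>2 = g1 x" unfolding g1_def a_def by simp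
  qed simp
  moreover have "(LINT x|lebesgue_on ?S. (to_u f x)\<^sup>2 / (norm x)\<^sup>2) = (LBINT x. indicator ?S x * g2 x)"
    by (rule integral_lebesgue_on_eq[OF _ m2]) (auto simp: g2_def)
  ultimately have "(LINT x|lebesgue_on ?S. (norm (grad (to_u f) x))\<^sup>2) - a\<^sup>2 * (LINT x|lebesgue_on ?S. (to_u f x)\<^sup>2 / (norm x)\<^sup>2) =
     (LBINT x. indicator ?S x * g1 x - a\<^sup>2 * (indicator ?S x * g2 x))"
    using i1 i2 by simp
  also have "\<dots> = (LBINT x. indicator ?S x * (wgt x * (norm (grad f x))\<^sup>2) - 2 * a * (indicator ?S x * k x))"
    by (rule Bochner_Integration.integral_cong) (use id in \<open>auto simp: indicator_def\<close>)
  also have "\<dots> = (LBINT x. indicator ?S x * (wgt x * (norm (grad f x))\<^sup>2)) - 2 * a * (LBINT x. indicator ?S x * k x)"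
    using iw ik by simp
  also have "(LBINT x. indicator ?S x * (wgt x * (norm (grad f x))\<^sup>2)) = (LBINT x. indicator (- ball 0 \<epsilon>) x * (wgt x * (norm (grad f x))\<^sup>2))"
  proof (rule Bochner_Integration.integral_cong[OF refl])
    fix x :: 'a
    have "x \<notin> ball 0 R \<Longrightarrow> grad f x = 0" using test_support[OF f] by (metis subsetD)
    then show "indicator ?S x * (wgt x * (norm (grad f x))\<^sup>2) = indicator (- ball 0 \<epsilon>) x * (wgt x * (norm (grad f x))\<^sup>2)"
      by (auto simp: indicator_def)
  qed
  also have "(LBINT x. indicator ?S x * k x) =
     (LBINT \<xi>. indicator pball \<xi> * (LBINT r. indicator {0<..} r * ((?N * r ^ (DIM('a) - 1)) * (indicator ?S (r *\<^sub>R sgn \<xi>) * k (r *\<^sub>R sgn \<xi>)))))"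
    by (rule integral_polar'[OF ik])
  also have "\<dots> = (LBINT \<xi>. - (?N / 2) * (indicator pball \<xi> * (f (\<epsilon> *\<^sub>R sgn \<xi>))\<^sup>2))"
  proof (rule Bochner_Integration.integral_cong[OF refl])
    fix \<xi> :: 'a
    show "indicator pball \<xi> * (LBINT r. indicator {0<..} r * ((?N * r ^ (DIM('a) - 1)) * (indicator ?S (r *\<^sub>R sgn \<xi>) * k (r *\<^sub>R sgn \<xi>)))) =
      - (?N / 2) * (indicator pball \<xi> * (f (\<epsilon> *\<^sub>R sgn \<xi>))\<^sup>2)"
    proof (cases "\<xi> \<in> pball")
      case True
      define e where "e = sgn \<xi>"
      have ne: "norm (r *\<^sub>R e) = r" if "r > 0" for r using norm_pball[OF True that] unfolding e_def .
      let ?h = "\<lambda>r. f (r *\<^sub>R e) * (e \<bullet> grad f (r *\<^sub>R e))"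
      have "(LBINT r. indicator {0<..} r * ((?N * r ^ (DIM('a) - 1)) * (indicator ?S (r *\<^sub>R e) * k (r *\<^sub>R e)))) =
          (LBINT r. indicator {\<epsilon>..R} r * (?N * ?h r))"
      proof (rule Bochner_Integration.integral_cong[OF refl])
        fix r :: real
        show "indicator {0<..} r * ((?N * r ^ (DIM('a) - 1)) * (indicator ?S (r *\<^sub>R e) * k (r *\<^sub>R e))) = indicator {\<epsilon>..R} r * (?N * ?h r)"
        proof (cases "r > 0")
          case False
          then show ?thesis using \<epsilon> by simp
        next
          case r: True
          have "r ^ (DIM('a) - 1) = r powr real (DIM('a) - 1)" using r powr_realpow[of r "DIM('a) - 1"] by simp
          moreover have "real (DIM('a) - 1) + (- ?N) = - 1" by (simp add: of_nat_diff)
          ultimately have "r ^ (DIM('a) - 1) * r powr (- ?N) = r powr - 1" by (metis powr_add)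
          also have "\<dots> = 1 / r" using r by (simp add: powr_minus divide_inverse)
          finally have p: "r ^ (DIM('a) - 1) * r powr (- ?N) = 1 / r" .
          have "r ^ (DIM('a) - 1) * k (r *\<^sub>R e) = (r ^ (DIM('a) - 1) * r powr (- ?N)) * (f (r *\<^sub>R e) * (r * (e \<bullet> grad f (r *\<^sub>R e))))"
            unfolding k_def ne[OF r] by simp
          also have "\<dots> = ?h r" unfolding p using r by simp
          finally have kh: "r ^ (DIM('a) - 1) * k (r *\<^sub>R e) = ?h r" .
          have "f (r *\<^sub>R e) = 0" if "r \<ge> R" by (rule test_functions_outside[OF f]) (use ne[OF r] that in simp)
          then have ind: "indicator ?S (r *\<^sub>R e) * ?h r = indicator {\<epsilon>..R} r * ?h r"
            using ne[OF r] by (auto simp: indicator_def)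
          have "indicator {0<..} r * ((?N * r ^ (DIM('a) - 1)) * (indicator ?S (r *\<^sub>R e) * k (r *\<^sub>R e))) =
            ?N * (indicator ?S (r *\<^sub>R e) * (r ^ (DIM('a) - 1) * k (r *\<^sub>R e)))" using r by simp
          also have "\<dots> = ?N * (indicator {\<epsilon>..R} r * ?h r)" unfolding kh ind ..
          finally show ?thesis by (simp only: mult.left_commute)
        qed
      qed
      also have "\<dots> = ?N * (LBINT r. indicator {\<epsilon>..R} r * ?h r)"
        by (subst integral_mult_right_zero[symmetric]) (simp add: mult_ac)
      also have "(LBINT r. indicator {\<epsilon>..R} r * ?h r) = (f (R *\<^sub>R e))\<^sup>2 / 2 - (f (\<epsilon> *\<^sub>R e))\<^sup>2 / 2"
      proof (rule integral_FTC_indicator)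
        fix r
        show "((\<lambda>r. (f (r *\<^sub>R e))\<^sup>2 / 2) has_real_derivative ?h r) (at r)"
          using DERIV_cdivide[OF DERIV_power[OF radial_derivative[OF f, of e r], of 2], of 2] by (simp add: mult_ac)
      next
        show "continuous_on UNIV ?h"
          by (intro continuous_on_mult continuous_on_ray_grad[OF f] continuous_on_compose2[OF test_continuous[OF f, of UNIV]])
            (auto intro!: continuous_intros)
      qed (use \<epsilon> in simp)
      also have "f (R *\<^sub>R e) = 0" by (rule test_functions_outside[OF f]) (use ne[of R] \<epsilon> in simp)
      finally show ?thesis unfolding e_def using True by simp
    qed simp
  qed
  also have "\<dots> = - (?N / 2) * (LBINT \<xi>. indicator pball \<xi> * (f (\<epsilon> *\<^sub>R sgn \<xi>))\<^sup>2)" by (rule integral_mult_right_zero)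
  finally show ?thesis by (simp add: mult_ac)
qed

text \<open>Dominated convergence is a statement about sequences, while the limits in the norm are
  taken along a real parameter.\<close>

lemma tendsto_at_right_0I:
  fixes g :: "real \<Rightarrow> real"
  assumes "\<And>X. (\<And>n. X n > 0) \<Longrightarrow> X \<longlonglongrightarrow> 0 \<Longrightarrow> (\<lambda>n. g (X n)) \<longlonglongrightarrow> L"
  shows "(g \<longlongrightarrow> L) (at_right 0)"
  unfolding tendsto_at_iff_sequentially comp_def using assms by auto

lemma spherical_limit:
  fixes f :: "'a::euclidean_space \<Rightarrow> real"
  assumes f: "continuous_on UNIV f" "\<And>x. \<bar>f x\<bar> \<le> B"
  shows "((\<lambda>\<epsilon>. \<integral>\<xi>. indicator pball \<xi> * f (\<epsilon> *\<^sub>R sgn \<xi>) \<partial>lborel) \<longlongrightarrow> omega TYPE('a) * f 0) (at_right 0)"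
proof (rule tendsto_at_right_0I)
  fix X :: "nat \<Rightarrow> real" assume X: "X \<longlonglongrightarrow> 0"
  note [measurable] = borel_measurable_continuous_onI[OF f(1)]
  have B: "B \<ge> 0" using f(2)[of 0] by linarith
  have "(\<lambda>n. \<integral>\<xi>. indicator pball \<xi> * f (X n *\<^sub>R sgn \<xi>) \<partial>lborel) \<longlonglongrightarrow> (LBINT \<xi>. indicator (pball::'a set) \<xi> * f 0)"
  proof (rule integral_dominated_convergence[where w="\<lambda>\<xi>. indicator pball \<xi> * B"])
    show "integrable lborel (\<lambda>\<xi>. indicator (pball::'a set) \<xi> * B)"
      by (intro integrable_mult_left integrable_real_indicator) (auto simp: emeasure_pball)
    show "AE \<xi> in lborel. (\<lambda>n. indicator pball \<xi> * f (X n *\<^sub>R sgn \<xi>)) \<longlonglongrightarrow> indicator pball \<xi> * f 0"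
    proof (rule AE_I2)
      fix \<xi> :: 'a
      have "isCont f 0" using f(1) by (simp add: continuous_on_eq_continuous_at)
      moreover have "(\<lambda>n. X n *\<^sub>R sgn \<xi>) \<longlonglongrightarrow> 0" using tendsto_scaleR[OF X tendsto_const, of "sgn \<xi>"] by simp
      ultimately have "(\<lambda>n. f (X n *\<^sub>R sgn \<xi>)) \<longlonglongrightarrow> f 0" by (rule isCont_tendsto_compose)
      then show "(\<lambda>n. indicator pball \<xi> * f (X n *\<^sub>R sgn \<xi>)) \<longlonglongrightarrow> indicator pball \<xi> * f 0" by (rule tendsto_mult_left)
    qed
    show "AE \<xi> in lborel. norm (indicator pball \<xi> * f (X n *\<^sub>R sgn \<xi>)) \<le> indicator pball \<xi> * B" for n
      using f(2) by (auto simp: indicator_def)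
  qed auto
  then show "(\<lambda>n. \<integral>\<xi>. indicator pball \<xi> * f (X n *\<^sub>R sgn \<xi>) \<partial>lborel) \<longlonglongrightarrow> omega TYPE('a) * f 0"
    by (simp add: measure_pball)
qed

text \<open>Integrals for \<open>surface_measure\<close> are a constant times integrals over the
  unit ball of functions of the direction. The constant cancels in the mean, and the power of
  \<open>\<rho>\<close> cancels against the one in \<open>to_u\<close>.\<close>

lemma spherical_mean_to_u:
  fixes f :: "'a::euclidean_space \<Rightarrow> real"
  assumes [measurable]: "f \<in> borel_measurable borel" and \<rho>: "\<rho> > 0"
  shows "\<rho> powr ((real DIM('a) - 2) / 2) * spherical_mean (to_u f) \<rho> =
    (LBINT \<xi>. indicator pball \<xi> * f (\<rho> *\<^sub>R sgn \<xi>)) / omega TYPE('a)"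
proof -
  let ?N = "real DIM('a)" and ?T = "\<lambda>x::'a. (\<rho> / norm x) *\<^sub>R x"
  define a where "a = (?N - 2) / 2"
  define c where "c = ?N * \<rho> ^ (DIM('a) - 1)"
  have c: "c > 0" unfolding c_def using \<rho> by simp
  have T: "?T x = \<rho> *\<^sub>R sgn x" for x by (simp add: sgn_div_norm divide_inverse)
  let ?B = "restrict_space lborel (ball (0::'a) 1)"
  have [measurable]: "?T \<in> measurable ?B borel" by (rule measurable_restrict_space1) measurable
  have sm: "surface_measure \<rho> = density (distr ?B borel ?T) (\<lambda>_. ennreal c)"
    unfolding surface_measure_def c_def[symmetric] by (rule measure_eqI) (auto simp: emeasure_density_const)
  have "integral\<^sup>L (surface_measure \<rho>) g = c * (LBINT \<xi>. indicator (ball 0 1) \<xi> * g (?T \<xi>))"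
    if [measurable]: "g \<in> borel_measurable borel" for g :: "'a \<Rightarrow> real"
  proof -
    have "integral\<^sup>L (surface_measure \<rho>) g = (\<integral>x. c * g x \<partial>distr ?B borel ?T)"
      unfolding sm by (subst integral_density) (use c in auto)
    also have "\<dots> = (\<integral>x. c * g (?T x) \<partial>?B)" by (rule integral_distr) auto
    also have "\<dots> = (LBINT x. indicator (ball 0 1) x *\<^sub>R (c * g (?T x)))"
      by (rule integral_restrict_space) auto
    finally show ?thesis by (simp add: mult.left_commute[of _ c])
  qed
  note I = this
  \<comment> \<open>The origin is mapped to 0, which is off the sphere; every other point of the
    unit ball lands on it.\<close>
  have ae: "AE \<xi> in lborel. indicator (ball 0 1) \<xi> * indicator (sphere 0 \<rho>) (?T \<xi>) = (indicator pball \<xi> :: real)"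
  proof (rule AE_mp[OF AE_lborel_singleton[of "0::'a"]], rule AE_I2, rule impI)
    fix \<xi> :: 'a assume "\<xi> \<noteq> 0"
    then have "norm (?T \<xi>) = \<rho>" using \<rho> by simp
    then have "?T \<xi> \<in> sphere 0 \<rho>" by (simp only: mem_sphere dist_0_norm)
    then show "indicator (ball 0 1) \<xi> * indicator (sphere 0 \<rho>) (?T \<xi>) = (indicator pball \<xi> :: real)"
      using \<open>\<xi> \<noteq> 0\<close> by (simp add: indicator_def)
  qed
  have [measurable]: "sphere (0::'a) \<rho> \<in> sets borel" by (simp add: borel_closed)
  have [measurable]: "to_u f \<in> borel_measurable borel" unfolding to_u_def[abs_def] by measurable
  have "(LINT x:sphere 0 \<rho>|surface_measure \<rho>. to_u f x) = c * (LBINT \<xi>. indicator (ball 0 1) \<xi> * (indicator (sphere 0 \<rho>) (?T \<xi>) *\<^sub>R to_u f (?T \<xi>)))"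
    unfolding set_lebesgue_integral_def by (rule I) measurable
  also have "(LBINT \<xi>. indicator (ball 0 1) \<xi> * (indicator (sphere 0 \<rho>) (?T \<xi>) *\<^sub>R to_u f (?T \<xi>))) = (LBINT \<xi>. \<rho> powr (- a) * (indicator pball \<xi> * f (\<rho> *\<^sub>R sgn \<xi>)))"
  proof (rule integral_cong_AE)
    show "AE \<xi> in lborel. indicator (ball 0 1) \<xi> * (indicator (sphere 0 \<rho>) (?T \<xi>) *\<^sub>R to_u f (?T \<xi>)) = \<rho> powr (- a) * (indicator pball \<xi> * f (\<rho> *\<^sub>R sgn \<xi>))"
      using ae
    proof eventually_elim
      case (elim \<xi>)
      have "indicator (ball 0 1) \<xi> * (indicator (sphere 0 \<rho>) (?T \<xi>) *\<^sub>R to_u f (?T \<xi>)) =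
         (indicator (ball 0 1) \<xi> * indicator (sphere 0 \<rho>) (?T \<xi>)) * to_u f (\<rho> *\<^sub>R sgn \<xi>)" unfolding T by simp
      also have "\<dots> = indicator pball \<xi> * to_u f (\<rho> *\<^sub>R sgn \<xi>)" unfolding elim ..
      also have "\<dots> = \<rho> powr (- a) * (indicator pball \<xi> * f (\<rho> *\<^sub>R sgn \<xi>))"
        using norm_pball[OF _ \<rho>, of \<xi>] unfolding to_u_def a_def by (cases "\<xi> \<in> pball") simp_all
      finally show ?case .
    qed
  qed measurable
  finally have num: "(LINT x:sphere 0 \<rho>|surface_measure \<rho>. to_u f x) = c * (\<rho> powr (- a) * (LBINT \<xi>. indicator pball \<xi> * f (\<rho> *\<^sub>R sgn \<xi>)))"
    by simp
  have "measure (surface_measure \<rho>) (sphere (0::'a) \<rho>) = integral\<^sup>L (surface_measure \<rho>) (indicator (sphere (0::'a) \<rho>))"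
    by (simp add: surface_measure_def space_scale_measure)
  also have "\<dots> = c * (LBINT \<xi>. indicator (ball 0 1) \<xi> * indicator (sphere 0 \<rho>) (?T \<xi>))" by (rule I) measurable
  also have "(LBINT \<xi>. indicator (ball 0 1) \<xi> * indicator (sphere 0 \<rho>) (?T \<xi>)) = (\<integral>\<xi>. indicator (pball::'a set) \<xi> \<partial>lborel :: real)"
  proof (rule integral_cong_AE)
    show "AE \<xi> in lborel. indicator (ball 0 1) \<xi> * indicator (sphere 0 \<rho>) (?T \<xi>) = (indicator pball \<xi> :: real)"
      by (rule ae)
  qed measurable
  finally have den: "measure (surface_measure \<rho>) (sphere (0::'a) \<rho>) = c * omega TYPE('a)" by (simp add: measure_pball)
  have "\<rho> powr a * \<rho> powr (- a) = 1" using \<rho> by (simp add: powr_add[symmetric])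
  then show ?thesis
    unfolding spherical_mean_def num den a_def[symmetric] using c by (simp add: mult.assoc[symmetric])
qed

text \<open>The scaled spherical means tend to \<open>f 0\<close>. The normalisation of
  \<open>L_functional\<close> makes its square equal to the limit of the boundary term in
  \<open>core_aux\<close> as the radius tends to 0.\<close>

lemma L_functional_to_u:
  fixes f :: "'a::euclidean_space \<Rightarrow> real"
  assumes f: "f \<in> test_functions S" and N: "DIM('a) \<ge> 3"
  shows "(L_functional (to_u f))\<^sup>2 = real DIM('a) * ((real DIM('a) - 2) / 2) * omega TYPE('a) * (f 0)\<^sup>2"
proof -
  let ?N = "real DIM('a)"
  obtain B where B: "\<And>x. \<bar>f x\<bar> \<le> B" using test_bounded[OF f] by metis
  have "((\<lambda>\<epsilon>. (LBINT \<xi>. indicator pball \<xi> * f (\<epsilon> *\<^sub>R sgn \<xi>)) / omega TYPE('a)) \<longlongrightarrow> omega TYPE('a) * f 0 / omega TYPE('a)) (at_right 0)"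
    by (intro tendsto_divide spherical_limit[OF test_continuous[OF f] B] tendsto_const) (use omega_pos[where 'a='a] in simp)
  then have l: "((\<lambda>\<epsilon>. (LBINT \<xi>. indicator pball \<xi> * f (\<epsilon> *\<^sub>R sgn \<xi>)) / omega TYPE('a)) \<longlongrightarrow> f 0) (at_right 0)"
    using omega_pos[where 'a='a] by simp
  have "((\<lambda>\<rho>. \<rho> powr ((?N - 2) / 2) * spherical_mean (to_u f) \<rho>) \<longlongrightarrow> f 0) (at_right 0)"
    by (rule Lim_transform_eventually[OF l])
      (use eventually_at_right_less[of "0::real"] in eventually_elim, simp add: spherical_mean_to_u[OF test_measurable[OF f]])
  then have "Lim (at_right 0) (\<lambda>\<rho>. \<rho> powr ((?N - 2) / 2) * spherical_mean (to_u f) \<rho>) = f 0"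
    by (intro tendsto_Lim) auto
  moreover have "measure lebesgue (ball (0::'a) 1) = omega TYPE('a)" unfolding omega_def by (simp add: measure_completion)
  ultimately show ?thesis
    using N omega_pos[where 'a='a] unfolding L_functional_def Let_def by (simp add: power_mult_distrib mult_ac)
qed

theorem core_norm_sq_to_u:
  fixes f :: "'a::euclidean_space \<Rightarrow> real"
  assumes f: "f \<in> test_functions (ball 0 R)" and N: "DIM('a) \<ge> 3" and R: "R > 0"
  shows "core_norm_sq R (to_u f) = Qf f"
proof -
  let ?N = "real DIM('a)"
  define a where "a = (?N - 2) / 2"
  note [measurable] = test_measurable[OF f] grad_measurable[OF f]
  obtain B where B: "\<And>x. \<bar>f x\<bar> \<le> B" using test_bounded[OF f] by metis
  have "\<bar>(f x)\<^sup>2\<bar> \<le> B\<^sup>2" for x using power_mono[OF B[of x], of 2] by simp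
  then have l2: "((\<lambda>\<epsilon>. \<integral>\<xi>. indicator pball \<xi> * (f (\<epsilon> *\<^sub>R sgn \<xi>))\<^sup>2 \<partial>lborel) \<longlongrightarrow> omega TYPE('a) * (f 0)\<^sup>2) (at_right 0)"
    using test_continuous[OF f] by (intro spherical_limit[of "\<lambda>x. (f x)\<^sup>2"] continuous_intros) auto
  have l1: "((\<lambda>\<epsilon>. \<integral>x. indicator (- ball 0 \<epsilon>) x * (wgt x * (norm (grad f x))\<^sup>2) \<partial>lborel) \<longlongrightarrow> Qf f) (at_right 0)"
  proof (rule tendsto_at_right_0I)
    fix X :: "nat \<Rightarrow> real" assume X: "X \<longlonglongrightarrow> 0"
    show "(\<lambda>n. \<integral>x. indicator (- ball 0 (X n)) x * (wgt x * (norm (grad f x))\<^sup>2) \<partial>lborel) \<longlonglongrightarrow> Qf f"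
      unfolding Qf_def
    proof (rule integral_dominated_convergence[where w="\<lambda>x. wgt x * (norm (grad f x))\<^sup>2"])
      show "integrable lborel (\<lambda>x. wgt x * (norm (grad f x))\<^sup>2)" by (rule integrable_Q(3)[OF f f])
      show "AE x in lborel. (\<lambda>n. indicator (- ball 0 (X n)) x * (wgt x * (norm (grad f x))\<^sup>2)) \<longlonglongrightarrow> wgt x * (norm (grad f x))\<^sup>2"
      proof (rule AE_mp[OF AE_lborel_singleton[of "0::'a"]], rule AE_I2, rule impI, rule tendsto_eventually)
        fix x :: 'a assume "x \<noteq> 0"
        then have "\<forall>\<^sub>F n in sequentially. X n < norm x" using X order_tendstoD(2)[of X 0 _ "norm x"] by simp
        then show "\<forall>\<^sub>F n in sequentially. indicator (- ball 0 (X n)) x * (wgt x * (norm (grad f x))\<^sup>2) = wgt x * (norm (grad f x))\<^sup>2"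
          by eventually_elim simp
      qed
    qed (auto simp: indicator_def)
  qed
  have "((\<lambda>\<epsilon>. (LBINT x. indicator (- ball 0 \<epsilon>) x * (wgt x * (norm (grad f x))\<^sup>2)) + ?N * a * (LBINT \<xi>. indicator pball \<xi> * (f (\<epsilon> *\<^sub>R sgn \<xi>))\<^sup>2))
     \<longlongrightarrow> Qf f + ?N * a * (omega TYPE('a) * (f 0)\<^sup>2)) (at_right 0)"
    by (intro tendsto_add l1 tendsto_mult_left l2)
  moreover have "\<forall>\<^sub>F \<epsilon> in at_right 0. (LBINT x. indicator (- ball 0 \<epsilon>) x * (wgt x * (norm (grad f x))\<^sup>2)) + ?N * a * (LBINT \<xi>. indicator pball \<xi> * (f (\<epsilon> *\<^sub>R sgn \<xi>))\<^sup>2) =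
     (LINT x|lebesgue_on (ball 0 R - ball 0 \<epsilon>). (norm (grad (to_u f) x))\<^sup>2) - a\<^sup>2 * (LINT x|lebesgue_on (ball 0 R - ball 0 \<epsilon>). (to_u f x)\<^sup>2 / (norm x)\<^sup>2)"
    using eventually_at_right_less[of "0::real"] eventually_at_right_real[OF R]
    by eventually_elim (simp add: core_aux[OF f] a_def)
  ultimately have "((\<lambda>\<epsilon>. (LINT x|lebesgue_on (ball 0 R - ball 0 \<epsilon>). (norm (grad (to_u f) x))\<^sup>2) - a\<^sup>2 * (LINT x|lebesgue_on (ball 0 R - ball 0 \<epsilon>). (to_u f x)\<^sup>2 / (norm x)\<^sup>2))
     \<longlongrightarrow> Qf f + ?N * a * (omega TYPE('a) * (f 0)\<^sup>2)) (at_right 0)"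
    by (rule Lim_transform_eventually)
  then have "Lim (at_right 0) (\<lambda>\<epsilon>. (LINT x|lebesgue_on (ball 0 R - ball 0 \<epsilon>). (norm (grad (to_u f) x))\<^sup>2) - a\<^sup>2 * (LINT x|lebesgue_on (ball 0 R - ball 0 \<epsilon>). (to_u f x)\<^sup>2 / (norm x)\<^sup>2)) =
     Qf f + ?N * a * (omega TYPE('a) * (f 0)\<^sup>2)"
    by (intro tendsto_Lim) auto
  then show ?thesis unfolding core_norm_sq_def L_functional_to_u[OF f N] a_def by simp
qed

text \<open>The support avoids a ball of radius \<open>a\<close>, so excising the ball of radius
  \<open>a / 2\<close> changes no integral and the boundary term of \<open>core_aux\<close> is zero.
  No limit has to be taken.\<close>

lemma punctured_core:
  fixes f :: "'a::euclidean_space \<Rightarrow> real"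
  assumes f: "f \<in> test_functions (ball 0 R - {0})" and R: "R > 0"
  shows "(LINT x|lebesgue_on (ball 0 R). (norm (grad (to_u f) x))\<^sup>2) -
     ((real DIM('a) - 2) / 2)\<^sup>2 * (LINT x|lebesgue_on (ball (0::'a) R). (to_u f x)\<^sup>2 / (norm x)\<^sup>2) = Qf f"
proof -
  obtain a b where ab: "0 < a" "a \<le> b" "b < R" "\<And>x. f x \<noteq> 0 \<Longrightarrow> a \<le> norm x \<and> norm x \<le> b"
    using test_functions_norm_bounds[OF f order_refl R] by metis
  have f0: "f x = 0" if "norm x < a" for x using ab(4)[of x] that by (cases "f x = 0") auto
  have g0: "grad f x = 0" "grad (to_u f) x = 0" "to_u f x = 0" if x: "x \<in> ball 0 a" for x
  proof -
    have "(f has_derivative (\<lambda>h. 0)) (at x)"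
    proof (rule has_derivative_transform_within_open[OF has_derivative_const[where c=0] open_ball x])
      show "0 = f y" if "y \<in> ball 0 a" for y using f0[of y] that by simp
    qed
    then show "grad f x = 0" by (intro grad_eqI) simp
    have "(to_u f has_derivative (\<lambda>h. 0)) (at x)"
    proof (rule has_derivative_transform_within_open[OF has_derivative_const[where c=0] open_ball x])
      show "0 = to_u f y" if "y \<in> ball 0 a" for y using f0[of y] that by (simp add: to_u_def)
    qed
    then show "grad (to_u f) x = 0" by (intro grad_eqI) simp
    show "to_u f x = 0" using f0[of x] x by (simp add: to_u_def)
  qed
  have f': "f \<in> test_functions (ball 0 R)" using f test_functions_subset[of "ball 0 R - {0}" "ball 0 R"] by auto
  have aR: "a < R" using ab by linarith
  have "(LBINT \<xi>. indicator pball \<xi> * (f ((a / 2) *\<^sub>R sgn \<xi>))\<^sup>2) = (\<integral>\<xi>. 0 \<partial>(lborel :: 'a measure))"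
  proof (rule Bochner_Integration.integral_cong[OF refl])
    fix \<xi> :: 'a
    have "norm ((a / 2) *\<^sub>R sgn \<xi>) < a" using ab(1) by (simp add: norm_sgn)
    then show "indicator pball \<xi> * (f ((a / 2) *\<^sub>R sgn \<xi>))\<^sup>2 = 0" by (simp add: f0)
  qed
  then have z: "(LBINT \<xi>. indicator pball \<xi> * (f ((a / 2) *\<^sub>R sgn \<xi>))\<^sup>2) = 0" by simp
  have "(LINT x|lebesgue_on (ball 0 R). (norm (grad (to_u f) x))\<^sup>2) -
     ((real DIM('a) - 2) / 2)\<^sup>2 * (LINT x|lebesgue_on (ball (0::'a) R). (to_u f x)\<^sup>2 / (norm x)\<^sup>2) =
     (LINT x|lebesgue_on (ball 0 R - ball 0 (a / 2)). (norm (grad (to_u f) x))\<^sup>2) -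
     ((real DIM('a) - 2) / 2)\<^sup>2 * (LINT x|lebesgue_on (ball (0::'a) R - ball 0 (a / 2)). (to_u f x)\<^sup>2 / (norm x)\<^sup>2)"
  proof -
    have sub: "x \<in> ball 0 a" if "x \<in> ball 0 (a / 2)" for x :: 'a using that ab(1) by auto
    have "(LINT x|lebesgue_on (ball 0 R). g x) = (LINT x|lebesgue_on (ball 0 R - ball 0 (a / 2)). g x)"
      if z: "\<And>x. x \<in> ball 0 a \<Longrightarrow> g x = 0" for g :: "'a \<Rightarrow> real"
    proof -
      have "(LINT x|lebesgue_on (ball 0 R). g x) = (LINT x|lebesgue. indicator (ball 0 R) x *\<^sub>R g x)"
        by (rule integral_restrict_space) auto
      also have "\<dots> = (LINT x|lebesgue. indicator (ball 0 R - ball 0 (a / 2)) x *\<^sub>R g x)"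
        by (rule Bochner_Integration.integral_cong) (use z sub in \<open>auto simp: indicator_def\<close>)
      also have "\<dots> = (LINT x|lebesgue_on (ball 0 R - ball 0 (a / 2)). g x)"
        by (rule integral_restrict_space[symmetric]) auto
      finally show ?thesis .
    qed
    then show ?thesis using g0 by simp
  qed
  also have "\<dots> = (LBINT x. indicator (- ball 0 (a / 2)) x * (wgt x * (norm (grad f x))\<^sup>2))"
    using core_aux[OF f', of "a / 2"] ab z by simp
  also have "\<dots> = Qf f"
    unfolding Qf_def by (rule Bochner_Integration.integral_cong) (use g0 ab(1) in \<open>auto simp: indicator_def\<close>)
  finally show ?thesis .
qed

subsection \<open>The completion\<close>

lemma integral_translate:
  fixes g :: "'a::euclidean_space \<Rightarrow> real"
  assumes [measurable]: "g \<in> borel_measurable borel"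
  shows "(LBINT x. g (c + x)) = (LBINT x. g x)"
proof -
  have "(\<integral>x. g x \<partial>distr lborel borel ((+) c)) = (LBINT x. g (c + x))"
    by (rule integral_distr) auto
  then show ?thesis by (simp add: lborel_distr_plus)
qed

lemma integrable_test:
  fixes g :: "'a::euclidean_space \<Rightarrow> real"
  assumes g: "g \<in> test_functions S"
  shows "integrable lborel g" and "integrable lborel (\<lambda>x. grad g x \<bullet> b)"
proof -
  obtain K where K: "compact K" "\<And>x. x \<notin> K \<Longrightarrow> g x = 0" "\<And>x. x \<notin> K \<Longrightarrow> grad g x = 0"
    using test_support[OF g] by metis
  have Kb: "K \<in> sets borel" using K(1) by (simp add: borel_compact)
  have "integrable lborel (\<lambda>x. indicator K x * g x)"
    by (rule integrable_indicator_compact[OF K(1) test_continuous[OF g] order_refl Kb])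
  moreover have "(\<lambda>x. indicator K x * g x) = g" using K(2) by (auto simp: fun_eq_iff indicator_def)
  ultimately show "integrable lborel g" by simp
  have "integrable lborel (\<lambda>x. indicator K x * (grad g x \<bullet> b))"
    by (rule integrable_indicator_compact[OF K(1) _ order_refl Kb]) (intro continuous_intros continuous_on_grad[OF g])
  moreover have "(\<lambda>x. indicator K x * (grad g x \<bullet> b)) = (\<lambda>x. grad g x \<bullet> b)" using K(3) by (auto simp: fun_eq_iff indicator_def)
  ultimately show "integrable lborel (\<lambda>x. grad g x \<bullet> b)" by simp
qed

text \<open>By translation invariance the difference quotients have integral zero. They are bounded
  by the mean value theorem and, as the steps \<open>hh n\<close> are at most 1, supported in one
  ball, so dominated convergence applies.\<close>

lemma integral_partial_zero:
  fixes g :: "'a::euclidean_space \<Rightarrow> real"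
  assumes g: "g \<in> test_functions S" and b: "b \<in> Basis"
  shows "(LBINT x. grad g x \<bullet> b) = 0"
proof -
  note [measurable] = test_measurable[OF g] grad_measurable[OF g]
  obtain B where B: "B \<ge> 0" "\<And>x. norm (grad g x) \<le> B" using test_bounded[OF g] by metis
  obtain K where K: "compact K" "\<And>x. x \<notin> K \<Longrightarrow> g x = 0" using test_support[OF g] by metis
  obtain r where r: "r > 0" "\<And>x. x \<in> K \<Longrightarrow> norm x \<le> r"
    using compact_imp_bounded[OF K(1)] unfolding bounded_pos by blast
  have d: "((\<lambda>t. g (x + t *\<^sub>R b)) has_real_derivative grad g (x + t *\<^sub>R b) \<bullet> b) (at t)" for x t
  proof -
    have "((\<lambda>t. x + t *\<^sub>R b) has_derivative (\<lambda>h. h *\<^sub>R b)) (at t)" by (auto intro!: derivative_eq_intros)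
    from has_derivative_compose[OF this test_has_derivative[OF g, of "x + t *\<^sub>R b"]]
    have "((\<lambda>t. g (x + t *\<^sub>R b)) has_derivative (\<lambda>h. (h *\<^sub>R b) \<bullet> grad g (x + t *\<^sub>R b))) (at t)" .
    moreover have "(\<lambda>h. (h *\<^sub>R b) \<bullet> grad g (x + t *\<^sub>R b)) = (*) (grad g (x + t *\<^sub>R b) \<bullet> b)"
      by (auto simp: fun_eq_iff inner_commute)
    ultimately show ?thesis unfolding has_field_derivative_def by simp
  qed
  define hh where "hh = (\<lambda>n. inverse (real (Suc n)))"
  have hh: "hh n > 0" "hh n \<le> 1" for n unfolding hh_def by (auto simp: divide_simps)
  let ?D = "\<lambda>n x. (g (x + hh n *\<^sub>R b) - g x) / hh n"
  have bound: "norm (?D n x) \<le> B * indicator (cball 0 (r + 1)) x" for n x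
  proof (cases "x \<in> cball 0 (r + 1)")
    case True
    obtain z where z: "g (x + hh n *\<^sub>R b) - g (x + 0 *\<^sub>R b) = (hh n - 0) * (grad g (x + z *\<^sub>R b) \<bullet> b)"
      using MVT2[of 0 "hh n" "\<lambda>t. g (x + t *\<^sub>R b)" "\<lambda>t. grad g (x + t *\<^sub>R b) \<bullet> b"] hh(1)[of n] d by blast
    then have "?D n x = grad g (x + z *\<^sub>R b) \<bullet> b" using hh(1)[of n] by (simp add: field_simps)
    moreover have "\<bar>grad g (x + z *\<^sub>R b) \<bullet> b\<bar> \<le> norm (grad g (x + z *\<^sub>R b)) * norm b" by (rule Cauchy_Schwarz_ineq2)
    ultimately show ?thesis using B(2)[of "x + z *\<^sub>R b"] b True by simp
  next
    case False
    have "norm (hh n *\<^sub>R b) \<le> 1" using hh[of n] b by simp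
    then have "norm (x + hh n *\<^sub>R b) > r" "norm x > r" using False norm_triangle_ineq2[of x "- (hh n *\<^sub>R b)"] by auto
    then have "g (x + hh n *\<^sub>R b) = 0" "g x = 0" using r(2) K(2) by (meson not_le)+
    then show ?thesis using False by simp
  qed
  have L: "(\<lambda>n. \<integral>x. ?D n x \<partial>lborel) \<longlonglongrightarrow> (LBINT x. grad g x \<bullet> b)"
  proof (rule integral_dominated_convergence[where w="\<lambda>x. B * indicator (cball 0 (r + 1)) x"])
    show "integrable lborel (\<lambda>x::'a. B * indicator (cball 0 (r + 1)) x)"
      by (intro integrable_mult_right integrable_real_indicator) (use emeasure_lborel_cball_finite[of "0::'a" "r + 1"] in auto)
    show "AE x in lborel. (\<lambda>n. ?D n x) \<longlonglongrightarrow> grad g x \<bullet> b"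
    proof (rule AE_I2)
      fix x
      have "((\<lambda>t. (g (x + t *\<^sub>R b) - g (x + 0 *\<^sub>R b)) / (t - 0)) \<longlongrightarrow> grad g (x + 0 *\<^sub>R b) \<bullet> b) (at 0)"
        using d[of x 0] unfolding has_field_derivative_iff .
      moreover have "hh \<longlonglongrightarrow> 0" unfolding hh_def by (rule LIMSEQ_inverse_real_of_nat)
      moreover have "hh n \<noteq> 0" for n using hh(1)[of n] by simp
      ultimately have "((\<lambda>t. (g (x + t *\<^sub>R b) - g (x + 0 *\<^sub>R b)) / (t - 0)) \<circ> hh) \<longlonglongrightarrow> grad g (x + 0 *\<^sub>R b) \<bullet> b"
        unfolding tendsto_at_iff_sequentially by simp
      then show "(\<lambda>n. ?D n x) \<longlonglongrightarrow> grad g x \<bullet> b" by (simp add: comp_def)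
    qed
    show "AE x in lborel. norm (?D n x) \<le> B * indicator (cball 0 (r + 1)) x" for n by (rule AE_I2) (rule bound)
  qed measurable
  have z: "(LBINT x. ?D n x) = 0" for n
  proof -
    have i: "integrable lborel g" by (rule integrable_test[OF g])
    have t: "(LBINT x. g (x + hh n *\<^sub>R b)) = (LBINT x. g x)"
      using integral_translate[of g "hh n *\<^sub>R b"] by (simp add: add.commute)
    have "integrable lborel (\<lambda>x. g (x + hh n *\<^sub>R b))"
    proof -
      have "integrable (distr lborel borel ((+) (hh n *\<^sub>R b))) g" using i by (simp add: lborel_distr_plus)
      then show ?thesis by (subst (asm) integrable_distr_eq) (auto simp: add.commute)
    qed
    then show ?thesis using i t by simp
  qed
  show ?thesis by (rule LIMSEQ_unique[OF L[unfolded z] tendsto_const])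
qed

lemma test_mult_smooth:
  assumes "f \<in> test_functions S" "smooth_on UNIV g"
  shows "(\<lambda>x. f x * g x) \<in> test_functions S"
proof -
  have "{x. f x * g x \<noteq> 0} \<subseteq> closure {x. f x \<noteq> 0}" using closure_subset[of "{x. f x \<noteq> 0}"] by auto
  from compact_closure_subset[OF this] show ?thesis
    using assms smooth_on_mult[OF open_UNIV, of f g] unfolding test_functions_iff_smooth by blast
qed

lemma grad_mult_test:
  assumes "f \<in> test_functions S" "g \<in> test_functions T"
  shows "grad (\<lambda>x. f x * g x) x = f x *\<^sub>R grad g x + g x *\<^sub>R grad f x"
  by (rule grad_eqI)
    (use has_derivative_mult[OF test_has_derivative[OF assms(1)] test_has_derivative[OF assms(2)]]
      in \<open>simp add: inner_add_right mult.commute\<close>)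

lemma integration_by_parts:
  fixes f g :: "'a::euclidean_space \<Rightarrow> real"
  assumes f: "f \<in> test_functions S" and g: "g \<in> test_functions T" and b: "b \<in> Basis"
  shows "integrable lborel (\<lambda>x. g x * (grad f x \<bullet> b))" "integrable lborel (\<lambda>x. f x * (grad g x \<bullet> b))"
    "(LBINT x. g x * (grad f x \<bullet> b)) = - (LBINT x. f x * (grad g x \<bullet> b))"
proof -
  have i: "integrable lborel (\<lambda>x. u x * (grad v x \<bullet> b))" if u: "u \<in> test_functions S'" and v: "v \<in> test_functions T'" for u v and S' T' :: "'a set"
  proof -
    note [measurable] = test_measurable[OF u] grad_measurable[OF v]
    obtain B where B: "\<And>x. \<bar>u x\<bar> \<le> B" using test_bounded[OF u] by metis
    show ?thesis
    proof (rule Bochner_Integration.integrable_bound[OF integrable_mult_right[OF integrable_test(2)[OF v, of b], of B]])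
      show "AE x in lborel. norm (u x * (grad v x \<bullet> b)) \<le> norm (B * (grad v x \<bullet> b))"
        using order_trans[OF B abs_ge_self] by (auto simp: abs_mult intro!: mult_right_mono)
    qed measurable
  qed
  show i1: "integrable lborel (\<lambda>x. g x * (grad f x \<bullet> b))" by (rule i[OF g f])
  show i2: "integrable lborel (\<lambda>x. f x * (grad g x \<bullet> b))" by (rule i[OF f g])
  have "(LBINT x. grad (\<lambda>x. f x * g x) x \<bullet> b) = 0"
    by (rule integral_partial_zero[OF test_mult_smooth[OF f test_smooth[OF g]] b])
  then show "(LBINT x. g x * (grad f x \<bullet> b)) = - (LBINT x. f x * (grad g x \<bullet> b))"
    unfolding grad_mult_test[OF f g] using i1 i2 by (simp add: inner_add_left)
qed

section \<open>The Dirichlet form as a seminorm, and its closability\<close>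

definition Bf :: "('a::euclidean_space \<Rightarrow> real) \<Rightarrow> ('a \<Rightarrow> real) \<Rightarrow> real" where
  "Bf f g = (LBINT x. wgt x * (grad f x \<bullet> grad g x))"

lemma Qf_nonneg: "Qf f \<ge> 0" unfolding Qf_def by simp

lemma Qf_diff:
  fixes f g :: "'a::euclidean_space \<Rightarrow> real"
  assumes f: "f \<in> test_functions (ball 0 R)" and g: "g \<in> test_functions (ball 0 R)"
  shows "Qf (\<lambda>x. f x - g x) = Qf f - 2 * Bf f g + Qf g"
proof -
  have "wgt x * (norm (grad (\<lambda>x. f x - g x) x))\<^sup>2 =
     wgt x * (norm (grad f x))\<^sup>2 - 2 * (wgt x * (grad f x \<bullet> grad g x)) + wgt x * (norm (grad g x))\<^sup>2" for x
    unfolding grad_diff[OF f g] power2_norm_eq_inner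
    by (simp add: inner_diff_left inner_diff_right inner_commute algebra_simps)
  then show ?thesis
    unfolding Qf_def Bf_def using integrable_Q(3)[OF f f] integrable_Q(3)[OF g g] integrable_Q(1)[OF f g] by simp
qed

text \<open>Young's inequality under the integral. The best \<open>t\<close> gives the
  Cauchy-Schwarz inequality in \<open>sqrt_Qf_triangle\<close>, and extreme values of
  \<open>t\<close> settle its degenerate case.\<close>

lemma Bf_square_le:
  fixes f g :: "'a::euclidean_space \<Rightarrow> real"
  assumes f: "f \<in> test_functions (ball 0 R)" and g: "g \<in> test_functions (ball 0 R)" and t: "t > 0"
  shows "2 * \<bar>Bf f g\<bar> \<le> t * Qf f + Qf g / t"
proof -
  have "2 * \<bar>wgt x * (grad f x \<bullet> grad g x)\<bar> \<le> t * (wgt x * (norm (grad f x))\<^sup>2) + wgt x * (norm (grad g x))\<^sup>2 / t" for x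
  proof -
    have "\<bar>grad f x \<bullet> grad g x\<bar> \<le> norm (grad f x) * norm (grad g x)" by (rule Cauchy_Schwarz_ineq2)
    moreover have "0 \<le> (t * norm (grad f x) - norm (grad g x))\<^sup>2 / t" using t by simp
    then have "2 * (norm (grad f x) * norm (grad g x)) \<le> t * (norm (grad f x))\<^sup>2 + (norm (grad g x))\<^sup>2 / t"
      using t by (simp add: power2_eq_square field_simps)
    ultimately have "2 * \<bar>grad f x \<bullet> grad g x\<bar> \<le> t * (norm (grad f x))\<^sup>2 + (norm (grad g x))\<^sup>2 / t" by linarith
    then have "wgt x * (2 * \<bar>grad f x \<bullet> grad g x\<bar>) \<le> wgt x * (t * (norm (grad f x))\<^sup>2 + (norm (grad g x))\<^sup>2 / t)"
      by (rule mult_left_mono) simp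
    then show ?thesis by (simp add: abs_mult distrib_left mult_ac)
  qed
  then have "(LBINT x. 2 * \<bar>wgt x * (grad f x \<bullet> grad g x)\<bar>) \<le> (LBINT x. t * (wgt x * (norm (grad f x))\<^sup>2) + wgt x * (norm (grad g x))\<^sup>2 / t)"
    using integrable_Q(3)[OF f f] integrable_Q(3)[OF g g] integrable_Q(1)[OF f g] by (intro integral_mono) auto
  also have "\<dots> = t * Qf f + Qf g / t"
    unfolding Qf_def using integrable_Q(3)[OF f f] integrable_Q(3)[OF g g] by simp
  finally have "2 * (LBINT x. \<bar>wgt x * (grad f x \<bullet> grad g x)\<bar>) \<le> t * Qf f + Qf g / t" by simp
  then show ?thesis
    unfolding Bf_def using integral_abs_bound[of lborel "\<lambda>x. wgt x * (grad f x \<bullet> grad g x)"] by linarith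
qed

lemma sqrt_Qf_triangle:
  fixes f g :: "'a::euclidean_space \<Rightarrow> real"
  assumes f: "f \<in> test_functions (ball 0 R)" and g: "g \<in> test_functions (ball 0 R)"
  shows "\<bar>sqrt (Qf f) - sqrt (Qf g)\<bar> \<le> sqrt (Qf (\<lambda>x. f x - g x))"
proof -
  have "Bf f g \<le> sqrt (Qf f) * sqrt (Qf g)"
  proof (cases "Qf f > 0 \<and> Qf g > 0")
    case True
    define s where "s = sqrt (Qf f)" define t where "t = sqrt (Qf g)"
    have st: "s > 0" "t > 0" "Qf f = s\<^sup>2" "Qf g = t\<^sup>2" using True Qf_nonneg by (auto simp: s_def t_def)
    have "2 * \<bar>Bf f g\<bar> \<le> t / s * s\<^sup>2 + t\<^sup>2 / (t / s)" using Bf_square_le[OF f g, of "t / s"] st by simp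
    also have "\<dots> = 2 * (s * t)" using st by (simp add: power2_eq_square field_simps)
    finally show ?thesis unfolding s_def t_def by linarith
  next
    case False
    \<comment> \<open>When one of the forms is zero there is no best parameter; giving that form a
      large weight, by \<open>c / e\<close> or \<open>e / c\<close>, makes the remaining term at
      most \<open>e\<close>.\<close>
    have "\<bar>Bf f g\<bar> \<le> 0"
    proof (rule field_le_epsilon)
      fix e :: real assume e: "e > 0"
      define c where "c = Qf f + Qf g + 1"
      have c: "c > 0" unfolding c_def using Qf_nonneg[of f] Qf_nonneg[of g] by linarith
      have z: "Qf f = 0 \<or> Qf g = 0" using False Qf_nonneg[of f] Qf_nonneg[of g] by linarith
      then show "\<bar>Bf f g\<bar> \<le> 0 + e"
      proof
        assume "Qf f = 0"
        then have "2 * \<bar>Bf f g\<bar> \<le> Qf g / (c / e)" using Bf_square_le[OF f g, of "c / e"] c e by simp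
        also have "\<dots> = e * (Qf g / c)" by simp
        also have "\<dots> \<le> e * 1" using c e unfolding c_def using Qf_nonneg[of f] Qf_nonneg[of g] by (intro mult_left_mono) auto
        finally show ?thesis using e by simp
      next
        assume "Qf g = 0"
        then have "2 * \<bar>Bf f g\<bar> \<le> e / c * Qf f" using Bf_square_le[OF f g, of "e / c"] c e by simp
        also have "\<dots> = e * (Qf f / c)" by simp
        also have "\<dots> \<le> e * 1" using c e unfolding c_def using Qf_nonneg[of f] Qf_nonneg[of g] by (intro mult_left_mono) auto
        finally show ?thesis using e by simp
      qed
    qed
    then show ?thesis using Qf_nonneg[of f] Qf_nonneg[of g] by (simp add: order_trans[of _ 0])
  qed
  then have "(sqrt (Qf f) - sqrt (Qf g))\<^sup>2 \<le> Qf (\<lambda>x. f x - g x)"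
    unfolding Qf_diff[OF f g] using Qf_nonneg[of f] Qf_nonneg[of g] by (simp add: power2_diff mult.assoc)
  then have "sqrt ((sqrt (Qf f) - sqrt (Qf g))\<^sup>2) \<le> sqrt (Qf (\<lambda>x. f x - g x))" by (rule real_sqrt_le_mono)
  then show ?thesis by simp
qed

lemma to_u_square:
  fixes f :: "'a::euclidean_space \<Rightarrow> real"
  shows "(to_u f x)\<^sup>2 = wgt x * (f x * f x)"
proof -
  have "norm x powr (- ((real DIM('a) - 2) / 2)) * norm x powr (- ((real DIM('a) - 2) / 2)) = wgt x"
    unfolding wgt_def powr_add[symmetric] by (rule arg_cong[where f="(powr) (norm x)"]) (simp add: field_simps)
  then show ?thesis unfolding to_u_def power2_eq_square by (metis mult.assoc mult.left_commute)
qed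

text \<open>On the ball the weight is at least \<open>R powr (2 - N)\<close>, so the weighted mean
  square dominates the ordinary one there. The parameter \<open>t\<close> in Young's inequality
  keeps the term that does not depend on \<open>k\<close> below \<open>e\<close>.\<close>

lemma pairing_tendsto_0:
  fixes Z :: "nat \<Rightarrow> 'a::euclidean_space \<Rightarrow> real"
  assumes Z: "\<And>k. Z k \<in> test_functions (ball 0 R)" and R: "R > 0" and N: "DIM('a) \<ge> 3"
    and n2: "(\<lambda>k. \<integral>x. wgt x * (Z k x * Z k x) \<partial>lborel) \<longlonglongrightarrow> 0"
    and G [measurable]: "G \<in> borel_measurable borel" and C: "\<And>x. \<bar>G x\<bar> \<le> C"
  shows "(\<lambda>k. \<integral>x. Z k x * G x \<partial>lborel) \<longlonglongrightarrow> 0"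
proof (rule LIMSEQ_I)
  fix e :: real assume e: "e > 0"
  define n where "n = (\<lambda>k. \<integral>x. wgt x * (Z k x * Z k x) \<partial>lborel)"
  define P where "P = R powr (real DIM('a) - 2)"
  define V where "V = C\<^sup>2 * measure lborel (ball (0::'a) R)"
  have V: "V \<ge> 0" unfolding V_def by simp
  have P: "P > 0" unfolding P_def using R by simp
  define t where "t = e / (V + 1)"
  have t: "t > 0" unfolding t_def using e V by simp
  have wP: "1 \<le> P * wgt x" if "x \<in> ball 0 R" "x \<noteq> 0" for x :: 'a
  proof -
    have "R powr (2 - real DIM('a)) \<le> wgt x" unfolding wgt_def using that N by (intro powr_mono2') auto
    then have "P * R powr (2 - real DIM('a)) \<le> P * wgt x" using P by simp
    moreover have "P * R powr (2 - real DIM('a)) = 1" unfolding P_def powr_add[symmetric] using R by simp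
    ultimately show ?thesis by simp
  qed
  have key: "2 * \<bar>\<integral>x. Z k x * G x \<partial>lborel\<bar> \<le> t * V + P / t * n k" for k
  proof -
    note [measurable] = test_measurable[OF Z[of k]]
    have i1: "integrable lborel (\<lambda>x::'a. t * (C\<^sup>2 * indicator (ball 0 R) x))"
      by (intro integrable_mult_right integrable_real_indicator) (use emeasure_lborel_ball_finite[of "0::'a" R] in auto)
    have i2: "integrable lborel (\<lambda>x. P / t * (wgt x * (Z k x * Z k x)))"
      by (intro integrable_mult_right integrable_Q(2)[OF Z Z])
    have "AE x in lborel. 2 * \<bar>Z k x * G x\<bar> \<le> t * (C\<^sup>2 * indicator (ball 0 R) x) + P / t * (wgt x * (Z k x * Z k x))"
    proof (rule AE_mp[OF AE_lborel_singleton[of "0::'a"]], rule AE_I2, rule impI)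
      fix x :: 'a assume x: "x \<noteq> 0"
      show "2 * \<bar>Z k x * G x\<bar> \<le> t * (C\<^sup>2 * indicator (ball 0 R) x) + P / t * (wgt x * (Z k x * Z k x))"
      proof (cases "x \<in> ball 0 R")
        case False
        then have "Z k x = 0" by (rule test_functions_outside[OF Z])
        then show ?thesis using False by simp
      next
        case True
        have "\<bar>Z k x * G x\<bar> \<le> \<bar>Z k x\<bar> * C" unfolding abs_mult using C by (intro mult_left_mono) auto
        moreover have "0 \<le> (t * C - \<bar>Z k x\<bar>)\<^sup>2 / t" using t by simp
        then have "2 * (\<bar>Z k x\<bar> * C) \<le> t * C\<^sup>2 + (Z k x * Z k x) / t" using t by (simp add: power2_eq_square field_simps)
        moreover have "(Z k x * Z k x) / t * 1 \<le> (Z k x * Z k x) / t * (P * wgt x)"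
          using wP[OF True x] t by (intro mult_left_mono) auto
        ultimately show ?thesis using True by (simp add: mult_ac)
      qed
    qed
    moreover have "integrable lborel (\<lambda>x. Z k x * G x)"
    proof (rule Bochner_Integration.integrable_bound[OF integrable_mult_right[OF integrable_test(1)[OF Z[of k]], of C]])
      show "AE x in lborel. norm (Z k x * G x) \<le> norm (C * Z k x)"
        using order_trans[OF C abs_ge_self] by (auto simp: abs_mult mult.commute intro!: mult_right_mono)
    qed measurable
    ultimately have "(LBINT x. 2 * \<bar>Z k x * G x\<bar>) \<le> (LBINT x. t * (C\<^sup>2 * indicator (ball 0 R) x) + P / t * (wgt x * (Z k x * Z k x)))"
      using i1 i2 by (intro integral_mono_AE) auto
    also have "\<dots> = t * V + P / t * n k"
      using i1 i2 unfolding V_def n_def by simp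
    finally have "2 * (LBINT x. \<bar>Z k x * G x\<bar>) \<le> t * V + P / t * n k" by simp
    then show ?thesis using integral_abs_bound[of lborel "\<lambda>x. Z k x * G x"] by linarith
  qed
  have "(\<lambda>k. P / t * n k) \<longlonglongrightarrow> P / t * 0" using n2 unfolding n_def by (intro tendsto_mult_left)
  then have "\<forall>\<^sub>F k in sequentially. P / t * n k < e" using e order_tendstoD(2) by fastforce
  then obtain M where M: "\<And>k. k \<ge> M \<Longrightarrow> P / t * n k < e" unfolding eventually_sequentially by blast
  have tV: "t * V \<le> e" unfolding t_def using e V by (simp add: field_simps)
  show "\<exists>M. \<forall>k\<ge>M. norm ((LBINT x. Z k x * G x) - 0) < e"
  proof (intro exI allI impI)
    fix k assume "k \<ge> M"
    with M[of k] key[of k] tV show "norm ((LBINT x. Z k x * G x) - 0) < e" by simp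
  qed
qed

text \<open>The weight is singular only at the origin; a cutoff that vanishes within distance
  \<open>\<delta>\<close> of it makes the product smooth everywhere.\<close>

lemma cutoff_wgt:
  assumes \<delta>: "\<delta> > 0"
  obtains \<eta> :: "'a::euclidean_space \<Rightarrow> real" where "smooth_on UNIV (\<lambda>x. \<eta> x * wgt x)" "\<And>x. 0 \<le> \<eta> x" "\<And>x. \<eta> x \<le> 1"
    "\<And>x. norm x \<ge> 2 * \<delta> \<Longrightarrow> \<eta> x = 1" "\<eta> \<in> borel_measurable borel"
proof -
  let ?s = "\<lambda>r. smooth_step (r / \<delta> - 1)"
  let ?F = "\<lambda>r. ?s r * r powr (2 - real DIM('a))"
  have sm: "smooth_on {0<..} ?s"
  proof (rule smooth_on_compose[OF _ open_UNIV smooth_on_smooth_step])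
    have "smooth_on {0<..} (\<lambda>r. (1 / \<delta>) * r - 1)" by (intro smooth_on_diff smooth_on_mult smooth_on_const smooth_on_id) auto
    then show "smooth_on {0<..} (\<lambda>r. r / \<delta> - 1)" by simp
  qed auto
  have F: "smooth_on {0<..} ?F" by (intro smooth_on_mult sm smooth_on_powr) auto
  have z: "smooth_step (r / \<delta> - 1) = 0" if "r \<le> \<delta>" for r
    using that \<delta> by (intro smooth_step_le_0) (simp add: field_simps)
  have "smooth_on (- {0}) (\<lambda>x::'a. ?F (norm x))"
    by (rule smooth_on_compose[OF _ _ F smooth_on_norm]) auto
  moreover have "smooth_on (ball 0 \<delta>) (\<lambda>x::'a. ?F (norm x))"
    by (rule smooth_on_cong[OF _ _ smooth_on_const[of _ 0]]) (auto simp: z)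
  ultimately have "smooth_on (- {0} \<union> ball 0 \<delta>) (\<lambda>x::'a. ?F (norm x))" by (intro smooth_on_Un) auto
  moreover have "- {0} \<union> ball (0::'a) \<delta> = UNIV" using \<delta> by auto
  ultimately have 1: "smooth_on UNIV (\<lambda>x::'a. ?s (norm x) * wgt x)" by (simp add: wgt_def)
  have 2: "?s (norm x) = 1" if "norm x \<ge> 2 * \<delta>" for x :: 'a
    using that \<delta> by (intro smooth_step_ge_1) (simp add: field_simps)
  have 3: "(\<lambda>x::'a. ?s (norm x)) \<in> borel_measurable borel"
    by (intro borel_measurable_continuous_onI continuous_on_compose2[OF smooth_continuous[OF smooth_on_smooth_step]] continuous_intros)
      (use \<delta> in auto)
  show ?thesis by (rule that[OF 1 smooth_step_bounds(1,2) 2 3])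
qed

text \<open>Closability: \<open>Z k\<close> itself, multiplied by a cutoff away from the origin, is an admissible test
  function for the weak derivative of \<open>Z j\<close>.\<close>

lemma Bf_tendsto_0:
  fixes Z :: "nat \<Rightarrow> 'a::euclidean_space \<Rightarrow> real"
  assumes Z: "\<And>k. Z k \<in> test_functions (ball 0 R)" and R: "R > 0" and N: "DIM('a) \<ge> 3"
    and n2: "(\<lambda>k. \<integral>x. wgt x * (Z k x * Z k x) \<partial>lborel) \<longlonglongrightarrow> 0"
    and S: "\<And>j. j \<ge> M \<Longrightarrow> Qf (Z j) \<le> S" and f: "f \<in> test_functions (ball 0 R)"
  shows "(\<lambda>j. Bf f (Z j)) \<longlonglongrightarrow> 0"
proof (rule LIMSEQ_I)
  fix e :: real assume e: "e > 0"
  obtain B where B: "B \<ge> 0" "\<And>x. norm (grad f x) \<le> B" using test_bounded[OF f] by metis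
  define V where "V = real DIM('a) * omega TYPE('a)"
  have V: "V > 0" unfolding V_def using omega_pos[where 'a='a] by simp
  have S0: "S \<ge> 0" using S[of M] Qf_nonneg[of "Z M"] by simp
  \<comment> \<open>The contribution near the origin is split by Young's inequality:
    \<open>t\<close> keeps the part with \<open>Qf (Z j)\<close> at most \<open>e / 2\<close>, then
    \<open>\<delta>\<close> keeps the weight of the ball of radius \<open>2 * \<delta>\<close> at
    most \<open>e / 2\<close>.\<close>
  define t where "t = e / (2 * (S + 1))"
  have t: "t > 0" unfolding t_def using e S0 by simp
  have tS: "t * S \<le> e / 2" unfolding t_def using e S0 by (simp add: field_simps)
  define A where "A = B\<^sup>2 / t * V * 4 + 1"
  have A: "A > 0" unfolding A_def using t V by (intro add_nonneg_pos mult_nonneg_nonneg divide_nonneg_pos) auto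
  define \<delta> where "\<delta> = sqrt (e / (2 * A))"
  have \<delta>: "\<delta> > 0" unfolding \<delta>_def using e A by simp
  have \<delta>2: "B\<^sup>2 / t * (V * (2 * \<delta>)\<^sup>2) \<le> e / 2"
  proof -
    have "\<delta>\<^sup>2 = e / (2 * A)" unfolding \<delta>_def using e A by simp
    then have "B\<^sup>2 / t * (V * (2 * \<delta>)\<^sup>2) = (A - 1) * (e / (2 * A))" unfolding A_def by (simp add: power_mult_distrib)
    also have "\<dots> \<le> A * (e / (2 * A))" using e A by (intro mult_right_mono) auto
    also have "\<dots> = e / 2" using A by simp
    finally show ?thesis .
  qed
  obtain \<eta> :: "'a \<Rightarrow> real" where \<eta>: "smooth_on UNIV (\<lambda>x. \<eta> x * wgt x)" "\<And>x. 0 \<le> \<eta> x" "\<And>x. \<eta> x \<le> 1"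
    "\<And>x. norm x \<ge> 2 * \<delta> \<Longrightarrow> \<eta> x = 1" and [measurable]: "\<eta> \<in> borel_measurable borel"
    using cutoff_wgt[OF \<delta>] by metis
  note [measurable] = grad_measurable[OF f] test_measurable[OF f]
  \<comment> \<open>The components of \<open>\<eta> * wgt * grad f\<close>: they do not depend on
    \<open>j\<close>, and the derivatives of \<open>Z j\<close> can be shifted onto them.\<close>
  define \<psi> where "\<psi> = (\<lambda>b x. (grad f x \<bullet> b) * (\<eta> x * wgt x))"
  have \<psi>: "\<psi> b \<in> test_functions UNIV" if b: "b \<in> Basis" for b
  proof -
    obtain K where K: "compact K" "\<And>x. x \<notin> K \<Longrightarrow> grad f x = 0" using test_support[OF f] by metis
    have "(\<lambda>x. grad f x \<bullet> b) = (\<lambda>x. frechet_derivative f (at x) b)"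
      by (rule ext) (rule grad_has_derivative(3)[OF smooth_differentiable[OF test_smooth[OF f]] b], simp)
    then have "smooth_on UNIV (\<lambda>x. grad f x \<bullet> b)" using smooth_partial[OF test_smooth[OF f] b] by simp
    then have sm: "smooth_on UNIV (\<psi> b)" unfolding \<psi>_def by (intro smooth_on_mult \<eta>) auto
    have "{x. \<psi> b x \<noteq> 0} \<subseteq> K"
    proof
      fix x assume "x \<in> {x. \<psi> b x \<noteq> 0}"
      then show "x \<in> K" using K(2)[of x] by (cases "x \<in> K") (simp_all add: \<psi>_def)
    qed
    from compact_closure_subset[OF this K(1)] show ?thesis using sm unfolding test_functions_iff_smooth by blast
  qed
  have "(\<lambda>j. \<Sum>b\<in>Basis. - (LBINT x. Z j x * (grad (\<psi> b) x \<bullet> b))) \<longlonglongrightarrow> (\<Sum>b\<in>(Basis::'a set). - 0)"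
  proof (intro tendsto_sum tendsto_minus)
    fix b :: 'a assume b: "b \<in> Basis"
    obtain C where C: "\<And>x. norm (grad (\<psi> b) x) \<le> C" using test_bounded[OF \<psi>[OF b]] by metis
    have "\<bar>grad (\<psi> b) x \<bullet> b\<bar> \<le> C" for x
      using Cauchy_Schwarz_ineq2[of "grad (\<psi> b) x" b] C[of x] b by simp
    then show "(\<lambda>j. \<integral>x. Z j x * (grad (\<psi> b) x \<bullet> b) \<partial>lborel) \<longlonglongrightarrow> 0"
      using grad_measurable[OF \<psi>[OF b]] by (intro pairing_tendsto_0[OF Z R N n2]) auto
  qed
  then have "(\<lambda>j. \<Sum>b\<in>(Basis::'a set). - (LBINT x. Z j x * (grad (\<psi> b) x \<bullet> b))) \<longlonglongrightarrow> 0" by simp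
  then have "\<forall>\<^sub>F j in sequentially. \<bar>\<Sum>b\<in>(Basis::'a set). - (LBINT x. Z j x * (grad (\<psi> b) x \<bullet> b))\<bar> < e / 2"
    using e tendstoD[of _ 0 sequentially "e / 2"] by fastforce
  then obtain M' where M': "\<And>j. j \<ge> M' \<Longrightarrow> \<bar>\<Sum>b\<in>(Basis::'a set). - (LBINT x. Z j x * (grad (\<psi> b) x \<bullet> b))\<bar> < e / 2"
    unfolding eventually_sequentially by blast
  show "\<exists>M. \<forall>j\<ge>M. norm (Bf f (Z j) - 0) < e"
  proof (intro exI[of _ "max M M'"] allI impI)
    fix j assume j: "max M M' \<le> j"
    note [measurable] = grad_measurable[OF Z[of j]]
    let ?p = "\<lambda>x. grad f x \<bullet> grad (Z j) x"
    have iB: "integrable lborel (\<lambda>x. wgt x * ?p x)" by (rule integrable_Q(1)[OF f Z])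
    have sum: "\<eta> x * wgt x * ?p x = (\<Sum>b\<in>Basis. \<psi> b x * (grad (Z j) x \<bullet> b))" for x
      unfolding \<psi>_def by (subst euclidean_inner) (simp add: sum_distrib_left mult_ac)
    have i1: "integrable lborel (\<lambda>x. \<eta> x * wgt x * ?p x)"
      unfolding sum using integration_by_parts(1)[OF Z \<psi>] by (intro Bochner_Integration.integrable_sum) auto
    have first: "(LBINT x. \<eta> x * wgt x * ?p x) = (\<Sum>b\<in>Basis. - (LBINT x. Z j x * (grad (\<psi> b) x \<bullet> b)))"
      unfolding sum using integration_by_parts(1,3)[OF Z \<psi>] by (subst Bochner_Integration.integral_sum) auto
    have i2: "integrable lborel (\<lambda>x. (1 - \<eta> x) * (wgt x * ?p x))"
      using Bochner_Integration.integrable_diff[OF iB i1] by (simp add: algebra_simps)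
    have "2 * \<bar>(1 - \<eta> x) * (wgt x * ?p x)\<bar> \<le> t * (wgt x * (norm (grad (Z j) x))\<^sup>2) + B\<^sup>2 / t * (indicator (ball 0 (2 * \<delta>)) x * wgt x)" for x
    proof (cases "norm x \<ge> 2 * \<delta>")
      case True
      then show ?thesis using \<eta>(4)[OF True] t by simp
    next
      case False
      have "\<bar>?p x\<bar> \<le> norm (grad f x) * norm (grad (Z j) x)" by (rule Cauchy_Schwarz_ineq2)
      also have "\<dots> \<le> B * norm (grad (Z j) x)" by (intro mult_right_mono B) simp
      finally have p: "\<bar>?p x\<bar> \<le> B * norm (grad (Z j) x)" .
      have "0 \<le> (t * norm (grad (Z j) x) - B)\<^sup>2 / t" using t by simp
      then have q: "2 * (B * norm (grad (Z j) x)) \<le> t * (norm (grad (Z j) x))\<^sup>2 + B\<^sup>2 / t"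
        using t by (simp add: power2_eq_square field_simps)
      have "2 * \<bar>(1 - \<eta> x) * (wgt x * ?p x)\<bar> = (1 - \<eta> x) * (wgt x * (2 * \<bar>?p x\<bar>))"
        using \<eta>(3)[of x] by (simp add: abs_mult)
      also have "\<dots> \<le> 1 * (wgt x * (2 * \<bar>?p x\<bar>))" using \<eta>(2)[of x] by (intro mult_right_mono) auto
      also have "\<dots> \<le> wgt x * (t * (norm (grad (Z j) x))\<^sup>2 + B\<^sup>2 / t)"
        using p q by (simp only: mult_1) (intro mult_left_mono, auto)
      finally show ?thesis using False by (simp add: algebra_simps)
    qed
    then have "(LBINT x. 2 * \<bar>(1 - \<eta> x) * (wgt x * ?p x)\<bar>) \<le>
       (LBINT x. t * (wgt x * (norm (grad (Z j) x))\<^sup>2) + B\<^sup>2 / t * (indicator (ball 0 (2 * \<delta>)) x * wgt x))"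
      using i2 integrable_Q(3)[OF Z[of j] Z] integrable_wgt_ball[of "2 * \<delta>", where 'a='a] by (intro integral_mono) auto
    also have "\<dots> = t * Qf (Z j) + B\<^sup>2 / t * (LBINT x. indicator (ball (0::'a) (2 * \<delta>)) x * wgt x)"
      unfolding Qf_def using integrable_Q(3)[OF Z[of j] Z] integrable_wgt_ball[of "2 * \<delta>", where 'a='a] by simp
    also have "\<dots> \<le> t * S + B\<^sup>2 / t * (V * (2 * \<delta>)\<^sup>2)"
      unfolding V_def using t S[of j] j \<delta>
      by (intro add_mono mult_left_mono integral_wgt_ball_le) auto
    also have "\<dots> \<le> e" using tS \<delta>2 by linarith
    finally have "2 * (LBINT x. \<bar>(1 - \<eta> x) * (wgt x * ?p x)\<bar>) \<le> e" by simp
    then have second: "\<bar>\<integral>x. (1 - \<eta> x) * (wgt x * ?p x) \<partial>lborel\<bar> \<le> e / 2"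
      using integral_abs_bound[of lborel "\<lambda>x. (1 - \<eta> x) * (wgt x * ?p x)"] by linarith
    have "Bf f (Z j) = (LBINT x. \<eta> x * wgt x * ?p x + (1 - \<eta> x) * (wgt x * ?p x))"
      unfolding Bf_def by (rule Bochner_Integration.integral_cong) (auto simp: algebra_simps)
    also have "\<dots> = (LBINT x. \<eta> x * wgt x * ?p x) + (LBINT x. (1 - \<eta> x) * (wgt x * ?p x))"
      by (rule Bochner_Integration.integral_add[OF i1 i2])
    finally show "norm (Bf f (Z j) - 0) < e" using second M'[of j] j unfolding first by simp
  qed
qed

text \<open>The form of \<open>Z k\<close> is at most that of \<open>Z k - Z j\<close> plus
  \<open>2 * Bf (Z k) (Z j)\<close>. For fixed \<open>k\<close> the mixed term vanishes as
  \<open>j\<close> tends to infinity, and the first term is small by the Cauchy property.\<close>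

theorem closability:
  fixes Z :: "nat \<Rightarrow> 'a::euclidean_space \<Rightarrow> real"
  assumes Z: "\<And>k. Z k \<in> test_functions (ball 0 R)" and R: "R > 0" and N: "DIM('a) \<ge> 3"
    and n2: "(\<lambda>k. \<integral>x. wgt x * (Z k x * Z k x) \<partial>lborel) \<longlonglongrightarrow> 0"
    and cauchy: "\<forall>e>0. \<exists>M. \<forall>j\<ge>M. \<forall>k\<ge>M. Qf (\<lambda>x. Z j x - Z k x) < e"
  shows "(\<lambda>k. Qf (Z k)) \<longlonglongrightarrow> 0"
proof -
  obtain M where M: "\<And>j k. j \<ge> M \<Longrightarrow> k \<ge> M \<Longrightarrow> Qf (\<lambda>x. Z j x - Z k x) < 1" using cauchy zero_less_one by blast
  have S: "Qf (Z j) \<le> (sqrt (Qf (Z M)) + 1)\<^sup>2" if "j \<ge> M" for j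
  proof -
    have "sqrt (Qf (\<lambda>x. Z j x - Z M x)) \<le> 1" using M[OF that order_refl] by simp
    then have "sqrt (Qf (Z j)) \<le> sqrt (Qf (Z M)) + 1" using sqrt_Qf_triangle[OF Z[of j] Z[of M]] by linarith
    then have "(sqrt (Qf (Z j)))\<^sup>2 \<le> (sqrt (Qf (Z M)) + 1)\<^sup>2" by (rule power_mono) (simp add: Qf_nonneg)
    then show ?thesis by (simp add: Qf_nonneg)
  qed
  show ?thesis
  proof (rule LIMSEQ_I)
    fix e :: real assume e: "e > 0"
    then obtain L where L: "\<And>j k. j \<ge> L \<Longrightarrow> k \<ge> L \<Longrightarrow> Qf (\<lambda>x. Z j x - Z k x) < e / 2" using cauchy by (meson half_gt_zero)
    have "norm (Qf (Z k) - 0) < e" if k: "k \<ge> L" for k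
    proof -
      have B0: "(\<lambda>j. 2 * Bf (Z k) (Z j)) \<longlonglongrightarrow> 2 * 0"
        by (intro tendsto_mult_left Bf_tendsto_0[OF Z R N n2 S Z[of k]])
      have "\<forall>\<^sub>F j in sequentially. Qf (Z k) \<le> e / 2 + 2 * Bf (Z k) (Z j)"
        using eventually_ge_at_top[of L]
      proof eventually_elim
        case (elim j)
        have "Qf (Z k) \<le> Qf (\<lambda>x. Z k x - Z j x) + 2 * Bf (Z k) (Z j)"
          unfolding Qf_diff[OF Z Z] using Qf_nonneg[of "Z j"] by simp
        then show ?case using L[OF k elim] by linarith
      qed
      moreover have "(\<lambda>j. e / 2 + 2 * Bf (Z k) (Z j)) \<longlonglongrightarrow> e / 2 + 2 * 0" by (intro tendsto_add tendsto_const B0)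
      ultimately have "Qf (Z k) \<le> e / 2 + 2 * 0" by (intro tendsto_lowerbound) auto
      then show ?thesis using e Qf_nonneg[of "Z k"] by simp
    qed
    then show "\<exists>L. \<forall>k\<ge>L. norm (Qf (Z k) - 0) < e" by blast
  qed
qed

section \<open>The extended norm\<close>

definition Q_approx :: "real \<Rightarrow> (nat \<Rightarrow> 'a::euclidean_space \<Rightarrow> real) \<Rightarrow> ('a \<Rightarrow> real) \<Rightarrow> bool" where
  "Q_approx R Z u \<longleftrightarrow> (\<forall>k. Z k \<in> test_functions (ball 0 R)) \<and>
     (\<forall>e>0. \<exists>M. \<forall>j\<ge>M. \<forall>k\<ge>M. Qf (\<lambda>x. Z j x - Z k x) < e) \<and>
     (\<lambda>k. \<integral>\<^sup>+x. ennreal ((to_u (Z k) x - u x)\<^sup>2) \<partial>lebesgue_on (ball 0 R)) \<longlonglongrightarrow> 0"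

lemma to_u_diff: "to_u (\<lambda>x. f x - g x) = (\<lambda>x. to_u f x - to_u g x)"
  by (simp add: to_u_def fun_eq_iff right_diff_distrib)

lemma core_norm_sq_diff:
  fixes f g :: "'a::euclidean_space \<Rightarrow> real"
  assumes "f \<in> test_functions (ball 0 R)" "g \<in> test_functions (ball 0 R)" "R > 0" "DIM('a) \<ge> 3"
  shows "core_norm_sq R (\<lambda>x. to_u f x - to_u g x) = Qf (\<lambda>x. f x - g x)"
  unfolding to_u_diff[symmetric] by (rule core_norm_sq_to_u[OF test_functions_diff[OF assms(1,2)] assms(4,3)])

text \<open>Passing from elements of the dense set to their factors replaces the given norm by
  \<open>Qf\<close>; linearity of \<open>to_u\<close> covers the differences in the Cauchy
  condition.\<close>

lemma H_approx_iff:
  fixes u :: "'a::euclidean_space \<Rightarrow> real"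
  assumes R: "R > 0" and N: "DIM('a) \<ge> 3"
  shows "H_approx R X u \<longleftrightarrow> (\<exists>Z. X = (\<lambda>k. to_u (Z k)) \<and> Q_approx R Z u)"
proof
  assume X: "H_approx R X u"
  then have "\<forall>k. \<exists>\<phi>. \<phi> \<in> test_functions (ball 0 R) \<and> X k = to_u \<phi>"
    unfolding H_approx_def H_core_def to_u_def[abs_def] by blast
  then obtain Z where Z: "\<And>k. Z k \<in> test_functions (ball 0 R)" "\<And>k. X k = to_u (Z k)" by metis
  then have e: "X = (\<lambda>k. to_u (Z k))" by auto
  have "Q_approx R Z u"
    using X Z(1) unfolding H_approx_def Q_approx_def e by (simp add: core_norm_sq_diff[OF Z(1) Z(1) R N])
  with e show "\<exists>Z. X = (\<lambda>k. to_u (Z k)) \<and> Q_approx R Z u" by blast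
next
  assume "\<exists>Z. X = (\<lambda>k. to_u (Z k)) \<and> Q_approx R Z u"
  then obtain Z where Z: "X = (\<lambda>k. to_u (Z k))" "Q_approx R Z u" by blast
  then have t: "\<And>k. Z k \<in> test_functions (ball 0 R)" unfolding Q_approx_def by blast
  have "to_u (Z k) \<in> H_core R" for k unfolding H_core_def to_u_def[abs_def] using t[of k] by blast
  then show "H_approx R X u"
    using Z unfolding H_approx_def Q_approx_def Z(1) by (simp add: core_norm_sq_diff[OF t t R N])
qed

lemma test_measurable_lebesgue_on:
  fixes f :: "'a::euclidean_space \<Rightarrow> real"
  assumes "f \<in> borel_measurable borel"
  shows "f \<in> borel_measurable (lebesgue_on S)" "to_u f \<in> borel_measurable (lebesgue_on S)"
proof -
  have "to_u f \<in> borel_measurable borel" unfolding to_u_def[abs_def] using assms by measurable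
  then show "f \<in> borel_measurable (lebesgue_on S)" "to_u f \<in> borel_measurable (lebesgue_on S)"
    using assms by (auto intro!: measurable_restrict_space1 measurable_completion)
qed

text \<open>The difference of two approximating sequences is Cauchy and tends to 0 in mean square,
  so closability makes its form tend to 0. The triangle inequality for \<open>sqrt (Qf _)\<close>
  then identifies the limits.\<close>

lemma Q_approx_unique:
  fixes u :: "'a::euclidean_space \<Rightarrow> real"
  assumes R: "R > 0" and N: "DIM('a) \<ge> 3" and u [measurable]: "u \<in> borel_measurable (lebesgue_on (ball 0 R))"
    and Z: "Q_approx R Z u" "(\<lambda>k. Qf (Z k)) \<longlonglongrightarrow> l" and W: "Q_approx R W u" "(\<lambda>k. Qf (W k)) \<longlonglongrightarrow> m"
  shows "l = m"
proof -
  have tZ: "\<And>k. Z k \<in> test_functions (ball 0 R)" and tW: "\<And>k. W k \<in> test_functions (ball 0 R)"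
    using Z(1) W(1) unfolding Q_approx_def by auto
  define D where "D = (\<lambda>k x. Z k x - W k x)"
  have tD: "\<And>k. D k \<in> test_functions (ball 0 R)" unfolding D_def by (rule test_functions_diff[OF tZ tW])
  have sub: "Qf (\<lambda>x. f x - g x) \<le> 2 * Qf f + 2 * Qf g" if "f \<in> test_functions (ball 0 R)" "g \<in> test_functions (ball 0 R)" for f g :: "'a \<Rightarrow> real"
    unfolding Qf_diff[OF that] using Bf_square_le[OF that, of 1] by simp
  have cauchy: "\<forall>e>0. \<exists>M. \<forall>j\<ge>M. \<forall>k\<ge>M. Qf (\<lambda>x. D j x - D k x) < e"
  proof (intro allI impI)
    fix e :: real assume "e > 0"
    then have e: "e / 4 > 0" by simp
    obtain M1 where M1: "\<And>j k. j \<ge> M1 \<Longrightarrow> k \<ge> M1 \<Longrightarrow> Qf (\<lambda>x. Z j x - Z k x) < e / 4" using Z(1) e unfolding Q_approx_def by blast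
    obtain M2 where M2: "\<And>j k. j \<ge> M2 \<Longrightarrow> k \<ge> M2 \<Longrightarrow> Qf (\<lambda>x. W j x - W k x) < e / 4" using W(1) e unfolding Q_approx_def by blast
    show "\<exists>M. \<forall>j\<ge>M. \<forall>k\<ge>M. Qf (\<lambda>x. D j x - D k x) < e"
    proof (intro exI[of _ "max M1 M2"] allI impI)
      fix j k assume jk: "max M1 M2 \<le> j" "max M1 M2 \<le> k"
      have "(\<lambda>x. D j x - D k x) = (\<lambda>x. (Z j x - Z k x) - (W j x - W k x))" unfolding D_def by auto
      then have "Qf (\<lambda>x. D j x - D k x) \<le> 2 * Qf (\<lambda>x. Z j x - Z k x) + 2 * Qf (\<lambda>x. W j x - W k x)"
        using sub[OF test_functions_diff[OF tZ[of j] tZ[of k]] test_functions_diff[OF tW[of j] tW[of k]]] by simp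
      then show "Qf (\<lambda>x. D j x - D k x) < e" using M1[of j k] M2[of j k] jk by simp
    qed
  qed
  have n2: "(\<lambda>k. \<integral>x. wgt x * (D k x * D k x) \<partial>lborel) \<longlonglongrightarrow> 0"
  proof -
    let ?I = "\<lambda>v. \<integral>\<^sup>+x. ennreal ((v x)\<^sup>2) \<partial>lebesgue_on (ball (0::'a) R)"
    have bound: "ennreal (LBINT x. wgt x * (D k x * D k x)) \<le> 2 * ?I (\<lambda>x. to_u (Z k) x - u x) + 2 * ?I (\<lambda>x. to_u (W k) x - u x)" for k
    proof -
      note [measurable] = test_measurable_lebesgue_on(2)[OF test_measurable[OF tZ[of k]], of "ball 0 R"]
        test_measurable_lebesgue_on(2)[OF test_measurable[OF tW[of k]], of "ball 0 R"]
      have "ennreal (LBINT x. wgt x * (D k x * D k x)) = (\<integral>\<^sup>+x. ennreal (wgt x * (D k x * D k x)) \<partial>lborel)"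
        by (rule nn_integral_eq_integral[OF integrable_Q(2)[OF tD tD], symmetric]) auto
      also have "\<dots> = (\<integral>\<^sup>+x. ennreal ((to_u (D k) x)\<^sup>2) * indicator (ball 0 R) x \<partial>lborel)"
        unfolding to_u_square using test_functions_outside[OF tD[of k]]
        by (intro nn_integral_cong) (auto simp: indicator_def)
      also have "\<dots> = ?I (to_u (D k))" by (rule nn_integral_lebesgue_on_eq[symmetric]) simp
      also have "\<dots> \<le> (\<integral>\<^sup>+x. 2 * ennreal ((to_u (Z k) x - u x)\<^sup>2) + 2 * ennreal ((to_u (W k) x - u x)\<^sup>2) \<partial>lebesgue_on (ball 0 R))"
      proof (rule nn_integral_mono)
        fix x
        have "(to_u (D k) x)\<^sup>2 \<le> 2 * (to_u (Z k) x - u x)\<^sup>2 + 2 * (to_u (W k) x - u x)\<^sup>2"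
        proof -
          have "0 \<le> ((to_u (Z k) x - u x) + (to_u (W k) x - u x))\<^sup>2" by simp
          then show ?thesis unfolding D_def to_u_diff by (simp add: power2_eq_square algebra_simps)
        qed
        then have "ennreal ((to_u (D k) x)\<^sup>2) \<le> ennreal (2 * (to_u (Z k) x - u x)\<^sup>2 + 2 * (to_u (W k) x - u x)\<^sup>2)" by (rule ennreal_leI)
        then show "ennreal ((to_u (D k) x)\<^sup>2) \<le> 2 * ennreal ((to_u (Z k) x - u x)\<^sup>2) + 2 * ennreal ((to_u (W k) x - u x)\<^sup>2)"
          by (simp add: ennreal_plus ennreal_mult)
      qed
      also have "\<dots> = 2 * ?I (\<lambda>x. to_u (Z k) x - u x) + 2 * ?I (\<lambda>x. to_u (W k) x - u x)"
        by (subst nn_integral_add) (auto simp: nn_integral_cmult)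
      finally show ?thesis .
    qed
    have "(\<lambda>k. 2 * ?I (\<lambda>x. to_u (Z k) x - u x) + 2 * ?I (\<lambda>x. to_u (W k) x - u x)) \<longlonglongrightarrow> 2 * 0 + 2 * 0"
      using Z(1) W(1) unfolding Q_approx_def by (intro tendsto_add ennreal_tendsto_cmult) auto
    then have lim: "(\<lambda>k. 2 * ?I (\<lambda>x. to_u (Z k) x - u x) + 2 * ?I (\<lambda>x. to_u (W k) x - u x)) \<longlonglongrightarrow> 0" by simp
    have "(\<lambda>k. ennreal (LBINT x. wgt x * (D k x * D k x))) \<longlonglongrightarrow> 0"
      by (rule tendsto_sandwich[OF _ _ tendsto_const lim]) (use bound in simp_all)
    then show ?thesis by (subst (asm) ennreal_tendsto_0_iff) (auto intro!: integral_nonneg)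
  qed
  have "(\<lambda>k. Qf (D k)) \<longlonglongrightarrow> 0" by (rule closability[OF tD R N n2 cauchy])
  then have "(\<lambda>k. sqrt (Qf (D k))) \<longlonglongrightarrow> sqrt 0" by (intro tendsto_real_sqrt)
  then have s0: "(\<lambda>k. sqrt (Qf (D k))) \<longlonglongrightarrow> 0" by simp
  have "(\<lambda>k. sqrt (Qf (Z k)) - sqrt (Qf (W k))) \<longlonglongrightarrow> 0"
    by (rule Lim_null_comparison[OF always_eventually s0])
      (use sqrt_Qf_triangle[OF tZ tW] in \<open>simp add: D_def\<close>)
  moreover have "(\<lambda>k. sqrt (Qf (Z k)) - sqrt (Qf (W k))) \<longlonglongrightarrow> sqrt l - sqrt m"
    by (intro tendsto_diff tendsto_real_sqrt Z W)
  ultimately have "sqrt l = sqrt m" using LIMSEQ_unique by fastforce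
  then show "l = m" by simp
qed

lemma Q_approx_convergent:
  fixes u :: "'a::euclidean_space \<Rightarrow> real"
  assumes "Q_approx R Z u"
  shows "\<exists>l. (\<lambda>k. Qf (Z k)) \<longlonglongrightarrow> l"
proof -
  have tZ: "\<And>k. Z k \<in> test_functions (ball 0 R)" using assms unfolding Q_approx_def by auto
  have "Cauchy (\<lambda>k. sqrt (Qf (Z k)))"
  proof (rule metric_CauchyI)
    fix e :: real assume e: "e > 0"
    then have "e\<^sup>2 > 0" by simp
    then obtain M where M: "\<And>j k. j \<ge> M \<Longrightarrow> k \<ge> M \<Longrightarrow> Qf (\<lambda>x. Z j x - Z k x) < e\<^sup>2"
      using assms unfolding Q_approx_def by meson
    show "\<exists>M. \<forall>j\<ge>M. \<forall>k\<ge>M. dist (sqrt (Qf (Z j))) (sqrt (Qf (Z k))) < e"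
    proof (intro exI allI impI)
      fix j k assume "M \<le> j" "M \<le> k"
      then have "sqrt (Qf (\<lambda>x. Z j x - Z k x)) < sqrt (e\<^sup>2)" using M by (intro real_sqrt_less_mono) auto
      then show "dist (sqrt (Qf (Z j))) (sqrt (Qf (Z k))) < e"
        using sqrt_Qf_triangle[OF tZ[of j] tZ[of k]] e by (simp add: dist_real_def)
    qed
  qed
  then obtain s where "(\<lambda>k. sqrt (Qf (Z k))) \<longlonglongrightarrow> s" using Cauchy_convergent_iff convergent_def by metis
  then have "(\<lambda>k. (sqrt (Qf (Z k)))\<^sup>2) \<longlonglongrightarrow> s\<^sup>2" by (intro tendsto_power)
  then show ?thesis by (auto simp: Qf_nonneg)
qed

text \<open>With uniqueness of the limit, the definite description in \<open>H_norm_sq\<close> may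
  be evaluated along any one approximating sequence.\<close>

theorem H_norm_sq_eqI:
  fixes u :: "'a::euclidean_space \<Rightarrow> real"
  assumes R: "R > 0" and N: "DIM('a) \<ge> 3" and u: "u \<in> borel_measurable (lebesgue_on (ball 0 R))"
    and Z: "Q_approx R Z u" "(\<lambda>k. Qf (Z k)) \<longlonglongrightarrow> l"
  shows "H_norm_sq R u = l"
  unfolding H_norm_sq_def
proof (rule the_equality)
  have t: "\<And>k. Z k \<in> test_functions (ball 0 R)" using Z(1) unfolding Q_approx_def by blast
  have "H_approx R (\<lambda>k. to_u (Z k)) u" unfolding H_approx_iff[OF R N] using Z(1) by blast
  moreover have "(\<lambda>k. core_norm_sq R (to_u (Z k))) \<longlonglongrightarrow> l" using Z(2) by (simp add: core_norm_sq_to_u[OF t N R])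
  ultimately show "\<exists>X. H_approx R X u \<and> (\<lambda>k. core_norm_sq R (X k)) \<longlonglongrightarrow> l"
    by (intro exI[of _ "\<lambda>k. to_u (Z k)"]) simp
  fix m assume "\<exists>X. H_approx R X u \<and> (\<lambda>k. core_norm_sq R (X k)) \<longlonglongrightarrow> m"
  then obtain W where W: "Q_approx R W u" "(\<lambda>k. core_norm_sq R (to_u (W k))) \<longlonglongrightarrow> m"
    unfolding H_approx_iff[OF R N] by blast
  have "\<And>k. W k \<in> test_functions (ball 0 R)" using W(1) unfolding Q_approx_def by blast
  then have "(\<lambda>k. Qf (W k)) \<longlonglongrightarrow> m" using W(2) by (simp add: core_norm_sq_to_u[OF _ N R])
  then show "m = l" by (rule Q_approx_unique[OF R N u W(1) _ Z])
qed

lemma H_space_approx: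
  fixes u :: "'a::euclidean_space \<Rightarrow> real"
  assumes R: "R > 0" and N: "DIM('a) \<ge> 3" and u: "u \<in> H_space R"
  obtains Z where "Q_approx R Z u" "(\<lambda>k. Qf (Z k)) \<longlonglongrightarrow> H_norm_sq R u"
proof -
  obtain Z where Z: "Q_approx R Z u" using u unfolding H_space_def H_approx_iff[OF R N] by blast
  obtain l where l: "(\<lambda>k. Qf (Z k)) \<longlonglongrightarrow> l" using Q_approx_convergent[OF Z] by blast
  have "H_norm_sq R u = l" by (rule H_norm_sq_eqI[OF R N _ Z l]) (use u in \<open>simp add: H_space_def\<close>)
  with that[OF Z] l show ?thesis by simp
qed

subsection \<open>Reduction to the line\<close>

text \<open>The inverse of \<open>\<tau> = ln (- ln (r / R))\<close>. It is decreasing: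
  \<open>t\<close> tends to infinity at the origin and to minus infinity at the boundary of the
  ball.\<close>

definition rho :: "real \<Rightarrow> real \<Rightarrow> real" where "rho R t = R * exp (- exp t)"

definition lvar :: "real \<Rightarrow> real \<Rightarrow> real" where "lvar R r = ln (- ln (r / R))"

lemma rho_bounds: "R > 0 \<Longrightarrow> 0 < rho R t \<and> rho R t < R"
  by (simp add: rho_def)

lemma lvar_rho: "R > 0 \<Longrightarrow> lvar R (rho R t) = t"
  by (simp add: lvar_def rho_def)

lemma rho_lvar: "0 < r \<Longrightarrow> r < R \<Longrightarrow> rho R (lvar R r) = r"
proof -
  assume r: "0 < r" "r < R"
  then have "ln (r / R) < 0" by simp
  then show ?thesis using r by (simp add: lvar_def rho_def)
qed

lemma rho_antimono: "R > 0 \<Longrightarrow> s \<le> t \<Longrightarrow> rho R t \<le> rho R s"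
  by (simp add: rho_def)

lemma rho_derivative: "(rho R has_real_derivative - (rho R t * exp t)) (at t)"
  unfolding rho_def[abs_def] by (auto intro!: derivative_eq_intros)

lemma continuous_rho: "continuous_on S (rho R)"
  unfolding rho_def[abs_def] by (intro continuous_intros)

lemma rho_measurable [measurable]: "rho R \<in> borel_measurable borel"
  by (rule borel_measurable_continuous_onI[OF continuous_rho])

lemma lvar_measurable [measurable]: "lvar R \<in> borel_measurable borel"
  unfolding lvar_def[abs_def] by measurable

text \<open>\<open>rho R t * exp t\<close> is the absolute value of the derivative of
  \<open>rho R\<close>. Its boundedness controls the derivative along a ray as well as mean squares
  over the ball.\<close>

lemma rho_exp_le: "R > 0 \<Longrightarrow> rho R t * exp t \<le> R"
proof -
  assume R: "R > 0"
  have "t \<le> exp t" using exp_ge_add_one_self[of t] by linarith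
  then have "exp (t - exp t) \<le> 1" by simp
  then have "R * exp (t - exp t) \<le> R" using R by simp
  moreover have "exp (t - exp t) = exp (- exp t) * exp t" by (simp add: exp_add[symmetric])
  ultimately show ?thesis by (simp add: rho_def mult.assoc)
qed

lemma rho_interval:
  assumes "R > 0"
  shows "r \<in> {0<..<R} \<longleftrightarrow> (\<exists>n::nat. rho R (real n) \<le> r \<and> r \<le> rho R (- real n))"
proof
  assume r: "r \<in> {0<..<R}"
  obtain n :: nat where n: "\<bar>lvar R r\<bar> \<le> real n" using real_arch_simple by blast
  have "rho R (real n) \<le> rho R (lvar R r)" "rho R (lvar R r) \<le> rho R (- real n)"
    using n by (intro rho_antimono assms; linarith)+
  then show "\<exists>n::nat. rho R (real n) \<le> r \<and> r \<le> rho R (- real n)" using rho_lvar r by auto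
next
  assume "\<exists>n::nat. rho R (real n) \<le> r \<and> r \<le> rho R (- real n)"
  then show "r \<in> {0<..<R}" using rho_bounds[OF assms] by (auto intro: less_le_trans le_less_trans)
qed

abbreviation ray_pt :: "real \<Rightarrow> 'a::euclidean_space \<Rightarrow> real \<Rightarrow> 'a" where
  "ray_pt R \<xi> t \<equiv> rho R t *\<^sub>R sgn \<xi>"

abbreviation ray_density :: "real \<Rightarrow> ('a::euclidean_space \<Rightarrow> real) \<Rightarrow> 'a \<Rightarrow> real \<Rightarrow> real" where
  "ray_density R f \<xi> t \<equiv> real DIM('a) * (exp t * (rho R t)\<^sup>2 * (norm (grad f (ray_pt R \<xi> t)))\<^sup>2)"

lemma nn_polar_rho:
  fixes F :: "'a::euclidean_space \<Rightarrow> ennreal"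
  assumes F [measurable]: "F \<in> borel_measurable borel" and R: "R > 0"
  shows "(\<integral>\<^sup>+x. F x * indicator (ball 0 R - {0}) x \<partial>lborel) = (\<integral>\<^sup>+\<xi>. indicator pball \<xi> *
     (\<integral>\<^sup>+t. ennreal (real DIM('a) * rho R t ^ DIM('a) * exp t) * F (ray_pt R \<xi> t) \<partial>lborel) \<partial>lborel)"
proof -
  let ?n = "DIM('a)"
  have [measurable]: "ball (0::'a) R - {0} \<in> sets borel" by (simp add: borel_open)
  have "(\<integral>\<^sup>+x. F x * indicator (ball 0 R - {0}) x \<partial>lborel) =
     (\<integral>\<^sup>+\<xi>. indicator pball \<xi> * (\<integral>\<^sup>+r. indicator {0<..} r * ennreal (real ?n * r ^ (?n - 1)) *
       (F (r *\<^sub>R sgn \<xi>) * indicator (ball 0 R - {0}) (r *\<^sub>R sgn \<xi>)) \<partial>lborel) \<partial>lborel)"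
    by (rule nn_integral_polar') measurable
  also have "\<dots> = (\<integral>\<^sup>+\<xi>. indicator pball \<xi> *
     (\<integral>\<^sup>+t. ennreal (real ?n * rho R t ^ ?n * exp t) * F (ray_pt R \<xi> t) \<partial>lborel) \<partial>lborel)"
  proof (rule nn_integral_cong)
    fix \<xi> :: 'a
    show "indicator pball \<xi> * (\<integral>\<^sup>+r. indicator {0<..} r * ennreal (real ?n * r ^ (?n - 1)) *
       (F (r *\<^sub>R sgn \<xi>) * indicator (ball 0 R - {0}) (r *\<^sub>R sgn \<xi>)) \<partial>lborel) = indicator pball \<xi> *
     (\<integral>\<^sup>+t. ennreal (real ?n * rho R t ^ ?n * exp t) * F (ray_pt R \<xi> t) \<partial>lborel)"
    proof (cases "\<xi> \<in> pball")
      case True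
      let ?G = "\<lambda>r. ennreal (real ?n * r ^ (?n - 1)) * F (r *\<^sub>R sgn \<xi>)"
      have "(\<integral>\<^sup>+r. indicator {0<..} r * ennreal (real ?n * r ^ (?n - 1)) *
         (F (r *\<^sub>R sgn \<xi>) * indicator (ball 0 R - {0}) (r *\<^sub>R sgn \<xi>)) \<partial>lborel) = (\<integral>\<^sup>+r. ?G r * indicator {0<..<R} r \<partial>lborel)"
      proof (rule nn_integral_cong)
        fix r :: real
        show "indicator {0<..} r * ennreal (real ?n * r ^ (?n - 1)) *
         (F (r *\<^sub>R sgn \<xi>) * indicator (ball 0 R - {0}) (r *\<^sub>R sgn \<xi>)) = ?G r * indicator {0<..<R} r"
        proof (cases "r > 0")
          case r: True
          have "r *\<^sub>R sgn \<xi> \<in> ball 0 R - {0} \<longleftrightarrow> r < R"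
            using norm_pball[OF True r] r by (metis DiffI Diff_iff dist_0_norm empty_iff insert_iff mem_ball norm_zero less_irrefl)
          then show ?thesis using r by (simp add: indicator_def)
        qed simp
      qed
      also have "\<dots> = (\<integral>\<^sup>+t. ?G (rho R t) * ennreal (- (- (rho R t * exp t))) \<partial>lborel)"
      proof (rule nn_integral_substitution_decreasing[OF _ rho_derivative _ _ rho_interval[OF R]])
        show "continuous_on UNIV (\<lambda>t. - (rho R t * exp t))" by (intro continuous_intros continuous_rho)
        show "- (rho R t * exp t) \<le> 0" for t using rho_bounds[OF R, of t] by simp
      qed measurable
      also have "\<dots> = (\<integral>\<^sup>+t. ennreal (real ?n * rho R t ^ ?n * exp t) * F (ray_pt R \<xi> t) \<partial>lborel)"
      proof (rule nn_integral_cong)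
        fix t
        have "rho R t * rho R t ^ (?n - 1) = rho R t ^ ?n" by (metis power_Suc Suc_diff_1 DIM_positive)
        then have "real ?n * rho R t ^ (?n - 1) * (rho R t * exp t) = real ?n * rho R t ^ ?n * exp t" by (simp add: mult_ac)
        then have "ennreal (real ?n * rho R t ^ (?n - 1)) * ennreal (rho R t * exp t) = ennreal (real ?n * rho R t ^ ?n * exp t)"
          using rho_bounds[OF R, of t] by (subst ennreal_mult'[symmetric]) auto
        then have "ennreal (real ?n * rho R t ^ (?n - 1)) * ennreal (rho R t * exp t) * X = ennreal (real ?n * rho R t ^ ?n * exp t) * X" for X by simp
        from this[of "F (ray_pt R \<xi> t)"]
        show "?G (rho R t) * ennreal (- (- (rho R t * exp t))) = ennreal (real ?n * rho R t ^ ?n * exp t) * F (ray_pt R \<xi> t)"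
          by (simp add: mult_ac)
      qed
      finally show ?thesis by simp
    qed simp
  qed
  finally show ?thesis .
qed

lemma nn_polar_rho_ball:
  fixes F :: "'a::euclidean_space \<Rightarrow> ennreal"
  assumes [measurable]: "F \<in> borel_measurable borel" and R: "R > 0"
  shows "(\<integral>\<^sup>+x. F x \<partial>lebesgue_on (ball 0 R)) = (\<integral>\<^sup>+\<xi>. indicator pball \<xi> *
     (\<integral>\<^sup>+t. ennreal (real DIM('a) * rho R t ^ DIM('a) * exp t) * F (ray_pt R \<xi> t) \<partial>lborel) \<partial>lborel)"
proof -
  have "(\<integral>\<^sup>+x. F x \<partial>lebesgue_on (ball 0 R)) = (\<integral>\<^sup>+x. F x * indicator (ball 0 R) x \<partial>lborel)"
    by (rule nn_integral_lebesgue_on_eq) simp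
  also have "\<dots> = (\<integral>\<^sup>+x. F x * indicator (ball 0 R - {0}) x \<partial>lborel)"
    by (rule nn_integral_cong_AE, rule AE_mp[OF AE_lborel_singleton[of "0::'a"]], rule AE_I2) (auto simp: indicator_def)
  finally show ?thesis unfolding nn_polar_rho[OF assms] .
qed

text \<open>The density in \<open>nn_polar_rho\<close> is positive, so a null set of points gives a
  null set of parameters on almost every ray.\<close>

lemma AE_rays:
  fixes P :: "'a::euclidean_space \<Rightarrow> bool"
  assumes P: "AE x in lborel. P x" and R: "R > 0"
  shows "AE \<xi> in lborel. \<xi> \<in> pball \<longrightarrow> (AE t in lborel. P (ray_pt R \<xi> t))"
proof -
  obtain N where N: "{x. \<not> P x} \<subseteq> N" "emeasure lborel N = 0" and [measurable]: "N \<in> sets borel"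
    using AE_E[OF P] by auto
  have [measurable]: "ball (0::'a) R - {0} \<in> sets borel" by (simp add: borel_open)
  let ?I = "\<lambda>\<xi>. \<integral>\<^sup>+t. ennreal (real DIM('a) * rho R t ^ DIM('a) * exp t) * indicator N (ray_pt R \<xi> t) \<partial>lborel"
  have [measurable]: "(\<lambda>x::'a \<times> real. indicator N (rho R (snd x) *\<^sub>R sgn (fst x)) :: ennreal) \<in> jointly_measurable"
    by (rule measurable_compose[where N=borel and g="indicator N"]) measurable
  have [measurable]: "?I \<in> borel_measurable lborel"
    by (rule lborel.borel_measurable_nn_integral) (unfold case_prod_beta, measurable)
  have "(\<integral>\<^sup>+\<xi>. indicator (pball::'a set) \<xi> * ?I \<xi> \<partial>lborel) = (\<integral>\<^sup>+x. indicator N x * indicator (ball 0 R - {0}) x \<partial>lborel)"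
    by (rule nn_polar_rho[symmetric, OF _ R]) measurable
  also have "\<dots> \<le> (\<integral>\<^sup>+x. indicator N x \<partial>lborel)" by (intro nn_integral_mono) (auto simp: indicator_def)
  also have "\<dots> = 0" using N(2) by simp
  finally have "AE \<xi> in lborel. indicator (pball::'a set) \<xi> * ?I \<xi> = 0"
    by (subst nn_integral_0_iff_AE[symmetric]) auto
  then show ?thesis
  proof eventually_elim
    case (elim \<xi>)
    show ?case
    proof
      assume "\<xi> \<in> pball"
      with elim have "?I \<xi> = 0" by simp
      then have "AE t in lborel. ennreal (real DIM('a) * rho R t ^ DIM('a) * exp t) * indicator N (ray_pt R \<xi> t) = 0"
        by (subst (asm) nn_integral_0_iff_AE) auto
      then show "AE t in lborel. P (ray_pt R \<xi> t)"
      proof eventually_elim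
        case (elim t)
        have "ennreal (real DIM('a) * rho R t ^ DIM('a) * exp t) \<noteq> 0" using rho_bounds[OF R, of t] by simp
        with elim have "ray_pt R \<xi> t \<notin> N" by (auto simp: indicator_def split: if_splits)
        then show ?case using N(1) by blast
      qed
    qed
  qed
qed

text \<open>The converse for conditions on the radius alone: the same null set of parameters occurs
  on every ray.\<close>

lemma AE_from_line:
  assumes P: "AE t in lborel. P t" and R: "R > 0"
  shows "AE x in lborel. x \<in> ball (0::'a::euclidean_space) R - {0} \<longrightarrow> P (lvar R (norm x))"
proof -
  obtain N where N: "{x. \<not> P x} \<subseteq> N" "emeasure lborel N = 0" and [measurable]: "N \<in> sets borel"
    using AE_E[OF P] by auto
  have [measurable]: "ball (0::'a) R - {0} \<in> sets borel" by (simp add: borel_open)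
  have [measurable]: "(\<lambda>x::'a. indicator N (lvar R (norm x)) :: ennreal) \<in> borel_measurable borel"
    by (rule measurable_compose[where N=borel and g="indicator N"]) measurable
  have "(\<integral>\<^sup>+x. indicator N (lvar R (norm (x::'a))) * indicator (ball 0 R - {0}) x \<partial>lborel) =
    (\<integral>\<^sup>+\<xi>. indicator (pball::'a set) \<xi> * (\<integral>\<^sup>+t. ennreal (real DIM('a) * rho R t ^ DIM('a) * exp t) * indicator N (lvar R (norm (ray_pt R \<xi> t))) \<partial>lborel) \<partial>lborel)"
    by (rule nn_polar_rho[OF _ R]) measurable
  also have "\<dots> = (\<integral>\<^sup>+\<xi>. 0 \<partial>(lborel :: 'a measure))"
  proof (rule nn_integral_cong)
    fix \<xi> :: 'a
    show "indicator pball \<xi> * (\<integral>\<^sup>+t. ennreal (real DIM('a) * rho R t ^ DIM('a) * exp t) * indicator N (lvar R (norm (ray_pt R \<xi> t))) \<partial>lborel) = 0"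
    proof (cases "\<xi> \<in> pball")
      case True
      have e: "lvar R (norm (ray_pt R \<xi> t)) = t" for t using norm_pball[OF True, of "rho R t"] rho_bounds[OF R, of t] lvar_rho[OF R] by simp
      have "AE t in lborel. t \<notin> N" using N(2) by (intro AE_not_in) (simp add: null_sets_def)
      then have "AE t in lborel. ennreal (real DIM('a) * rho R t ^ DIM('a) * exp t) * indicator N t = 0"
        by eventually_elim simp
      then show ?thesis unfolding e by (subst nn_integral_0_iff_AE[THEN iffD2]) auto
    qed simp
  qed
  finally have "AE x in lborel. indicator N (lvar R (norm (x::'a))) * indicator (ball 0 R - {0}) x = (0::ennreal)"
    by (subst nn_integral_0_iff_AE[symmetric]) auto
  then show ?thesis
    by eventually_elim (use N(1) in \<open>auto simp: indicator_def split: if_splits\<close>)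
qed

section \<open>Restriction to rays\<close>

definition ray :: "real \<Rightarrow> ('a::euclidean_space \<Rightarrow> real) \<Rightarrow> 'a \<Rightarrow> real \<Rightarrow> real" where
  "ray R f \<xi> t = exp (- t / 2) * f (ray_pt R \<xi> t)"

definition ray' :: "real \<Rightarrow> ('a::euclidean_space \<Rightarrow> real) \<Rightarrow> 'a \<Rightarrow> real \<Rightarrow> real" where
  "ray' R f \<xi> t = - (exp (- t / 2) * (rho R t * exp t) * (sgn \<xi> \<bullet> grad f (ray_pt R \<xi> t))) - ray R f \<xi> t / 2"

lemma ray_derivative:
  assumes "f \<in> test_functions S"
  shows "(ray R f \<xi> has_real_derivative ray' R f \<xi> t) (at t)"
proof -
  have 1: "((\<lambda>t. f (ray_pt R \<xi> t)) has_real_derivative (sgn \<xi> \<bullet> grad f (ray_pt R \<xi> t)) * - (rho R t * exp t)) (at t)"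
    by (rule DERIV_chain2[OF radial_derivative[OF assms] rho_derivative])
  have 2: "((\<lambda>t. exp (- t / 2)) has_real_derivative - (1 / 2) * exp (- t / 2)) (at t)"
    by (auto intro!: derivative_eq_intros)
  show ?thesis unfolding ray_def[abs_def] ray'_def
    by (rule DERIV_cong[OF DERIV_mult[OF 2 1]]) (simp add: algebra_simps)
qed

lemma ray_diff:
  assumes "f \<in> test_functions S" "g \<in> test_functions S"
  shows "ray R (\<lambda>x. f x - g x) \<xi> t = ray R f \<xi> t - ray R g \<xi> t"
    and "ray' R (\<lambda>x. f x - g x) \<xi> t = ray' R f \<xi> t - ray' R g \<xi> t"
  unfolding ray'_def ray_def grad_diff[OF assms] by (simp_all add: inner_diff_right algebra_simps diff_divide_distrib)

lemma test_support_radius: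
  fixes f :: "'a::euclidean_space \<Rightarrow> real"
  assumes f: "f \<in> test_functions (ball 0 R)" and R: "R > 0"
  obtains b where "0 < b" "b < R" "\<And>x. norm x > b \<Longrightarrow> f x = 0 \<and> grad f x = 0"
proof -
  obtain K where K: "compact K" "K \<subseteq> ball 0 R" "\<And>x. x \<notin> K \<Longrightarrow> f x = 0" "\<And>x. x \<notin> K \<Longrightarrow> grad f x = 0"
    using test_support[OF f] by metis
  have "\<exists>b. 0 < b \<and> b < R \<and> (\<forall>x\<in>K. norm x \<le> b)"
  proof (cases "K = {}")
    case True
    then show ?thesis using R by (intro exI[of _ "R / 2"]) simp
  next
    case False
    have "continuous_on K norm" by (intro continuous_intros)
    then obtain p where p: "p \<in> K" "\<And>x. x \<in> K \<Longrightarrow> norm x \<le> norm p"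
      using continuous_attains_sup[OF K(1) False] by blast
    have "norm p < R" using p(1) K(2) by auto
    then show ?thesis using p(2) R by (intro exI[of _ "max (norm p) (R / 2)"]) (auto intro: le_max_iff_disj[THEN iffD2])
  qed
  then obtain b where b: "0 < b" "b < R" "\<And>x. x \<in> K \<Longrightarrow> norm x \<le> b" by blast
  have "f x = 0 \<and> grad f x = 0" if "norm x > b" for x
  proof -
    have "x \<notin> K" using b(3)[of x] that by auto
    then show ?thesis using K(3,4)[of x] by simp
  qed
  then show ?thesis using that[OF b(1,2)] by blast
qed

text \<open>The factor \<open>exp (- t / 2)\<close> gives the decay to the right, the vanishing of
  \<open>k\<close> before \<open>- T\<close> the decay to the left, and \<open>exp T\<close> absorbs
  the interval from \<open>- T\<close> to 0. This form serves the rays of (A) and of (B)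
  alike.\<close>

lemma line_fun_exp_half:
  fixes k k' :: "real \<Rightarrow> real"
  assumes d: "\<And>t. ((\<lambda>t. exp (- t / 2) * k t) has_real_derivative exp (- t / 2) * (k' t - k t / 2)) (at t)"
    and c: "continuous_on UNIV k" "continuous_on UNIV k'"
    and B: "\<And>t. \<bar>k t\<bar> \<le> B" "\<And>t. \<bar>k' t\<bar> \<le> B" and z: "\<And>t. t < - T \<Longrightarrow> k t = 0 \<and> k' t = 0" and T: "T \<ge> 0"
  shows "line_fun (\<lambda>t. exp (- t / 2) * k t) (\<lambda>t. exp (- t / 2) * (k' t - k t / 2))"
  unfolding line_fun_def
proof (intro conjI allI exI)
  show "continuous_on UNIV (\<lambda>t. exp (- t / 2) * (k' t - k t / 2))" by (intro continuous_intros c) auto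
  fix t
  have b: "\<bar>exp (- t / 2) * x\<bar> \<le> 2 * B * exp T * exp (- \<bar>t\<bar> / 2)" if "\<bar>x\<bar> \<le> 2 * B" "t < - T \<Longrightarrow> x = 0" for x
  proof (cases "t < - T")
    case True
    then show ?thesis using that order_trans[OF abs_ge_zero that(1)] by simp
  next
    case False
    then have "exp (- t / 2) \<le> exp (T + - \<bar>t\<bar> / 2)" using T unfolding exp_le_cancel_iff by (cases "t \<ge> 0") auto
    then have "exp (- t / 2) \<le> exp T * exp (- \<bar>t\<bar> / 2)" unfolding exp_add .
    from mult_mono[OF this that(1)] show ?thesis by (simp add: abs_mult mult_ac)
  qed
  show "\<bar>exp (- t / 2) * k t\<bar> \<le> 2 * B * exp T * exp (- \<bar>t\<bar> / 2)"
    by (rule b) (use B(1)[of t] z[of t] in auto)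
  show "\<bar>exp (- t / 2) * (k' t - k t / 2)\<bar> \<le> 2 * B * exp T * exp (- \<bar>t\<bar> / 2)"
    by (rule b) (use B(1)[of t] B(2)[of t] z[of t] in auto)
qed (rule d)

lemma line_fun_ray:
  fixes f :: "'a::euclidean_space \<Rightarrow> real"
  assumes f: "f \<in> test_functions (ball 0 R)" and R: "R > 0" and \<xi>: "\<xi> \<in> pball"
  shows "line_fun (ray R f \<xi>) (ray' R f \<xi>)"
proof -
  let ?k = "\<lambda>t. f (ray_pt R \<xi> t)" and ?k' = "\<lambda>t. - ((rho R t * exp t) * (sgn \<xi> \<bullet> grad f (ray_pt R \<xi> t)))"
  have ray: "ray R f \<xi> = (\<lambda>t. exp (- t / 2) * ?k t)" "ray' R f \<xi> = (\<lambda>t. exp (- t / 2) * (?k' t - ?k t / 2))"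
    by (rule ext, simp add: ray'_def ray_def right_diff_distrib mult.assoc)+
  obtain B where B: "B \<ge> 0" "\<And>x. \<bar>f x\<bar> \<le> B" "\<And>x. norm (grad f x) \<le> B" using test_bounded[OF f] by metis
  obtain b where b: "0 < b" "b < R" "\<And>x. norm x > b \<Longrightarrow> f x = 0 \<and> grad f x = 0" using test_support_radius[OF f R] by metis
  have ns: "norm (sgn \<xi>) = 1" using \<xi> by (simp add: norm_sgn)
  show ?thesis unfolding ray
  proof (rule line_fun_exp_half[where B = "max 1 R * B" and T = "\<bar>lvar R b\<bar>"])
    show "((\<lambda>t. exp (- t / 2) * ?k t) has_real_derivative exp (- t / 2) * (?k' t - ?k t / 2)) (at t)" for t
      using ray_derivative[OF f, of R \<xi> t] unfolding ray .
    show "continuous_on UNIV ?k" "continuous_on UNIV ?k'"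
      by (intro continuous_intros continuous_rho continuous_on_compose2[OF continuous_on_grad[OF f, of UNIV]]
        continuous_on_compose2[OF test_continuous[OF f, of UNIV]]; simp)+
    show "\<bar>?k t\<bar> \<le> max 1 R * B" for t
      using B(2)[of "ray_pt R \<xi> t"] mult_right_mono[of 1 "max 1 R" B] B(1) by simp
    show "\<bar>?k' t\<bar> \<le> max 1 R * B" for t
    proof -
      have "\<bar>sgn \<xi> \<bullet> grad f (ray_pt R \<xi> t)\<bar> \<le> B"
        using Cauchy_Schwarz_ineq2[of "sgn \<xi>" "grad f (ray_pt R \<xi> t)"] B(3)[of "ray_pt R \<xi> t"] ns by simp
      moreover have "\<bar>rho R t * exp t\<bar> \<le> max 1 R" using rho_exp_le[OF R, of t] rho_bounds[OF R, of t] by simp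
      ultimately show ?thesis unfolding abs_minus_cancel abs_mult[of "rho R t * exp t"] by (intro mult_mono) auto
    qed
    show "?k t = 0 \<and> ?k' t = 0" if "t < - \<bar>lvar R b\<bar>" for t
    proof -
      have "rho R (lvar R b) < rho R t" using that R unfolding rho_def by simp
      then have "norm (ray_pt R \<xi> t) > b" using rho_lvar[OF b(1,2)] rho_bounds[OF R, of t] ns by simp
      from b(3)[OF this] show ?thesis by simp
    qed
  qed simp
qed

lemma ray_energy_density:
  "(ray' R f \<xi> t + ray R f \<xi> t / 2)\<^sup>2 = exp t * (rho R t)\<^sup>2 * (sgn \<xi> \<bullet> grad f (ray_pt R \<xi> t))\<^sup>2"
proof -
  have "exp (- t / 2) * exp (- t / 2) * (exp t * exp t) = exp t" by (simp add: exp_add[symmetric])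
  then have "exp (- t / 2) * exp (- t / 2) * (exp t * exp t) * X = exp t * X" for X by simp
  from this[of "(rho R t)\<^sup>2 * (sgn \<xi> \<bullet> grad f (ray_pt R \<xi> t))\<^sup>2"]
  show ?thesis unfolding ray'_def by (simp add: power2_eq_square mult_ac)
qed

lemma rho_wgt:
  assumes R: "R > 0" and \<xi>: "(\<xi>::'a::euclidean_space) \<in> pball"
  shows "rho R t ^ DIM('a) * wgt (ray_pt R \<xi> t) = (rho R t)\<^sup>2"
proof -
  have r: "rho R t > 0" using rho_bounds[OF R, of t] by simp
  have "rho R t ^ DIM('a) = rho R t powr real DIM('a)" using r by (simp add: powr_realpow)
  then have "rho R t ^ DIM('a) * wgt (ray_pt R \<xi> t) = rho R t powr (real DIM('a) + (2 - real DIM('a)))"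
    unfolding wgt_def norm_pball[OF \<xi> r] powr_add by simp
  also have "real DIM('a) + (2 - real DIM('a)) = 2" by simp
  finally show ?thesis using r by simp
qed

lemma nn_energy: "line_fun h h' \<Longrightarrow> (\<integral>\<^sup>+t. ennreal ((h' t + h t / 2)\<^sup>2) \<partial>lborel) = ennreal (energy h h')"
  unfolding energy_def by (rule nn_integral_eq_integral[OF line_fun_integrable(1)]) auto

lemma nn_Q:
  fixes f :: "'a::euclidean_space \<Rightarrow> real"
  assumes f: "f \<in> test_functions (ball 0 R)" and R: "R > 0"
  shows "ennreal (Qf f) = (\<integral>\<^sup>+\<xi>. indicator pball \<xi> * (\<integral>\<^sup>+t. ennreal (ray_density R f \<xi> t) \<partial>lborel) \<partial>lborel)"
proof -
  note [measurable] = grad_measurable[OF f]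
  have "ennreal (Qf f) = (\<integral>\<^sup>+x. ennreal (wgt x * (norm (grad f x))\<^sup>2) \<partial>lborel)"
    unfolding Qf_def by (rule nn_integral_eq_integral[OF integrable_Q(3)[OF f f], symmetric]) auto
  also have "\<dots> = (\<integral>\<^sup>+x. ennreal (wgt x * (norm (grad f x))\<^sup>2) * indicator (ball 0 R - {0}) x \<partial>lborel)"
  proof (rule nn_integral_cong_AE, rule AE_mp[OF AE_lborel_singleton[of "0::'a"]], rule AE_I2, rule impI)
    fix x :: 'a assume "x \<noteq> 0"
    have "x \<notin> ball 0 R \<Longrightarrow> grad f x = 0" using test_support[OF f] by (metis subsetD)
    then show "ennreal (wgt x * (norm (grad f x))\<^sup>2) = ennreal (wgt x * (norm (grad f x))\<^sup>2) * indicator (ball 0 R - {0}) x"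
      using \<open>x \<noteq> 0\<close> by (cases "x \<in> ball 0 R") auto
  qed
  also have "\<dots> = (\<integral>\<^sup>+\<xi>. indicator pball \<xi> * (\<integral>\<^sup>+t. ennreal (real DIM('a) * rho R t ^ DIM('a) * exp t) *
      ennreal (wgt (ray_pt R \<xi> t) * (norm (grad f (ray_pt R \<xi> t)))\<^sup>2) \<partial>lborel) \<partial>lborel)"
    by (rule nn_polar_rho[OF _ R]) measurable
  also have "\<dots> = (\<integral>\<^sup>+\<xi>. indicator pball \<xi> * (\<integral>\<^sup>+t. ennreal (ray_density R f \<xi> t) \<partial>lborel) \<partial>lborel)"
  proof (rule nn_integral_cong)
    fix \<xi> :: 'a
    show "indicator pball \<xi> * (\<integral>\<^sup>+t. ennreal (real DIM('a) * rho R t ^ DIM('a) * exp t) *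
      ennreal (wgt (ray_pt R \<xi> t) * (norm (grad f (ray_pt R \<xi> t)))\<^sup>2) \<partial>lborel) =
      indicator pball \<xi> * (\<integral>\<^sup>+t. ennreal (ray_density R f \<xi> t) \<partial>lborel)"
    proof (cases "\<xi> \<in> pball")
      case True
      have "ennreal (real DIM('a) * rho R t ^ DIM('a) * exp t) * ennreal (wgt (ray_pt R \<xi> t) * X\<^sup>2) = ennreal (real DIM('a) * (exp t * (rho R t)\<^sup>2 * X\<^sup>2))" for t X
        unfolding rho_wgt[OF R True, symmetric] using rho_bounds[OF R, of t]
        by (subst ennreal_mult'[symmetric]) (auto simp: mult_ac)
      then show ?thesis by simp
    qed simp
  qed
  finally show ?thesis .
qed

text \<open>Only the component of the gradient along a ray enters its energy, so the other
  components are dropped. For radial functions nothing is lost, which is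
  \<open>Q_radial\<close>.\<close>

lemma energy_rays_le:
  fixes f :: "'a::euclidean_space \<Rightarrow> real"
  assumes f: "f \<in> test_functions (ball 0 R)" and R: "R > 0"
  shows "(\<integral>\<^sup>+\<xi>. indicator pball \<xi> * ennreal (real DIM('a) * energy (ray R f \<xi>) (ray' R f \<xi>)) \<partial>lborel) \<le> ennreal (Qf f)"
  unfolding nn_Q[OF assms]
proof (rule nn_integral_mono)
  fix \<xi> :: 'a
  show "indicator pball \<xi> * ennreal (real DIM('a) * energy (ray R f \<xi>) (ray' R f \<xi>)) \<le>
    indicator pball \<xi> * (\<integral>\<^sup>+t. ennreal (ray_density R f \<xi> t) \<partial>lborel)"
  proof (cases "\<xi> \<in> pball")
    case True
    note lf = line_fun_ray[OF f R True]
    note [measurable] = line_fun_measurable[OF lf]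
    have ns: "norm (sgn \<xi>) = 1" using True by (simp add: norm_sgn)
    have "ennreal (real DIM('a) * energy (ray R f \<xi>) (ray' R f \<xi>)) = (\<integral>\<^sup>+t. ennreal (real DIM('a)) * ennreal ((ray' R f \<xi> t + ray R f \<xi> t / 2)\<^sup>2) \<partial>lborel)"
      by (subst nn_integral_cmult) (auto simp: nn_energy[OF lf] ennreal_mult' energy_nonneg)
    also have "\<dots> \<le> (\<integral>\<^sup>+t. ennreal (ray_density R f \<xi> t) \<partial>lborel)"
    proof (rule nn_integral_mono)
      fix t
      have "\<bar>sgn \<xi> \<bullet> grad f (ray_pt R \<xi> t)\<bar> \<le> norm (grad f (ray_pt R \<xi> t))"
        using Cauchy_Schwarz_ineq2[of "sgn \<xi>" "grad f (ray_pt R \<xi> t)"] ns by simp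
      then have "(sgn \<xi> \<bullet> grad f (ray_pt R \<xi> t))\<^sup>2 \<le> (norm (grad f (ray_pt R \<xi> t)))\<^sup>2"
        using abs_le_square_iff[of "sgn \<xi> \<bullet> grad f (ray_pt R \<xi> t)" "norm (grad f (ray_pt R \<xi> t))"] by simp
      then have "real DIM('a) * (exp t * (rho R t)\<^sup>2 * (sgn \<xi> \<bullet> grad f (ray_pt R \<xi> t))\<^sup>2) \<le> ray_density R f \<xi> t"
        by (intro mult_left_mono) auto
      then show "ennreal (real DIM('a)) * ennreal ((ray' R f \<xi> t + ray R f \<xi> t / 2)\<^sup>2) \<le> ennreal (ray_density R f \<xi> t)"
        unfolding ray_energy_density by (simp add: ennreal_mult'[symmetric] ennreal_leI)
    qed
    finally show ?thesis using True by simp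
  qed simp
qed

lemma radial_grad:
  fixes f :: "'a::euclidean_space \<Rightarrow> real"
  assumes f: "f \<in> test_functions S" and r: "radial f" and e: "norm e = 1" and x: "x \<noteq> 0"
  shows "grad f x = (e \<bullet> grad f (norm x *\<^sub>R e)) *\<^sub>R (x /\<^sub>R norm x)"
proof (rule grad_eqI)
  have dn: "(norm has_derivative (\<lambda>h. h \<bullet> (x /\<^sub>R norm x))) (at x)"
    using has_derivative_norm[OF x] by (simp add: sgn_div_norm)
  have "((\<lambda>r. f (r *\<^sub>R e)) has_derivative (*) (e \<bullet> grad f (norm x *\<^sub>R e))) (at (norm x))"
    using radial_derivative[OF f] unfolding has_field_derivative_def .
  from has_derivative_compose[OF dn this]
  have "((\<lambda>x. f (norm x *\<^sub>R e)) has_derivative (\<lambda>h. (e \<bullet> grad f (norm x *\<^sub>R e)) * (h \<bullet> (x /\<^sub>R norm x)))) (at x)" .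
  moreover have "(\<lambda>x. f (norm x *\<^sub>R e)) = f" using radial_eq[OF r e] by auto
  ultimately show "(f has_derivative (\<lambda>h. h \<bullet> ((e \<bullet> grad f (norm x *\<^sub>R e)) *\<^sub>R (x /\<^sub>R norm x)))) (at x)"
    by (simp add: mult_ac)
qed

text \<open>Directions are points of the open unit ball, to which a unit vector does not belong;
  half of it has the same direction.\<close>

definition half :: "'a::euclidean_space \<Rightarrow> 'a" where "half e = (1 / 2) *\<^sub>R e"

lemma half_pball: "norm e = 1 \<Longrightarrow> half e \<in> pball" "norm e = 1 \<Longrightarrow> sgn (half e) = e"
  by (auto simp: half_def sgn_div_norm)

lemma Q_radial:
  fixes f :: "'a::euclidean_space \<Rightarrow> real"
  assumes f: "f \<in> test_functions (ball 0 R)" and R: "R > 0" and r: "radial f" and e: "norm (e::'a) = 1"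
  shows "Qf f = real DIM('a) * omega TYPE('a) * energy (ray R f (half e)) (ray' R f (half e))"
proof -
  note lf = line_fun_ray[OF f R half_pball(1)[OF e]]
  note [measurable] = line_fun_measurable[OF lf]
  let ?E = "energy (ray R f (half e)) (ray' R f (half e))"
  have "ennreal (Qf f) = (\<integral>\<^sup>+\<xi>. indicator (pball::'a set) \<xi> * ennreal (real DIM('a) * ?E) \<partial>lborel)"
    unfolding nn_Q[OF f R]
  proof (rule nn_integral_cong)
    fix \<xi> :: 'a
    show "indicator pball \<xi> * (\<integral>\<^sup>+t. ennreal (ray_density R f \<xi> t) \<partial>lborel) =
      indicator pball \<xi> * ennreal (real DIM('a) * ?E)"
    proof (cases "\<xi> \<in> pball")
      case True
      have "(\<integral>\<^sup>+t. ennreal (ray_density R f \<xi> t) \<partial>lborel) =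
        (\<integral>\<^sup>+t. ennreal (real DIM('a)) * ennreal ((ray' R f (half e) t + ray R f (half e) t / 2)\<^sup>2) \<partial>lborel)"
      proof (rule nn_integral_cong)
        fix t
        let ?x = "ray_pt R \<xi> t"
        have rt: "rho R t > 0" using rho_bounds[OF R, of t] by simp
        have nx: "norm ?x = rho R t" by (rule norm_pball[OF True rt])
        then have "?x \<noteq> 0" using rt by auto
        from radial_grad[OF f r e this] have "(norm (grad f ?x))\<^sup>2 = (e \<bullet> grad f (rho R t *\<^sub>R e))\<^sup>2"
          unfolding nx using nx rt by (simp add: power2_eq_square)
        then show "ennreal (real DIM('a) * (exp t * (rho R t)\<^sup>2 * (norm (grad f ?x))\<^sup>2)) =
          ennreal (real DIM('a)) * ennreal ((ray' R f (half e) t + ray R f (half e) t / 2)\<^sup>2)"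
          unfolding ray_energy_density half_pball(2)[OF e] by (simp add: ennreal_mult'[symmetric])
      qed
      also have "\<dots> = ennreal (real DIM('a) * ?E)"
        by (subst nn_integral_cmult) (auto simp: nn_energy[OF lf] ennreal_mult' energy_nonneg)
      finally show ?thesis by simp
    qed simp
  qed
  also have "\<dots> = ennreal (real DIM('a) * omega TYPE('a) * ?E)"
    using omega_pos[where 'a='a] energy_nonneg
    by (subst nn_integral_multc) (auto simp: emeasure_pball ennreal_mult'[symmetric] mult_ac)
  finally show ?thesis using omega_pos[where 'a='a] energy_nonneg Qf_nonneg by (subst (asm) ennreal_inj) auto
qed

text \<open>The radial function with the line profile \<open>H\<close>: for radial \<open>f\<close>
  it recovers \<open>to_u f\<close> from the restriction of \<open>f\<close> to one ray.\<close>

definition line_u :: "real \<Rightarrow> (real \<Rightarrow> real) \<Rightarrow> 'a::euclidean_space \<Rightarrow> real" where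
  "line_u R H x = norm x powr (- ((real DIM('a) - 2) / 2)) * exp (lvar R (norm x) / 2) * H (lvar R (norm x))"

lemma line_u_measurable:
  assumes [measurable]: "H \<in> borel_measurable borel"
  shows "line_u R H \<in> borel_measurable borel"
  unfolding line_u_def[abs_def] by measurable

lemma line_u_ray:
  assumes \<xi>: "(\<xi>::'a::euclidean_space) \<in> pball" and R: "R > 0"
  shows "line_u R H (ray_pt R \<xi> t) = rho R t powr (- ((real DIM('a) - 2) / 2)) * exp (t / 2) * H t"
proof -
  have "rho R t > 0" using rho_bounds[OF R, of t] by simp
  then show ?thesis unfolding line_u_def norm_pball[OF \<xi> \<open>rho R t > 0\<close>] lvar_rho[OF R] by simp
qed

lemma to_u_ray:
  assumes \<xi>: "(\<xi>::'a::euclidean_space) \<in> pball" and R: "R > 0"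
  shows "to_u f (ray_pt R \<xi> t) = rho R t powr (- ((real DIM('a) - 2) / 2)) * exp (t / 2) * ray R f \<xi> t"
proof -
  have "rho R t > 0" using rho_bounds[OF R, of t] by simp
  moreover have "exp (t / 2) * exp (- t / 2) = 1" by (simp add: exp_add[symmetric])
  ultimately show ?thesis unfolding to_u_def ray_def norm_pball[OF \<xi> \<open>rho R t > 0\<close>] by (simp add: mult.assoc[symmetric])
qed

text \<open>The exponent of the logarithm is exactly the one for which all powers of
  \<open>rho R t\<close> and of \<open>exp t\<close>, Jacobian included, cancel. Equality with
  \<open>line_u\<close> is assumed almost everywhere because elements of the completion are
  determined only up to null sets.\<close>

lemma weighted_mass_line_u:
  fixes u :: "'a::euclidean_space \<Rightarrow> real"
  assumes N: "DIM('a) \<ge> 3" and R: "R > 0" and H [measurable]: "H \<in> borel_measurable borel"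
    and u: "AE x in lebesgue_on (ball 0 R). u x = line_u R H x" and um: "u \<in> borel_measurable (lebesgue_on (ball 0 R))"
  shows "weighted_mass R u = real DIM('a) * omega TYPE('a) * mass (2 / (real DIM('a) - 2)) H"
proof -
  let ?N = "real DIM('a)"
  define q where "q = 2 / (?N - 2)"
  define p where "p = 2 * ?N / (?N - 2)"
  have N2: "?N > 2" using N by simp
  have pq: "p = 2 + 2 * q" unfolding p_def q_def using N2 by (simp add: field_simps)
  note [measurable] = line_u_measurable[OF H, of R, where 'a='a]
  let ?w = "\<lambda>x::'a. (- ln (norm x / R)) powr (- (2 * (?N - 1) / (?N - 2)))"
  let ?g = "\<lambda>x::'a. \<bar>line_u R H x\<bar> powr p * ?w x"
  have wm: "?w \<in> borel_measurable (lebesgue_on (ball 0 R))"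
    by (intro measurable_restrict_space1 measurable_completion) measurable
  have lm: "line_u R H \<in> borel_measurable (lebesgue_on (ball (0::'a) R))"
    by (intro measurable_restrict_space1 measurable_completion) measurable
  have "weighted_mass R u = (LINT x|lebesgue_on (ball 0 R). \<bar>u x\<bar> powr p * ?w x)"
    unfolding weighted_mass_def Let_def p_def ..
  also have "\<dots> = (LINT x|lebesgue_on (ball 0 R). ?g x)"
    by (rule integral_cong_AE) (use um wm lm u in auto)
  also have "\<dots> = enn2real (\<integral>\<^sup>+x. ennreal (?g x) \<partial>lebesgue_on (ball 0 R))"
    by (rule integral_eq_nn_integral) (use wm lm in auto)
  also have "(\<integral>\<^sup>+x. ennreal (?g x) \<partial>lebesgue_on (ball 0 R)) = (\<integral>\<^sup>+\<xi>. indicator pball \<xi> * (\<integral>\<^sup>+t. ennreal (?N * rho R t ^ DIM('a) * exp t) * ennreal (?g (ray_pt R \<xi> t)) \<partial>lborel) \<partial>lborel)"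
    by (rule nn_polar_rho_ball[OF _ R]) measurable
  also have "\<dots> = (\<integral>\<^sup>+\<xi>. indicator (pball::'a set) \<xi> * (ennreal ?N * (nn_mass q H)) \<partial>lborel)"
  proof (rule nn_integral_cong)
    fix \<xi> :: 'a
    show "indicator pball \<xi> * (\<integral>\<^sup>+t. ennreal (?N * rho R t ^ DIM('a) * exp t) * ennreal (?g (ray_pt R \<xi> t)) \<partial>lborel) =
      indicator pball \<xi> * (ennreal ?N * (nn_mass q H))"
    proof (cases "\<xi> \<in> pball")
      case True
      have "ennreal (?N * rho R t ^ DIM('a) * exp t) * ennreal (?g (ray_pt R \<xi> t)) = ennreal ?N * ennreal (\<bar>H t\<bar> powr (2 + 2 * q))" for t
      proof -
        have r: "rho R t > 0" using rho_bounds[OF R, of t] by simp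
        have w: "?w (ray_pt R \<xi> t) = exp (- t * (2 * (?N - 1) / (?N - 2)))"
        proof -
          have "- ln (rho R t / R) = exp t" using R by (simp add: rho_def)
          then show ?thesis unfolding norm_pball[OF True r] by (simp add: exp_powr_real)
        qed
        have a: "(rho R t powr (- ((?N - 2) / 2))) powr p = rho R t powr (- ?N)"
          unfolding powr_powr p_def using N2 by simp
        have b: "(exp (t / 2)) powr p = exp (t * (?N / (?N - 2)))"
          unfolding exp_powr_real p_def by (simp add: field_simps)
        have "\<bar>line_u R H (ray_pt R \<xi> t)\<bar> powr p = rho R t powr (- ?N) * exp (t * (?N / (?N - 2))) * \<bar>H t\<bar> powr p"
          unfolding line_u_ray[OF True R] abs_mult using r a b by (simp add: powr_mult)
        then have "?N * rho R t ^ DIM('a) * exp t * ?g (ray_pt R \<xi> t) =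
          ?N * (rho R t powr ?N * rho R t powr (- ?N)) * (exp t * exp (t * (?N / (?N - 2))) * exp (- t * (2 * (?N - 1) / (?N - 2)))) * \<bar>H t\<bar> powr p"
          unfolding w using r by (simp add: powr_realpow mult_ac)
        also have "rho R t powr ?N * rho R t powr (- ?N) = 1" unfolding powr_add[symmetric] using r by simp
        also have "exp t * exp (t * (?N / (?N - 2))) * exp (- t * (2 * (?N - 1) / (?N - 2))) = 1"
        proof -
          have e1: "t + t * (?N / (?N - 2)) + - t * (2 * (?N - 1) / (?N - 2)) = t * (1 + ?N / (?N - 2) - 2 * (?N - 1) / (?N - 2))"
            by (simp only: distrib_left right_diff_distrib mult_1_right mult_minus_left add_uminus_conv_diff)
          have e2: "1 + ?N / (?N - 2) - 2 * (?N - 1) / (?N - 2) = 0" using N2 by (simp add: divide_simps)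
          show ?thesis by (simp only: exp_add[symmetric] e1 e2 mult_zero_right exp_zero)
        qed
        finally have "?N * rho R t ^ DIM('a) * exp t * ?g (ray_pt R \<xi> t) = ?N * \<bar>H t\<bar> powr (2 + 2 * q)" unfolding pq by simp
        then show ?thesis using r by (simp add: ennreal_mult'[symmetric])
      qed
      then show ?thesis by (simp add: nn_integral_cmult)
    qed simp
  qed
  also have "\<dots> = ennreal (?N * omega TYPE('a)) * (nn_mass q H)"
    using omega_pos[where 'a='a] by (subst nn_integral_multc) (auto simp: emeasure_pball ennreal_mult' mult_ac)
  finally have "weighted_mass R u = enn2real (ennreal (?N * omega TYPE('a)) * (nn_mass q H))" .
  also have "\<dots> = ?N * omega TYPE('a) * enn2real (nn_mass q H)"
    using omega_pos[where 'a='a] by (simp add: enn2real_mult less_imp_le)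
  also have "enn2real (nn_mass q H) = mass q H"
    unfolding mass_def by (rule integral_eq_nn_integral[symmetric]) auto
  finally show ?thesis unfolding q_def .
qed

section \<open>Choice of a good direction\<close>

lemma geometric_limit:
  fixes a :: "nat \<Rightarrow> real"
  assumes "\<And>k. \<bar>a (Suc k) - a k\<bar> \<le> c * (1 / 2) ^ k"
  shows "\<exists>L. \<forall>k. \<bar>a k - L\<bar> \<le> 2 * c * (1 / 2) ^ k"
proof -
  \<comment> \<open>A decreasing and an increasing sequence that enclose \<open>a\<close>. Their gap
    is the explicit error bound, which later becomes the \<open>\<delta>\<close> of
    \<open>line_limit\<close>.\<close>
  define b where "b = (\<lambda>k. a k + 2 * c * (1 / 2) ^ k)"
  define d where "d = (\<lambda>k. a k - 2 * c * (1 / 2) ^ k)"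
  have c: "c \<ge> 0" using assms[of 0] by simp
  have s: "(1 / 2 :: real) ^ Suc k = (1 / 2) ^ k / 2" for k by simp
  have as: "a (Suc k) - a k \<le> c * (1 / 2) ^ k" "a k - a (Suc k) \<le> c * (1 / 2) ^ k" for k
    using assms[of k] by (auto simp only: abs_le_iff minus_diff_eq)
  have b: "decseq b" unfolding b_def
  proof (rule decseq_SucI)
    fix k show "a (Suc k) + 2 * c * (1 / 2) ^ Suc k \<le> a k + 2 * c * (1 / 2) ^ k"
      using as(1)[of k] unfolding s by argo
  qed
  have d: "incseq d" unfolding d_def
  proof (rule incseq_SucI)
    fix k show "a k - 2 * c * (1 / 2) ^ k \<le> a (Suc k) - 2 * c * (1 / 2) ^ Suc k"
      using as(2)[of k] unfolding s by argo
  qed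
  have db: "d k \<le> b m" for k m
  proof -
    have "d k \<le> d (max k m)" by (rule incseqD[OF d]) simp
    also have "\<dots> \<le> b (max k m)" unfolding d_def b_def using c by simp
    also have "\<dots> \<le> b m" by (rule decseqD[OF b]) simp
    finally show ?thesis .
  qed
  obtain L where L: "b \<longlonglongrightarrow> L" "\<And>i. L \<le> b i" using decseq_convergent[OF b allI[OF db[of 0]]] by blast
  have "d k \<le> L" for k by (rule LIMSEQ_le_const[OF L(1)]) (use db in blast)
  then have "\<bar>a k - L\<bar> \<le> 2 * c * (1 / 2) ^ k" for k
    using L(2)[of k] unfolding b_def d_def by (smt (verit))
  then show ?thesis by blast
qed

lemma AE_lebesgue_on_iff:
  assumes "S \<in> sets borel"
  shows "(AE x in lebesgue_on S. P x) \<longleftrightarrow> (AE x in lborel. x \<in> S \<longrightarrow> P x)"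
  using assms by (subst AE_restrict_space_iff) (auto simp: AE_completion_iff)

lemma AE_suminf_finite:
  fixes f :: "nat \<Rightarrow> 'b \<Rightarrow> ennreal"
  assumes [measurable]: "\<And>k. f k \<in> borel_measurable M" and f: "\<And>k. (\<integral>\<^sup>+x. f k x \<partial>M) \<le> ennreal ((1 / 2) ^ k)"
  shows "AE x in M. (\<Sum>k. f k x) \<noteq> \<infinity>"
proof (rule nn_integral_PInf_AE)
  have "(\<integral>\<^sup>+x. (\<Sum>k. f k x) \<partial>M) = (\<Sum>k. \<integral>\<^sup>+x. f k x \<partial>M)" by (rule nn_integral_suminf) simp
  also have "\<dots> \<le> (\<Sum>k. ennreal ((1 / 2) ^ k))" by (intro suminf_le f) auto
  also have "\<dots> = ennreal (\<Sum>k. (1 / 2) ^ k)" by (rule suminf_ennreal2) (auto intro: summable_geometric)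
  finally show "(\<integral>\<^sup>+x. (\<Sum>k. f k x) \<partial>M) \<noteq> \<infinity>" by (auto simp: top_unique)
qed simp

lemma ray_jointly_measurable:
  fixes f :: "'a::euclidean_space \<Rightarrow> real"
  assumes f: "f \<in> test_functions S"
  shows "(\<lambda>x::'a \<times> real. (ray' R f (fst x) (snd x) + ray R f (fst x) (snd x) / 2)\<^sup>2) \<in> jointly_measurable"
proof -
  note [measurable] = test_measurable[OF f] grad_measurable[OF f]
  have [measurable]: "(\<lambda>x::'a \<times> real. rho R (snd x) *\<^sub>R sgn (fst x)) \<in> measurable (lborel \<Otimes>\<^sub>M lborel) borel" by measurable
  have [measurable]: "(\<lambda>x::'a \<times> real. f (rho R (snd x) *\<^sub>R sgn (fst x))) \<in> jointly_measurable"
    by (rule measurable_compose[where N=borel and g=f]) measurable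
  have [measurable]: "(\<lambda>x::'a \<times> real. grad f (rho R (snd x) *\<^sub>R sgn (fst x))) \<in> jointly_measurable"
    by (rule measurable_compose[where N=borel and g="grad f"]) measurable
  show ?thesis unfolding ray'_def ray_def by measurable
qed

lemma energy_ray_measurable:
  fixes f :: "'a::euclidean_space \<Rightarrow> real"
  assumes f: "f \<in> test_functions S"
  shows "(\<lambda>\<xi>. energy (ray R f \<xi>) (ray' R f \<xi>)) \<in> borel_measurable lborel"
  unfolding energy_def
  by (rule lborel.borel_measurable_lebesgue_integral) (use ray_jointly_measurable[OF f] in \<open>simp add: case_prod_beta\<close>)

text \<open>The rate \<open>1 / 8\<close> leaves room for a factor \<open>4 ^ k\<close>: the sums
  weighted in this way stay finite on almost every ray. There the energies of the increments are of
  order \<open>4^(-k)\<close>, and the increments themselves of order \<open>2^(-k)\<close>,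
  uniformly in \<open>t\<close>.\<close>

lemma fast_subsequence:
  fixes J :: "nat \<Rightarrow> ennreal" and D :: "nat \<Rightarrow> nat \<Rightarrow> real"
  assumes D: "\<forall>e>0. \<exists>M. \<forall>j\<ge>M. \<forall>k\<ge>M. D j k < e" and J: "J \<longlonglongrightarrow> 0"
  obtains s :: "nat \<Rightarrow> nat" where "strict_mono s" "\<And>k. D (s (Suc k)) (s k) < (1 / 8) ^ k" "\<And>k. J (s k) \<le> ennreal ((1 / 2) ^ k)"
proof -
  have "\<exists>M. (\<forall>j\<ge>M. \<forall>i\<ge>M. D j i < (1 / 8) ^ k) \<and> (\<forall>j\<ge>M. J j \<le> ennreal ((1 / 2) ^ k))" for k
  proof -
    have "(0::real) < (1 / 8) ^ k" by simp
    then obtain M1 where M1: "\<And>i j. i \<ge> M1 \<Longrightarrow> j \<ge> M1 \<Longrightarrow> D i j < (1 / 8) ^ k" using D by meson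
    have "\<forall>\<^sub>F j in sequentially. J j < ennreal ((1 / 2) ^ k)" using J by (rule order_tendstoD(2)) simp
    then obtain M2 where M2: "\<And>j. j \<ge> M2 \<Longrightarrow> J j < ennreal ((1 / 2) ^ k)" unfolding eventually_sequentially by blast
    show ?thesis using M1 M2 by (intro exI[of _ "max M1 M2"]) (auto intro: less_imp_le)
  qed
  then obtain m where m: "\<And>k i j. j \<ge> m k \<Longrightarrow> i \<ge> m k \<Longrightarrow> D j i < (1 / 8) ^ k" "\<And>k j. j \<ge> m k \<Longrightarrow> J j \<le> ennreal ((1 / 2) ^ k)" by metis
  define s where "s = (\<lambda>k. k + (\<Sum>i\<le>k. m i))"
  have sm: "strict_mono s" unfolding s_def by (intro strict_monoI_Suc) simp
  have ge: "m k \<le> s k" for k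
  proof -
    have "m k \<le> (\<Sum>i\<le>k. m i)" by (rule member_le_sum) auto
    then show ?thesis by (simp add: s_def)
  qed
  have "m k \<le> s (Suc k)" for k using ge[of k] strict_monoD[OF sm, of k "Suc k"] by simp
  then show ?thesis using that[OF sm] m ge by blast
qed

text \<open>The approximants need not be radial, so a single ray does not represent them. One
  direction is selected in which the profiles converge fast, the limit agrees with \<open>g\<close>,
  and the limiting energy is at most the average. As \<open>g\<close> is radial, that ray determines
  \<open>u\<close> almost everywhere.\<close>

theorem good_direction:
  fixes u g :: "'a::euclidean_space \<Rightarrow> real"
  assumes R: "R > 0" and N: "DIM('a) \<ge> 3" and u: "u \<in> borel_measurable (lebesgue_on (ball 0 R))"
    and Z: "Q_approx R Z u" and l: "(\<lambda>k. Qf (Z k)) \<longlonglongrightarrow> l"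
    and g: "radial g" "AE x in lebesgue_on (ball 0 R). u x = g x"
  shows "\<exists>h h' H \<delta> e. line_limit (2 / (real DIM('a) - 2)) h h' H \<delta> e \<and> e \<le> l / (real DIM('a) * omega TYPE('a)) \<and>
    (AE x in lebesgue_on (ball 0 R). u x = line_u R H x)"
proof -
  let ?N = "real DIM('a)" and ?B = "ball (0::'a) R" and ?\<omega> = "omega TYPE('a)"
  have \<omega>: "?\<omega> > 0" by (rule omega_pos)
  have tZ: "\<And>k. Z k \<in> test_functions ?B" using Z unfolding Q_approx_def by blast
  have l0: "l \<ge> 0" by (rule LIMSEQ_le_const[OF l]) (use Qf_nonneg in auto)
  have [measurable]: "?B - {0} \<in> sets borel" by (simp add: borel_open)
  obtain s where s: "strict_mono s" "\<And>k. Qf (\<lambda>x. Z (s (Suc k)) x - Z (s k) x) < (1 / 8) ^ k"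
    "\<And>k. (\<integral>\<^sup>+x. ennreal ((to_u (Z (s k)) x - u x)\<^sup>2) \<partial>lebesgue_on ?B) \<le> ennreal ((1 / 2) ^ k)"
    using fast_subsequence[of "\<lambda>j k. Qf (\<lambda>x. Z j x - Z k x)" "\<lambda>k. \<integral>\<^sup>+x. ennreal ((to_u (Z k) x - u x)\<^sup>2) \<partial>lebesgue_on ?B"]
      Z unfolding Q_approx_def by blast
  define Y where "Y = (\<lambda>k. Z (s k))"
  have tY: "\<And>k. Y k \<in> test_functions ?B" unfolding Y_def by (rule tZ)
  have lY: "(\<lambda>k. Qf (Y k)) \<longlonglongrightarrow> l" unfolding Y_def using LIMSEQ_subseq_LIMSEQ[OF l s(1)] by (simp add: comp_def)
  note [measurable] = test_measurable[OF tY]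
  have [measurable]: "to_u (Y k) \<in> borel_measurable borel" for k unfolding to_u_def[abs_def] by measurable
  define \<Delta> where "\<Delta> = (\<lambda>k x. Y (Suc k) x - Y k x)"
  have t\<Delta>: "\<And>k. \<Delta> k \<in> test_functions ?B" unfolding \<Delta>_def by (rule test_functions_diff[OF tY tY])
  \<comment> \<open>a Borel representative of \<open>u\<close>\<close>
  have "(\<lambda>x. if x \<in> ?B then u x else 0) \<in> borel_measurable (completion lborel)"
    using borel_measurable_if_lebesgue_on[of ?B UNIV u] u by simp
  from completion_ex_borel_measurable_real[OF this]
  obtain v where v [measurable]: "v \<in> borel_measurable borel" and uv: "AE x in lborel. (if x \<in> ?B then u x else 0) = v x" by auto
  have gv: "AE x in lborel. x \<in> ?B \<longrightarrow> v x = g x"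
    using uv g(2)[unfolded AE_lebesgue_on_iff[OF ball_borel]] by eventually_elim auto
  let ?w = "\<lambda>t. ?N * rho R t ^ DIM('a) * exp t"
  have w: "?w t > 0" for t using rho_bounds[OF R, of t] by simp
  \<comment> \<open>The weighted mean-square distance between \<open>to_u (Y k)\<close> and
    \<open>v\<close> along the ray of direction \<open>\<xi>\<close>; integrated over directions it
    gives the distance over the ball.\<close>
  define A where "A = (\<lambda>k (\<xi>::'a). \<integral>\<^sup>+t. ennreal (?w t) * ennreal ((to_u (Y k) (ray_pt R \<xi> t) - v (ray_pt R \<xi> t))\<^sup>2) \<partial>lborel)"
  have Ajm: "(\<lambda>x::'a \<times> real. ennreal ((to_u (Y k) (rho R (snd x) *\<^sub>R sgn (fst x)) - v (rho R (snd x) *\<^sub>R sgn (fst x)))\<^sup>2)) \<in> jointly_measurable" for k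
    by (rule measurable_compose[where N=borel and g="\<lambda>x. ennreal ((to_u (Y k) x - v x)\<^sup>2)"]) measurable
  have Am [measurable]: "A k \<in> borel_measurable lborel" for k
    unfolding A_def
    by (rule lborel.borel_measurable_nn_integral) (unfold case_prod_beta, use Ajm[of k] in measurable)
  have Aint: "(\<integral>\<^sup>+\<xi>. indicator pball \<xi> * A k \<xi> \<partial>lborel) \<le> ennreal ((1 / 2) ^ k)" for k
  proof -
    have "(\<integral>\<^sup>+\<xi>. indicator pball \<xi> * A k \<xi> \<partial>lborel) = (\<integral>\<^sup>+x. ennreal ((to_u (Y k) x - v x)\<^sup>2) * indicator (?B - {0}) x \<partial>lborel)"
      unfolding A_def by (rule nn_polar_rho[symmetric, OF _ R]) measurable
    also have "\<dots> \<le> (\<integral>\<^sup>+x. ennreal ((to_u (Y k) x - u x)\<^sup>2) * indicator ?B x \<partial>lborel)"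
      by (rule nn_integral_mono_AE, use uv in eventually_elim) (auto simp: indicator_def)
    also have "\<dots> = (\<integral>\<^sup>+x. ennreal ((to_u (Y k) x - u x)\<^sup>2) \<partial>lebesgue_on ?B)"
      by (rule nn_integral_lebesgue_on_eq[symmetric]) simp
    also have "\<dots> \<le> ennreal ((1 / 2) ^ k)" unfolding Y_def by (rule s(3))
    finally show ?thesis .
  qed
  have A_fin: "AE \<xi> in lborel. (\<Sum>k. indicator pball \<xi> * A k \<xi>) \<noteq> \<infinity>"
    by (rule AE_suminf_finite[OF _ Aint]) measurable
  define E where "E = (\<lambda>k \<xi>. energy (ray R (\<Delta> k) \<xi>) (ray' R (\<Delta> k) \<xi>))"
  have Em [measurable]: "E k \<in> borel_measurable lborel" for k unfolding E_def by (rule energy_ray_measurable[OF t\<Delta>])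
  have Eint: "(\<integral>\<^sup>+\<xi>. ennreal (4 ^ k) * (indicator pball \<xi> * ennreal (?N * E k \<xi>)) \<partial>lborel) \<le> ennreal ((1 / 2) ^ k)" for k
  proof -
    have "(\<integral>\<^sup>+\<xi>. ennreal (4 ^ k) * (indicator pball \<xi> * ennreal (?N * E k \<xi>)) \<partial>lborel) = ennreal (4 ^ k) * (\<integral>\<^sup>+\<xi>. indicator pball \<xi> * ennreal (?N * E k \<xi>) \<partial>lborel)"
      by (rule nn_integral_cmult) measurable
    also have "\<dots> \<le> ennreal (4 ^ k) * ennreal (Qf (\<Delta> k))"
      unfolding E_def by (intro mult_left_mono energy_rays_le[OF t\<Delta> R]) simp
    also have "\<dots> = ennreal (4 ^ k * Qf (\<Delta> k))" by (simp add: ennreal_mult' Qf_nonneg)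
    also have "\<dots> \<le> ennreal (4 ^ k * (1 / 8) ^ k)"
      using s(2)[of k] unfolding \<Delta>_def Y_def by (intro ennreal_leI mult_left_mono) auto
    also have "(4::real) ^ k * (1 / 8) ^ k = (1 / 2) ^ k" by (simp add: power_mult_distrib[symmetric])
    finally show ?thesis .
  qed
  have E_fin: "AE \<xi> in lborel. (\<Sum>k. ennreal (4 ^ k) * (indicator pball \<xi> * ennreal (?N * E k \<xi>))) \<noteq> \<infinity>"
    by (rule AE_suminf_finite[OF _ Eint]) measurable
  define e where "e = (\<lambda>k \<xi>. energy (ray R (Y k) \<xi>) (ray' R (Y k) \<xi>))"
  have em [measurable]: "e k \<in> borel_measurable lborel" for k unfolding e_def by (rule energy_ray_measurable[OF tY])
  have e0: "e k \<xi> \<ge> 0" for k \<xi> unfolding e_def by (rule energy_nonneg)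
  \<comment> \<open>Along a fixed ray the energies of the whole forms are not known to converge.
    Fatou's lemma bounds the integral of their lower limits by \<open>l\<close>.\<close>
  define L where "L = (\<lambda>\<xi>. liminf (\<lambda>k. ennreal (?N * e k \<xi>)))"
  have Lm [measurable]: "L \<in> borel_measurable lborel" unfolding L_def by measurable
  have Lint: "(\<integral>\<^sup>+\<xi>. indicator pball \<xi> * L \<xi> \<partial>lborel) \<le> ennreal l"
  proof -
    have "(\<integral>\<^sup>+\<xi>. indicator pball \<xi> * L \<xi> \<partial>lborel) = (\<integral>\<^sup>+\<xi>. liminf (\<lambda>k. indicator pball \<xi> * ennreal (?N * e k \<xi>)) \<partial>lborel)"
      unfolding L_def by (intro nn_integral_cong) (auto simp: indicator_def Liminf_const)
    also have "\<dots> \<le> liminf (\<lambda>k. \<integral>\<^sup>+\<xi>. indicator pball \<xi> * ennreal (?N * e k \<xi>) \<partial>lborel)"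
      by (rule nn_integral_liminf) measurable
    also have "\<dots> \<le> liminf (\<lambda>k. ennreal (Qf (Y k)))"
      unfolding e_def by (intro Liminf_mono always_eventually allI energy_rays_le[OF tY R])
    also have "\<dots> = ennreal l" by (intro lim_imp_Liminf tendsto_ennrealI lY) simp
    finally show ?thesis .
  qed
  have rays: "AE \<xi> in lborel. \<xi> \<in> pball \<longrightarrow> (AE t in lborel. ray_pt R \<xi> t \<in> ?B \<longrightarrow> v (ray_pt R \<xi> t) = g (ray_pt R \<xi> t))"
    by (rule AE_rays[OF gv R])
  have "\<exists>\<xi>\<in>pball. (\<Sum>k. indicator pball \<xi> * A k \<xi>) \<noteq> \<infinity> \<and> (\<Sum>k. ennreal (4 ^ k) * (indicator pball \<xi> * ennreal (?N * E k \<xi>))) \<noteq> \<infinity> \<and>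
    (AE t in lborel. ray_pt R \<xi> t \<in> ?B \<longrightarrow> v (ray_pt R \<xi> t) = g (ray_pt R \<xi> t)) \<and> L \<xi> \<le> ennreal (l / ?\<omega>)"
  \<comment> \<open>Otherwise \<open>L\<close> exceeds \<open>l / omega\<close> in almost every
    direction, and its integral over the unit ball exceeds \<open>l\<close>.\<close>
  proof (rule ccontr)
    assume no: "\<not> ?thesis"
    have gt: "AE \<xi> in lborel. \<xi> \<in> pball \<longrightarrow> ennreal (l / ?\<omega>) < L \<xi>"
      using A_fin E_fin rays
    proof eventually_elim
      case (elim \<xi>)
      show ?case
      proof
        assume p: "\<xi> \<in> pball"
        show "ennreal (l / ?\<omega>) < L \<xi>"
        proof (rule ccontr)
          assume "\<not> ennreal (l / ?\<omega>) < L \<xi>"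
          then have "L \<xi> \<le> ennreal (l / ?\<omega>)" by (simp only: not_less)
          with elim p no show False by blast
        qed
      qed
    qed
    have f1: "(\<integral>\<^sup>+\<xi>. indicator (pball::'a set) \<xi> * ennreal (l / ?\<omega>) \<partial>lborel) = ennreal l"
      using \<omega> l0 by (subst nn_integral_multc) (auto simp: emeasure_pball ennreal_mult'[symmetric])
    have "(\<integral>\<^sup>+\<xi>. indicator (pball::'a set) \<xi> * ennreal (l / ?\<omega>) \<partial>lborel) < (\<integral>\<^sup>+\<xi>. indicator pball \<xi> * L \<xi> \<partial>lborel)"
    proof (rule nn_integral_less)
      show "(\<integral>\<^sup>+\<xi>. indicator (pball::'a set) \<xi> * ennreal (l / ?\<omega>) \<partial>lborel) \<noteq> \<infinity>" unfolding f1 by simp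
      show "AE \<xi> in lborel. indicator (pball::'a set) \<xi> * ennreal (l / ?\<omega>) \<le> indicator pball \<xi> * L \<xi>"
        using gt
      proof eventually_elim
        case (elim \<xi>)
        then show ?case by (cases "\<xi> \<in> pball") (auto intro: less_imp_le)
      qed
      show "\<not> (AE \<xi> in lborel. indicator pball \<xi> * L \<xi> \<le> indicator (pball::'a set) \<xi> * ennreal (l / ?\<omega>))"
      proof
        assume "AE \<xi> in lborel. indicator pball \<xi> * L \<xi> \<le> indicator (pball::'a set) \<xi> * ennreal (l / ?\<omega>)"
        with gt have "AE \<xi> in lborel. \<xi> \<notin> (pball::'a set)"
        proof eventually_elim
          case (elim \<xi>)
          show ?case
          proof
            assume p: "\<xi> \<in> pball"
            then have "L \<xi> \<le> ennreal (l / ?\<omega>)" using elim(2) by simp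
            moreover have "ennreal (l / ?\<omega>) < L \<xi>" using elim(1) p by blast
            ultimately show False by (simp add: leD)
          qed
        qed
        then have "emeasure lborel (pball::'a set) = 0" by (subst (asm) AE_iff_measurable[of pball]) auto
        then show False unfolding emeasure_pball using \<omega> by simp
      qed
    qed measurable
    then show False unfolding f1 using Lint by (simp add: leD)
  qed
  then obtain \<xi> where \<xi>: "\<xi> \<in> pball" and A\<xi>: "(\<Sum>k. indicator pball \<xi> * A k \<xi>) \<noteq> \<infinity>"
    and E\<xi>: "(\<Sum>k. ennreal (4 ^ k) * (indicator pball \<xi> * ennreal (?N * E k \<xi>))) \<noteq> \<infinity>"
    and g\<xi>: "AE t in lborel. ray_pt R \<xi> t \<in> ?B \<longrightarrow> v (ray_pt R \<xi> t) = g (ray_pt R \<xi> t)"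
    and L\<xi>: "L \<xi> \<le> ennreal (l / ?\<omega>)" by blast
  have N1: "?N \<ge> 1" using N by simp
  have E0: "E k \<xi> \<ge> 0" for k unfolding E_def by (rule energy_nonneg)
  have "(\<Sum>k. ennreal (4 ^ k * (?N * E k \<xi>))) \<noteq> top"
    using E\<xi> \<xi> E0 by (simp add: ennreal_mult')
  then have sumE: "summable (\<lambda>k. 4 ^ k * (?N * E k \<xi>))" by (rule summable_suminf_not_top[rotated]) (use E0 in simp)
  define S where "S = (\<Sum>k. 4 ^ k * (?N * E k \<xi>))"
  \<comment> \<open>Each term of a convergent nonnegative series is at most its sum
    \<open>S\<close>; the factor \<open>DIM('a)\<close> is at least 1 and is dropped.\<close>
  have ES: "E k \<xi> \<le> S * (1 / 4) ^ k" for k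
  proof -
    have "4 ^ k * (?N * E k \<xi>) \<le> S" unfolding S_def
      using sum_le_suminf[OF sumE, of "{k}"] E0 by simp
    moreover have "4 ^ k * (1 * E k \<xi>) \<le> 4 ^ k * (?N * E k \<xi>)" using N1 E0 by (intro mult_left_mono mult_right_mono) auto
    ultimately have "4 ^ k * (1 * E k \<xi>) \<le> S" by (rule order_trans[rotated])
    then have "4 ^ k * E k \<xi> \<le> S" unfolding mult_1 .
    then have "(1 / 4) ^ k * (4 ^ k * E k \<xi>) \<le> (1 / 4) ^ k * S" by (rule mult_left_mono) simp
    then show ?thesis by (simp only: mult.assoc[symmetric] power_mult_distrib[symmetric]) (simp add: mult.commute)
  qed
  have S0: "S \<ge> 0" using order_trans[OF E0 ES[of 0]] by simp
  have step: "\<bar>ray R (Y (Suc k)) \<xi> t - ray R (Y k) \<xi> t\<bar> \<le> sqrt S * (1 / 2) ^ k" for k t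
  proof -
    have "(ray R (\<Delta> k) \<xi> t)\<^sup>2 \<le> E k \<xi>" unfolding E_def by (rule line_fun_square_le_energy[OF line_fun_ray[OF t\<Delta> R \<xi>]])
    also have "\<dots> \<le> S * (1 / 4) ^ k" by (rule ES)
    also have "\<dots> = (sqrt S * (1 / 2) ^ k)\<^sup>2" using S0 by (simp add: power_mult_distrib power_divide power2_eq_square power_mult_distrib[symmetric])
    finally have "\<bar>ray R (\<Delta> k) \<xi> t\<bar> \<le> sqrt S * (1 / 2) ^ k" using S0 by (intro abs_le_square_iff[THEN iffD2, THEN order_trans[OF _ eq_refl]]) auto
    then show ?thesis unfolding \<Delta>_def ray_diff(1)[OF tY tY] .
  qed
  have "\<forall>t. \<exists>H. \<forall>k. \<bar>ray R (Y k) \<xi> t - H\<bar> \<le> 2 * sqrt S * (1 / 2) ^ k"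
  proof
    fix t
    have "\<exists>L. \<forall>k. \<bar>ray R (Y k) \<xi> t - L\<bar> \<le> 2 * sqrt S * (1 / 2) ^ k" by (rule geometric_limit[of "\<lambda>k. ray R (Y k) \<xi> t"]) (rule step)
    then show "\<exists>H. \<forall>k. \<bar>ray R (Y k) \<xi> t - H\<bar> \<le> 2 * sqrt S * (1 / 2) ^ k" .
  qed
  then obtain H where H: "\<And>k t. \<bar>ray R (Y k) \<xi> t - H t\<bar> \<le> 2 * sqrt S * (1 / 2) ^ k" by metis
  have z: "(\<lambda>k. 2 * sqrt S * (1 / 2) ^ k) \<longlonglongrightarrow> 0"
    using tendsto_mult_right_zero[OF LIMSEQ_realpow_zero[of "1/2"]] by simp
  have Hlim: "(\<lambda>k. ray R (Y k) \<xi> t) \<longlonglongrightarrow> H t" for t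
    by (rule LIM_zero_cancel, rule Lim_null_comparison[OF always_eventually z]) (use H in simp)
  \<comment> \<open>\<open>line_limit\<close> asks for convergent energies, so a subsequence
    realising the lower limit is taken; uniform convergence to \<open>H\<close> is
    inherited.\<close>
  obtain r :: "nat \<Rightarrow> nat" where r: "strict_mono r" "((\<lambda>k. ennreal (?N * e k \<xi>)) \<circ> r) \<longlonglongrightarrow> L \<xi>"
    using liminf_subseq_lim[of "\<lambda>k. ennreal (?N * e k \<xi>)"] unfolding L_def by blast
  define c where "c = enn2real (L \<xi>)"
  have Lc: "L \<xi> = ennreal c" unfolding c_def using L\<xi> by (metis ennreal_enn2real ennreal_less_top order_le_less_trans)
  have c0: "c \<ge> 0" by (simp add: c_def)
  have cl: "c \<le> l / ?\<omega>" using L\<xi> l0 \<omega> unfolding Lc by (subst (asm) ennreal_le_iff) auto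
  have "(\<lambda>k. ennreal (?N * e (r k) \<xi>)) \<longlonglongrightarrow> ennreal c" using r(2) unfolding Lc comp_def .
  then have "(\<lambda>k. ?N * e (r k) \<xi>) \<longlonglongrightarrow> c" using e0 c0 by (subst (asm) tendsto_ennreal_iff) auto
  then have "(\<lambda>k. ?N * e (r k) \<xi> / ?N) \<longlonglongrightarrow> c / ?N" by (intro tendsto_divide tendsto_const) (use N in auto)
  then have elim: "(\<lambda>k. e (r k) \<xi>) \<longlonglongrightarrow> c / ?N" using N by simp
  have ll: "line_limit (2 / (?N - 2)) (\<lambda>k. ray R (Y (r k)) \<xi>) (\<lambda>k. ray' R (Y (r k)) \<xi>) H (\<lambda>k. 2 * sqrt S * (1 / 2) ^ r k) (c / ?N)"
  proof
    show "2 / (?N - 2) > 0" using N by simp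
    show "line_fun (ray R (Y (r k)) \<xi>) (ray' R (Y (r k)) \<xi>)" for k by (rule line_fun_ray[OF tY R \<xi>])
    show "\<bar>ray R (Y (r k)) \<xi> t - H t\<bar> \<le> 2 * sqrt S * (1 / 2) ^ r k" for k t by (rule H)
    show "(\<lambda>k. 2 * sqrt S * (1 / 2) ^ r k) \<longlonglongrightarrow> 0" using LIMSEQ_subseq_LIMSEQ[OF z r(1)] by (simp add: comp_def)
    show "(\<lambda>k. energy (ray R (Y (r k)) \<xi>) (ray' R (Y (r k)) \<xi>)) \<longlonglongrightarrow> c / ?N" using elim unfolding e_def .
  qed
  have el: "c / ?N \<le> l / (?N * ?\<omega>)" using divide_right_mono[OF cl, of ?N] by (simp add: mult.commute)
  \<comment> \<open>The squared distances are summable along the ray, which forces convergence at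
    almost every \<open>t\<close> without a further subsequence and identifies \<open>H\<close> with
    the profile of \<open>g\<close>.\<close>
  have "AE t in lborel. (\<Sum>k. ennreal (?w t) * ennreal ((to_u (Y k) (ray_pt R \<xi> t) - v (ray_pt R \<xi> t))\<^sup>2)) \<noteq> \<infinity>"
  proof (rule nn_integral_PInf_AE)
    have m: "(\<lambda>t. ennreal (?w t) * ennreal ((to_u (Y k) (ray_pt R \<xi> t) - v (ray_pt R \<xi> t))\<^sup>2)) \<in> borel_measurable lborel" for k by measurable
    show "(\<integral>\<^sup>+t. (\<Sum>k. ennreal (?w t) * ennreal ((to_u (Y k) (ray_pt R \<xi> t) - v (ray_pt R \<xi> t))\<^sup>2)) \<partial>lborel) \<noteq> \<infinity>"
      using A\<xi> \<xi> by (subst nn_integral_suminf[OF m]) (simp add: A_def)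
  qed measurable
  then have AEg: "AE t in lborel. g (ray_pt R \<xi> t) = rho R t powr (- ((?N - 2) / 2)) * exp (t / 2) * H t"
    using g\<xi>
  proof eventually_elim
    case (elim t)
    let ?x = "ray_pt R \<xi> t"
    have rt: "0 < rho R t" "rho R t < R" using rho_bounds[OF R, of t] by auto
    have "norm ?x = rho R t" by (rule norm_pball[OF \<xi> rt(1)])
    then have "?x \<in> ?B" using rt by simp
    then have gx: "v ?x = g ?x" using elim(2) by blast
    have "(\<Sum>k. ennreal (?w t * (to_u (Y k) ?x - v ?x)\<^sup>2)) \<noteq> top" using elim(1) w[of t] by (simp add: ennreal_mult' less_imp_le)
    then have "summable (\<lambda>k. ?w t * (to_u (Y k) ?x - v ?x)\<^sup>2)" by (rule summable_suminf_not_top[rotated]) (use w[of t] in simp)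
    then have "(\<lambda>k. ?w t * (to_u (Y k) ?x - v ?x)\<^sup>2) \<longlonglongrightarrow> 0" by (rule summable_LIMSEQ_zero)
    moreover have wn: "?w t \<noteq> 0" using w[of t] by (rule less_imp_neq[THEN not_sym])
    ultimately have "(\<lambda>k. (?w t * (to_u (Y k) ?x - v ?x)\<^sup>2) / ?w t) \<longlonglongrightarrow> 0 / ?w t" by (intro tendsto_divide tendsto_const)
    then have "(\<lambda>k. (to_u (Y k) ?x - v ?x)\<^sup>2) \<longlonglongrightarrow> 0" unfolding nonzero_mult_div_cancel_left[OF wn] by simp
    then have "(\<lambda>k. sqrt ((to_u (Y k) ?x - v ?x)\<^sup>2)) \<longlonglongrightarrow> sqrt 0" by (rule tendsto_real_sqrt)
    then have "(\<lambda>k. to_u (Y k) ?x - v ?x) \<longlonglongrightarrow> 0" by (simp add: tendsto_rabs_zero_iff)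
    then have "(\<lambda>k. to_u (Y k) ?x) \<longlonglongrightarrow> v ?x" by (rule LIM_zero_cancel)
    moreover have "(\<lambda>k. to_u (Y k) ?x) \<longlonglongrightarrow> rho R t powr (- ((?N - 2) / 2)) * exp (t / 2) * H t"
      unfolding to_u_ray[OF \<xi> R] by (intro tendsto_mult_left Hlim)
    ultimately have "v ?x = rho R t powr (- ((?N - 2) / 2)) * exp (t / 2) * H t" by (rule LIMSEQ_unique)
    then show ?case using gx by simp
  qed
  have "AE x in lebesgue_on ?B. u x = line_u R H x"
    unfolding AE_lebesgue_on_iff[OF ball_borel]
    using AE_from_line[OF AEg R, where 'a='a] g(2)[unfolded AE_lebesgue_on_iff[OF ball_borel]] AE_lborel_singleton[of "0::'a"]
  proof eventually_elim
    case (elim x)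
    show ?case
    proof
      assume x: "x \<in> ?B"
      have nx: "0 < norm x" "norm x < R" using x elim(3) by auto
      have rl: "rho R (lvar R (norm x)) = norm x" by (rule rho_lvar[OF nx])
      have "g x = g (norm x *\<^sub>R sgn \<xi>)"
        using g(1) norm_pball[OF \<xi> nx(1)] unfolding radial_def by metis
      also have "\<dots> = line_u R H x" using elim(1) x elim(3) unfolding rl line_u_def by blast
      finally show "u x = line_u R H x" using elim(2) x by simp
    qed
  qed
  with ll el show ?thesis by blast
qed

subsection \<open>Approximation by cutoffs\<close>

lemma ex_cutoff:
  obtains \<theta> \<theta>' :: "real \<Rightarrow> real" and B where "smooth_on UNIV \<theta>" "\<And>x. 0 \<le> \<theta> x" "\<And>x. \<theta> x \<le> 1"
    "\<And>x. \<bar>x\<bar> \<le> 1 \<Longrightarrow> \<theta> x = 1" "\<And>x. \<bar>x\<bar> \<ge> 2 \<Longrightarrow> \<theta> x = 0"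
    "\<And>x. (\<theta> has_real_derivative \<theta>' x) (at x)" "continuous_on UNIV \<theta>'" "\<And>x. \<bar>\<theta>' x\<bar> \<le> B" "B \<ge> 0"
proof -
  define \<theta> where "\<theta> = (\<lambda>x::real. smooth_step (2 - x) * smooth_step (2 + x))"
  have s: "smooth_on UNIV \<theta>" unfolding \<theta>_def
    by (intro smooth_on_mult smooth_on_compose[OF _ _ smooth_on_smooth_step] smooth_on_diff smooth_on_add smooth_on_const smooth_on_id) auto
  have z: "\<theta> x = 0" if "\<bar>x\<bar> \<ge> 2" for x
  proof (cases "x \<ge> 2")
    case True then show ?thesis by (simp add: \<theta>_def smooth_step_le_0)
  next
    case False then show ?thesis using that by (simp add: \<theta>_def smooth_step_le_0)
  qed
  have "{x. \<theta> x \<noteq> 0} \<subseteq> {-2..2}"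
  proof
    fix x assume "x \<in> {x. \<theta> x \<noteq> 0}"
    then have "\<not> \<bar>x\<bar> \<ge> 2" using z by blast
    then show "x \<in> {-2..2}" by auto
  qed
  from compact_closure_subset[OF this] have t: "\<theta> \<in> test_functions UNIV"
    unfolding test_functions_iff_smooth using s by simp
  obtain B where B: "B \<ge> 0" "\<And>x. norm (grad \<theta> x) \<le> B" using test_bounded[OF t] by metis
  show ?thesis
  proof (rule that[of \<theta> "grad \<theta>" B])
    show "(\<theta> has_real_derivative grad \<theta> x) (at x)" for x
    proof -
      have "(\<lambda>y. y \<bullet> grad \<theta> x) = (*) (grad \<theta> x)" by (rule ext) (simp add: mult.commute)
      then show ?thesis using test_has_derivative[OF t, of x] unfolding has_field_derivative_def by simp
    qed
    show "continuous_on UNIV (grad \<theta>)" by (rule continuous_on_grad[OF t])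
    show "0 \<le> \<theta> x" "\<theta> x \<le> 1" for x
      using smooth_step_bounds[of "2 - x"] smooth_step_bounds[of "2 + x"] by (simp_all add: \<theta>_def mult_le_one)
    show "\<theta> x = 1" if "\<bar>x\<bar> \<le> 1" for x using that by (simp add: \<theta>_def smooth_step_ge_1)
  qed (use s z B in auto)
qed

lemma line_fun_diff:
  assumes "line_fun f f'" "line_fun g g'"
  shows "line_fun (\<lambda>t. f t - g t) (\<lambda>t. f' t - g' t)"
proof -
  obtain C D where C: "\<And>t. \<bar>f t\<bar> \<le> C * exp (- \<bar>t\<bar> / 2)" "\<And>t. \<bar>f' t\<bar> \<le> C * exp (- \<bar>t\<bar> / 2)"
    and D: "\<And>t. \<bar>g t\<bar> \<le> D * exp (- \<bar>t\<bar> / 2)" "\<And>t. \<bar>g' t\<bar> \<le> D * exp (- \<bar>t\<bar> / 2)"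
    using assms unfolding line_fun_def by metis
  have "\<bar>f t - g t\<bar> \<le> (C + D) * exp (- \<bar>t\<bar> / 2)" "\<bar>f' t - g' t\<bar> \<le> (C + D) * exp (- \<bar>t\<bar> / 2)" for t
    using C[of t] D[of t] unfolding distrib_right by linarith+
  moreover have "((\<lambda>t. f t - g t) has_real_derivative f' t - g' t) (at t)" for t
    using assms unfolding line_fun_def by (intro DERIV_diff) auto
  moreover have "continuous_on UNIV (\<lambda>t. f' t - g' t)"
    using assms unfolding line_fun_def by (intro continuous_on_diff) auto
  ultimately show ?thesis unfolding line_fun_def by blast
qed

lemma energy_diff_le:
  assumes "line_fun f f'" "line_fun g g'"
  shows "energy (\<lambda>t. f t - g t) (\<lambda>t. f' t - g' t) \<le> 2 * energy f f' + 2 * energy g g'"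
proof -
  have "energy (\<lambda>t. f t - g t) (\<lambda>t. f' t - g' t) \<le> (LBINT t. 2 * (f' t + f t / 2)\<^sup>2 + 2 * (g' t + g t / 2)\<^sup>2)"
    unfolding energy_def
  proof (rule integral_mono)
    show "integrable lborel (\<lambda>t. (f' t - g' t + (f t - g t) / 2)\<^sup>2)"
      by (rule line_fun_integrable(1)[OF line_fun_diff[OF assms]])
    show "integrable lborel (\<lambda>t. 2 * (f' t + f t / 2)\<^sup>2 + 2 * (g' t + g t / 2)\<^sup>2)"
      by (intro Bochner_Integration.integrable_add integrable_mult_right line_fun_integrable(1) assms)
    fix t
    have *: "(x - y)\<^sup>2 \<le> 2 * x\<^sup>2 + 2 * y\<^sup>2" for x y :: real
      using zero_le_power2[of "x + y"] by (simp add: power2_eq_square algebra_simps)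
    have "f' t - g' t + (f t - g t) / 2 = (f' t + f t / 2) - (g' t + g t / 2)" by (simp add: field_simps)
    then show "(f' t - g' t + (f t - g t) / 2)\<^sup>2 \<le> 2 * (f' t + f t / 2)\<^sup>2 + 2 * (g' t + g t / 2)\<^sup>2"
      by (simp only: *)
  qed
  also have "\<dots> = 2 * energy f f' + 2 * energy g g'"
    unfolding energy_def using line_fun_integrable(1)[OF assms(1)] line_fun_integrable(1)[OF assms(2)] by simp
  finally show ?thesis .
qed

text \<open>The cutoffs \<open>\<theta> (c n * t)\<close> widen, so their derivatives carry the
  factor \<open>c n\<close>, which tends to 0. Energies and squares are dominated by a multiple of
  \<open>exp (- \<bar>t\<bar>)\<close>, masses by the integrand for \<open>h\<close>.\<close>

lemma line_fun_cutoff: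
  assumes h: "line_fun h h'" and q: "q > 0" and hs: "smooth_on UNIV h"
  obtains k k' :: "nat \<Rightarrow> real \<Rightarrow> real" where "\<And>n. line_fun (k n) (k' n)" "\<And>n. smooth_on UNIV (k n)"
    "\<And>n t. k n t \<noteq> 0 \<Longrightarrow> \<bar>t\<bar> \<le> 2 * real (Suc n)"
    "(\<lambda>n. energy (k n) (k' n)) \<longlonglongrightarrow> energy h h'"
    "(\<lambda>n. energy (\<lambda>t. k n t - h t) (\<lambda>t. k' n t - h' t)) \<longlonglongrightarrow> 0"
    "(\<lambda>n. mass q (k n)) \<longlonglongrightarrow> mass q h"
    "(\<lambda>n. \<integral>t. (k n t - h t)\<^sup>2 \<partial>lborel) \<longlonglongrightarrow> 0"
    "\<And>n. integrable lborel (\<lambda>t. (k n t - h t)\<^sup>2)"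
proof -
  obtain \<theta> \<theta>' :: "real \<Rightarrow> real" and B where \<theta>: "smooth_on UNIV \<theta>" "\<And>x. 0 \<le> \<theta> x" "\<And>x. \<theta> x \<le> 1"
    "\<And>x. \<bar>x\<bar> \<le> 1 \<Longrightarrow> \<theta> x = 1" "\<And>x. \<bar>x\<bar> \<ge> 2 \<Longrightarrow> \<theta> x = 0"
    "\<And>x. (\<theta> has_real_derivative \<theta>' x) (at x)" "continuous_on UNIV \<theta>'" "\<And>x. \<bar>\<theta>' x\<bar> \<le> B" "B \<ge> 0"
    using ex_cutoff by metis
  obtain C where C: "\<And>t. \<bar>h t\<bar> \<le> C * exp (- \<bar>t\<bar> / 2)" "\<And>t. \<bar>h' t\<bar> \<le> C * exp (- \<bar>t\<bar> / 2)"
    using h unfolding line_fun_def by blast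
  define c where "c = (\<lambda>n. 1 / real (Suc n))"
  have c: "c n > 0" "c n \<le> 1" for n by (auto simp: c_def)
  have c0: "c \<longlonglongrightarrow> 0" unfolding c_def by (rule LIMSEQ_Suc[OF lim_1_over_n])
  define k where "k = (\<lambda>n t. h t * \<theta> (c n * t))"
  define k' where "k' = (\<lambda>n t. h' t * \<theta> (c n * t) + h t * (\<theta>' (c n * t) * c n))"
  have dh: "(h has_real_derivative h' t) (at t)" for t using h unfolding line_fun_def by blast
  have d: "(k n has_real_derivative k' n t) (at t)" for n t
  proof -
    have "((\<lambda>t. c n * t) has_real_derivative c n) (at t)" by (auto intro!: derivative_eq_intros)
    from DERIV_chain2[OF \<theta>(6) this] have "((\<lambda>t. \<theta> (c n * t)) has_real_derivative \<theta>' (c n * t) * c n) (at t)" .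
    from DERIV_mult[OF dh this] show ?thesis unfolding k_def k'_def by (rule DERIV_cong) simp
  qed
  have c\<theta>: "continuous_on UNIV \<theta>" using \<theta>(1) by (rule smooth_continuous)
  have ck': "continuous_on UNIV (k' n)" for n
    unfolding k'_def using line_fun_continuous[OF h, of UNIV]
    by (intro continuous_intros continuous_on_compose2[OF c\<theta>] continuous_on_compose2[OF \<theta>(7)]) auto
  have C0: "C \<ge> 0" using order_trans[OF abs_ge_zero C(1)[of 0]] by simp
  have kb: "\<bar>k n t\<bar> \<le> \<bar>h t\<bar>" for n t
    unfolding k_def abs_mult using \<theta>(2,3)[of "c n * t"] by (intro mult_left_le) auto
  have kb': "\<bar>k' n t\<bar> \<le> C * (1 + B) * exp (- \<bar>t\<bar> / 2)" for n t
  proof -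
    have "\<bar>h' t * \<theta> (c n * t)\<bar> \<le> \<bar>h' t\<bar>" unfolding abs_mult using \<theta>(2,3)[of "c n * t"] by (intro mult_left_le) auto
    also have "\<dots> \<le> C * exp (- \<bar>t\<bar> / 2)" by (rule C(2))
    finally have 1: "\<bar>h' t * \<theta> (c n * t)\<bar> \<le> C * exp (- \<bar>t\<bar> / 2)" .
    have "\<bar>\<theta>' (c n * t) * c n\<bar> \<le> B * 1" unfolding abs_mult using c[of n] \<theta>(8)[of "c n * t"] \<theta>(9) by (intro mult_mono) auto
    then have "\<bar>h t * (\<theta>' (c n * t) * c n)\<bar> \<le> (C * exp (- \<bar>t\<bar> / 2)) * B"
      unfolding abs_mult[of "h t"] using C(1)[of t] C0 by (intro mult_mono) auto
    with 1 show ?thesis unfolding k'_def by (simp add: algebra_simps)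
  qed
  have kb2: "\<bar>k n t\<bar> \<le> C * (1 + B) * exp (- \<bar>t\<bar> / 2)" for n t
  proof -
    have "C * exp (- \<bar>t\<bar> / 2) \<le> C * (1 + B) * exp (- \<bar>t\<bar> / 2)"
      using C0 \<theta>(9) by (intro mult_right_mono) (auto simp: algebra_simps)
    then show ?thesis using kb[of n t] C(1)[of t] by linarith
  qed
  have lk: "line_fun (k n) (k' n)" for n
    unfolding line_fun_def using d ck' kb' kb2 by blast
  have ks: "smooth_on UNIV (k n)" for n
    unfolding k_def by (intro smooth_on_mult hs smooth_on_compose[OF _ _ \<theta>(1)] smooth_on_const smooth_on_id) auto
  have kz: "\<bar>t\<bar> \<le> 2 * real (Suc n)" if nz: "k n t \<noteq> 0" for n t
  proof (rule ccontr)
    assume "\<not> \<bar>t\<bar> \<le> 2 * real (Suc n)"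
    then have "\<bar>c n * t\<bar> \<ge> 2" by (simp add: c_def abs_mult field_simps)
    from \<theta>(5)[OF this] nz show False by (simp add: k_def)
  qed
  have k_ev: "\<forall>\<^sub>F n in sequentially. k n t = h t" for t
  proof -
    have "(\<lambda>n. \<bar>c n * t\<bar>) \<longlonglongrightarrow> \<bar>0 * t\<bar>" by (intro tendsto_rabs tendsto_mult c0 tendsto_const)
    then have "\<forall>\<^sub>F n in sequentially. \<bar>c n * t\<bar> < 1" by (rule order_tendstoD(2)) simp
    then show ?thesis by eventually_elim (simp add: k_def \<theta>(4))
  qed
  have klim: "(\<lambda>n. k n t) \<longlonglongrightarrow> h t" for t by (rule tendsto_eventually[OF k_ev])
  have ct: "(\<lambda>n. c n * t) \<longlonglongrightarrow> 0 * t" for t by (intro tendsto_mult c0 tendsto_const)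
  have klim': "(\<lambda>n. k' n t) \<longlonglongrightarrow> h' t" for t
  proof -
    have 1: "(\<lambda>n. \<theta> (c n * t)) \<longlonglongrightarrow> \<theta> (0 * t)"
      by (rule continuous_on_tendsto_compose[OF c\<theta> ct]) auto
    have 2: "(\<lambda>n. \<theta>' (c n * t) * c n) \<longlonglongrightarrow> \<theta>' (0 * t) * 0"
      by (intro tendsto_mult[OF continuous_on_tendsto_compose[OF \<theta>(7) ct] c0]) auto
    have "(\<lambda>n. k' n t) \<longlonglongrightarrow> h' t * \<theta> (0 * t) + h t * (\<theta>' (0 * t) * 0)"
      unfolding k'_def by (intro tendsto_intros 1 2)
    then show ?thesis by (simp add: \<theta>(4))
  qed
  note [measurable] = line_fun_measurable[OF h] line_fun_measurable[OF lk]
  let ?W = "\<lambda>D::real. \<lambda>t. D\<^sup>2 * exp (- \<bar>t\<bar>)"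
  have iW: "integrable lborel (?W D)" for D by (intro integrable_mult_right integrable_exp_abs)
  have sq: "x\<^sup>2 \<le> ?W D t" if "\<bar>x\<bar> \<le> D * exp (- \<bar>t\<bar> / 2)" for x D t
    using power_mono[OF that, of 2] unfolding power_mult_distrib exp_half_square by simp
  let ?D = "2 * (C * (1 + B))"
  have e1: "(\<lambda>n. energy (k n) (k' n)) \<longlonglongrightarrow> energy h h'"
    unfolding energy_def
  proof (rule integral_dominated_convergence[OF _ _ iW[of ?D]])
    show "AE t in lborel. (\<lambda>n. (k' n t + k n t / 2)\<^sup>2) \<longlonglongrightarrow> (h' t + h t / 2)\<^sup>2"
      by (intro AE_I2 tendsto_intros klim klim') auto
    show "AE t in lborel. norm ((k' n t + k n t / 2)\<^sup>2) \<le> ?W ?D t" for n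
    proof (rule AE_I2)
      fix t show "norm ((k' n t + k n t / 2)\<^sup>2) \<le> ?W ?D t"

      proof -
        define A where "A = C * (1 + B) * exp (- \<bar>t\<bar> / 2)"
        have "\<bar>k' n t\<bar> \<le> A" "\<bar>k n t\<bar> \<le> A" unfolding A_def by (rule kb' kb2)+
        then have "\<bar>k' n t + k n t / 2\<bar> \<le> 2 * A" by argo
        then show ?thesis unfolding A_def using sq[of "k' n t + k n t / 2" ?D t] by simp
      qed
    qed
  qed measurable
  have Ch: "C * exp (- \<bar>t\<bar> / 2) \<le> C * (1 + B) * exp (- \<bar>t\<bar> / 2)" for t
    using C0 \<theta>(9) by (intro mult_right_mono) (auto simp: algebra_simps)
  have e2: "(\<lambda>n. energy (\<lambda>t. k n t - h t) (\<lambda>t. k' n t - h' t)) \<longlonglongrightarrow> (\<integral>t. 0 \<partial>(lborel :: real measure))"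
    unfolding energy_def
  proof (rule integral_dominated_convergence[OF _ _ iW[of "2 * ?D"]])
    show "AE t in lborel. (\<lambda>n. (k' n t - h' t + (k n t - h t) / 2)\<^sup>2) \<longlonglongrightarrow> 0"
    proof (rule AE_I2)
      fix t
      have "(\<lambda>n. (k' n t - h' t + (k n t - h t) / 2)\<^sup>2) \<longlonglongrightarrow> (h' t - h' t + (h t - h t) / 2)\<^sup>2"
        by (intro tendsto_intros klim klim') auto
      then show "(\<lambda>n. (k' n t - h' t + (k n t - h t) / 2)\<^sup>2) \<longlonglongrightarrow> 0" by simp
    qed
    show "AE t in lborel. norm ((k' n t - h' t + (k n t - h t) / 2)\<^sup>2) \<le> ?W (2 * ?D) t" for n
    proof (rule AE_I2)
      fix t
      have "\<bar>k' n t - h' t + (k n t - h t) / 2\<bar> \<le> 2 * ?D * exp (- \<bar>t\<bar> / 2)"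
      proof -
        define A where "A = C * (1 + B) * exp (- \<bar>t\<bar> / 2)"
        have "\<bar>k' n t\<bar> \<le> A" "\<bar>k n t\<bar> \<le> A" "\<bar>h t\<bar> \<le> A" "\<bar>h' t\<bar> \<le> A"
          unfolding A_def by (rule kb' kb2 order_trans[OF C(1) Ch] order_trans[OF C(2) Ch])+
        then have "\<bar>k' n t - h' t + (k n t - h t) / 2\<bar> \<le> 4 * A" by argo
        then show ?thesis unfolding A_def by simp
      qed
      then show "norm ((k' n t - h' t + (k n t - h t) / 2)\<^sup>2) \<le> ?W (2 * ?D) t"
        using sq[of "k' n t - h' t + (k n t - h t) / 2" "2 * ?D" t] by simp
    qed
  qed measurable
  have e3: "(\<lambda>n. mass q (k n)) \<longlonglongrightarrow> mass q h"
    unfolding mass_def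
  proof (rule integral_dominated_convergence[OF _ _ line_fun_integrable(4)[OF h q]])
    show "AE t in lborel. (\<lambda>n. \<bar>k n t\<bar> powr (2 + 2 * q)) \<longlonglongrightarrow> \<bar>h t\<bar> powr (2 + 2 * q)"
    proof (rule AE_I2, rule tendsto_eventually)
      fix t show "\<forall>\<^sub>F n in sequentially. \<bar>k n t\<bar> powr (2 + 2 * q) = \<bar>h t\<bar> powr (2 + 2 * q)"
        using k_ev[of t] by eventually_elim simp
    qed
    show "AE t in lborel. norm (\<bar>k n t\<bar> powr (2 + 2 * q)) \<le> \<bar>h t\<bar> powr (2 + 2 * q)" for n
      using kb q by (intro AE_I2) (simp add: powr_mono2)
  qed measurable
  have e4: "(\<lambda>n. \<integral>t. (k n t - h t)\<^sup>2 \<partial>lborel) \<longlonglongrightarrow> (\<integral>t. 0 \<partial>(lborel :: real measure))"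
  proof (rule integral_dominated_convergence[OF _ _ iW[of ?D]])
    show "AE t in lborel. (\<lambda>n. (k n t - h t)\<^sup>2) \<longlonglongrightarrow> 0"
    proof (rule AE_I2, rule tendsto_eventually)
      fix t show "\<forall>\<^sub>F n in sequentially. (k n t - h t)\<^sup>2 = 0"
        using k_ev[of t] by eventually_elim simp
    qed
    show "AE t in lborel. norm ((k n t - h t)\<^sup>2) \<le> ?W ?D t" for n
    proof (rule AE_I2)
      fix t
      have "\<bar>k n t - h t\<bar> \<le> ?D * exp (- \<bar>t\<bar> / 2)"
      proof -
        define A where "A = C * (1 + B) * exp (- \<bar>t\<bar> / 2)"
        have "\<bar>k n t\<bar> \<le> A" "\<bar>h t\<bar> \<le> A" unfolding A_def by (rule kb2 order_trans[OF C(1) Ch])+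
        then have "\<bar>k n t - h t\<bar> \<le> 2 * A" by argo
        then show ?thesis unfolding A_def by simp
      qed
      then show "norm ((k n t - h t)\<^sup>2) \<le> ?W ?D t" using sq[of "k n t - h t" ?D t] by simp
    qed
  qed measurable
  show ?thesis
    by (rule that[of k k', OF lk ks kz e1 _ e3])
      (use e2 e4 line_fun_integrable(2)[OF line_fun_diff[OF lk h]] in auto)
qed

text \<open>A bounded range of \<open>t\<close> is a closed annulus inside the punctured ball, so
  the radial function built from \<open>k\<close> is a test function. Its second profile is
  \<open>k'\<close> by uniqueness of derivatives.\<close>

lemma test_function_of_line:
  assumes R: "R > 0" and k: "smooth_on UNIV k" and kz: "\<And>t. k t \<noteq> 0 \<Longrightarrow> \<bar>t\<bar> \<le> T"
    and d: "\<And>t. (k has_real_derivative k' t) (at t)"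
  obtains f :: "'a::euclidean_space \<Rightarrow> real" where "f \<in> test_functions (ball 0 R - {0})" "radial f"
    "\<And>\<xi>. \<xi> \<in> pball \<Longrightarrow> ray R f \<xi> = k" "\<And>\<xi>. \<xi> \<in> pball \<Longrightarrow> ray' R f \<xi> = k'"
proof -
  define F where "F = (\<lambda>r. if r \<in> {0<..<R} then exp (lvar R r / 2) * k (lvar R r) else 0)"
  define b where "b = rho R (- T)"
  have b: "0 < b" "b < R" using rho_bounds[OF R] unfolding b_def by auto
  have sl: "smooth_on {0<..<R} (lvar R)"
    unfolding lvar_def[abs_def]
    by (rule smooth_on_compose[OF _ _ smooth_on_ln smooth_on_neg_ln_div[OF R]]) (use R in auto)
  have "smooth_on {0<..<R} (\<lambda>r. exp (lvar R r * (1 / 2)) * k (lvar R r))"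
    by (intro smooth_on_mult smooth_on_compose[OF _ _ k sl] smooth_on_compose[OF _ _ smooth_on_exp]
       smooth_on_const sl) auto
  then have s1: "smooth_on {0<..<R} F"
    by (rule smooth_on_cong[rotated 2]) (auto simp: F_def)
  have bnd: "rho R T \<le> r \<and> r \<le> b" if "F r \<noteq> 0" for r
  proof -
    have r: "0 < r" "r < R" using that by (auto simp: F_def split: if_splits)
    have "k (lvar R r) \<noteq> 0" using that by (auto simp: F_def split: if_splits)
    from kz[OF this] have "- T \<le> lvar R r" "lvar R r \<le> T" by auto
    from rho_antimono[OF R this(1)] rho_antimono[OF R this(2)] show ?thesis
      unfolding rho_lvar[OF r] b_def by blast
  qed
  have s2: "smooth_on {b<..} F"
    by (rule smooth_on_cong[OF _ _ smooth_on_const[of _ 0]]) (use bnd in fastforce)+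
  have "smooth_on ({0<..<R} \<union> {b<..}) F" by (rule smooth_on_Un[OF _ _ s1 s2]) auto
  moreover have "{0<..<R} \<union> {b<..} = {0<..}" using b by auto
  ultimately have s: "smooth_on {0<..} F" by simp
  have r0: "0 < rho R T" using rho_bounds[OF R] by blast
  define f where "f = (\<lambda>x::'a. F (norm x))"
  have "f \<in> test_functions (cball 0 b - ball 0 (rho R T))"
    unfolding f_def by (rule test_functions_profile[OF s r0 bnd])
  moreover have "cball (0::'a) b - ball 0 (rho R T) \<subseteq> ball 0 R - {0}" using b r0 by auto
  ultimately have f: "f \<in> test_functions (ball 0 R - {0})" using test_functions_subset by blast
  have ray: "ray R f \<xi> = k" if "\<xi> \<in> pball" for \<xi>
  proof
    fix t
    have "0 < rho R t" "rho R t < R" using rho_bounds[OF R, of t] by auto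
    then show "ray R f \<xi> t = k t"
      unfolding ray_def f_def norm_pball[OF that \<open>0 < rho R t\<close>] F_def
      by (simp add: lvar_rho[OF R] mult.assoc[symmetric] exp_add[symmetric])
  qed
  have ray': "ray' R f \<xi> = k'" if "\<xi> \<in> pball" for \<xi>
  proof
    fix t show "ray' R f \<xi> t = k' t"
      using ray_derivative[OF f, of R \<xi> t] d[of t] unfolding ray[OF that] by (rule DERIV_unique)
  qed
  show ?thesis by (rule that[OF f _ ray ray']) (simp_all add: f_def radial_def)
qed

text \<open>The approximants are radial and vanish near the origin, so they serve twice: they place
  the extremals in the completion, and they are admissible in (A), where they show that the constant
  is optimal.\<close>

theorem approximation_by_tests:
  fixes R q :: real and h h' :: "real \<Rightarrow> real" and e :: "'a::euclidean_space"
  assumes h: "line_fun h h'" "smooth_on UNIV h" and q: "q > 0" and R: "R > 0" and N: "DIM('a) \<ge> 3"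
    and e: "norm e = 1"
  obtains Z :: "nat \<Rightarrow> 'a \<Rightarrow> real" where
    "\<And>n. Z n \<in> test_functions (ball 0 R - {0})" "\<And>n. radial (Z n)"
    "Q_approx R Z (line_u R h)" "(\<lambda>n. Qf (Z n)) \<longlonglongrightarrow> real DIM('a) * omega TYPE('a) * energy h h'"
    "(\<lambda>n. mass q (ray R (Z n) (half e))) \<longlonglongrightarrow> mass q h"
proof -
  let ?V = "real DIM('a) * omega TYPE('a)"
  have V: "?V > 0" using omega_pos[where 'a='a] N by simp
  obtain k k' :: "nat \<Rightarrow> real \<Rightarrow> real" where k: "\<And>n. line_fun (k n) (k' n)" "\<And>n. smooth_on UNIV (k n)"
    "\<And>n t. k n t \<noteq> 0 \<Longrightarrow> \<bar>t\<bar> \<le> 2 * real (Suc n)"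
    and lim: "(\<lambda>n. energy (k n) (k' n)) \<longlonglongrightarrow> energy h h'"
    "(\<lambda>n. energy (\<lambda>t. k n t - h t) (\<lambda>t. k' n t - h' t)) \<longlonglongrightarrow> 0"
    "(\<lambda>n. mass q (k n)) \<longlonglongrightarrow> mass q h"
    "(\<lambda>n. \<integral>t. (k n t - h t)\<^sup>2 \<partial>lborel) \<longlonglongrightarrow> 0"
    and int: "\<And>n. integrable lborel (\<lambda>t. (k n t - h t)\<^sup>2)"
    using line_fun_cutoff[OF h(1) q h(2)] by blast
  have "\<exists>f::'a \<Rightarrow> real. f \<in> test_functions (ball 0 R - {0}) \<and> radial f \<and> (\<forall>\<xi>\<in>pball. ray R f \<xi> = k n \<and> ray' R f \<xi> = k' n)" for n
  proof -
    have d: "(k n has_real_derivative k' n t) (at t)" for t using k(1) unfolding line_fun_def by blast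
    show ?thesis
    proof (rule test_function_of_line[where 'a='a, OF R k(2)[of n] _ d])
      show "\<bar>t\<bar> \<le> 2 * real (Suc n)" if "k n t \<noteq> 0" for t by (rule k(3)[OF that])
      fix f :: "'a \<Rightarrow> real"
      assume "f \<in> test_functions (ball 0 R - {0})" "radial f"
        "\<And>\<xi>. \<xi> \<in> pball \<Longrightarrow> ray R f \<xi> = k n" "\<And>\<xi>. \<xi> \<in> pball \<Longrightarrow> ray' R f \<xi> = k' n"
      then show ?thesis by (intro exI[of _ f] conjI ballI)
    qed
  qed
  then have "\<forall>n. \<exists>f::'a \<Rightarrow> real. f \<in> test_functions (ball 0 R - {0}) \<and> radial f \<and> (\<forall>\<xi>\<in>pball. ray R f \<xi> = k n \<and> ray' R f \<xi> = k' n)" by (rule allI)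
  from choice[OF this] obtain Z :: "nat \<Rightarrow> 'a \<Rightarrow> real" where
    ZZ: "\<forall>n. Z n \<in> test_functions (ball 0 R - {0}) \<and> radial (Z n) \<and> (\<forall>\<xi>\<in>pball. ray R (Z n) \<xi> = k n \<and> ray' R (Z n) \<xi> = k' n)" ..
  have Z: "Z n \<in> test_functions (ball 0 R - {0})" "radial (Z n)" for n by (rule conjunct1[OF spec[OF ZZ]], rule conjunct1[OF conjunct2[OF spec[OF ZZ]]])
  have Z34: "ray R (Z n) \<xi> = k n" "ray' R (Z n) \<xi> = k' n" if "\<xi> \<in> pball" for n \<xi>
    using bspec[OF conjunct2[OF conjunct2[OF spec[OF ZZ, of n]]] that] by (rule conjunct1)(rule conjunct2[OF bspec[OF conjunct2[OF conjunct2[OF spec[OF ZZ, of n]]] that]])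
  have tZ: "Z n \<in> test_functions (ball 0 R)" for n using Z(1) test_functions_subset[of "ball 0 R - {0}" "ball 0 R"] by blast
  have QZ: "Qf (Z n) = ?V * energy (k n) (k' n)" for n
    unfolding Q_radial[OF tZ R Z(2) e] unfolding Z34[OF half_pball(1)[OF e]] ..
  define d where "d = (\<lambda>n. energy (\<lambda>t. k n t - h t) (\<lambda>t. k' n t - h' t))"
  have Qd: "Qf (\<lambda>x. Z i x - Z j x) \<le> ?V * (2 * d i + 2 * d j)" for i j
  proof -
    have r: "radial (\<lambda>x. Z i x - Z j x)" using Z(2)[of i] Z(2)[of j] unfolding radial_def by metis
    have eq: "Qf (\<lambda>x. Z i x - Z j x) = ?V * energy (\<lambda>t. k i t - k j t) (\<lambda>t. k' i t - k' j t)"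
    proof -
      have "ray R (\<lambda>x. Z i x - Z j x) (half e) = (\<lambda>t. k i t - k j t)" "ray' R (\<lambda>x. Z i x - Z j x) (half e) = (\<lambda>t. k' i t - k' j t)"
        by (rule ext, simp only: ray_diff[OF tZ tZ] Z34[OF half_pball(1)[OF e]])+
      then show ?thesis unfolding Q_radial[OF test_functions_diff[OF tZ tZ] R r e] by simp
    qed
    have le: "energy (\<lambda>t. k i t - k j t) (\<lambda>t. k' i t - k' j t) \<le> 2 * d i + 2 * d j"
      using energy_diff_le[OF line_fun_diff[OF k(1)[of i] h(1)] line_fun_diff[OF k(1)[of j] h(1)]] unfolding d_def by simp
    show ?thesis unfolding eq by (rule mult_left_mono[OF le less_imp_le[OF V]])
  qed
  have cauchy: "\<exists>M. \<forall>j\<ge>M. \<forall>i\<ge>M. Qf (\<lambda>x. Z j x - Z i x) < r" if r: "r > 0" for r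
  proof -
    have "\<forall>\<^sub>F n in sequentially. d n < r / (4 * ?V)"
      using lim(2) unfolding d_def[symmetric] by (rule order_tendstoD(2)) (use r V in simp)
    then obtain M where M: "\<And>n. n \<ge> M \<Longrightarrow> d n < r / (4 * ?V)" unfolding eventually_sequentially by blast
    have "Qf (\<lambda>x. Z j x - Z i x) < r" if "j \<ge> M" "i \<ge> M" for i j
    proof -
      have "2 * d j + 2 * d i < r / ?V" using M[OF that(1)] M[OF that(2)] by (simp add: field_simps)
      then have "?V * (2 * d j + 2 * d i) < ?V * (r / ?V)" using V by (rule mult_strict_left_mono)
      also have "?V * (r / ?V) = r"
        unfolding times_divide_eq_right by (rule nonzero_mult_div_cancel_left) (use V in \<open>rule less_imp_neq[THEN not_sym]\<close>)
      finally show ?thesis using Qd[of j i] by linarith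
    qed
    then show ?thesis by blast
  qed
  note [measurable] = line_fun_measurable[OF h(1)] line_fun_measurable[OF k(1)]
  let ?N = "real DIM('a)"
  define J where "J = (\<lambda>n. \<integral>t. (k n t - h t)\<^sup>2 \<partial>lborel)"
  have L2: "(\<integral>\<^sup>+x. ennreal ((to_u (Z n) x - line_u R h x)\<^sup>2) \<partial>lebesgue_on (ball 0 R)) \<le> ennreal (?V * R\<^sup>2 * J n)" for n
  proof -
    note [measurable] = test_measurable[OF tZ[of n]] line_u_measurable[OF line_fun_measurable(1)[OF h(1)], of R, where 'a='a]
    have [measurable]: "to_u (Z n) \<in> borel_measurable borel" unfolding to_u_def[abs_def] by measurable
    have "(\<integral>\<^sup>+x. ennreal ((to_u (Z n) x - line_u R h x)\<^sup>2) \<partial>lebesgue_on (ball 0 R)) =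
       (\<integral>\<^sup>+\<xi>. indicator pball \<xi> * (\<integral>\<^sup>+t. ennreal (?N * rho R t ^ DIM('a) * exp t) *
        ennreal ((to_u (Z n) (ray_pt R \<xi> t) - line_u R h (ray_pt R \<xi> t))\<^sup>2) \<partial>lborel) \<partial>lborel)"
      by (rule nn_polar_rho_ball[OF _ R]) measurable
    also have "\<dots> \<le> (\<integral>\<^sup>+\<xi>. indicator (pball::'a set) \<xi> * ennreal (?N * R\<^sup>2 * J n) \<partial>lborel)"
    proof (rule nn_integral_mono)
      fix \<xi> :: 'a
      show "indicator pball \<xi> * (\<integral>\<^sup>+t. ennreal (?N * rho R t ^ DIM('a) * exp t) *
        ennreal ((to_u (Z n) (ray_pt R \<xi> t) - line_u R h (ray_pt R \<xi> t))\<^sup>2) \<partial>lborel) \<le>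
        indicator (pball::'a set) \<xi> * ennreal (?N * R\<^sup>2 * J n)"
      proof (cases "\<xi> \<in> pball")
        case True
        have "(\<integral>\<^sup>+t. ennreal (?N * rho R t ^ DIM('a) * exp t) *
          ennreal ((to_u (Z n) (ray_pt R \<xi> t) - line_u R h (ray_pt R \<xi> t))\<^sup>2) \<partial>lborel) \<le>
          (\<integral>\<^sup>+t. ennreal (?N * R\<^sup>2 * (k n t - h t)\<^sup>2) \<partial>lborel)"
        proof (rule nn_integral_mono)
          fix t
          have rt: "rho R t > 0" using rho_bounds[OF R, of t] by simp
          have p: "(rho R t powr (- ((?N - 2) / 2)))\<^sup>2 = wgt (ray_pt R \<xi> t)"
            unfolding wgt_def norm_pball[OF True rt] power2_eq_square powr_add[symmetric]
            by (rule arg_cong[where f="(powr) (rho R t)"]) (simp add: field_simps)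
          have ee: "(exp (t / 2))\<^sup>2 = exp t" by (simp add: exp_double[symmetric])
          \<comment> \<open>The Jacobian and the squared prefactors combine to
            \<open>(rho R t * exp t)^2\<close>, which is at most \<open>R^2\<close>; mean squares
            over the ball are thus controlled by those on the line.\<close>
          have "?N * rho R t ^ DIM('a) * exp t * (to_u (Z n) (ray_pt R \<xi> t) - line_u R h (ray_pt R \<xi> t))\<^sup>2 =
            ?N * rho R t ^ DIM('a) * exp t * ((rho R t powr (- ((?N - 2) / 2)))\<^sup>2 * (exp (t / 2))\<^sup>2 * (k n t - h t)\<^sup>2)"
            unfolding to_u_ray[OF True R] line_u_ray[OF True R] Z34(1)[OF True]
            by (simp only: right_diff_distrib[symmetric] power_mult_distrib)
          also have "\<dots> = ?N * (rho R t ^ DIM('a) * wgt (ray_pt R \<xi> t)) * (exp t)\<^sup>2 * (k n t - h t)\<^sup>2"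
            unfolding p ee by (simp only: power2_eq_square mult_ac)
          also have "\<dots> = ?N * (rho R t * exp t)\<^sup>2 * (k n t - h t)\<^sup>2"
            unfolding rho_wgt[OF R True] by (simp only: power_mult_distrib mult_ac)
          also have "\<dots> \<le> ?N * R\<^sup>2 * (k n t - h t)\<^sup>2"
            using rho_exp_le[OF R, of t] rt by (intro mult_right_mono mult_left_mono power_mono) auto
          finally have le: "?N * rho R t ^ DIM('a) * exp t * (to_u (Z n) (ray_pt R \<xi> t) - line_u R h (ray_pt R \<xi> t))\<^sup>2 \<le>
            ?N * R\<^sup>2 * (k n t - h t)\<^sup>2" .
          have "0 \<le> ?N * rho R t ^ DIM('a) * exp t" using rt by simp
          from ennreal_leI[OF le] show "ennreal (?N * rho R t ^ DIM('a) * exp t) *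
            ennreal ((to_u (Z n) (ray_pt R \<xi> t) - line_u R h (ray_pt R \<xi> t))\<^sup>2) \<le> ennreal (?N * R\<^sup>2 * (k n t - h t)\<^sup>2)"
            unfolding ennreal_mult'[OF \<open>0 \<le> ?N * rho R t ^ DIM('a) * exp t\<close>] .
        qed
        also have "\<dots> = ennreal (?N * R\<^sup>2 * J n)"
          unfolding J_def by (subst nn_integral_eq_integral) (use int in auto)
        finally show ?thesis using True by simp
      qed simp
    qed
    also have "\<dots> = ennreal (?V * R\<^sup>2 * J n)"
      using omega_pos[where 'a='a]
      by (subst nn_integral_multc) (auto simp: emeasure_pball ennreal_mult'[symmetric] mult_ac)
    finally show ?thesis .
  qed
  have "(\<lambda>n. ennreal (?V * R\<^sup>2 * J n)) \<longlonglongrightarrow> ennreal (?V * R\<^sup>2 * 0)"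
    by (intro tendsto_ennrealI tendsto_mult_left) (use lim(4) in \<open>simp add: J_def\<close>)
  then have lim0: "(\<lambda>n. ennreal (?V * R\<^sup>2 * J n)) \<longlonglongrightarrow> 0" by simp
  have "(\<lambda>n. \<integral>\<^sup>+x. ennreal ((to_u (Z n) x - line_u R h x)\<^sup>2) \<partial>lebesgue_on (ball 0 R)) \<longlonglongrightarrow> 0"
    by (rule tendsto_sandwich[OF _ _ tendsto_const lim0]) (use L2 in auto)
  then have qa: "Q_approx R Z (line_u R h)" unfolding Q_approx_def using tZ cauchy by blast
  show ?thesis
  proof (rule that[OF Z(1,2) qa])
    show "(\<lambda>n. Qf (Z n)) \<longlonglongrightarrow> ?V * energy h h'" unfolding QZ by (intro tendsto_mult_left lim(1))
    show "(\<lambda>n. mass q (ray R (Z n) (half e))) \<longlonglongrightarrow> mass q h" unfolding Z34(1)[OF half_pball(1)[OF e]] by (rule lim(3))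
  qed
qed

lemma smooth_on_prof: "smooth_on UNIV (\<lambda>t. M * prof q (t - t0))"
proof -
  have 1: "smooth_on UNIV (\<lambda>t. (q / 2) * (t - t0))"
    by (intro smooth_on_mult smooth_on_diff smooth_on_const smooth_on_id) auto
  have 2: "smooth_on UNIV (\<lambda>t. (- (q / 2)) * (t - t0))"
    by (intro smooth_on_mult smooth_on_diff smooth_on_const smooth_on_id) auto
  have "smooth_on UNIV (\<lambda>t. (1 / 2) * (exp ((q / 2) * (t - t0)) + exp ((- (q / 2)) * (t - t0))))"
    by (intro smooth_on_mult smooth_on_add smooth_on_const smooth_on_compose[OF _ _ smooth_on_exp] 1 2) auto
  moreover have "(\<lambda>t. (1 / 2) * (exp ((q / 2) * (t - t0)) + exp ((- (q / 2)) * (t - t0)))) = (\<lambda>t. cosh (q * (t - t0) / 2))"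
    by (simp add: cosh_def)
  ultimately have c: "smooth_on UNIV (\<lambda>t. cosh (q * (t - t0) / 2))" by simp
  have "smooth_on UNIV (\<lambda>t. prof q (t - t0))"
    unfolding prof_def by (rule smooth_on_compose[OF open_UNIV _ smooth_on_powr c]) (use cosh_real_pos in auto)
  then show ?thesis by (intro smooth_on_mult smooth_on_const) auto
qed

subsection \<open>The constant\<close>

text \<open>\<open>N * omega\<close> is the area of the unit sphere of the space, and
  \<open>8 * c_const q\<close> is the integral of \<open>sin^(N-1)\<close> over
  \<open>{0..pi}\<close>. Their product is \<open>sphere_area N\<close>, as slicing that sphere
  suggests; the rest is a count of powers of \<open>N - 2\<close>.\<close>

lemma hardy_sobolev_constant:
  assumes N: "DIM('a::euclidean_space) \<ge> 3"
  defines "N \<equiv> real DIM('a)"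
  shows "sobolev_const N * (N - 2) powr (- (2 * (N - 1) / N)) =
    (N * omega TYPE('a)) powr (2 / N) * K_const (2 / (N - 2))"
proof -
  define q where "q = 2 / (N - 2)"
  define c where "c = c_const q"
  have N2: "N > 2" using N by (simp add: N_def)
  have q: "q > 0" using N2 by (simp add: q_def)
  have G: "Gamma (N / 2) > 0" "Gamma ((N + 1) / 2) > 0" using N2 by (auto intro: Gamma_real_pos)
  have w: "omega TYPE('a) = pi powr (N / 2) / (N / 2 * Gamma (N / 2))"
  proof -
    have "omega TYPE('a) = unit_ball_vol N"
      using content_ball[of 1 "0::'a"] by (simp add: omega_def N_def)
    moreover have "Gamma (N / 2 + 1) = N / 2 * Gamma (N / 2)"
      by (rule Gamma_plus1) (use N2 nonpos_Ints_nonpos[of "N / 2"] in auto)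
    ultimately show ?thesis unfolding unit_ball_vol_def by simp
  qed
  have c8: "8 * c = sqrt pi * Gamma (N / 2) / Gamma ((N + 1) / 2)"
  proof -
    have a: "N / 2 - 1 > 0" using N2 by simp
    have g: "Gamma (N / 2) = (N / 2 - 1) * Gamma (N / 2 - 1)"
      using Gamma_plus1[of "N / 2 - 1"] a nonpos_Ints_nonpos[of "N / 2 - 1"] by auto
    have g3: "Gamma (3 / 2 :: real) = sqrt pi / 2"
      using Gamma_plus1[of "1 / 2 :: real"] Gamma_one_half_real nonpos_Ints_nonpos[of "1 / 2 :: real"] by auto
    have e: "1 / q = N / 2 - 1" "4 * q = 8 / (N - 2)" "N / 2 - 1 + 3 / 2 = (N + 1) / 2" unfolding q_def by (simp_all add: field_simps)
    have "8 * c = (N - 2) * (Gamma (N / 2 - 1) * (sqrt pi / 2) / Gamma ((N + 1) / 2))"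
      unfolding c_def c_const_eq[OF q] e Beta_def g3 by simp
    also have "\<dots> = sqrt pi * ((N / 2 - 1) * Gamma (N / 2 - 1)) / Gamma ((N + 1) / 2)"
      by (simp add: field_simps)
    finally show ?thesis unfolding g .
  qed
  have A: "N * omega TYPE('a) * (8 * c) = sphere_area N"
  proof -
    have p: "pi powr ((N + 1) / 2) = pi powr (N / 2) * sqrt pi"
      unfolding powr_half_sqrt[OF less_imp_le[OF pi_gt_zero], symmetric] powr_add[symmetric] by (simp add: add_divide_distrib)
    have aux: "N * (p / (N / 2 * g)) * (s * g / k) = 2 * (p * s) / k" if "g \<noteq> 0" for p s g k
      using N2 that by (simp add: field_simps)
    show ?thesis unfolding w c8 sphere_area_def p by (rule aux) (use G in simp)
  qed
  define D where "D = 8 * c * (N - 2)"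
  have c0: "c > 0" unfolding c_def by (rule c_const_pos[OF q])
  have D: "D > 0" unfolding D_def using c0 N2 by simp
  have K: "K_const q = N / (4 * (N - 2)) * D powr (2 / N)"
  proof -
    have e: "1 / (1 + q) = (N - 2) / N" "16 * c / q = D" "4 * c * (1 + q) / q = N / (4 * (N - 2)) * D"
      unfolding q_def D_def using N2 by (simp_all add: field_simps)
    have "D powr (2 / N) = D powr (1 + - ((N - 2) / N))" using N2 by (intro arg_cong[where f="(powr) D"]) (simp add: field_simps)
    also have "\<dots> = D * D powr (- ((N - 2) / N))" unfolding powr_add using D by simp
    finally have d: "D * D powr (- ((N - 2) / N)) = D powr (2 / N)" ..
    have "K_const q = 4 * c * (1 + q) / q * (16 * c / q) powr (- (1 / (1 + q)))" unfolding K_const_def c_def ..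
    also have "\<dots> = N / (4 * (N - 2)) * (D * D powr (- ((N - 2) / N)))" unfolding e by (simp only: mult.assoc)
    finally show ?thesis unfolding d .
  qed
  have S: "sphere_area N > 0" unfolding sphere_area_def using G by simp
  have "(N * omega TYPE('a)) powr (2 / N) * K_const q = N / (4 * (N - 2)) * (N * omega TYPE('a) * D) powr (2 / N)"
    unfolding K using omega_pos[where 'a='a] D N2 by (simp add: powr_mult)
  also have "N * omega TYPE('a) * D = sphere_area N * (N - 2)" unfolding D_def A[symmetric] by simp
  also have "(sphere_area N * (N - 2)) powr (2 / N) = sphere_area N powr (2 / N) * (N - 2) powr (2 / N)"
    using S N2 by (simp add: powr_mult)
  finally have 1: "(N * omega TYPE('a)) powr (2 / N) * K_const q =
    N / (4 * (N - 2)) * (sphere_area N powr (2 / N) * (N - 2) powr (2 / N))" .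
  have "(N - 2) powr (- (2 * (N - 1) / N)) = (N - 2) powr (2 / N + (- 2))"
    using N2 by (intro arg_cong[where f="(powr) (N - 2)"]) (simp add: field_simps)
  also have "\<dots> = (N - 2) powr (2 / N) / (N - 2)\<^sup>2"
    unfolding powr_add using N2 by (simp add: powr_minus field_simps)
  finally have 2: "(N - 2) powr (- (2 * (N - 1) / N)) = (N - 2) powr (2 / N) / (N - 2)\<^sup>2" .
  show ?thesis unfolding q_def[symmetric] 1 2 sobolev_const_def using N2 by (simp add: power2_eq_square)
qed

subsection \<open>The two inequalities on the line\<close>

lemma radial_powr_mult:
  fixes f :: "'a::euclidean_space \<Rightarrow> real"
  assumes f: "f \<in> test_functions (ball 0 R - {0})" "radial f" and R: "R > 0"
  shows "(\<lambda>x. norm x powr b * f x) \<in> test_functions (ball 0 R - {0})" "radial (\<lambda>x. norm x powr b * f x)"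
proof -
  obtain e :: 'a where e: "norm e = 1" using ex_unit_vector by blast
  obtain c d where cd: "0 < c" "c \<le> d" "d < R" "\<And>x. f x \<noteq> 0 \<Longrightarrow> c \<le> norm x \<and> norm x \<le> d"
    using test_functions_norm_bounds[OF f(1) order_refl R] by metis
  define F where "F = (\<lambda>r. if r > 0 then r powr b * f (r *\<^sub>R e) else 0)"
  have "smooth_on {0<..} (\<lambda>r. r powr b * f (r *\<^sub>R e))"
    by (intro smooth_on_mult smooth_on_powr smooth_on_subset[OF smooth_profile[OF f(1)]]) auto
  then have s: "smooth_on {0<..} F" by (rule smooth_on_cong[rotated 2]) (auto simp: F_def)
  have b: "c \<le> r \<and> r \<le> d" if "F r \<noteq> 0" for r
  proof -
    have "r > 0" "f (r *\<^sub>R e) \<noteq> 0" using that by (auto simp: F_def split: if_splits)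
    then show ?thesis using cd(4)[of "r *\<^sub>R e"] e by simp
  qed
  have "(\<lambda>x::'a. F (norm x)) \<in> test_functions (cball 0 d - ball 0 c)" by (rule test_functions_profile[OF s cd(1) b])
  moreover have "(\<lambda>x. F (norm x)) = (\<lambda>x. norm x powr b * f x)"
  proof
    fix x show "F (norm x) = norm x powr b * f x"
      using radial_eq[OF f(2) e, of x] by (simp add: F_def)
  qed
  moreover have "cball (0::'a) d - ball 0 c \<subseteq> ball 0 R - {0}" using cd by auto
  ultimately show "(\<lambda>x. norm x powr b * f x) \<in> test_functions (ball 0 R - {0})"
    using test_functions_subset by (metis subsetD)
  show "radial (\<lambda>x. norm x powr b * f x)" unfolding radial_def
  proof (intro allI impI)
    fix x y :: 'a assume n: "norm x = norm y"
    then have "f x = f y" using f(2) unfolding radial_def by blast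
    with n show "norm x powr b * f x = norm y powr b * f y" by simp
  qed
qed

lemma to_u_line_u:
  fixes f :: "'a::euclidean_space \<Rightarrow> real"
  assumes "radial f" "norm (e::'a) = 1" "x \<in> ball 0 R - {0}"
  shows "to_u f x = line_u R (ray R f (half e)) x"
proof -
  have nx: "0 < norm x" "norm x < R" using assms(3) by auto
  have "exp (lvar R (norm x) / 2) * exp (- lvar R (norm x) / 2) = 1" by (simp add: exp_add[symmetric])
  then show ?thesis unfolding to_u_def line_u_def ray_def half_pball(2)[OF assms(2)] rho_lvar[OF nx]
    radial_eq[OF assms(1,2), of x, symmetric] by (simp add: mult.assoc[symmetric])
qed

text \<open>By \<open>punctured_core\<close> the difference of the two integrals in (A) is
  \<open>Qf f\<close>, which for radial \<open>f\<close> is a multiple of the energy on one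
  ray.\<close>

lemma ineq_A_line:
  fixes f :: "'a::euclidean_space \<Rightarrow> real"
  assumes N: "DIM('a) \<ge> 3" and R: "R > 0" and f: "f \<in> test_functions (ball 0 R - {0})" "radial f" and e: "norm (e::'a) = 1"
  defines "V \<equiv> real DIM('a) * omega TYPE('a)"
  shows "ineq_A R C (to_u f) \<longleftrightarrow>
    C * (V * mass (2 / (real DIM('a) - 2)) (ray R f (half e))) powr ((real DIM('a) - 2) / real DIM('a)) \<le>
      V * energy (ray R f (half e)) (ray' R f (half e))"
    and "Qf f = V * energy (ray R f (half e)) (ray' R f (half e))"
proof -
  have fb: "f \<in> test_functions (ball 0 R)" using f(1) test_functions_subset[of "ball 0 R - {0}" "ball 0 R"] by blast
  note lf = line_fun_ray[OF fb R half_pball(1)[OF e]]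
  have ae: "AE x in lebesgue_on (ball 0 R). to_u f x = line_u R (ray R f (half e)) x"
    unfolding AE_lebesgue_on_iff[OF ball_borel]
    by (rule AE_mp[OF AE_lborel_singleton[of "0::'a"]], rule AE_I2, intro impI, rule to_u_line_u[OF f(2) e]) auto
  have m: "weighted_mass R (to_u f) = V * mass (2 / (real DIM('a) - 2)) (ray R f (half e))"
    unfolding V_def
    by (rule weighted_mass_line_u[OF N R line_fun_measurable(1)[OF lf] ae test_measurable_lebesgue_on(2)[OF test_measurable[OF fb]]])
  show Q: "Qf f = V * energy (ray R f (half e)) (ray' R f (half e))" unfolding V_def by (rule Q_radial[OF fb R f(2) e])
  show "ineq_A R C (to_u f) \<longleftrightarrow>
    C * (V * mass (2 / (real DIM('a) - 2)) (ray R f (half e))) powr ((real DIM('a) - 2) / real DIM('a)) \<le>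
      V * energy (ray R f (half e)) (ray' R f (half e))"
    unfolding ineq_A_def Let_def m Q[symmetric] punctured_core[OF f(1) R, symmetric] by linarith
qed

section \<open>Inequality (B) on the line\<close>

lemma integral_radial_exp:
  fixes F :: "'a::euclidean_space \<Rightarrow> real" and N :: real and k :: "real \<Rightarrow> real"
  assumes F: "F \<in> borel_measurable borel" "\<And>x. F x \<ge> 0" and dim: "DIM('a) \<ge> 3"
    and k: "integrable lborel k" "\<And>t. k t \<ge> 0"
    and eq: "\<And>x t. norm (x::'a) = 1 \<Longrightarrow>
      real DIM('a) * exp (- t / (real DIM('a) - 2)) ^ DIM('a) / (real DIM('a) - 2) * F (exp (- t / (real DIM('a) - 2)) *\<^sub>R x) = k t"
  shows "(LINT y|lebesgue. F y) = omega TYPE('a) * integral\<^sup>L lborel k"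
proof -
  note [measurable] = F(1)
  let ?n = "DIM('a)" and ?g = "\<lambda>t. exp (- t / (real DIM('a) - 2))"
  let ?I = "\<lambda>\<xi>::'a. (\<integral>\<^sup>+r. indicator {0<..} r * ennreal (real ?n * r ^ (?n - 1)) * ennreal (F (r *\<^sub>R sgn \<xi>)) \<partial>lborel)"
  have N2: "real ?n - 2 > 0" using dim by simp
  have pr: "?I \<xi> =
    ennreal (integral\<^sup>L lborel k)" if \<xi>: "\<xi> \<in> pball" for \<xi> :: 'a
  proof -
    let ?H = "\<lambda>r. ennreal (real ?n * r ^ (?n - 1)) * ennreal (F (r *\<^sub>R sgn \<xi>))"
    have "?I \<xi> =
      (\<integral>\<^sup>+r. ?H r * indicator {0<..} r \<partial>lborel)" by (simp add: mult_ac)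
    also have "\<dots> = (\<integral>\<^sup>+t. ?H (?g t) * ennreal (- (- (?g t / (real ?n - 2)))) \<partial>lborel)"
    proof (rule nn_integral_substitution_decreasing)
      show "?H \<in> borel_measurable borel" by measurable
      show "(?g has_real_derivative - (?g t / (real ?n - 2))) (at t)" for t
        using N2 by (auto intro!: derivative_eq_intros)
      show "continuous_on UNIV (\<lambda>t. - (?g t / (real ?n - 2)))" using N2 by (intro continuous_intros) auto
      show "- (?g t / (real ?n - 2)) \<le> 0" for t using N2 by simp
      show "r \<in> {0<..} \<longleftrightarrow> (\<exists>n. ?g (real n) \<le> r \<and> r \<le> ?g (- real n))" for r
      proof
        assume r: "r \<in> {0<..}"
        obtain n :: nat where n: "(real ?n - 2) * \<bar>ln r\<bar> \<le> real n" using real_arch_simple by blast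
        then have b: "\<bar>ln r\<bar> \<le> real n / (real ?n - 2)" using N2 by (simp add: field_simps)
        have "?g (real n) \<le> exp (ln r)" "exp (ln r) \<le> ?g (- real n)"
          unfolding exp_le_cancel_iff using b by auto
        moreover have "exp (ln r) = r" using r by simp
        ultimately have "?g (real n) \<le> r \<and> r \<le> ?g (- real n)" by simp
        then show "\<exists>n. ?g (real n) \<le> r \<and> r \<le> ?g (- real n)" by (rule exI)
      next
        assume "\<exists>n. ?g (real n) \<le> r \<and> r \<le> ?g (- real n)"
        then obtain n :: nat where "?g (real n) \<le> r" by blast
        then have "0 < r" by (rule less_le_trans[OF exp_gt_zero])
        then show "r \<in> {0<..}" by simp
      qed
    qed simp
    also have "\<dots> = (\<integral>\<^sup>+t. ennreal (k t) \<partial>lborel)"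
    proof (rule nn_integral_cong)
      fix t
      have ns: "norm (sgn \<xi>) = 1" using \<xi> by (simp add: norm_sgn)
      have "?g t ^ ?n = ?g t ^ (?n - 1) * ?g t" using dim by (metis power_minus_mult DIM_positive)
      then have "k t = real ?n * ?g t ^ (?n - 1) * F (?g t *\<^sub>R sgn \<xi>) * (?g t / (real ?n - 2))"
        using eq[OF ns, of t] by (simp add: mult_ac)
      then show "?H (?g t) * ennreal (- (- (?g t / (real ?n - 2)))) = ennreal (k t)"
        using F(2) N2 by (simp add: ennreal_mult'[symmetric])
    qed
    also have "\<dots> = ennreal (integral\<^sup>L lborel k)" by (rule nn_integral_eq_integral[OF k(1)]) (use k(2) in auto)
    finally show ?thesis .
  qed
  have k0: "integral\<^sup>L lborel k \<ge> 0" using k(2) by simp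
  have "(\<integral>\<^sup>+y. ennreal (F y) \<partial>lborel) = (\<integral>\<^sup>+\<xi>. indicator (pball::'a set) \<xi> * ennreal (integral\<^sup>L lborel k) \<partial>lborel)"
  proof (subst nn_integral_polar')
    show "(\<lambda>y. ennreal (F y)) \<in> borel_measurable borel" by measurable
    show "(\<integral>\<^sup>+\<xi>. indicator pball \<xi> * ?I \<xi> \<partial>lborel) =
      (\<integral>\<^sup>+\<xi>. indicator (pball::'a set) \<xi> * ennreal (integral\<^sup>L lborel k) \<partial>lborel)"
    proof (rule nn_integral_cong)
      fix \<xi> :: 'a
      show "indicator pball \<xi> * ?I \<xi> =
        indicator pball \<xi> * ennreal (integral\<^sup>L lborel k)"
        using pr[of \<xi>] by (cases "\<xi> \<in> pball") simp_all
    qed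
  qed
  also have "\<dots> = ennreal (omega TYPE('a) * integral\<^sup>L lborel k)"
    using omega_pos[where 'a='a] k0 by (subst nn_integral_multc) (auto simp: emeasure_pball ennreal_mult'[symmetric])
  finally have nn: "(\<integral>\<^sup>+y. ennreal (F y) \<partial>lborel) = ennreal (omega TYPE('a) * integral\<^sup>L lborel k)" .
  have "(LINT y|lebesgue. F y) = (LINT y|lborel. F y)" by (rule integral_completion) simp
  also have "\<dots> = enn2real (\<integral>\<^sup>+y. ennreal (F y) \<partial>lborel)" by (rule integral_eq_nn_integral) (use F in auto)
  also have "\<dots> = omega TYPE('a) * integral\<^sup>L lborel k" unfolding nn using omega_pos[where 'a='a] k0 by simp
  finally show ?thesis .
qed

text \<open>The radius that the transformation assigns to \<open>r\<close> is
  \<open>exp (- \<tau> / (N - 2))\<close> with the \<open>\<tau>\<close> of \<open>r\<close>. In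
  this parametrisation both inequalities have the same line variable.\<close>

definition ray_B :: "('a::euclidean_space \<Rightarrow> real) \<Rightarrow> 'a \<Rightarrow> real \<Rightarrow> real" where
  "ray_B w e t = exp (- t / 2) * w (exp (- t / (real DIM('a) - 2)) *\<^sub>R e)"

definition ray_B' :: "('a::euclidean_space \<Rightarrow> real) \<Rightarrow> 'a \<Rightarrow> real \<Rightarrow> real" where
  "ray_B' w e t = - (exp (- t / 2) * (exp (- t / (real DIM('a) - 2)) / (real DIM('a) - 2)) *
     (e \<bullet> grad w (exp (- t / (real DIM('a) - 2)) *\<^sub>R e))) - ray_B w e t / 2"

lemma ray_B_derivative:
  fixes w :: "'a::euclidean_space \<Rightarrow> real"
  assumes w: "w \<in> test_functions S" and N: "DIM('a) \<ge> 3"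
  shows "(ray_B w e has_real_derivative ray_B' w e t) (at t)"
proof -
  have g: "((\<lambda>t. exp (- t / (real DIM('a) - 2))) has_real_derivative - (exp (- t / (real DIM('a) - 2)) / (real DIM('a) - 2))) (at t)"
    using N by (auto intro!: derivative_eq_intros)
  have 1: "((\<lambda>t. w (exp (- t / (real DIM('a) - 2)) *\<^sub>R e)) has_real_derivative
    (e \<bullet> grad w (exp (- t / (real DIM('a) - 2)) *\<^sub>R e)) * - (exp (- t / (real DIM('a) - 2)) / (real DIM('a) - 2))) (at t)"
    by (rule DERIV_chain2[OF radial_derivative[OF w] g])
  have 2: "((\<lambda>t. exp (- t / 2)) has_real_derivative - (1 / 2) * exp (- t / 2)) (at t)"
    by (auto intro!: derivative_eq_intros)
  show ?thesis unfolding ray_B_def[abs_def] ray_B'_def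
    by (rule DERIV_cong[OF DERIV_mult[OF 2 1]]) (simp add: algebra_simps)
qed

lemma line_fun_ray_B:
  fixes w :: "'a::euclidean_space \<Rightarrow> real"
  assumes w: "w \<in> test_functions S" and N: "DIM('a) \<ge> 3" and e: "norm (e::'a) = 1"
  shows "line_fun (ray_B w e) (ray_B' w e)"
proof -
  let ?d = "real DIM('a) - 2"
  let ?g = "\<lambda>t. exp (- t / ?d)"
  let ?k = "\<lambda>t. w (?g t *\<^sub>R e)" and ?k' = "\<lambda>t. - ((?g t / ?d) * (e \<bullet> grad w (?g t *\<^sub>R e)))"
  have N2: "?d \<ge> 1" using N by simp
  have ray: "ray_B w e = (\<lambda>t. exp (- t / 2) * ?k t)" "ray_B' w e = (\<lambda>t. exp (- t / 2) * (?k' t - ?k t / 2))"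
    by (rule ext, simp add: ray_B'_def ray_B_def right_diff_distrib mult.assoc)+
  obtain B where B: "B \<ge> 0" "\<And>x. \<bar>w x\<bar> \<le> B" "\<And>x. norm (grad w x) \<le> B" using test_bounded[OF w] by metis
  obtain K where K: "compact K" "K \<subseteq> S" "\<And>x. x \<notin> K \<Longrightarrow> w x = 0" "\<And>x. x \<notin> K \<Longrightarrow> grad w x = 0"
    using test_support[OF w] by metis
  obtain b where b: "b > 0" "\<And>x. x \<in> K \<Longrightarrow> norm x \<le> b" using compact_imp_bounded[OF K(1)] unfolding bounded_pos by blast
  have z: "?k t = 0 \<and> ?k' t = 0" if "\<not> ?g t \<le> b" for t
  proof -
    have "?g t *\<^sub>R e \<notin> K" using b(2)[of "?g t *\<^sub>R e"] e that by auto
    then show ?thesis using K(3,4) by simp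
  qed
  show ?thesis unfolding ray
  proof (rule line_fun_exp_half[where B = "max 1 b * B" and T = "?d * \<bar>ln b\<bar>"])
    show "((\<lambda>t. exp (- t / 2) * ?k t) has_real_derivative exp (- t / 2) * (?k' t - ?k t / 2)) (at t)" for t
      using ray_B_derivative[OF w N, of e t] unfolding ray .
    show "continuous_on UNIV ?k" "continuous_on UNIV ?k'"
      by (intro continuous_intros continuous_on_compose2[OF continuous_on_grad[OF w, of UNIV]]
        continuous_on_compose2[OF test_continuous[OF w, of UNIV]]; use N2 in simp)+
    show "\<bar>?k t\<bar> \<le> max 1 b * B" for t
      using B(2)[of "?g t *\<^sub>R e"] mult_right_mono[of 1 "max 1 b" B] B(1) by simp
    show "\<bar>?k' t\<bar> \<le> max 1 b * B" for t
    proof (cases "?g t \<le> b")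
      case True
      have "\<bar>e \<bullet> grad w (?g t *\<^sub>R e)\<bar> \<le> B"
        using Cauchy_Schwarz_ineq2[of e "grad w (?g t *\<^sub>R e)"] B(3)[of "?g t *\<^sub>R e"] e by simp
      moreover have "\<bar>?g t / ?d\<bar> \<le> max 1 b"
      proof -
        have "?g t / ?d \<le> ?g t / 1" using N2 by (intro divide_left_mono) auto
        moreover have "?g t / ?d \<ge> 0" using N2 by simp
        ultimately show ?thesis using True by linarith
      qed
      ultimately show ?thesis unfolding abs_minus_cancel abs_mult[of "?g t / ?d"] by (intro mult_mono) auto
    next
      case False
      then show ?thesis using z[OF False] B(1) by (simp only: abs_zero) simp
    qed
    show "?k t = 0 \<and> ?k' t = 0" if t: "t < - (?d * \<bar>ln b\<bar>)" for t
    proof (rule z)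
      have d: "?d > 0" using N2 by linarith
      have "\<bar>ln b\<bar> * ?d < - t" using t unfolding mult.commute[of "\<bar>ln b\<bar>" ?d] by linarith
      then have "\<bar>ln b\<bar> < - t / ?d" unfolding pos_less_divide_eq[OF d] .
      then have "ln b < - t / ?d" by linarith
      then have "exp (ln b) < ?g t" unfolding exp_less_cancel_iff .
      then show "\<not> ?g t \<le> b" using b(1) by simp
    qed
  qed (use N2 in simp)
qed

text \<open>The change of variable multiplies the energy by \<open>N - 2\<close> and divides the
  mass by it. The factor \<open>(N - 2) powr (2 * (N - 1) / N)\<close> in (B) compensates for
  exactly this.\<close>

lemma ineq_B_line:
  fixes w :: "'a::euclidean_space \<Rightarrow> real"
  assumes N: "DIM('a) \<ge> 3" and w: "w \<in> test_functions S" "radial w" and e: "norm (e::'a) = 1"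
  defines "V \<equiv> real DIM('a) * omega TYPE('a)"
  shows "ineq_B C w \<longleftrightarrow>
    C * (V * mass (2 / (real DIM('a) - 2)) (ray_B w e)) powr ((real DIM('a) - 2) / real DIM('a)) \<le>
      V * energy (ray_B w e) (ray_B' w e)"
proof -
  define n where "n = real DIM('a)"
  define q where "q = 2 / (n - 2)"
  have n2: "n - 2 > 0" using N by (simp add: n_def)
  have q: "q > 0" using n2 by (simp add: q_def)
  let ?g = "\<lambda>t. exp (- t / (n - 2))"
  note lf = line_fun_ray_B[OF w(1) N e]
  note [measurable] = test_measurable[OF w(1)] grad_measurable[OF w(1)]
  have gN: "?g t ^ DIM('a) = exp (- t * (n / (n - 2)))" for t
    unfolding exp_of_nat_mult[symmetric] n_def by (simp add: field_simps)
  have E: "(LINT y|lebesgue. (norm (grad w y))\<^sup>2) = omega TYPE('a) * (LBINT t. n * (n - 2) * (ray_B' w e t + ray_B w e t / 2)\<^sup>2)"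
  proof (rule integral_radial_exp[OF _ _ N])
    show "integrable lborel (\<lambda>t. n * (n - 2) * (ray_B' w e t + ray_B w e t / 2)\<^sup>2)"
      by (intro integrable_mult_right line_fun_integrable(1)[OF lf])
    show "n * (n - 2) * (ray_B' w e t + ray_B w e t / 2)\<^sup>2 \<ge> 0" for t using n2 by simp
    fix x :: 'a and t :: real assume x: "norm x = 1"
    have g0: "?g t > 0" by simp
    have nx: "norm (?g t *\<^sub>R x) = ?g t" using x by simp
    then have "?g t *\<^sub>R x \<noteq> 0" using g0 by (metis norm_zero less_irrefl)
    from radial_grad[OF w(1,2) e this] have gr: "(norm (grad w (?g t *\<^sub>R x)))\<^sup>2 = (e \<bullet> grad w (?g t *\<^sub>R e))\<^sup>2"
      unfolding nx using nx g0 by (simp add: power2_eq_square x)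
    have s: "ray_B' w e t + ray_B w e t / 2 = - (exp (- t / 2) * (?g t / (n - 2)) * (e \<bullet> grad w (?g t *\<^sub>R e)))"
      unfolding ray_B'_def n_def by simp
    have "n * ?g t ^ DIM('a) / (n - 2) = n * (n - 2) * (exp (- t / 2) * (?g t / (n - 2)))\<^sup>2"
    proof -
      have "(exp (- t / 2) * ?g t)\<^sup>2 = ?g t ^ DIM('a)"
        unfolding gN exp_add[symmetric] exp_double[symmetric] using n2 by (simp add: field_simps)
      moreover have "n * (n - 2) * (exp (- t / 2) * (?g t / (n - 2)))\<^sup>2 = n * (exp (- t / 2) * ?g t)\<^sup>2 / (n - 2)"
        using n2 by (simp add: power2_eq_square)
      ultimately show ?thesis by simp
    qed
    then show "real DIM('a) * exp (- t / (real DIM('a) - 2)) ^ DIM('a) / (real DIM('a) - 2) *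
      (norm (grad w (exp (- t / (real DIM('a) - 2)) *\<^sub>R x)))\<^sup>2 = n * (n - 2) * (ray_B' w e t + ray_B w e t / 2)\<^sup>2"
      unfolding n_def[symmetric] gr s power2_minus power_mult_distrib[of _ "e \<bullet> grad w (?g t *\<^sub>R e)"] by (simp only: mult.assoc)
  qed measurable
  have M: "(LINT y|lebesgue. \<bar>w y\<bar> powr (2 * n / (n - 2))) = omega TYPE('a) * (LBINT t. n / (n - 2) * \<bar>ray_B w e t\<bar> powr (2 + 2 * q))"
  proof (rule integral_radial_exp[OF _ _ N])
    show "integrable lborel (\<lambda>t. n / (n - 2) * \<bar>ray_B w e t\<bar> powr (2 + 2 * q))"
      by (intro integrable_mult_right line_fun_integrable(4)[OF lf q])
    show "n / (n - 2) * \<bar>ray_B w e t\<bar> powr (2 + 2 * q) \<ge> 0" for t using n2 by simp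
    fix x :: 'a and t :: real assume x: "norm x = 1"
    have "w (?g t *\<^sub>R x) = w (?g t *\<^sub>R e)" using radial_eq[OF w(2) e, of "?g t *\<^sub>R x"] x by simp
    moreover have p: "2 + 2 * q = 2 * n / (n - 2)" unfolding q_def using n2 by (simp add: field_simps)
    have "\<bar>ray_B w e t\<bar> powr (2 + 2 * q) = exp (- t / 2) powr (2 * n / (n - 2)) * \<bar>w (?g t *\<^sub>R e)\<bar> powr (2 * n / (n - 2))"
      unfolding ray_B_def n_def[symmetric] abs_mult p by (simp add: powr_mult)
    moreover have "exp (- t / 2) powr (2 * n / (n - 2)) = ?g t ^ DIM('a)"
      unfolding gN exp_powr_real by simp
    ultimately show "real DIM('a) * exp (- t / (real DIM('a) - 2)) ^ DIM('a) / (real DIM('a) - 2) *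
      \<bar>w (exp (- t / (real DIM('a) - 2)) *\<^sub>R x)\<bar> powr (2 * n / (n - 2)) = n / (n - 2) * \<bar>ray_B w e t\<bar> powr (2 + 2 * q)"
      unfolding n_def[symmetric] by simp
  qed measurable
  define P where "P = V * mass q (ray_B w e)"
  define D where "D = V * energy (ray_B w e) (ray_B' w e)"
  have V: "V \<ge> 0" using omega_pos[where 'a='a] by (simp add: V_def)
  have E': "(LINT y|lebesgue. (norm (grad w y))\<^sup>2) = (n - 2) * D"
    unfolding E D_def V_def energy_def n_def[symmetric] by simp
  have M': "(LINT y|lebesgue. \<bar>w y\<bar> powr (2 * n / (n - 2))) = P / (n - 2)"
    unfolding M P_def V_def mass_def n_def[symmetric] by simp
  have P: "P \<ge> 0" unfolding P_def using V mass_nonneg by simp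
  have "(n - 2) powr (2 * (n - 1) / n) = (n - 2) powr (1 + (n - 2) / n)"
    using n2 by (intro arg_cong[where f="(powr) (n - 2)"]) (simp add: field_simps)
  also have "\<dots> = (n - 2) * (n - 2) powr ((n - 2) / n)" unfolding powr_add using n2 by simp
  finally have pw: "(n - 2) powr (2 * (n - 1) / n) * (P / (n - 2)) powr ((n - 2) / n) = (n - 2) * P powr ((n - 2) / n)"
    using n2 P by (simp add: powr_divide)
  have "ineq_B C w \<longleftrightarrow> (n - 2) powr (2 * (n - 1) / n) * C * (P / (n - 2)) powr ((n - 2) / n) \<le> (n - 2) * D"
    unfolding ineq_B_def Let_def n_def[symmetric] E' M' ..
  also have "(n - 2) powr (2 * (n - 1) / n) * C * (P / (n - 2)) powr ((n - 2) / n) =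
     (n - 2) * (C * P powr ((n - 2) / n))"
    using pw by (simp add: mult_ac)
  also have "(n - 2) * (C * P powr ((n - 2) / n)) \<le> (n - 2) * D \<longleftrightarrow> C * P powr ((n - 2) / n) \<le> D"
    using n2 by (rule mult_le_cancel_left_pos)
  finally show ?thesis unfolding P_def D_def q_def n_def .
qed

subsection \<open>The functions \<open>u\<^sub>m\<^sub>,\<^sub>n\<close>\<close>

lemma ln_div_neg: "0 < r \<Longrightarrow> r < R \<Longrightarrow> ln (r / R) < 0" for r R :: real
  by simp

text \<open>Factoring out the geometric mean gives \<open>m^2 + n^2 * exp (- q * \<tau>) = exp (- q
  * \<tau> / 2) * 2 * |m n| * cosh (q * \<tau> / 2 + ln |m / n|)\<close>. So \<open>|m n|\<close>
  fixes the height of the profile and \<open>|m / n|\<close> its position.\<close>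

lemma u_mn_line_u:
  assumes N: "DIM('a::euclidean_space) \<ge> 3" and R: "R > 0" and mn: "m \<noteq> 0" "n \<noteq> 0" and x: "x \<in> ball (0::'a) R - {0}"
  defines "q \<equiv> 2 / (real DIM('a) - 2)"
  shows "u_mn R m n x = line_u R (\<lambda>t. (2 * \<bar>m * n\<bar>) powr (- (1 / q)) * prof q (t - (- (2 / q) * ln \<bar>m / n\<bar>))) x"
proof -
  have q: "q > 0" using N by (simp add: q_def)
  have q1: "(real DIM('a) - 2) / 2 = 1 / q" "2 / (real DIM('a) - 2) = q" using N by (simp_all add: q_def)
  define \<tau> where "\<tau> = lvar R (norm x)"
  have nx: "0 < norm x" "norm x < R" using x by auto
  have "ln (norm x / R) < 0" by (rule ln_div_neg[OF nx])
  then have l: "- ln (norm x / R) = exp \<tau>" by (simp add: \<tau>_def lvar_def)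
  define c where "c = cosh (q * \<tau> / 2 + ln \<bar>m / n\<bar>)"
  have c: "c > 0" by (simp add: c_def cosh_real_pos)
  have "(exp \<tau>) powr (- q) = exp (- (q * \<tau>))" unfolding exp_powr_real by (simp add: mult.commute)
  have e: "m\<^sup>2 + n\<^sup>2 * (exp \<tau>) powr (- q) = exp (- (q * \<tau>) / 2) * (2 * \<bar>m * n\<bar> * c)"
  proof -
    have 1: "exp (q * \<tau> / 2 + ln \<bar>m / n\<bar>) = exp (q * \<tau> / 2) * \<bar>m / n\<bar>"
      using mn unfolding exp_add by simp
    have 2: "exp (- (q * \<tau> / 2 + ln \<bar>m / n\<bar>)) = exp (- (q * \<tau>) / 2) * \<bar>n / m\<bar>"
      unfolding minus_add_distrib exp_add using mn by (simp add: exp_minus[of "ln _"] field_simps)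
    have 3: "exp (- (q * \<tau>) / 2) * exp (q * \<tau> / 2) = 1" "exp (- (q * \<tau>) / 2) * exp (- (q * \<tau>) / 2) = (exp \<tau>) powr (- q)"
      unfolding exp_powr_real exp_add[symmetric] by (simp_all add: field_simps)
    have 4: "\<bar>m * n\<bar> * \<bar>m / n\<bar> = m\<^sup>2" "\<bar>m * n\<bar> * \<bar>n / m\<bar> = n\<^sup>2"
      unfolding abs_mult abs_divide using mn by (simp_all add: power2_eq_square)
    have "exp (- (q * \<tau>) / 2) * (2 * \<bar>m * n\<bar> * c) =
      exp (- (q * \<tau>) / 2) * (\<bar>m * n\<bar> * (exp (q * \<tau> / 2) * \<bar>m / n\<bar> + exp (- (q * \<tau>) / 2) * \<bar>n / m\<bar>))"
      unfolding c_def cosh_def 1 2 by simp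
    also have "\<dots> = (exp (- (q * \<tau>) / 2) * exp (q * \<tau> / 2)) * (\<bar>m * n\<bar> * \<bar>m / n\<bar>) +
      (exp (- (q * \<tau>) / 2) * exp (- (q * \<tau>) / 2)) * (\<bar>m * n\<bar> * \<bar>n / m\<bar>)"
      by (simp only: distrib_left mult_ac)
    finally show ?thesis unfolding 3 4 by simp
  qed
  have "exp (- (q * \<tau>) / 2) powr (- (1 / q)) = exp (\<tau> / 2)"
    unfolding exp_powr_real using q by simp
  then have "(exp (- (q * \<tau>) / 2) * (2 * \<bar>m * n\<bar> * c)) powr (- (1 / q)) = exp (\<tau> / 2) * ((2 * \<bar>m * n\<bar>) powr (- (1 / q)) * c powr (- (1 / q)))"
    using c by (simp add: powr_mult)
  then have "u_mn R m n x = norm x powr (- (1 / q)) * (exp (\<tau> / 2) * ((2 * \<bar>m * n\<bar>) powr (- (1 / q)) * c powr (- (1 / q))))"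
    unfolding u_mn_def Let_def q1 l e using x by simp
  moreover have "c powr (- (1 / q)) = prof q (\<tau> - (- (2 / q) * ln \<bar>m / n\<bar>))"
  proof -
    have "q * (\<tau> - (- (2 / q) * L)) / 2 = q * \<tau> / 2 + L" for L using q by (simp add: field_simps)
    then show ?thesis unfolding prof_def c_def by (simp only:)
  qed
  ultimately show ?thesis unfolding line_u_def \<tau>_def[symmetric] q1 by (simp only: mult.assoc)
qed

text \<open>The factor \<open>s x powr (- q)\<close> is taken out of the bracket; its power
  \<open>- (1 / q)\<close> is \<open>s x\<close>, which vanishes on the boundary sphere. The formula
  \<open>g\<close> so obtained extends continuously to the sphere with the value 0.\<close>

lemma u_mn_continuous:
  assumes N: "DIM('a::euclidean_space) \<ge> 3" and R: "R > 0" and mn: "n \<noteq> 0"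
  shows "continuous_on (cball 0 R - {0}) (u_mn R m n :: 'a \<Rightarrow> real)"
proof -
  define q where "q = 2 / (real DIM('a) - 2)"
  have q: "q > 0" using N by (simp add: q_def)
  have q1: "(real DIM('a) - 2) / 2 = 1 / q" "2 / (real DIM('a) - 2) = q" using N by (simp_all add: q_def)
  define s where "s = (\<lambda>x::'a. - ln (norm x / R))"
  define g where "g = (\<lambda>x::'a. norm x powr (- (1 / q)) * (s x * (m\<^sup>2 * s x powr q + n\<^sup>2) powr (- (1 / q))))"
  have s0: "s x \<ge> 0" if "x \<in> cball 0 R - {0}" for x
  proof -
    have "0 < norm x / R" "norm x / R \<le> 1" using that R by simp_all
    then show ?thesis unfolding s_def by (simp only: neg_0_le_iff_le ln_le_zero_iff)
  qed
  have d: "m\<^sup>2 * s x powr q + n\<^sup>2 > 0" for x using mn by (intro add_nonneg_pos) auto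
  have cs: "continuous_on (cball 0 R - {0}) s" unfolding s_def using R by (intro continuous_intros) auto
  have cp: "continuous_on (cball 0 R - {0}) (\<lambda>x. s x powr q)"
    by (rule continuous_on_powr'[OF cs continuous_on_const]) (use s0 q in auto)
  have c1: "continuous_on (cball 0 R - {0}) (\<lambda>x. m\<^sup>2 * s x powr q + n\<^sup>2)"
    by (intro continuous_on_add continuous_on_mult continuous_on_const cp)
  have c2: "continuous_on (cball 0 R - {0}) (\<lambda>x. (m\<^sup>2 * s x powr q + n\<^sup>2) powr (- (1 / q)))"
    by (rule continuous_on_powr[OF c1 continuous_on_const]) (intro ballI less_imp_neq[OF d, THEN not_sym])
  have c3: "continuous_on (cball 0 R - {0::'a}) (\<lambda>x. norm x powr (- (1 / q)))"
    by (rule continuous_on_powr[OF continuous_on_norm[OF continuous_on_id] continuous_on_const]) auto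
  have "continuous_on (cball 0 R - {0}) g" unfolding g_def by (intro continuous_on_mult c3 cs c2)
  moreover have "g x = u_mn R m n x" if x: "x \<in> cball 0 R - {0}" for x
  proof (cases "x \<in> ball 0 R")
    case False
    then have "norm x = R" using x by auto
    then show ?thesis using R by (simp add: g_def s_def u_mn_def Let_def)
  next
    case True
    then have nx: "0 < norm x" "norm x < R" using x by auto
    then have sp: "s x > 0" unfolding s_def by (simp only: neg_0_less_iff_less ln_div_neg)
    have "s x powr (- q) * s x powr q = 1" using sp by (simp add: powr_add[symmetric])
    then have "m\<^sup>2 + n\<^sup>2 * s x powr (- q) = s x powr (- q) * (m\<^sup>2 * s x powr q + n\<^sup>2)"
      by (simp add: algebra_simps)
    then have "(m\<^sup>2 + n\<^sup>2 * s x powr (- q)) powr (- (1 / q)) = (s x powr (- q)) powr (- (1 / q)) * (m\<^sup>2 * s x powr q + n\<^sup>2) powr (- (1 / q))"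
      using d[of x] by (simp add: powr_mult)
    also have "(s x powr (- q)) powr (- (1 / q)) = s x" unfolding powr_powr using q sp by simp
    finally have F: "(m\<^sup>2 + n\<^sup>2 * s x powr (- q)) powr (- (1 / q)) = s x * (m\<^sup>2 * s x powr q + n\<^sup>2) powr (- (1 / q))" .
    have sx: "- ln (norm x / R) = s x" by (simp add: s_def)
    show ?thesis unfolding g_def u_mn_def Let_def q1 sx F using True x by simp
  qed
  ultimately show ?thesis by (rule continuous_on_cong[OF refl, THEN iffD1, rotated])
qed

subsection \<open>The variational problem\<close>

text \<open>Completeness of the measure: the exceptional part of every preimage is a subset of a
  null set.\<close>

lemma lebesgue_on_measurable_AE:
  fixes u g :: "'a::euclidean_space \<Rightarrow> real"
  assumes S: "S \<in> sets borel" and g: "g \<in> borel_measurable borel" and ae: "AE x in lebesgue_on S. u x = g x"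
  shows "u \<in> borel_measurable (lebesgue_on S)"
proof (rule measurableI)
  have Sl: "S \<in> sets lebesgue" using S by simp
  obtain N where N: "{x \<in> space lborel. \<not> (x \<in> S \<longrightarrow> u x = g x)} \<subseteq> N" "N \<in> null_sets lborel"
    using ae unfolding AE_lebesgue_on_iff[OF S] by (auto elim!: AE_E simp: null_sets_def)
  fix A :: "real set" assume A: "A \<in> sets borel"
  have Nl: "N \<in> null_sets lebesgue" using N(2) by (rule null_sets_completionI)
  have 1: "u -` A \<inter> S \<inter> N \<in> sets lebesgue"
    using null_sets_completion_subset[OF _ Nl, of "u -` A \<inter> S \<inter> N"] by auto
  have "g -` A \<in> sets borel" using measurable_sets[OF g A] by simp
  then have 2: "(g -` A \<inter> S) - N \<in> sets lebesgue" using S N(2) by (auto simp: null_sets_def)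
  have "u -` A \<inter> S = ((g -` A \<inter> S) - N) \<union> (u -` A \<inter> S \<inter> N)" using N(1) by auto
  then have "u -` A \<inter> S \<in> sets lebesgue" using sets.Un[OF 2 1] by simp
  then show "u -` A \<inter> space (lebesgue_on S) \<in> sets (lebesgue_on S)"
    using Sl by (auto simp: sets_restrict_space_iff space_restrict_space)
qed simp

lemma line_u_cmult: "line_u R (\<lambda>t. c * H t) x = c * line_u R H x"
  by (simp add: line_u_def)

lemma radial_line_u: "radial (line_u R H)"
  unfolding radial_def line_u_def by simp

text \<open>All parameters have fixed values: \<open>V\<close> is the area of the unit sphere of the
  space, \<open>\<alpha>\<close> is \<open>2 / p\<close>, and \<open>C\<^sub>0\<close> is the sharp
  constant in the form in which the line yields it.\<close>

locale radial_problem =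
  fixes T :: "'a::euclidean_space itself" and R q V \<alpha> C\<^sub>0 :: real
  assumes N: "DIM('a) \<ge> 3" and R: "R > 0" and q_def: "q = 2 / (real DIM('a) - 2)"
    and V_def: "V = real DIM('a) * omega TYPE('a)" and \<alpha>_def: "\<alpha> = (real DIM('a) - 2) / real DIM('a)"
    and C_def: "C\<^sub>0 = V powr (2 / real DIM('a)) * K_const q"
begin

lemma q_pos: "q > 0" and V_pos: "V > 0" and alpha_eq: "1 / (1 + q) = \<alpha>" and C0_pos: "C\<^sub>0 > 0"
proof -
  show q: "q > 0" using N by (simp add: q_def)
  show V: "V > 0" using N omega_pos[where 'a='a] by (simp add: V_def)
  show "1 / (1 + q) = \<alpha>" using N by (simp add: q_def \<alpha>_def field_simps)
  have "V powr (2 / real DIM('a)) > 0" using V by simp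
  then show "C\<^sub>0 > 0" unfolding C_def using K_const_pos[OF q] by (rule mult_pos_pos)
qed

lemmas weighted_mass_line = weighted_mass_line_u[where 'a='a, OF N R, folded q_def V_def]

text \<open>The energy scales with \<open>V\<close> and the mass term with
  \<open>V powr \<alpha>\<close>; since \<open>\<alpha> + 2 / N = 1\<close>, the factor
  \<open>V powr (2 / N)\<close> in \<open>C\<^sub>0\<close> makes up the difference.\<close>

lemma scaled_constant:
  assumes "P \<ge> 0"
  shows "C\<^sub>0 * (V * P) powr \<alpha> = V * (K_const q * P powr (1 / (1 + q)))"
proof -
  have "V powr (2 / real DIM('a)) * V powr \<alpha> = V powr 1"
    unfolding powr_add[symmetric] using N by (intro arg_cong[where f="(powr) V"]) (simp add: \<alpha>_def field_simps)
  then have v: "V powr (2 / real DIM('a)) * V powr \<alpha> = V" using V_pos by simp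
  have "C\<^sub>0 * (V * P) powr \<alpha> = (V powr (2 / real DIM('a)) * V powr \<alpha>) * (K_const q * P powr \<alpha>)"
    unfolding powr_mult C_def by (simp only: mult_ac)
  then show ?thesis unfolding v alpha_eq .
qed

text \<open>\<open>V * e\<close> lies between the mass term and the norm, so a function whose
  quotient is \<open>C\<^sub>0\<close> forces equality on the line and falls under
  \<open>line_limit_equality\<close>.\<close>

lemma radial_lower_bound:
  fixes v :: "'a \<Rightarrow> real"
  assumes v: "v \<in> Hr_space R"
  obtains h h' H \<delta> e where "line_limit q h h' H \<delta> e" "V * e \<le> H_norm_sq R v"
    "AE x in lebesgue_on (ball 0 R). v x = line_u R H x" "weighted_mass R v = V * mass q H"
    "C\<^sub>0 * weighted_mass R v powr \<alpha> \<le> V * e"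
proof -
  have vm: "v \<in> borel_measurable (lebesgue_on (ball 0 R))" and vH: "v \<in> H_space R"
    using v unfolding Hr_space_def H_space_def by auto
  obtain g where g: "radial g" "AE x in lebesgue_on (ball 0 R). v x = g x" using v unfolding Hr_space_def by blast
  obtain Z where Z: "Q_approx R Z v" "(\<lambda>k. Qf (Z k)) \<longlonglongrightarrow> H_norm_sq R v" using H_space_approx[OF R N vH] by blast
  from good_direction[OF R N vm Z g, folded q_def V_def] obtain h h' H \<delta> e where
    l: "line_limit q h h' H \<delta> e" "e \<le> H_norm_sq R v / V" "AE x in lebesgue_on (ball 0 R). v x = line_u R H x"
    by (elim exE conjE)
  have m: "weighted_mass R v = V * mass q H"
    by (rule weighted_mass_line[OF line_limit.H_meas[OF l(1)] l(3) vm])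
  have e: "V * e \<le> H_norm_sq R v" using l(2) V_pos by (simp add: pos_le_divide_eq mult.commute)
  have "K_const q * mass q H powr (1 / (1 + q)) \<le> e" by (rule line_limit.limit_inequality[OF l(1)])
  from mult_left_mono[OF this less_imp_le[OF V_pos]]
  have c: "C\<^sub>0 * weighted_mass R v powr \<alpha> \<le> V * e" unfolding m scaled_constant[OF mass_nonneg] .
  show ?thesis by (rule that[OF l(1) e l(3) m c])
qed

lemma extremal:
  fixes u :: "'a \<Rightarrow> real"
  assumes M: "M \<noteq> 0" and u: "AE x in lebesgue_on (ball 0 R). u x = line_u R (\<lambda>t. M * prof q (t - t0)) x"
  shows "u \<in> Hr_space R" "weighted_mass R u > 0" "H_norm_sq R u = C\<^sub>0 * weighted_mass R u powr \<alpha>"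
proof -
  let ?h = "\<lambda>t. M * prof q (t - t0)" and ?h' = "\<lambda>t. M * prof' q (t - t0)"
  obtain e :: 'a where e: "norm e = 1" using ex_unit_vector by blast
  note lf = line_fun_prof[OF q_pos, of M t0]
  obtain Z :: "nat \<Rightarrow> 'a \<Rightarrow> real" where Z: "Q_approx R Z (line_u R ?h)" "(\<lambda>n. Qf (Z n)) \<longlonglongrightarrow> V * energy ?h ?h'"
  proof (rule approximation_by_tests[OF lf smooth_on_prof q_pos R N e])
    fix Z :: "nat \<Rightarrow> 'a \<Rightarrow> real"
    assume "Q_approx R Z (line_u R ?h)" "(\<lambda>n. Qf (Z n)) \<longlonglongrightarrow> real DIM('a) * omega TYPE('a) * energy ?h ?h'"
    then show thesis unfolding V_def[symmetric] by (rule that)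
  qed
  have um: "u \<in> borel_measurable (lebesgue_on (ball 0 R))"
    by (rule lebesgue_on_measurable_AE[OF ball_borel line_u_measurable[OF line_fun_measurable(1)[OF lf]] u])
  have "(\<integral>\<^sup>+x. ennreal ((to_u (Z k) x - u x)\<^sup>2) \<partial>lebesgue_on (ball 0 R)) =
    (\<integral>\<^sup>+x. ennreal ((to_u (Z k) x - line_u R ?h x)\<^sup>2) \<partial>lebesgue_on (ball 0 R))" for k
    by (rule nn_integral_cong_AE) (use u in eventually_elim, simp)
  then have Zu: "Q_approx R Z u" using Z(1) unfolding Q_approx_def by simp
  then have "H_approx R (\<lambda>k. to_u (Z k)) u" unfolding H_approx_iff[OF R N] by blast
  then have "u \<in> H_space R" using um unfolding H_space_def by blast
  then show "u \<in> Hr_space R" unfolding Hr_space_def using u radial_line_u by blast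
  have n: "H_norm_sq R u = V * energy ?h ?h'" by (rule H_norm_sq_eqI[OF R N um Zu Z(2)])
  have m: "weighted_mass R u = V * mass q ?h"
    by (rule weighted_mass_line[OF line_fun_measurable(1)[OF lf] u um])
  show "H_norm_sq R u = C\<^sub>0 * weighted_mass R u powr \<alpha>"
    unfolding n m scaled_constant[OF mass_nonneg] mass_energy_prof_shift(3)[OF q_pos] ..
  have "mass q ?h > 0" unfolding mass_energy_prof_shift(1)[OF q_pos]
    using M c_const_pos[OF q_pos] q_pos by (intro mult_pos_pos divide_pos_pos) auto
  then show "weighted_mass R u > 0" unfolding m using V_pos by (rule mult_pos_pos[rotated])
qed

lemma mass_pos:
  assumes "line_limit q h h' H \<delta> e" and "H t \<noteq> 0"
  shows "mass q H > 0"
proof (rule ccontr)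
  assume "\<not> mass q H > 0"
  then have m: "mass q H = 0" using mass_nonneg[of q H] by simp
  let ?f = "\<lambda>t. \<bar>H t\<bar> powr (2 + 2 * q)"
  have c: "continuous_on {t - 1..t + 1} ?f"
    using continuous_on_subset[OF line_limit.H_cont[OF assms(1)]] q_pos
    by (intro continuous_on_powr' continuous_on_rabs continuous_on_const) auto
  have "integral {t - 1..t + 1} ?f \<le> 0"
    using integral_interval_le[OF line_limit.H_integrable[OF assms(1)], of "t - 1" "t + 1"] m unfolding mass_def by simp
  moreover have "integral {t - 1..t + 1} ?f \<ge> 0"
    by (rule Henstock_Kurzweil_Integration.integral_nonneg[OF integrable_continuous_interval[OF c]]) simp
  ultimately have "integral {t - 1..t + 1} ?f = 0" by simp
  then have "\<forall>s\<in>{t - 1..t + 1}. ?f s = 0" by (subst (asm) integral_eq_0_iff[OF c]) auto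
  then have "?f t = 0" by simp
  then show False using assms(2) by simp
qed

lemma AE_zero_weighted_mass:
  fixes u :: "'a \<Rightarrow> real"
  assumes "AE x in lebesgue_on (ball 0 R). u x = 0"
  shows "weighted_mass R u = 0"
proof -
  have z: "AE x in lebesgue_on (ball 0 R). u x = line_u R (\<lambda>t. 0) x" using assms by (simp add: line_u_def)
  have "weighted_mass R u = V * mass q (\<lambda>t. 0)"
    by (rule weighted_mass_line[OF _ z lebesgue_on_measurable_AE[OF ball_borel _ assms]]) auto
  then show ?thesis by (simp add: mass_def)
qed

lemma HS_quotient_eq: "HS_quotient R (v :: 'a \<Rightarrow> real) = H_norm_sq R v / weighted_mass R v powr \<alpha>"
  unfolding HS_quotient_def \<alpha>_def ..

lemma quotient_lower_bound:
  fixes v :: "'a \<Rightarrow> real"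
  assumes v: "v \<in> Hr_space R" "\<not> (AE x in lebesgue_on (ball 0 R). v x = 0)"
  shows "C\<^sub>0 \<le> HS_quotient R v"
    and "HS_quotient R v \<le> C\<^sub>0 \<Longrightarrow> \<exists>M t0. M \<noteq> 0 \<and> (AE x in lebesgue_on (ball 0 R). v x = line_u R (\<lambda>t. M * prof q (t - t0)) x)"
proof -
  from radial_lower_bound[OF v(1)] obtain h h' H \<delta> e where
    l: "line_limit q h h' H \<delta> e" and e: "V * e \<le> H_norm_sq R v" and ae: "AE x in lebesgue_on (ball 0 R). v x = line_u R H x"
    and m: "weighted_mass R v = V * mass q H" and C: "C\<^sub>0 * weighted_mass R v powr \<alpha> \<le> V * e" .
  have "\<exists>t. H t \<noteq> 0"
  proof (rule ccontr)
    assume "\<not> (\<exists>t. H t \<noteq> 0)"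
    then have "line_u R H x = 0" for x :: 'a by (simp add: line_u_def)
    then show False using ae v(2) by simp
  qed
  then obtain t where t: "H t \<noteq> 0" by blast
  have "weighted_mass R v > 0" unfolding m using V_pos mass_pos[OF l t] by (rule mult_pos_pos)
  then have w: "weighted_mass R v powr \<alpha> > 0" by simp
  show "C\<^sub>0 \<le> HS_quotient R v"
    unfolding HS_quotient_eq pos_le_divide_eq[OF w] using order_trans[OF C e] .
  assume "HS_quotient R v \<le> C\<^sub>0"
  then have "H_norm_sq R v \<le> C\<^sub>0 * weighted_mass R v powr \<alpha>" unfolding HS_quotient_eq pos_divide_le_eq[OF w] .
  from order_trans[OF e this] have "V * e \<le> V * (K_const q * mass q H powr (1 / (1 + q)))"
    unfolding m scaled_constant[OF mass_nonneg] .
  then have "e \<le> K_const q * mass q H powr (1 / (1 + q))" using V_pos by (rule mult_left_le_imp_le)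
  from line_limit_equality[OF l this t] obtain M t0 where M: "M \<noteq> 0" "\<forall>t. H t = M * prof q (t - t0)" by blast
  then have "H = (\<lambda>t. M * prof q (t - t0))" by (intro ext) blast
  with ae M(1) show "\<exists>M t0. M \<noteq> 0 \<and> (AE x in lebesgue_on (ball 0 R). v x = line_u R (\<lambda>t. M * prof q (t - t0)) x)"
    by (intro exI[of _ M] exI[of _ t0]) simp
qed

lemma extremal_quotient:
  fixes u :: "'a \<Rightarrow> real"
  assumes "M \<noteq> 0" "AE x in lebesgue_on (ball 0 R). u x = line_u R (\<lambda>t. M * prof q (t - t0)) x"
  shows "HS_quotient R u = C\<^sub>0" "\<not> (AE x in lebesgue_on (ball 0 R). u x = 0)"
proof -
  note ex = extremal[OF assms]
  have "weighted_mass R u powr \<alpha> \<noteq> 0" using ex(2) by simp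
  then show "HS_quotient R u = C\<^sub>0" unfolding HS_quotient_eq ex(3) by (rule nonzero_mult_div_cancel_right)
  show "\<not> (AE x in lebesgue_on (ball 0 R). u x = 0)" using AE_zero_weighted_mass[of u] ex(2) by auto
qed

lemma AE_ball_punctured:
  assumes "\<And>x::'a. x \<in> ball 0 R - {0} \<Longrightarrow> P x"
  shows "AE x in lebesgue_on (ball (0::'a) R). P x"
  unfolding AE_lebesgue_on_iff[OF ball_borel]
  by (rule AE_mp[OF AE_lborel_singleton[of "0::'a"]], rule AE_I2, intro impI, rule assms) simp

lemma u_mn_extremal:
  assumes "m \<noteq> 0" "n \<noteq> 0"
  shows "AE x in lebesgue_on (ball (0::'a) R). u_mn R m n x =
    line_u R (\<lambda>t. (2 * \<bar>m * n\<bar>) powr (- (1 / q)) * prof q (t - (- (2 / q) * ln \<bar>m / n\<bar>))) x"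
  by (rule AE_ball_punctured, rule u_mn_line_u[OF N R assms, folded q_def])

lemma minimizer_iff:
  fixes u :: "'a \<Rightarrow> real"
  shows "HS_minimizer R u \<longleftrightarrow> (\<exists>c m n. c \<noteq> 0 \<and> m \<noteq> 0 \<and> n \<noteq> 0 \<and> (AE x in lebesgue_on (ball 0 R). u x = c * u_mn R m n x))"
proof
  assume u: "HS_minimizer R u"
  \<comment> \<open>One explicit competitor is enough: its quotient is \<open>C\<^sub>0\<close>, so
    that of a minimizer is at most \<open>C\<^sub>0\<close>.\<close>
  define w :: "'a \<Rightarrow> real" where "w = u_mn R 1 1"
  have p1: "(2 * \<bar>1 * 1\<bar>) powr (- (1 / q)) \<noteq> (0::real)" by simp
  have w1: "AE x in lebesgue_on (ball 0 R). w x =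
    line_u R (\<lambda>t. (2 * \<bar>1 * 1\<bar>) powr (- (1 / q)) * prof q (t - (- (2 / q) * ln \<bar>1 / 1\<bar>))) x"
    unfolding w_def by (rule u_mn_extremal) simp_all
  have "\<forall>v\<in>Hr_space R. \<not> (AE x in lebesgue_on (ball (0::'a) R). v x = 0) \<longrightarrow> HS_quotient R u \<le> HS_quotient R v"
    using u unfolding HS_minimizer_def by (elim conjE)
  from mp[OF bspec[OF this extremal(1)[OF p1 w1]] extremal_quotient(2)[OF p1 w1]]
  have "HS_quotient R u \<le> HS_quotient R w" .
  then have uC: "HS_quotient R u \<le> C\<^sub>0" unfolding extremal_quotient(1)[OF p1 w1] .
  have "u \<in> Hr_space R" "\<not> (AE x in lebesgue_on (ball 0 R). u x = 0)" using u unfolding HS_minimizer_def by simp_all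
  from quotient_lower_bound(2)[OF this uC] obtain M t0 where M: "M \<noteq> 0" "AE x in lebesgue_on (ball 0 R). u x = line_u R (\<lambda>t. M * prof q (t - t0)) x"
    by (elim exE conjE)
  \<comment> \<open>The product \<open>m * n = 1\<close> normalises the height and the quotient
    \<open>m / n\<close> produces the shift \<open>t0\<close>; the actual height goes into the
    constant multiple.\<close>
  define m n where "m = exp (- (q * t0) / 4)" and "n = exp (q * t0 / 4)"
  have mn: "m > 0" "n > 0" "m * n = 1" unfolding m_def n_def by (simp_all add: exp_add[symmetric])
  have "m / n = exp (- (q * t0) / 2)" unfolding m_def n_def exp_diff[symmetric] by (simp add: field_simps)
  then have "- (2 / q) * ln \<bar>m / n\<bar> = t0" using q_pos by simp
  moreover have "(2 * \<bar>m * n\<bar>) powr (- (1 / q)) = 2 powr (- (1 / q))" using mn(3) by simp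
  ultimately have "AE x in lebesgue_on (ball (0::'a) R). u_mn R m n x = line_u R (\<lambda>t. 2 powr (- (1 / q)) * prof q (t - t0)) x"
    using u_mn_extremal[of m n] mn by simp
  with M(2) have "AE x in lebesgue_on (ball 0 R). u x = (M * 2 powr (1 / q)) * u_mn R m n x"
  proof eventually_elim
    case (elim x)
    have "2 powr (1 / q) * 2 powr (- (1 / q)) = (1::real)" by (simp add: powr_add[symmetric])
    then have c: "(M * 2 powr (1 / q)) * 2 powr (- (1 / q)) = M" by (simp only: mult.assoc mult_1_right)
    show ?case unfolding elim line_u_cmult mult.assoc[symmetric] c ..
  qed
  then show "\<exists>c m n. c \<noteq> 0 \<and> m \<noteq> 0 \<and> n \<noteq> 0 \<and> (AE x in lebesgue_on (ball 0 R). u x = c * u_mn R m n x)"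
    using M(1) mn by (intro exI[of _ "M * 2 powr (1 / q)"] exI[of _ m] exI[of _ n] conjI) simp_all
next
  assume "\<exists>c m n. c \<noteq> 0 \<and> m \<noteq> 0 \<and> n \<noteq> 0 \<and> (AE x in lebesgue_on (ball 0 R). u x = c * u_mn R m n x)"
  then obtain c m n where cmn: "c \<noteq> 0" "m \<noteq> 0" "n \<noteq> 0" "AE x in lebesgue_on (ball 0 R). u x = c * u_mn R m n x" by blast
  define t0 where "t0 = - (2 / q) * ln \<bar>m / n\<bar>"
  define M where "M = c * (2 * \<bar>m * n\<bar>) powr (- (1 / q))"
  have M: "M \<noteq> 0" using cmn by (simp add: M_def)
  have ae: "AE x in lebesgue_on (ball 0 R). u x = line_u R (\<lambda>t. M * prof q (t - t0)) x"
    using cmn(4) u_mn_extremal[OF cmn(2,3)]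
  proof eventually_elim
    case (elim x)
    show ?case unfolding elim M_def t0_def line_u_cmult by (simp only: mult.assoc)
  qed
  show "HS_minimizer R u"
    unfolding HS_minimizer_def extremal_quotient(1)[OF M ae]
    by (intro conjI ballI impI extremal(1)[OF M ae] extremal_quotient(2)[OF M ae] quotient_lower_bound(1))
qed


lemma to_u_inverse:
  fixes u :: "'a \<Rightarrow> real"
  assumes u: "u \<in> test_functions (ball 0 R - {0})" "radial u"
  obtains f where "f \<in> test_functions (ball 0 R - {0})" "radial f" "u = to_u f"
proof
  let ?f = "\<lambda>x. norm x powr ((real DIM('a) - 2) / 2) * u x"
  show "?f \<in> test_functions (ball 0 R - {0})" "radial ?f" by (rule radial_powr_mult[OF u R])+
  show "u = to_u ?f"
  proof
    fix x
    show "u x = to_u ?f x"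
    proof (cases "x = 0")
      case True
      then show ?thesis using test_functions_outside[OF u(1), of 0] by (simp add: to_u_def)
    next
      case False
      then have "norm x powr (- ((real DIM('a) - 2) / 2)) * norm x powr ((real DIM('a) - 2) / 2) = 1"
        by (simp add: powr_add[symmetric])
      then show ?thesis unfolding to_u_def mult.assoc[symmetric] by simp
    qed
  qed
qed

text \<open>The two radius substitutions compose: \<open>exp (- t / (N - 2))\<close> is sent to
  \<open>rho R t\<close>, and the power in \<open>transformed\<close> cancels the one in
  \<open>to_u\<close>. Hence (A) for \<open>u\<close> and (B) for \<open>w\<close> are one statement
  about one line function.\<close>

lemma ray_B_transformed:
  fixes f w :: "'a \<Rightarrow> real"
  assumes f: "f \<in> test_functions (ball 0 R - {0})" "radial f" and w: "w \<in> test_functions S" "radial w"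
    and tr: "transformed R (to_u f) w" and e: "norm (e :: 'a) = 1"
  shows "ray_B w e = ray R f (half e)" "ray_B' w e = ray' R f (half e)"
proof -
  have ru: "radial (to_u f)" unfolding to_u_def[abs_def] by (rule radial_powr_mult(2)[OF f R])
  show eq: "ray_B w e = ray R f (half e)"
  proof
    fix t
    let ?s = "exp (- t / (real DIM('a) - 2))"
    have r: "exp_radius R (real DIM('a)) ?s = rho R t"
    proof -
      have "- t / d * - d = t" if "d \<noteq> 0" for d :: real using that by simp
      from this[of "real DIM('a) - 2"] have "?s powr (- (real DIM('a) - 2)) = exp t" unfolding exp_powr_real using N by simp
      then show ?thesis unfolding exp_radius_def rho_def by simp
    qed
    have rt: "rho R t > 0" using rho_bounds[OF R, of t] by simp
    have "w (?s *\<^sub>R e) = rho R t powr ((real DIM('a) - 2) / 2) * to_u f (rho R t *\<^sub>R e)"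
      using tr[unfolded transformed_iff[OF N R e ru w(2)], rule_format, of ?s] unfolding r by simp
    also have "to_u f (rho R t *\<^sub>R e) = rho R t powr (- ((real DIM('a) - 2) / 2)) * f (rho R t *\<^sub>R e)"
      unfolding to_u_def using e rt by simp
    also have "rho R t powr ((real DIM('a) - 2) / 2) * (rho R t powr (- ((real DIM('a) - 2) / 2)) * f (rho R t *\<^sub>R e)) = f (rho R t *\<^sub>R e)"
      unfolding mult.assoc[symmetric] powr_add[symmetric] using rt by simp
    finally show "ray_B w e t = ray R f (half e) t" unfolding ray_B_def ray_def half_pball(2)[OF e] by simp
  qed
  show "ray_B' w e = ray' R f (half e)"
  proof
    fix t show "ray_B' w e t = ray' R f (half e) t"
      by (rule DERIV_unique[OF ray_B_derivative[OF w(1) N, of e t, unfolded eq] ray_derivative[OF f(1)]])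
  qed
qed

lemma inequalities_equivalent:
  fixes u w :: "'a \<Rightarrow> real"
  assumes u: "u \<in> test_functions (ball 0 R - {0})" "radial u" and w: "w \<in> test_functions S" "radial w"
    and tr: "transformed R u w"
  shows "ineq_A R C u \<longleftrightarrow> ineq_B C w"
proof -
  obtain e :: 'a where e: "norm e = 1" using ex_unit_vector by blast
  obtain f where f: "f \<in> test_functions (ball 0 R - {0})" "radial f" "u = to_u f" using to_u_inverse[OF u] .
  show ?thesis
    unfolding f(3) ineq_A_line(1)[OF N R f(1,2) e] ineq_B_line[OF N w e]
      ray_B_transformed[OF f(1,2) w tr[unfolded f(3)] e] ..
qed

lemma line_inequality_scaled:
  assumes "line_fun h h'" "C \<le> C\<^sub>0"
  shows "C * (V * mass q h) powr \<alpha> \<le> V * energy h h'"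
proof -
  have "C * (V * mass q h) powr \<alpha> \<le> C\<^sub>0 * (V * mass q h) powr \<alpha>" using assms(2) by (rule mult_right_mono) simp
  also have "\<dots> \<le> V * energy h h'"
    unfolding scaled_constant[OF mass_nonneg] using line_inequality[OF q_pos assms(1)] V_pos by (intro mult_left_mono) auto
  finally show ?thesis .
qed

lemma ineq_B_valid:
  fixes w :: "'a \<Rightarrow> real"
  assumes w: "w \<in> test_functions S" "radial w" and C: "C \<le> C\<^sub>0"
  shows "ineq_B C w"
proof -
  obtain e :: 'a where e: "norm e = 1" using ex_unit_vector by blast
  show ?thesis unfolding ineq_B_line[OF N w e, folded q_def V_def \<alpha>_def]
    by (rule line_inequality_scaled[OF line_fun_ray_B[OF w(1) N e] C])
qed

lemma ineq_A_valid:
  fixes u :: "'a \<Rightarrow> real"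
  assumes u: "u \<in> test_functions (ball 0 R - {0})" "radial u"
  shows "ineq_A R C\<^sub>0 u"
proof -
  obtain e :: 'a where e: "norm e = 1" using ex_unit_vector by blast
  obtain f where f: "f \<in> test_functions (ball 0 R - {0})" "radial f" "u = to_u f" using to_u_inverse[OF u] .
  have "f \<in> test_functions (ball 0 R)" using f(1) test_functions_subset[of "ball 0 R - {0}" "ball 0 R"] by blast
  from line_fun_ray[OF this R half_pball(1)[OF e]] show ?thesis
    unfolding f(3) ineq_A_line(1)[OF N R f(1,2) e, folded q_def V_def \<alpha>_def]
    by (rule line_inequality_scaled) simp
qed

text \<open>(A) is tested on cutoffs of the extremal profile. Energy and mass converge, and in the
  limit \<open>C\<close> is compared with the constant that the profile attains.\<close>

lemma ineq_A_optimal: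
  assumes A: "\<And>u::'a \<Rightarrow> real. u \<in> test_functions (ball 0 R - {0}) \<Longrightarrow> radial u \<Longrightarrow> ineq_A R C u"
  shows "C \<le> C\<^sub>0"
proof -
  obtain e :: 'a where e: "norm e = 1" using ex_unit_vector by blast
  let ?h = "\<lambda>t. 1 * prof q (t - 0)" and ?h' = "\<lambda>t. 1 * prof' q (t - 0)"
  have P: "mass q ?h > 0" unfolding mass_energy_prof_shift(1)[OF q_pos]
    using c_const_pos[OF q_pos] q_pos by (intro mult_pos_pos divide_pos_pos) auto
  show ?thesis
  proof (rule approximation_by_tests[OF line_fun_prof[OF q_pos, of 1 0] smooth_on_prof q_pos R N e])
    fix Z :: "nat \<Rightarrow> 'a \<Rightarrow> real"
    assume Z: "\<And>n. Z n \<in> test_functions (ball 0 R - {0})" "\<And>n. radial (Z n)"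
      and Q: "(\<lambda>n. Qf (Z n)) \<longlonglongrightarrow> real DIM('a) * omega TYPE('a) * energy ?h ?h'"
      and m: "(\<lambda>n. mass q (ray R (Z n) (half e))) \<longlonglongrightarrow> mass q ?h"
    have le: "C * (V * mass q (ray R (Z n) (half e))) powr \<alpha> \<le> Qf (Z n)" for n
    proof -
      have "ineq_A R C (to_u (Z n))"
        unfolding to_u_def[abs_def] by (rule A; rule radial_powr_mult[OF Z R])
      then show ?thesis
        unfolding ineq_A_line(1)[OF N R Z e, folded q_def V_def \<alpha>_def] ineq_A_line(2)[OF N R Z e, folded V_def] .
    qed
    have "V * mass q ?h \<noteq> 0" using V_pos P by simp
    then have "(\<lambda>n. C * (V * mass q (ray R (Z n) (half e))) powr \<alpha>) \<longlonglongrightarrow> C * (V * mass q ?h) powr \<alpha>"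
      by (intro tendsto_mult_left tendsto_powr tendsto_const m)
    from LIMSEQ_le[OF this Q[folded V_def]] le
    have "C * (V * mass q ?h) powr \<alpha> \<le> V * energy ?h ?h'" by blast
    also have "\<dots> = C\<^sub>0 * (V * mass q ?h) powr \<alpha>"
      unfolding scaled_constant[OF mass_nonneg] mass_energy_prof_shift(3)[OF q_pos] ..
    finally show "C \<le> C\<^sub>0" using \<open>V * mass q ?h \<noteq> 0\<close> by (simp add: mult_le_cancel_right)
  qed
qed

lemma u_mn_quotient:
  assumes "m \<noteq> 0" "n \<noteq> 0"
  shows "HS_quotient R (u_mn R m n :: 'a \<Rightarrow> real) = C\<^sub>0"
  by (rule extremal_quotient(1)[OF _ u_mn_extremal[OF assms]]) (use assms in simp)

end

theorem theorem1p2: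
  fixes R :: real
  assumes N: "DIM('a::euclidean_space) \<ge> 3" and R: "R > 0"
  shows
    "\<comment> \<open>the transformation is a bijection between the admissible functions\<close>
     (\<forall>u. u \<in> test_functions (ball (0::'a) R - {0}) \<and> radial u \<longrightarrow>
        (\<exists>!w. w \<in> test_functions (UNIV - {0}) \<and> radial w \<and> transformed R u w)) \<and>
     (\<forall>w. w \<in> test_functions (UNIV - {0::'a}) \<and> radial w \<longrightarrow>
        (\<exists>!u. u \<in> test_functions (ball 0 R - {0}) \<and> radial u \<and> transformed R u w)) \<and>
     \<comment> \<open>it turns (A) into (B), with the same constant\<close>
     (\<forall>C>0. \<forall>u w. u \<in> test_functions (ball (0::'a) R - {0}) \<and> radial u \<and>
        w \<in> test_functions (UNIV - {0}) \<and> radial w \<and> transformed R u w \<longrightarrow>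
        (ineq_A R C u \<longleftrightarrow> ineq_B C w)) \<and>
     (\<forall>C>0. (\<forall>u. u \<in> test_functions (ball (0::'a) R - {0}) \<and> radial u \<longrightarrow> ineq_A R C u) \<longleftrightarrow>
        (\<forall>w. w \<in> test_functions (UNIV :: 'a set) \<and> radial w \<longrightarrow> ineq_B C w)) \<and>
     \<comment> \<open>best constant and minimizers\<close>
     (let C\<^sub>H\<^sub>S = sobolev_const (real DIM('a)) *
        (real DIM('a) - 2) powr (- (2 * (real DIM('a) - 1) / real DIM('a))) in
        C\<^sub>H\<^sub>S > 0 \<and>
        (\<forall>u. u \<in> test_functions (ball (0::'a) R - {0}) \<and> radial u \<longrightarrow> ineq_A R C\<^sub>H\<^sub>S u) \<and>
        (\<forall>C>0. (\<forall>u. u \<in> test_functions (ball (0::'a) R - {0}) \<and> radial u \<longrightarrow> ineq_A R C u)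
           \<longrightarrow> C \<le> C\<^sub>H\<^sub>S) \<and>
        (\<forall>m n. m \<noteq> 0 \<and> n \<noteq> 0 \<longrightarrow>
           HS_quotient R (u_mn R m n :: 'a \<Rightarrow> real) = C\<^sub>H\<^sub>S \<and>
           continuous_on (cball 0 R - {0}) (u_mn R m n :: 'a \<Rightarrow> real)) \<and>
        (\<forall>u :: 'a \<Rightarrow> real. HS_minimizer R u \<longleftrightarrow>
           (\<exists>c m n. c \<noteq> 0 \<and> m \<noteq> 0 \<and> n \<noteq> 0 \<and>
              (AE x in lebesgue_on (ball 0 R). u x = c * u_mn R m n x))))"
proof -
  let ?N = "real DIM('a)"
  interpret radial_problem "TYPE('a)" R "2 / (?N - 2)" "?N * omega TYPE('a)" "(?N - 2) / ?N"
    "(?N * omega TYPE('a)) powr (2 / ?N) * K_const (2 / (?N - 2))"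
    by unfold_locales (use N R in auto)
  let ?T = "test_functions (ball (0::'a) R - {0})" and ?W = "test_functions (UNIV - {0::'a})"
  have AB: "(\<forall>u. u \<in> ?T \<and> radial u \<longrightarrow> ineq_A R C u) \<longleftrightarrow>
      (\<forall>w. w \<in> test_functions (UNIV :: 'a set) \<and> radial w \<longrightarrow> ineq_B C w)" for C
  proof (intro iffI allI impI)
    fix w :: "'a \<Rightarrow> real"
    assume A: "\<forall>u. u \<in> ?T \<and> radial u \<longrightarrow> ineq_A R C u" and w: "w \<in> test_functions UNIV \<and> radial w"
    \<comment> \<open>A test function \<open>w\<close> on the whole space may be nonzero at the
      origin and then has no counterpart \<open>u\<close>. This direction therefore uses optimality:
      (A) forces \<open>C \<le> C\<^sub>0\<close>, and for such \<open>C\<close> inequality (B)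
      holds for every \<open>w\<close>.\<close>
    have "C \<le> (?N * omega TYPE('a)) powr (2 / ?N) * K_const (2 / (?N - 2))"
      by (rule ineq_A_optimal) (use A in blast)
    with conjunct1[OF w] conjunct2[OF w] show "ineq_B C w" by (rule ineq_B_valid)
  next
    fix u :: "'a \<Rightarrow> real"
    assume B: "\<forall>w. w \<in> test_functions (UNIV :: 'a set) \<and> radial w \<longrightarrow> ineq_B C w" and u: "u \<in> ?T \<and> radial u"
    obtain w where w: "w \<in> ?W" "radial w" "transformed R u w"
      using transform_bijection(1)[OF N R conjunct1[OF u] conjunct2[OF u]] by (elim ex1E conjE)
    have "w \<in> test_functions UNIV" using w(1) test_functions_subset[of "UNIV - {0}" UNIV] by blast
    then have "ineq_B C w" using B w(2) by blast
    then show "ineq_A R C u" unfolding inequalities_equivalent[OF conjunct1[OF u] conjunct2[OF u] w] .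
  qed
  show ?thesis
    unfolding Let_def hardy_sobolev_constant[OF N]
  proof (intro conjI)
    show "\<forall>u. u \<in> ?T \<and> radial u \<longrightarrow> (\<exists>!w. w \<in> ?W \<and> radial w \<and> transformed R u w)"
      using transform_bijection(1)[OF N R] by (intro allI impI, elim conjE)
    show "\<forall>w. w \<in> ?W \<and> radial w \<longrightarrow> (\<exists>!u. u \<in> ?T \<and> radial u \<and> transformed R u w)"
      using transform_bijection(2)[OF N R] by (intro allI impI, elim conjE)
    show "\<forall>C>0. \<forall>u w. u \<in> ?T \<and> radial u \<and> w \<in> ?W \<and> radial w \<and> transformed R u w \<longrightarrow> (ineq_A R C u \<longleftrightarrow> ineq_B C w)"
      by (intro allI impI, elim conjE, rule inequalities_equivalent)
    show "\<forall>C>0. (\<forall>u. u \<in> ?T \<and> radial u \<longrightarrow> ineq_A R C u) \<longleftrightarrow>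
      (\<forall>w. w \<in> test_functions (UNIV :: 'a set) \<and> radial w \<longrightarrow> ineq_B C w)"
      using AB by (intro allI impI)
    show "(?N * omega TYPE('a)) powr (2 / ?N) * K_const (2 / (?N - 2)) > 0" by (rule C0_pos)
    show "\<forall>u. u \<in> ?T \<and> radial u \<longrightarrow> ineq_A R ((?N * omega TYPE('a)) powr (2 / ?N) * K_const (2 / (?N - 2))) u"
      by (intro allI impI, elim conjE, rule ineq_A_valid)
    show "\<forall>C>0. (\<forall>u. u \<in> ?T \<and> radial u \<longrightarrow> ineq_A R C u) \<longrightarrow> C \<le> (?N * omega TYPE('a)) powr (2 / ?N) * K_const (2 / (?N - 2))"
    proof (intro allI impI)
      fix C assume A: "\<forall>u. u \<in> ?T \<and> radial u \<longrightarrow> ineq_A R C u"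
      show "C \<le> (?N * omega TYPE('a)) powr (2 / ?N) * K_const (2 / (?N - 2))"
        by (rule ineq_A_optimal) (use A in blast)
    qed
    show "\<forall>m n. m \<noteq> 0 \<and> n \<noteq> 0 \<longrightarrow>
       HS_quotient R (u_mn R m n :: 'a \<Rightarrow> real) = (?N * omega TYPE('a)) powr (2 / ?N) * K_const (2 / (?N - 2)) \<and>
       continuous_on (cball 0 R - {0}) (u_mn R m n :: 'a \<Rightarrow> real)"
      by (intro allI impI, elim conjE, intro conjI u_mn_quotient u_mn_continuous[OF N R])
    show "\<forall>u :: 'a \<Rightarrow> real. HS_minimizer R u \<longleftrightarrow>
       (\<exists>c m n. c \<noteq> 0 \<and> m \<noteq> 0 \<and> n \<noteq> 0 \<and> (AE x in lebesgue_on (ball 0 R). u x = c * u_mn R m n x))"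
      by (intro allI minimizer_iff)
  qed
qed

end
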